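(* Problem (P) has a unique weak solution $\{\mathbf u,p\}$, and it satisfies $$\|\mathbf u\|_{L^2(0,T;H_0^1(D)^d)}+\|\mathbf u\|_{L^\infty(0,T;L^2(D)^d)}+\sqrt\alpha\,\|p\|_{L^\infty(0,T;L^2(D))}\le C_{\mathbf f,\alpha}E,$$ $$\|\mathbf u\|_{L^2(0,T;H_0^1(D)^d)}+\|\mathbf u_t\|_{L^2(0,T;H^{-1}(D)^d)}\le\frac1{\sqrt\alpha}\tilde C_{\mathbf f,\alpha}E,$$ where $$E=\|\mathbf u_0\|_{L^2(D)^d}+\sqrt\alpha\|p_0\|_{L^2(D)}+\frac1{\sqrt\alpha}\|\sigma\|_{L^2(0,T;L^2(D))}+\|\mathbf s\|_{L^2(0,T;H^{-1}(D)^d)}$$ and the constants $C_{\mathbf f,\alpha},\tilde C_{\mathbf f,\alpha}$ depend only on $\|\mathbf f\|_{L^\infty(Q_T)^d}$ and $\alpha$ (and $\rho_0,\mu,\eta$), and for fixed $\mathbf f$ remain bounded as $\alpha\to0$. Moreover, if $p_0\in\widehat L^2(D)$ and $\sigma\in L^2(0,T;\widehat L^2(D))$, then $p\in W^{1,2}(0,T;\widehat L^2(D))$.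
   Context: $D\subset\mathbb R^d$ ($d\ge2$) is a bounded domain with piecewise smooth boundary, $T>0$, $Q_T=D\times(0,T)$. Constants $\rho_0>0$, $\alpha>0$, $\mu>0$, $\eta\ge0$. Data: $\sigma\in L^2(0,T;L^2(D))$, $\mathbf s\in L^2(0,T;H^{-1}(D)^d)$ ($H^{-1}(D)^d$ the dual of $H_0^1(D)^d$), $\mathbf f\in L^\infty(Q_T)^d$, $\mathbf u_0\in L^2(D)^d$, $p_0\in L^2(D)$. $\widehat L^2(D)=\{u\in L^2(D):\int_Du\,dx=0\}$. Notation: $(\cdot,\cdot)$ is the $L^2(D)$ inner product, $((\mathbf u,\mathbf v))=\int_D\partial_iu_k\partial_iv_k\,dx$, $\langle\cdot,\cdot\rangle$ the $H^{-1}$–$H_0^1$ duality. Problem (P) is: $\alpha p_t+\rho_0\operatorname{div}\mathbf u=\sigma$, $\rho_0\mathbf u_t+\nabla p=\mu\Delta\mathbf u+\eta\nabla\operatorname{div}\mathbf u+\alpha p\mathbf f+\mathbf s$ in $Q_T$, $\mathbf u=0$ on $\partial D$, $\mathbf u(0)=\mathbf u_0$, $p(0)=p_0$. A weak solution of (P) is a pair $\{\mathbf u,p\}\in L^2(0,T;H_0^1(D)^d)\times L^2(0,T;L^2(D))$ such that for all $\varphi\in C_0^\infty([0,T))$, $\mathbf v\in H_0^1(D)^d$, $r\in L^2(D)$: $-\int_0^T(\alpha p,r)\varphi_t\,dt-(\alpha p_0,r)\varphi(0)+\int_0^T(\rho_0\operatorname{div}\mathbf u,r)\varphi\,dt=\int_0^T(\sigma,r)\varphi\,dt$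 and $-\int_0^T\rho_0(\mathbf u,\mathbf v)\varphi_t\,dt-\rho_0(\mathbf u_0,\mathbf v)\varphi(0)-\int_0^T(p,\operatorname{div}\mathbf v)\varphi\,dt=-\mu\int_0^T((\mathbf u,\mathbf v))\varphi\,dt-\eta\int_0^T(\operatorname{div}\mathbf u,\operatorname{div}\mathbf v)\varphi\,dt+\int_0^T(\alpha p\mathbf f,\mathbf v)\varphi\,dt+\int_0^T\langle\mathbf s,\mathbf v\rangle\varphi\,dt$. *)

theory Defs
  imports "HOL-Analysis.Analysis" "HOL-Probability.Essential_Supremum"
begin

definition pd :: "('a::euclidean_space \<Rightarrow> real) \<Rightarrow> 'a \<Rightarrow> 'a \<Rightarrow> real" where
  "pd f b x = frechet_derivative f (at x) b"

fun Ck :: "nat \<Rightarrow> ('a::euclidean_space \<Rightarrow> real) \<Rightarrow> bool" where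
  "Ck 0 f = continuous_on UNIV f"
| "Ck (Suc n) f = (f differentiable_on UNIV \<and> continuous_on UNIV f \<and>
                   (\<forall>b\<in>Basis. Ck n (pd f b)))"

definition smooth :: "('a::euclidean_space \<Rightarrow> real) \<Rightarrow> bool" where
  "smooth f \<longleftrightarrow> (\<forall>n. Ck n f)"

definition test_fun :: "'a::euclidean_space set \<Rightarrow> ('a \<Rightarrow> real) \<Rightarrow> bool" where
  "test_fun U \<phi> \<longleftrightarrow> smooth \<phi> \<and> compact (closure {x. \<phi> x \<noteq> 0}) \<and> closure {x. \<phi> x \<noteq> 0} \<subseteq> U"

text \<open>C_0^infinity([0,T)): smooth, vanishing near T (values for t<0 are irrelevant).\<close>
definition test_fun_0T :: "real \<Rightarrow> (real \<Rightarrow> real) \<Rightarrow> bool" where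
  "test_fun_0T T \<phi> \<longleftrightarrow> smooth \<phi> \<and> (\<exists>b<T. \<forall>t\<ge>b. \<phi> t = 0)"

definition piecewise_smooth_boundary :: "(real^'d) set \<Rightarrow> bool" where
  "piecewise_smooth_boundary D \<longleftrightarrow>
     (\<forall>x\<in>frontier D. \<exists>r>0. \<exists>(A::nat set set) (g::nat \<Rightarrow> real^'d \<Rightarrow> real).
        finite A \<and> (\<forall>a\<in>A. finite a) \<and>
        (\<forall>i\<in>\<Union>A. smooth (g i) \<and> frechet_derivative (g i) (at x) \<noteq> (\<lambda>_. 0)) \<and>
        D \<inter> ball x r = ball x r \<inter> (\<Union>a\<in>A. \<Inter>i\<in>a. {y. g i y < 0}))"

definition bounded_domain :: "(real^'d) set \<Rightarrow> bool" where
  "bounded_domain D \<longleftrightarrow> open D \<and> connected D \<and> bounded D \<and> D \<noteq> {}"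

definition QT :: "(real^'d) set \<Rightarrow> real \<Rightarrow> (real \<times> (real^'d)) set" where
  "QT D T = {0<..<T} \<times> D"

definition L2 :: "(real^'d) set \<Rightarrow> (real^'d \<Rightarrow> real) \<Rightarrow> bool" where
  "L2 D g \<longleftrightarrow> g \<in> borel_measurable (lebesgue_on D) \<and> integrable (lebesgue_on D) (\<lambda>x. (g x)\<^sup>2)"

definition L2norm :: "(real^'d) set \<Rightarrow> (real^'d \<Rightarrow> real) \<Rightarrow> real" where
  "L2norm D g = sqrt (integral\<^sup>L (lebesgue_on D) (\<lambda>x. (g x)\<^sup>2))"

definition L2v :: "(real^'d) set \<Rightarrow> (real^'d \<Rightarrow> 'b::euclidean_space) \<Rightarrow> bool" where
  "L2v D g \<longleftrightarrow> g \<in> borel_measurable (lebesgue_on D) \<and> integrable (lebesgue_on D) (\<lambda>x. (norm (g x))\<^sup>2)"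

definition L2vnorm :: "(real^'d) set \<Rightarrow> (real^'d \<Rightarrow> 'b::euclidean_space) \<Rightarrow> real" where
  "L2vnorm D g = sqrt (integral\<^sup>L (lebesgue_on D) (\<lambda>x. (norm (g x))\<^sup>2))"

definition L2hat :: "(real^'d) set \<Rightarrow> (real^'d \<Rightarrow> real) \<Rightarrow> bool" where
  "L2hat D g \<longleftrightarrow> L2 D g \<and> integral\<^sup>L (lebesgue_on D) g = 0"

text \<open>L^2(0,T;L^2(D)) = L^2(Q_T), for scalar / vector / matrix valued functions.\<close>
definition L2Q :: "(real^'d) set \<Rightarrow> real \<Rightarrow> (real \<Rightarrow> real^'d \<Rightarrow> 'b::euclidean_space) \<Rightarrow> bool" where
  "L2Q D T g \<longleftrightarrow> (\<lambda>(t,x). g t x) \<in> borel_measurable (lebesgue_on (QT D T)) \<and>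
      integrable (lebesgue_on (QT D T)) (\<lambda>(t,x). (norm (g t x))\<^sup>2)"

definition L2Qnorm :: "(real^'d) set \<Rightarrow> real \<Rightarrow> (real \<Rightarrow> real^'d \<Rightarrow> 'b::euclidean_space) \<Rightarrow> real" where
  "L2Qnorm D T g = sqrt (integral\<^sup>L (lebesgue_on (QT D T)) (\<lambda>(t,x). (norm (g t x))\<^sup>2))"

definition LinfL2norm :: "(real^'d) set \<Rightarrow> real \<Rightarrow> (real \<Rightarrow> real^'d \<Rightarrow> 'b::euclidean_space) \<Rightarrow> ereal" where
  "LinfL2norm D T g = esssup (lebesgue_on {0..T}) (\<lambda>t. ereal (L2vnorm D (g t)))"

definition LinfQ :: "(real^'d) set \<Rightarrow> real \<Rightarrow> (real \<Rightarrow> real^'d \<Rightarrow> real^'d) \<Rightarrow> bool" where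
  "LinfQ D T f \<longleftrightarrow> (\<lambda>(t,x). f t x) \<in> borel_measurable (lebesgue_on (QT D T)) \<and>
      esssup (lebesgue_on (QT D T)) (\<lambda>(t,x). ereal (norm (f t x))) < \<infinity>"

definition LinfQnorm :: "(real^'d) set \<Rightarrow> real \<Rightarrow> (real \<Rightarrow> real^'d \<Rightarrow> real^'d) \<Rightarrow> real" where
  "LinfQnorm D T f = real_of_ereal (esssup (lebesgue_on (QT D T)) (\<lambda>(t,x). ereal (norm (f t x))))"

definition has_weak_jac :: "(real^'d) set \<Rightarrow> (real^'d \<Rightarrow> real^'d) \<Rightarrow> (real^'d \<Rightarrow> real^'d^'d) \<Rightarrow> bool" where
  "has_weak_jac D u G \<longleftrightarrow> L2v D u \<and> L2v D G \<and>
     (\<forall>\<phi>. test_fun D \<phi> \<longrightarrow> (\<forall>k i.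
        integral\<^sup>L (lebesgue_on D) (\<lambda>x. u x $ k * pd \<phi> (axis i 1) x)
        = - integral\<^sup>L (lebesgue_on D) (\<lambda>x. G x $ k $ i * \<phi> x)))"

definition H01 :: "(real^'d) set \<Rightarrow> (real^'d \<Rightarrow> real^'d) \<Rightarrow> (real^'d \<Rightarrow> real^'d^'d) \<Rightarrow> bool" where
  "H01 D v G \<longleftrightarrow> has_weak_jac D v G \<and>
     (\<exists>\<Phi>::nat \<Rightarrow> real^'d \<Rightarrow> real^'d. (\<forall>n k. test_fun D (\<lambda>x. \<Phi> n x $ k)) \<and>
        (\<lambda>n. integral\<^sup>L (lebesgue_on D) (\<lambda>x. (norm (\<Phi> n x - v x))\<^sup>2)
            + integral\<^sup>L (lebesgue_on D)
                (\<lambda>x. (\<Sum>k\<in>UNIV. \<Sum>i\<in>UNIV. (pd (\<lambda>y. \<Phi> n y $ k) (axis i 1) x - G x $ k $ i)\<^sup>2)))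
        \<longlonglongrightarrow> 0)"

definition divJ :: "real^'d^'d \<Rightarrow> real" where
  "divJ J = (\<Sum>i\<in>UNIV. J $ i $ i)"

definition jac_inner :: "real^'d^'d \<Rightarrow> real^'d^'d \<Rightarrow> real" where
  "jac_inner J K = (\<Sum>k\<in>UNIV. \<Sum>i\<in>UNIV. J $ k $ i * K $ k $ i)"

definition Hm1 :: "(real^'d) set \<Rightarrow> ((real^'d \<Rightarrow> real^'d) \<Rightarrow> real) \<Rightarrow> bool" where
  "Hm1 D F \<longleftrightarrow>
     (\<forall>v1 G1 v2 G2 a b. H01 D v1 G1 \<longrightarrow> H01 D v2 G2 \<longrightarrow>
        F (\<lambda>x. a *\<^sub>R v1 x + b *\<^sub>R v2 x) = a * F v1 + b * F v2) \<and>
     (\<exists>C. \<forall>v G. H01 D v G \<longrightarrow> \<bar>F v\<bar> \<le> C * L2vnorm D G)"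

definition Hm1norm :: "(real^'d) set \<Rightarrow> ((real^'d \<Rightarrow> real^'d) \<Rightarrow> real) \<Rightarrow> real" where
  "Hm1norm D F = Inf {C. C \<ge> 0 \<and> (\<forall>v G. H01 D v G \<longrightarrow> \<bar>F v\<bar> \<le> C * L2vnorm D G)}"

definition L2Hm1 :: "(real^'d) set \<Rightarrow> real \<Rightarrow> (real \<Rightarrow> (real^'d \<Rightarrow> real^'d) \<Rightarrow> real) \<Rightarrow> bool" where
  "L2Hm1 D T s \<longleftrightarrow> (AE t in lebesgue_on {0..T}. Hm1 D (s t)) \<and>
     (\<forall>v G. H01 D v G \<longrightarrow> (\<lambda>t. s t v) \<in> borel_measurable (lebesgue_on {0..T})) \<and>
     (\<lambda>t. Hm1norm D (s t)) \<in> borel_measurable (lebesgue_on {0..T}) \<and>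
     integrable (lebesgue_on {0..T}) (\<lambda>t. (Hm1norm D (s t))\<^sup>2)"

definition L2Hm1norm :: "(real^'d) set \<Rightarrow> real \<Rightarrow> (real \<Rightarrow> (real^'d \<Rightarrow> real^'d) \<Rightarrow> real) \<Rightarrow> real" where
  "L2Hm1norm D T s = sqrt (integral\<^sup>L (lebesgue_on {0..T}) (\<lambda>t. (Hm1norm D (s t))\<^sup>2))"

text \<open>L^2(0,T;H_0^1(D)^d): u with a jointly square integrable Jacobian G such that
  u(t) is in H_0^1 with Jacobian G(t) for a.e. t; its norm is the L^2(Q_T) norm of G.\<close>
definition L2H01 :: "(real^'d) set \<Rightarrow> real \<Rightarrow> (real \<Rightarrow> real^'d \<Rightarrow> real^'d) \<Rightarrow> (real \<Rightarrow> real^'d \<Rightarrow> real^'d^'d) \<Rightarrow> bool" where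
  "L2H01 D T u G \<longleftrightarrow> L2Q D T u \<and> L2Q D T G \<and> (AE t in lebesgue_on {0..T}. H01 D (u t) (G t))"

definition has_dt_Hm1 :: "(real^'d) set \<Rightarrow> real \<Rightarrow> (real \<Rightarrow> real^'d \<Rightarrow> real^'d) \<Rightarrow> (real \<Rightarrow> (real^'d \<Rightarrow> real^'d) \<Rightarrow> real) \<Rightarrow> bool" where
  "has_dt_Hm1 D T u w \<longleftrightarrow> L2Hm1 D T w \<and>
     (\<forall>v Gv \<phi>. H01 D v Gv \<longrightarrow> test_fun {0<..<T} \<phi> \<longrightarrow>
        integral\<^sup>L (lebesgue_on {0..T}) (\<lambda>t. integral\<^sup>L (lebesgue_on D) (\<lambda>x. u t x \<bullet> v x) * pd \<phi> 1 t)
        = - integral\<^sup>L (lebesgue_on {0..T}) (\<lambda>t. w t v * \<phi> t))"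

definition W12hat :: "(real^'d) set \<Rightarrow> real \<Rightarrow> (real \<Rightarrow> real^'d \<Rightarrow> real) \<Rightarrow> bool" where
  "W12hat D T p \<longleftrightarrow> L2Q D T p \<and> (AE t in lebesgue_on {0..T}. L2hat D (p t)) \<and>
     (\<exists>q. L2Q D T q \<and> (AE t in lebesgue_on {0..T}. L2hat D (q t)) \<and>
        (\<forall>r \<phi>. L2 D r \<longrightarrow> test_fun {0<..<T} \<phi> \<longrightarrow>
          integral\<^sup>L (lebesgue_on {0..T}) (\<lambda>t. integral\<^sup>L (lebesgue_on D) (\<lambda>x. p t x * r x) * pd \<phi> 1 t)
          = - integral\<^sup>L (lebesgue_on {0..T}) (\<lambda>t. integral\<^sup>L (lebesgue_on D) (\<lambda>x. q t x * r x) * \<phi> t)))"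

text \<open>G is the Jacobian of u (determined a.e. by u).\<close>
definition weak_sol ::
  "(real^'d) set \<Rightarrow> real \<Rightarrow> real \<Rightarrow> real \<Rightarrow> real \<Rightarrow> real \<Rightarrow>
   (real \<Rightarrow> real^'d \<Rightarrow> real) \<Rightarrow> (real \<Rightarrow> (real^'d \<Rightarrow> real^'d) \<Rightarrow> real) \<Rightarrow>
   (real \<Rightarrow> real^'d \<Rightarrow> real^'d) \<Rightarrow> (real^'d \<Rightarrow> real^'d) \<Rightarrow> (real^'d \<Rightarrow> real) \<Rightarrow>
   (real \<Rightarrow> real^'d \<Rightarrow> real^'d) \<Rightarrow> (real \<Rightarrow> real^'d \<Rightarrow> real^'d^'d) \<Rightarrow> (real \<Rightarrow> real^'d \<Rightarrow> real) \<Rightarrow> bool" where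
  "weak_sol D T \<rho>0 \<alpha> \<mu> \<eta> \<sigma> s f u0 p0 u G p \<longleftrightarrow>
     L2H01 D T u G \<and> L2Q D T p \<and>
     (\<forall>\<phi> r. test_fun_0T T \<phi> \<longrightarrow> L2 D r \<longrightarrow>
        - integral\<^sup>L (lebesgue_on {0..T}) (\<lambda>t. integral\<^sup>L (lebesgue_on D) (\<lambda>x. \<alpha> * p t x * r x) * pd \<phi> 1 t)
        - integral\<^sup>L (lebesgue_on D) (\<lambda>x. \<alpha> * p0 x * r x) * \<phi> 0
        + integral\<^sup>L (lebesgue_on {0..T}) (\<lambda>t. integral\<^sup>L (lebesgue_on D) (\<lambda>x. \<rho>0 * divJ (G t x) * r x) * \<phi> t)
        = integral\<^sup>L (lebesgue_on {0..T}) (\<lambda>t. integral\<^sup>L (lebesgue_on D) (\<lambda>x. \<sigma> t x * r x) * \<phi> t)) \<and>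
     (\<forall>\<phi> v Gv. test_fun_0T T \<phi> \<longrightarrow> H01 D v Gv \<longrightarrow>
        - integral\<^sup>L (lebesgue_on {0..T}) (\<lambda>t. \<rho>0 * integral\<^sup>L (lebesgue_on D) (\<lambda>x. u t x \<bullet> v x) * pd \<phi> 1 t)
        - \<rho>0 * integral\<^sup>L (lebesgue_on D) (\<lambda>x. u0 x \<bullet> v x) * \<phi> 0
        - integral\<^sup>L (lebesgue_on {0..T}) (\<lambda>t. integral\<^sup>L (lebesgue_on D) (\<lambda>x. p t x * divJ (Gv x)) * \<phi> t)
        = - \<mu> * integral\<^sup>L (lebesgue_on {0..T}) (\<lambda>t. integral\<^sup>L (lebesgue_on D) (\<lambda>x. jac_inner (G t x) (Gv x)) * \<phi> t)
          - \<eta> * integral\<^sup>L (lebesgue_on {0..T}) (\<lambda>t. integral\<^sup>L (lebesgue_on D) (\<lambda>x. divJ (G t x) * divJ (Gv x)) * \<phi> t)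
          + integral\<^sup>L (lebesgue_on {0..T}) (\<lambda>t. integral\<^sup>L (lebesgue_on D) (\<lambda>x. \<alpha> * p t x * (f t x \<bullet> v x)) * \<phi> t)
          + integral\<^sup>L (lebesgue_on {0..T}) (\<lambda>t. s t v * \<phi> t))"

end

(* Multiply the mass equation by 1/rho_0 and carry the Jacobian of u as a redundant middle
   component of U = (u, Du, p).  Problem (P) then reads (m U)_t = B U + Z with m degenerate
   (it annihilates Du) and kappa m - B coercive for large kappa, since the pressure and
   divergence terms of the two equations cancel.  Existence follows from Lions' projection
   argument.  The energy inequality is obtained without regularity of U by testing with the
   solution of a scalar backward equation in time applied to finite sums of tensors that
   approximate U; it gives uniqueness and the estimates.  The forcing s and the time derivative
   u_t live in the dual of H_0^1 and are represented, jointly in time and space, as divergences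
   of square integrable matrix fields, which avoids Bochner spaces. *)
theory Submission
  imports Defs
begin

section \<open>Square-integrable functions\<close>

text \<open>With Du as a component, all operators act pointwise on finite-dimensional values and
  every estimate starts from a pointwise quadratic inequality. The only nonlocal fact, that the
  middle component is the Jacobian of the first, is put into the closed subspace \<open>KK\<close>.
  The obstacle is that m gives no time derivative of Du, so U itself is not an admissible test
  function. For an approximant \<psi> of U the solution of \<xi> - h \<xi>' = \<psi>, \<xi>(T) = 0,
  is admissible, and the surplus - h <m \<xi>', \<xi>'> has a favourable sign. Choosing \<psi> after
  h makes <m (U - \<psi>), \<xi>'> small although \<xi>' is of size 1/h. The result is an
  inequality, with the energy at time T dropped; weights in time turn it into both the dissipation
  bound and the bound for almost every t. The weights \<rho> and \<alpha>/\<rho> in m make the term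
  \<alpha> p f cost only |f| sqrt \<alpha> / 2 in \<kappa>. For this reason the constants stay
  bounded as \<alpha> tends to 0.\<close>

definition l2 :: "'a measure \<Rightarrow> ('a \<Rightarrow> 'b::euclidean_space) \<Rightarrow> bool" where
  "l2 N f \<longleftrightarrow> f \<in> borel_measurable N \<and> integrable N (\<lambda>x. (norm (f x))\<^sup>2)"

text \<open>Functions are kept as functions and not as classes modulo null sets, so
  \<open>ip\<close> is only positive semidefinite and equality is always stated with
  \<open>AE\<close>.\<close>

definition ip :: "'a measure \<Rightarrow> ('a \<Rightarrow> 'b::euclidean_space) \<Rightarrow> ('a \<Rightarrow> 'b) \<Rightarrow> real" where
  "ip N f g = (\<integral>x. f x \<bullet> g x \<partial>N)"

definition l2n :: "'a measure \<Rightarrow> ('a \<Rightarrow> 'b::euclidean_space) \<Rightarrow> real" where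
  "l2n N f = sqrt (\<integral>x. (norm (f x))\<^sup>2 \<partial>N)"

lemma l2_meas [measurable_dest]: "l2 N f \<Longrightarrow> f \<in> borel_measurable N"
  by (simp add: l2_def)

lemma l2_integrable_sq: "l2 N f \<Longrightarrow> integrable N (\<lambda>x. (norm (f x))\<^sup>2)"
  by (simp add: l2_def)

lemma l2_zero [simp]: "l2 N (\<lambda>x. 0)"
  by (simp add: l2_def)

lemma l2_integrable_inner:
  assumes "l2 N f" "l2 N g" shows "integrable N (\<lambda>x. f x \<bullet> g x)"
proof (rule Bochner_Integration.integrable_bound)
  show "integrable N (\<lambda>x. (norm (f x))\<^sup>2 + (norm (g x))\<^sup>2)"
    using assms by (auto simp: l2_def)
  show "(\<lambda>x. f x \<bullet> g x) \<in> borel_measurable N"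
    using assms by (auto simp: l2_def)
  have "\<bar>f x \<bullet> g x\<bar> \<le> (norm (f x))\<^sup>2 + (norm (g x))\<^sup>2" for x
  proof -
    have "2 * (norm (f x) * norm (g x)) \<le> (norm (f x))\<^sup>2 + (norm (g x))\<^sup>2"
      using sum_squares_bound[of "norm (f x)" "norm (g x)"] by simp
    moreover have "0 \<le> norm (f x) * norm (g x)" by simp
    ultimately show ?thesis using Cauchy_Schwarz_ineq2[of "f x" "g x"] by linarith
  qed
  then show "AE x in N. norm (f x \<bullet> g x) \<le> norm ((norm (f x))\<^sup>2 + (norm (g x))\<^sup>2)"
    by auto
qed

lemma l2_scale: assumes "l2 N f" shows "l2 N (\<lambda>x. a *\<^sub>R f x)"
  using assms by (auto simp: l2_def power_mult_distrib)

lemma l2_add: assumes "l2 N f" "l2 N g" shows "l2 N (\<lambda>x. f x + g x)"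
proof -
  have "integrable N (\<lambda>x. (norm (f x))\<^sup>2 + (norm (g x))\<^sup>2 + 2 * (f x \<bullet> g x))"
    using assms l2_integrable_inner[OF assms] by (auto simp: l2_def)
  moreover have "(\<lambda>x. (norm (f x))\<^sup>2 + (norm (g x))\<^sup>2 + 2 * (f x \<bullet> g x)) = (\<lambda>x. (norm (f x + g x))\<^sup>2)"
    by (auto simp: power2_norm_eq_inner inner_add inner_commute)
  ultimately show ?thesis using assms by (auto simp: l2_def)
qed

lemma l2_lin: assumes "l2 N f" "l2 N g" shows "l2 N (\<lambda>x. a *\<^sub>R f x + b *\<^sub>R g x)"
  by (intro l2_add l2_scale assms)

lemma l2_diff: assumes "l2 N f" "l2 N g" shows "l2 N (\<lambda>x. f x - g x)"
  using l2_lin[OF assms, of 1 "-1"] by simp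

lemma l2_bound:
  assumes "l2 N f" "g \<in> borel_measurable N" "AE x in N. norm (g x) \<le> C * norm (f x)"
  shows "l2 N g"
  unfolding l2_def
proof
  show "integrable N (\<lambda>x. (norm (g x))\<^sup>2)"
  proof (rule Bochner_Integration.integrable_bound)
    show "integrable N (\<lambda>x. C\<^sup>2 * (norm (f x))\<^sup>2)" using assms by (auto simp: l2_def)
    show "AE x in N. norm ((norm (g x))\<^sup>2) \<le> norm (C\<^sup>2 * (norm (f x))\<^sup>2)"
      using assms(3) by eventually_elim (simp add: power_mono flip: power_mult_distrib)
  qed (use assms in auto)
qed (fact assms)

lemma l2_AE_cong:
  assumes "l2 N f" "g \<in> borel_measurable N" "AE x in N. f x = g x"
  shows "l2 N g"
  by (rule l2_bound[where C=1, OF assms(1,2)]) (use assms(3) in \<open>eventually_elim, simp\<close>)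

lemma ip_lin_left:
  assumes "l2 N f" "l2 N g" "l2 N h"
  shows "ip N (\<lambda>x. a *\<^sub>R f x + b *\<^sub>R g x) h = a * ip N f h + b * ip N g h"
  using l2_integrable_inner[OF assms(1,3)] l2_integrable_inner[OF assms(2,3)]
  by (simp add: ip_def inner_add_left)

lemma ip_commute: "ip N f g = ip N g f"
  by (simp add: ip_def inner_commute)

lemma ip_lin_right:
  assumes "l2 N f" "l2 N g" "l2 N h"
  shows "ip N h (\<lambda>x. a *\<^sub>R f x + b *\<^sub>R g x) = a * ip N h f + b * ip N h g"
  using ip_lin_left[OF assms] by (simp only: ip_commute[of N h])

lemma ip_diff_left:
  assumes "l2 N f" "l2 N g" "l2 N h"
  shows "ip N (\<lambda>x. f x - g x) h = ip N f h - ip N g h"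
  using ip_lin_left[OF assms, of 1 "-1"] by simp

lemma ip_diff_right:
  assumes "l2 N f" "l2 N g" "l2 N h"
  shows "ip N h (\<lambda>x. f x - g x) = ip N h f - ip N h g"
  using ip_lin_right[OF assms, of 1 "-1"] by simp

lemma ip_scale_left: "ip N (\<lambda>x. a *\<^sub>R f x) h = a * ip N f h"
  by (simp add: ip_def)

lemma ip_scale_right: "ip N f (\<lambda>x. a *\<^sub>R h x) = a * ip N f h"
  by (simp add: ip_def)

lemma ip_AE_cong:
  assumes "AE x in N. f x = f' x" "AE x in N. g x = g' x"
    "f \<in> borel_measurable N" "f' \<in> borel_measurable N" "g \<in> borel_measurable N" "g' \<in> borel_measurable N"
  shows "ip N f g = ip N f' g'"
  unfolding ip_def by (rule integral_cong_AE) (use assms in \<open>auto\<close>)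

lemma l2n_nonneg [simp]: "0 \<le> l2n N f"
  by (simp add: l2n_def)

lemma l2n_sq: "(l2n N f)\<^sup>2 = ip N f f"
  by (simp add: l2n_def ip_def power2_norm_eq_inner)

lemma l2n_zero [simp]: "l2n N (\<lambda>x. 0) = 0"
  by (simp add: l2n_def)

lemma l2n_scale: "l2n N (\<lambda>x. a *\<^sub>R f x) = \<bar>a\<bar> * l2n N f"
  by (simp add: l2n_def power_mult_distrib real_sqrt_mult)

lemma l2n_lin_sq:
  assumes "l2 N f" "l2 N g"
  shows "(l2n N (\<lambda>x. a *\<^sub>R f x + b *\<^sub>R g x))\<^sup>2 = a\<^sup>2 * (l2n N f)\<^sup>2 + 2*a*b * ip N f g + b\<^sup>2 * (l2n N g)\<^sup>2"
  unfolding l2n_sq using assms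
  by (simp add: ip_lin_left ip_lin_right l2_lin ip_commute[of N g f] algebra_simps power2_eq_square)

lemma l2_CS:
  assumes "l2 N f" "l2 N g" shows "\<bar>ip N f g\<bar> \<le> l2n N f * l2n N g"
proof -
  have *: "0 \<le> a\<^sup>2 * (l2n N f)\<^sup>2 + 2*a*b * ip N f g + b\<^sup>2 * (l2n N g)\<^sup>2" for a b
    using l2n_lin_sq[OF assms, of a b] by (metis zero_le_power2)
  have "(ip N f g)\<^sup>2 \<le> (l2n N f * l2n N g)\<^sup>2"
  proof (cases "l2n N g = 0")
    case True
    show ?thesis
    proof (rule ccontr)
      assume "\<not> ?thesis"
      then have nz: "ip N f g \<noteq> 0" using True by auto
      \<comment> \<open>When g has norm zero the quadratic form is affine in b, and an affine
        function bounded below on the whole line has slope zero.\<close>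
      have "0 \<le> (l2n N f)\<^sup>2 + 2 * b * ip N f g" for b using *[of 1 b] True by simp
      from this[of "-((l2n N f)\<^sup>2 + 1) / (2 * ip N f g)"] nz show False by (simp add: field_simps)
    qed
  next
    case False
    then have pos: "(l2n N g)\<^sup>2 > 0" by simp
    have "0 \<le> (l2n N g)\<^sup>2 * ((l2n N f)\<^sup>2 * (l2n N g)\<^sup>2 - (ip N f g)\<^sup>2)"
      using *[of "(l2n N g)\<^sup>2" "- ip N f g"] by (simp add: algebra_simps power2_eq_square)
    then show ?thesis using pos by (simp add: zero_le_mult_iff power_mult_distrib)
  qed
  then show ?thesis by (simp add: abs_le_square_iff[symmetric] )
qed

lemma l2n_add:
  assumes "l2 N f" "l2 N g" shows "l2n N (\<lambda>x. f x + g x) \<le> l2n N f + l2n N g"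
proof -
  have "(l2n N (\<lambda>x. f x + g x))\<^sup>2 \<le> (l2n N f + l2n N g)\<^sup>2"
    using l2n_lin_sq[OF assms, of 1 1] l2_CS[OF assms] by (simp add: power2_sum)
  then show ?thesis by (rule power2_le_imp_le) simp
qed

lemma l2n_diff_commute: "l2n N (\<lambda>x. f x - g x) = l2n N (\<lambda>x. g x - f x)"
  by (simp add: l2n_def norm_minus_commute)

lemma l2n_diff_triangle:
  assumes "l2 N f" "l2 N g" "l2 N h"
  shows "l2n N (\<lambda>x. f x - h x) \<le> l2n N (\<lambda>x. f x - g x) + l2n N (\<lambda>x. g x - h x)"
  using l2n_add[OF l2_diff[OF assms(1,2)] l2_diff[OF assms(2,3)]] by simp

lemma l2n_le_add_diff:
  assumes "l2 N f" "l2 N g"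
  shows "l2n N f \<le> l2n N g + l2n N (\<lambda>x. f x - g x)"
  using l2n_add[OF assms(2) l2_diff[OF assms]] by simp

lemma l2n_AE_cong:
  assumes "AE x in N. f x = g x" "f \<in> borel_measurable N" "g \<in> borel_measurable N"
  shows "l2n N f = l2n N g"
  unfolding l2n_def by (intro arg_cong[where f=sqrt] integral_cong_AE) (use assms in \<open>auto\<close>)

lemma l2n_bound:
  assumes "l2 N f" "l2 N g" "AE x in N. norm (g x) \<le> C * norm (f x)" "C \<ge> 0"
  shows "l2n N g \<le> C * l2n N f"
proof -
  have "(\<integral>x. (norm (g x))\<^sup>2 \<partial>N) \<le> (\<integral>x. C\<^sup>2 * (norm (f x))\<^sup>2 \<partial>N)"
    using assms(1,2)
    apply (intro integral_mono_AE)
    apply (auto simp: l2_def)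
    using assms(3) by eventually_elim (metis norm_ge_zero power_mono power_mult_distrib)
  then have "sqrt (\<integral>x. (norm (g x))\<^sup>2 \<partial>N) \<le> sqrt (C\<^sup>2 * (\<integral>x. (norm (f x))\<^sup>2 \<partial>N))"
    by simp
  then show ?thesis using assms(4) by (simp add: l2n_def real_sqrt_mult)
qed

lemma l2n_eq_0_AE:
  assumes "l2 N f" "l2n N f = 0" shows "AE x in N. f x = 0"
proof -
  have "(\<integral>x. (norm (f x))\<^sup>2 \<partial>N) = 0" using assms(2) by (simp add: l2n_def)
  then have "AE x in N. (norm (f x))\<^sup>2 = 0"
    using assms(1) by (subst integral_nonneg_eq_0_iff_AE[symmetric]) (auto simp: l2_def)
  then show ?thesis by simp
qed

text \<open>Riesz-Fischer. A subsequence with geometrically decreasing increments converges almost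
  everywhere, and Fatou's lemma turns the pointwise limit into a limit in norm of the whole
  sequence.\<close>

lemma l2_complete:
  fixes f :: "nat \<Rightarrow> 'a \<Rightarrow> 'b::euclidean_space"
  assumes f: "\<And>n. l2 N (f n)"
    and C: "\<And>e. e > 0 \<Longrightarrow> \<exists>k. \<forall>m\<ge>k. \<forall>n\<ge>k. l2n N (\<lambda>x. f m x - f n x) < e"
  shows "\<exists>g. l2 N g \<and> (\<lambda>n. l2n N (\<lambda>x. f n x - g x)) \<longlonglongrightarrow> 0"
proof -
  have [measurable]: "\<And>n. f n \<in> borel_measurable N" using f by (simp add: l2_def)
  obtain k where k: "\<And>j m n. m \<ge> k j \<Longrightarrow> n \<ge> k j \<Longrightarrow> l2n N (\<lambda>x. f m x - f n x) < (1/2)^j"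
  proof -
    have "\<exists>k. \<forall>m\<ge>k. \<forall>n\<ge>k. l2n N (\<lambda>x. f m x - f n x) < (1/2)^j" for j
      by (rule C) simp
    then show thesis using that by metis
  qed
  \<comment> \<open>Partial sums of \<open>k\<close> are monotone indices that are still at least
    \<open>k j\<close>.\<close>
  define r where "r j = (\<Sum>i\<le>j. k i)" for j
  have r: "r j \<ge> k j" "r (Suc j) \<ge> r j" for j by (auto simp: r_def atMost_Suc sum.insert member_le_sum)
  have rmono: "mono r" by (rule incseq_SucI) (rule r)
  define d where "d j x = f (r (Suc j)) x - f (r j) x" for j x
  have [measurable]: "d j \<in> borel_measurable N" for j unfolding d_def by measurable
  have ld: "l2 N (d j)" for j unfolding d_def by (intro l2_diff f)
  have "l2n N (d j) < (1/2)^j" for j unfolding d_def using k r by (meson order_trans)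
  then have dn: "(l2n N (d j))\<^sup>2 \<le> (1/4)^j" for j
  proof -
    have "(l2n N (d j))\<^sup>2 \<le> ((1/2)^j)\<^sup>2" by (rule power_mono) (use \<open>\<And>j. l2n N (d j) < (1/2)^j\<close>[of j] in auto)
    also have "((1/2)^j)\<^sup>2 = (1/4::real)^j" by (simp add: power2_eq_square flip: power_mult_distrib)
    finally show ?thesis .
  qed
  have nnd: "(\<integral>\<^sup>+x. ennreal ((norm (d j x))\<^sup>2) \<partial>N) \<le> ennreal ((1/4)^j)" for j
    using dn[of j] ld[of j] by (subst nn_integral_eq_integral) (auto simp: l2_def l2n_def)
  \<comment> \<open>The weight 2^j is summable against squared norms of at most 4^(-j), and it is
    large enough to force absolute convergence of the increments at almost every point.\<close>
  have "(\<integral>\<^sup>+x. (\<Sum>j. ennreal (2^j * (norm (d j x))\<^sup>2)) \<partial>N) = (\<Sum>j. \<integral>\<^sup>+x. ennreal (2^j) * ennreal ((norm (d j x))\<^sup>2) \<partial>N)"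
    by (subst nn_integral_suminf[symmetric]) (auto simp: ennreal_mult)
  also have "\<dots> = (\<Sum>j. ennreal (2^j) * (\<integral>\<^sup>+x. ennreal ((norm (d j x))\<^sup>2) \<partial>N))"
    by (intro suminf_cong nn_integral_cmult) measurable
  also have "\<dots> \<le> (\<Sum>j. ennreal ((1/2)^j))"
  proof (intro suminf_le)
    fix j
    have "ennreal (2^j) * (\<integral>\<^sup>+x. ennreal ((norm (d j x))\<^sup>2) \<partial>N) \<le> ennreal (2^j) * ennreal ((1/4)^j)"
      by (intro mult_left_mono nnd) simp
    also have "\<dots> = ennreal ((1/2)^j)"
      by (subst ennreal_mult[symmetric]) (auto simp: power_mult_distrib[symmetric])
    finally show "ennreal (2^j) * (\<integral>\<^sup>+x. ennreal ((norm (d j x))\<^sup>2) \<partial>N) \<le> ennreal ((1/2)^j)" .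
  qed auto
  also have "\<dots> < top"
    by (subst suminf_ennreal2) auto
  finally have fin: "(\<integral>\<^sup>+x. (\<Sum>j. ennreal (2^j * (norm (d j x))\<^sup>2)) \<partial>N) \<noteq> \<infinity>"
    by simp
  have "AE x in N. (\<Sum>j. ennreal (2^j * (norm (d j x))\<^sup>2)) \<noteq> \<infinity>"
    by (rule nn_integral_PInf_AE[OF _ fin]) measurable
  then have conv: "AE x in N. convergent (\<lambda>j. f (r j) x)"
  proof eventually_elim
    case (elim x)
    then have s: "summable (\<lambda>j. 2^j * (norm (d j x))\<^sup>2)"
      by (intro summable_suminf_not_top) auto
    have "summable (\<lambda>j. norm (d j x))"
    proof (rule summable_comparison_test)
      show "summable (\<lambda>j. 2^j * (norm (d j x))\<^sup>2 + (1/2)^j)"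
        by (intro summable_add s summable_geometric) auto
      \<comment> \<open>Either the increment is at most 2^(-j), or 2^j times the increment exceeds 1
        and multiplying by it only enlarges.\<close>
      have "norm (d j x) \<le> 2^j * (norm (d j x))\<^sup>2 + (1/2)^j" for j
      proof (cases "norm (d j x) \<le> (1/2)^j")
        case True then show ?thesis by (simp add: add_increasing)
      next
        case False
        then have "(1/2)^j * norm (d j x) \<le> (norm (d j x))\<^sup>2" by (simp add: power2_eq_square mult_right_mono)
        then have "2^j * ((1/2)^j * norm (d j x)) \<le> 2^j * (norm (d j x))\<^sup>2" by (intro mult_left_mono) auto
        then have "norm (d j x) \<le> 2^j * (norm (d j x))\<^sup>2" by (simp add: mult.assoc[symmetric] power_mult_distrib[symmetric])
        then show ?thesis by (simp add: add_increasing2)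
      qed
      then show "\<exists>M. \<forall>n\<ge>M. norm (norm (d n x)) \<le> 2^n * (norm (d n x))\<^sup>2 + (1/2)^n" by auto
    qed
    then have "summable (\<lambda>j. d j x)" by (rule summable_norm_cancel)
    then have "convergent (\<lambda>n. \<Sum>j<n. d j x)" by (simp add: summable_iff_convergent)
    moreover have "(\<Sum>j<n. d j x) = f (r n) x - f (r 0) x" for n
      unfolding d_def by (rule sum_lessThan_telescope)
    ultimately have "convergent (\<lambda>n. f (r n) x - f (r 0) x)" by simp
    then show ?case by (simp add: convergent_diff_const_right_iff)
  qed
  define g where "g x = lim (\<lambda>j. f (r j) x)" for x
  have [measurable]: "g \<in> borel_measurable N" unfolding g_def by (rule borel_measurable_lim_metric) measurable
  have lim: "AE x in N. (\<lambda>j. f (r j) x) \<longlonglongrightarrow> g x"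
    using conv by eventually_elim (simp add: g_def convergent_LIMSEQ_iff)
  \<comment> \<open>Fatou is applied in the index i of the subsequence with n fixed, so the bound
    holds for every late n and not only along \<open>r\<close>.\<close>
  have fatou: "(\<integral>\<^sup>+x. ennreal ((norm (f n x - g x))\<^sup>2) \<partial>N) \<le> ennreal (((1/2)^j)\<^sup>2)" if "n \<ge> k j" for n j
  proof -
    have "(\<integral>\<^sup>+x. ennreal ((norm (f n x - g x))\<^sup>2) \<partial>N) = (\<integral>\<^sup>+x. liminf (\<lambda>i. ennreal ((norm (f n x - f (r i) x))\<^sup>2)) \<partial>N)"
    proof (rule nn_integral_cong_AE)
      show "AE x in N. ennreal ((norm (f n x - g x))\<^sup>2) = liminf (\<lambda>i. ennreal ((norm (f n x - f (r i) x))\<^sup>2))"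
        using lim
      proof eventually_elim
        case (elim x)
        have "(\<lambda>i. ennreal ((norm (f n x - f (r i) x))\<^sup>2)) \<longlonglongrightarrow> ennreal ((norm (f n x - g x))\<^sup>2)"
          by (intro tendsto_intros elim)
        then show ?case by (intro lim_imp_Liminf[symmetric]) auto
      qed
    qed
    also have "\<dots> \<le> liminf (\<lambda>i. \<integral>\<^sup>+x. ennreal ((norm (f n x - f (r i) x))\<^sup>2) \<partial>N)"
      by (rule nn_integral_liminf) measurable
    also have "\<dots> \<le> ennreal (((1/2)^j)\<^sup>2)"
    proof -
      have "eventually (\<lambda>i. (\<integral>\<^sup>+x. ennreal ((norm (f n x - f (r i) x))\<^sup>2) \<partial>N) \<le> ennreal (((1/2)^j)\<^sup>2)) sequentially"
      proof (rule eventually_sequentiallyI)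
        fix i assume "j \<le> i"
        then have "r i \<ge> k j" using r(1)[of j] rmono by (meson monoD order_trans)
        then have *: "l2n N (\<lambda>x. f n x - f (r i) x) < (1/2)^j" using that k by blast
        have "l2 N (\<lambda>x. f n x - f (r i) x)" by (intro l2_diff f)
        then have "(\<integral>\<^sup>+x. ennreal ((norm (f n x - f (r i) x))\<^sup>2) \<partial>N) = ennreal ((l2n N (\<lambda>x. f n x - f (r i) x))\<^sup>2)"
          by (subst nn_integral_eq_integral) (auto simp: l2_def l2n_def)
        also have "\<dots> \<le> ennreal (((1/2)^j)\<^sup>2)" using * by (intro ennreal_leI power_mono) auto
        finally show "(\<integral>\<^sup>+x. ennreal ((norm (f n x - f (r i) x))\<^sup>2) \<partial>N) \<le> ennreal (((1/2)^j)\<^sup>2)" .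
      qed
      then show ?thesis
        by (intro order_trans[OF Liminf_le_Limsup Limsup_bounded]) auto
    qed
    finally show ?thesis .
  qed
  have ldiff: "l2 N (\<lambda>x. f n x - g x)" if "n \<ge> k 0" for n
    unfolding l2_def
  proof
    show "integrable N (\<lambda>x. (norm (f n x - g x))\<^sup>2)"
      by (rule integrableI_bounded) (use fatou[OF that] in \<open>auto simp: le_less_trans top.not_eq_extremum intro: le_less_trans\<close>)
  qed measurable
  have lg: "l2 N g" using l2_diff[OF f[of "k 0"] ldiff[of "k 0"]] by simp
  have small: "l2n N (\<lambda>x. f n x - g x) \<le> (1/2)^j" if "n \<ge> k j" for n j
  proof -
    have "ennreal (\<integral>x. (norm (f n x - g x))\<^sup>2 \<partial>N) \<le> ennreal (((1/2)^j)\<^sup>2)"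
      using fatou[OF that] l2_diff[OF f lg, of n] by (subst nn_integral_eq_integral[symmetric]) (auto simp: l2_def)
    then have "(\<integral>x. (norm (f n x - g x))\<^sup>2 \<partial>N) \<le> ((1/2)^j)\<^sup>2" by (subst (asm) ennreal_le_iff) auto
    then show ?thesis unfolding l2n_def by (intro real_le_lsqrt) auto
  qed
  have "(\<lambda>n. l2n N (\<lambda>x. f n x - g x)) \<longlonglongrightarrow> 0"
  proof (rule LIMSEQ_I)
    fix e :: real assume "e > 0"
    then obtain j where "(1/2)^j < e" using real_arch_pow_inv[of e "1/2"] by auto
    then have "\<forall>n\<ge>k j. norm (l2n N (\<lambda>x. f n x - g x) - 0) < e" using small[of j] by (auto intro: le_less_trans)
    then show "\<exists>no. \<forall>n\<ge>no. norm (l2n N (\<lambda>x. f n x - g x) - 0) < e" by blast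
  qed
  with lg show ?thesis by blast
qed

lemma ip_tendsto:
  assumes "\<And>n. l2 N (f n)" "l2 N z" "(\<lambda>n. l2n N (\<lambda>x. f n x - z x)) \<longlonglongrightarrow> 0" "l2 N g"
  shows "(\<lambda>n. ip N (f n) g) \<longlonglongrightarrow> ip N z g"
proof (rule LIM_zero_cancel, rule Lim_null_comparison)
  show "(\<lambda>n. l2n N (\<lambda>x. f n x - z x) * l2n N g) \<longlonglongrightarrow> 0"
    by (intro tendsto_mult_left_zero assms)
  show "\<forall>\<^sub>F n in sequentially. norm (ip N (f n) g - ip N z g) \<le> l2n N (\<lambda>x. f n x - z x) * l2n N g"
    using l2_CS[OF l2_diff[OF assms(1,2)] assms(4)] by (simp add: ip_diff_left[OF assms(1,2,4)])
qed

lemma l2n_tendsto: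
  assumes "\<And>n. l2 N (f n)" "l2 N z" "(\<lambda>n. l2n N (\<lambda>x. f n x - z x)) \<longlonglongrightarrow> 0"
  shows "(\<lambda>n. l2n N (f n)) \<longlonglongrightarrow> l2n N z"
proof (rule LIM_zero_cancel, rule Lim_null_comparison)
  show "\<forall>\<^sub>F n in sequentially. norm (l2n N (f n) - l2n N z) \<le> l2n N (\<lambda>x. f n x - z x)"
  proof (rule always_eventually, rule allI)
    fix n
    show "norm (l2n N (f n) - l2n N z) \<le> l2n N (\<lambda>x. f n x - z x)"
      using l2n_le_add_diff[OF assms(1)[of n] assms(2)] l2n_le_add_diff[OF assms(2) assms(1)[of n]]
        l2n_diff_commute[of N "f n" z] by (simp add: abs_le_iff)
  qed
qed (fact assms)

text \<open>Riesz representation by minimising |f|^2 - 2 y. The functional is given as a linear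
  relation because in its uses y is computed from data that f does not display, such as a test
  function or a potential; the bound makes it single-valued. The approximating sequence places z in
  the closure of the domain, so closed linear constraints on the domain pass to z.\<close>

lemma riesz_relation:
  fixes R :: "(('a \<Rightarrow> 'b::euclidean_space) \<times> real) set"
  assumes ne: "R \<noteq> {}"
    and bd: "\<And>f y. (f,y) \<in> R \<Longrightarrow> l2 N f \<and> \<bar>y\<bar> \<le> C * l2n N f"
    and lin: "\<And>f y g z a b. (f,y) \<in> R \<Longrightarrow> (g,z) \<in> R \<Longrightarrow> (\<lambda>x. a *\<^sub>R f x + b *\<^sub>R g x, a * y + b * z) \<in> R"
    and C: "C \<ge> 0"
  shows "\<exists>z. l2 N z \<and> l2n N z \<le> C \<and> (\<exists>f. (\<forall>n. f n \<in> fst ` R) \<and> (\<lambda>n. l2n N (\<lambda>x. f n x - z x)) \<longlonglongrightarrow> 0)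
     \<and> (\<forall>(f,y)\<in>R. ip N z f = y)"
proof -
  define J where "J q = (l2n N (fst q))\<^sup>2 - 2 * snd q" for q :: "('a \<Rightarrow> 'b) \<times> real"
  \<comment> \<open>Completing the square: |f|^2 - 2 C |f| is at least - C^2.\<close>
  have lb: "- C\<^sup>2 \<le> J q" if "q \<in> R" for q
  proof -
    have "snd q \<le> C * l2n N (fst q)" using bd[of "fst q" "snd q"] that by auto
    moreover have "0 \<le> (l2n N (fst q) - C)\<^sup>2" by simp
    ultimately show ?thesis unfolding J_def by (simp add: power2_diff mult.commute)
  qed
  define j where "j = Inf (J ` R)"
  have bdd: "bdd_below (J ` R)" using lb by (intro bdd_belowI[of _ "- C\<^sup>2"]) auto
  have j: "j \<le> J q" if "q \<in> R" for q unfolding j_def by (intro cInf_lower bdd) (use that in auto)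
  have "\<exists>q\<in>R. J q < j + 1 / real (Suc n)" for n
  proof -
    have "Inf (J ` R) < j + 1 / real (Suc n)" by (simp add: j_def)
    then show ?thesis using ne bdd by (subst (asm) cInf_less_iff) auto
  qed
  then obtain q where q: "\<And>n. q n \<in> R" "\<And>n. J (q n) < j + 1 / real (Suc n)" by metis
  define f where "f n = fst (q n)" for n
  define y where "y n = snd (q n)" for n
  have R: "(f n, y n) \<in> R" for n using q(1) by (simp add: f_def y_def)
  have lf: "l2 N (f n)" for n using bd[OF R] by simp
  have Jn: "(l2n N (f n))\<^sup>2 - 2 * y n < j + 1 / real (Suc n)" for n using q(2)[of n] by (simp add: J_def f_def y_def)
  \<comment> \<open>Parallelogram law: the midpoint of two near-minimisers lies in R, so its value
    is at least \<open>j\<close>, which leaves little room for their distance.\<close>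
  have cau: "(l2n N (\<lambda>x. f m x - f n x))\<^sup>2 \<le> 2 / real (Suc m) + 2 / real (Suc n)" for m n
  proof -
    have "(\<lambda>x. (1/2) *\<^sub>R f m x + (1/2) *\<^sub>R f n x, (1/2) * y m + (1/2) * y n) \<in> R" by (intro lin R)
    from j[OF this] have "j \<le> (l2n N (\<lambda>x. (1/2) *\<^sub>R f m x + (1/2) *\<^sub>R f n x))\<^sup>2 - (y m + y n)"
      by (simp add: J_def)
    moreover have "(l2n N (\<lambda>x. (1/2) *\<^sub>R f m x + (1/2) *\<^sub>R f n x))\<^sup>2
        = (l2n N (f m))\<^sup>2 / 4 + ip N (f m) (f n) / 2 + (l2n N (f n))\<^sup>2 / 4"
      by (subst l2n_lin_sq[OF lf lf]) (simp add: power2_eq_square)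
    moreover have "(l2n N (\<lambda>x. f m x - f n x))\<^sup>2 = (l2n N (f m))\<^sup>2 - 2 * ip N (f m) (f n) + (l2n N (f n))\<^sup>2"
      using l2n_lin_sq[OF lf lf, of 1 m "-1" n] by simp
    ultimately show ?thesis using Jn[of m] Jn[of n] by simp
  qed
  have "\<exists>z. l2 N z \<and> (\<lambda>n. l2n N (\<lambda>x. f n x - z x)) \<longlonglongrightarrow> 0"
  proof (rule l2_complete[OF lf])
    fix e :: real assume e: "e > 0"
    then obtain k where k: "4 / e\<^sup>2 < real k" using reals_Archimedean2 by blast
    have kp: "real k > 0" using k e by (meson divide_pos_pos less_trans zero_less_numeral zero_less_power)
    have "l2n N (\<lambda>x. f m x - f n x) < e" if "m \<ge> k" "n \<ge> k" for m n
    proof -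
      have "2 / real (Suc m) < e\<^sup>2/2" "2 / real (Suc n) < e\<^sup>2/2"
      proof -
        have "2 / real (Suc i) < e\<^sup>2/2" if "i \<ge> k" for i
        proof -
          have "4 / real (Suc i) \<le> 4 / real k" using that kp by (intro divide_left_mono) auto
          also have "\<dots> < e\<^sup>2" using k kp e by (simp add: field_simps)
          finally show ?thesis by simp
        qed
        then show "2 / real (Suc m) < e\<^sup>2/2" "2 / real (Suc n) < e\<^sup>2/2" using that by auto
      qed
      then have "(l2n N (\<lambda>x. f m x - f n x))\<^sup>2 < e\<^sup>2" using cau[of m n] by linarith
      then show ?thesis using e by (simp add: power_less_imp_less_base)
    qed
    then show "\<exists>k. \<forall>m\<ge>k. \<forall>n\<ge>k. l2n N (\<lambda>x. f m x - f n x) < e" by blast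
  qed
  then obtain z where z: "l2 N z" "(\<lambda>n. l2n N (\<lambda>x. f n x - z x)) \<longlonglongrightarrow> 0" by blast
  have ipc: "(\<lambda>n. ip N (f n) g) \<longlonglongrightarrow> ip N z g" if "l2 N g" for g
    by (rule ip_tendsto[OF lf z that])
  have rep: "ip N z g = w" if g: "(g,w) \<in> R" for g w
  proof -
    have lg: "l2 N g" using bd[OF g] by simp
    \<comment> \<open>First variation: the minimum property at f n + t g, passed to the limit in
      n.\<close>
    have *: "0 \<le> 2 * t * (ip N z g - w) + t\<^sup>2 * (l2n N g)\<^sup>2" for t
    proof (rule LIMSEQ_le_const)
      show "(\<lambda>n. 1 / real (Suc n) + (2 * t * (ip N (f n) g - w) + t\<^sup>2 * (l2n N g)\<^sup>2))
          \<longlonglongrightarrow> 2 * t * (ip N z g - w) + t\<^sup>2 * (l2n N g)\<^sup>2"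
      proof -
        have "(\<lambda>n. 1 / real (Suc n) + (2 * t * (ip N (f n) g - w) + t\<^sup>2 * (l2n N g)\<^sup>2))
          \<longlonglongrightarrow> 0 + (2 * t * (ip N z g - w) + t\<^sup>2 * (l2n N g)\<^sup>2)"
          using LIMSEQ_inverse_real_of_nat unfolding inverse_eq_divide by (intro tendsto_intros ipc lg)
        then show ?thesis by simp
      qed
      have "0 \<le> 1 / real (Suc n) + (2 * t * (ip N (f n) g - w) + t\<^sup>2 * (l2n N g)\<^sup>2)" for n
      proof -
        have "(\<lambda>x. 1 *\<^sub>R f n x + t *\<^sub>R g x, 1 * y n + t * w) \<in> R" by (intro lin R g)
        from j[OF this] have "j \<le> (l2n N (\<lambda>x. 1 *\<^sub>R f n x + t *\<^sub>R g x))\<^sup>2 - 2 * (y n + t * w)" by (simp add: J_def)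
        then show ?thesis using Jn[of n] unfolding l2n_lin_sq[OF lf lg] by (simp add: algebra_simps)
      qed
      then show "\<exists>M. \<forall>n\<ge>M. 0 \<le> 1 / real (Suc n) + (2 * t * (ip N (f n) g - w) + t\<^sup>2 * (l2n N g)\<^sup>2)" by blast
    qed
    have "ip N z g - w = 0"
    proof (rule ccontr)
      assume nz: "ip N z g - w \<noteq> 0"
      define a where "a = ip N z g - w"
      \<comment> \<open>The added 1 keeps the denominator positive when g has norm zero; t = - a / b
        then makes the quadratic in t negative.\<close>
      define b where "b = (l2n N g)\<^sup>2 + 1"
      have b: "b > 0" by (simp add: b_def add_nonneg_pos)
      have "0 \<le> 2 * (- a / b) * a + (- a / b)\<^sup>2 * (l2n N g)\<^sup>2" using *[of "- a / b"] by (simp add: a_def)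
      also have "\<dots> \<le> 2 * (- a / b) * a + (- a / b)\<^sup>2 * b" by (simp add: b_def mult_left_mono)
      also have "\<dots> = - (a\<^sup>2 / b)" using b by (simp add: field_simps power2_eq_square)
      also have "\<dots> < 0" using b nz by (simp add: a_def)
      finally show False by simp
    qed
    then show ?thesis by simp
  qed
  have "l2n N z \<le> C"
  proof -
    have "(\<lambda>n. ip N (f n) z) \<longlonglongrightarrow> ip N z z" by (rule ipc[OF z(1)])
    moreover have "(\<lambda>n. C * l2n N (f n)) \<longlonglongrightarrow> C * l2n N z" by (intro tendsto_intros l2n_tendsto[OF lf z])
    moreover have "ip N (f n) z \<le> C * l2n N (f n)" for n
      using rep[OF R[of n]] bd[OF R[of n]] by (auto simp: ip_commute[of N "f n"])
    ultimately have "ip N z z \<le> C * l2n N z" by (intro LIMSEQ_le) auto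
    then have "l2n N z * l2n N z \<le> C * l2n N z" by (simp add: l2n_sq[symmetric] power2_eq_square)
    then show ?thesis using C l2n_nonneg[of N z] by (cases "l2n N z = 0") auto
  qed
  moreover have "\<forall>n. f n \<in> fst ` R" using R by (metis fst_conv image_eqI)
  ultimately show ?thesis using z rep by blast
qed

text \<open>Riesz representation of v |-> <g, v> on V alone: the representative is the orthogonal
  projection of g on the closure of V, with f as witness for membership in that closure.\<close>

lemma l2_projection:
  assumes V: "V \<noteq> {}" "\<And>f. f \<in> V \<Longrightarrow> l2 N f" "\<And>f g a b. f \<in> V \<Longrightarrow> g \<in> V \<Longrightarrow> (\<lambda>x. a *\<^sub>R f x + b *\<^sub>R g x) \<in> V"
    and g: "l2 N g"
  shows "\<exists>z f. l2 N z \<and> (\<forall>n. f n \<in> V) \<and> (\<lambda>n. l2n N (\<lambda>x. f n x - z x)) \<longlonglongrightarrow> 0 \<and> (\<forall>v\<in>V. ip N z v = ip N g v)"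
proof -
  define R where "R = (\<lambda>v. (v, ip N g v)) ` V"
  have "\<exists>z. l2 N z \<and> l2n N z \<le> l2n N g \<and> (\<exists>f. (\<forall>n. f n \<in> fst ` R) \<and> (\<lambda>n. l2n N (\<lambda>x. f n x - z x)) \<longlonglongrightarrow> 0)
     \<and> (\<forall>(f,y)\<in>R. ip N z f = y)"
  proof (rule riesz_relation)
    show "R \<noteq> {}" using V by (auto simp: R_def)
    show "l2 N f \<and> \<bar>y\<bar> \<le> l2n N g * l2n N f" if "(f,y) \<in> R" for f y
      using that V l2_CS[OF g] by (auto simp: R_def)
    show "(\<lambda>x. a *\<^sub>R f x + b *\<^sub>R h x, a * y + b * z) \<in> R" if "(f,y) \<in> R" "(h,z) \<in> R" for f y h z a b
      using that V ip_lin_right[OF _ _ g] by (auto simp: R_def image_iff)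
  qed simp
  then obtain z f where z: "l2 N z" "\<forall>n. f n \<in> fst ` R" "(\<lambda>n. l2n N (\<lambda>x. f n x - z x)) \<longlonglongrightarrow> 0"
    "\<forall>(f,y)\<in>R. ip N z f = y" by blast
  have "fst ` R = V" by (auto simp: R_def image_iff)
  moreover have "\<forall>v\<in>V. ip N z v = ip N g v" using z(4) by (auto simp: R_def)
  ultimately show ?thesis using z(1-3) by (intro exI[of _ z] exI[of _ f]) simp
qed

section \<open>Test functions of time\<close>

text \<open>Derivatives are taken on the whole line, so no one-sided derivatives occur at 0 and T.
  Only the value at T is prescribed, since initial values have to be seen by the test
  functions.\<close>

definition C1T :: "real \<Rightarrow> (real \<Rightarrow> real) \<Rightarrow> (real \<Rightarrow> real) \<Rightarrow> bool" where
  "C1T T \<phi> \<phi>' \<longleftrightarrow> (\<forall>t. (\<phi> has_real_derivative \<phi>' t) (at t)) \<and> continuous_on UNIV \<phi>' \<and> \<phi> T = 0"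

lemma deriv_continuous_on_UNIV:
  assumes "\<forall>t. (\<phi> has_real_derivative \<phi>' t) (at t)"
  shows "continuous_on UNIV \<phi>"
  using assms by (meson DERIV_isCont continuous_at_imp_continuous_on)

lemma C1T_cont: assumes "C1T T \<phi> \<phi>'" shows "continuous_on UNIV \<phi>" "continuous_on UNIV \<phi>'"
  using assms deriv_continuous_on_UNIV by (auto simp: C1T_def)

lemma cont_integrable_MT:
  fixes f :: "real \<Rightarrow> real"
  shows "continuous_on UNIV f \<Longrightarrow> integrable (lebesgue_on {0..T}) f"
  by (intro continuous_imp_integrable_real) (auto intro: continuous_on_subset)

lemma cont_meas_MT:
  fixes f :: "real \<Rightarrow> 'b::euclidean_space"
  shows "continuous_on UNIV f \<Longrightarrow> f \<in> borel_measurable (lebesgue_on S)"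
  by (intro measurable_restrict_space1 measurable_completion) (simp add: borel_measurable_continuous_onI)

lemma cont_bounded_interval:
  fixes f :: "real \<Rightarrow> real"
  assumes "continuous_on UNIV f"
  shows "\<exists>K\<ge>0. \<forall>t\<in>{a..b}. \<bar>f t\<bar> \<le> K"
proof -
  have "compact (f ` {a..b})" using assms by (intro compact_continuous_image) (auto intro: continuous_on_subset)
  then obtain K where "\<forall>t\<in>{a..b}. \<bar>f t\<bar> \<le> K" using compact_imp_bounded bounded_iff by (metis image_eqI real_norm_def)
  then show ?thesis by (intro exI[of _ "max K 0"]) (auto simp: le_max_iff_disj)
qed

lemma cont_mult_integrable_MT:
  fixes f h :: "real \<Rightarrow> real"
  assumes "continuous_on UNIV f" "integrable (lebesgue_on {0..T}) h"
  shows "integrable (lebesgue_on {0..T}) (\<lambda>t. f t * h t)"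
proof -
  obtain K where K: "K \<ge> 0" "\<forall>t\<in>{0..T}. \<bar>f t\<bar> \<le> K" using cont_bounded_interval[OF assms(1)] by blast
  have [measurable]: "f \<in> borel_measurable (lebesgue_on {0..T})" by (rule cont_meas_MT[OF assms(1)])
  show ?thesis
  proof (rule Bochner_Integration.integrable_bound)
    show "integrable (lebesgue_on {0..T}) (\<lambda>t. K * h t)" using assms(2) by simp
    show "(\<lambda>t. f t * h t) \<in> borel_measurable (lebesgue_on {0..T})" using assms(2) by measurable
    show "AE t in lebesgue_on {0..T}. norm (f t * h t) \<le> norm (K * h t)"
      using K by (intro AE_I2) (auto simp: abs_mult intro!: mult_right_mono)
  qed
qed

lemma ftc_MT:
  assumes "\<forall>t. (F has_real_derivative f t) (at t)" "continuous_on UNIV f" "a \<le> b"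
  shows "integral\<^sup>L (lebesgue_on {a..b}) f = F b - F a"
proof -
  have "integrable (lebesgue_on {a..b}) f"
    by (intro continuous_imp_integrable_real continuous_on_subset[OF assms(2)]) auto
  then have "integral\<^sup>L (lebesgue_on {a..b}) f = integral {a..b} f"
    by (intro lebesgue_integral_eq_integral) auto
  also have "\<dots> = F b - F a"
    using assms by (intro integral_unique fundamental_theorem_of_calculus)
      (auto simp: has_real_derivative_iff_has_vector_derivative[symmetric] intro: has_field_derivative_at_within)
  finally show ?thesis .
qed

lemma C1T_ibp:
  assumes "C1T T \<phi> \<phi>'" "C1T T \<xi> \<xi>'" "T > 0"
  shows "integral\<^sup>L (lebesgue_on {0..T}) (\<lambda>t. \<phi> t * \<xi>' t + \<phi>' t * \<xi> t) = - (\<phi> 0 * \<xi> 0)"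
proof -
  have "integral\<^sup>L (lebesgue_on {0..T}) (\<lambda>t. \<phi> t * \<xi>' t + \<phi>' t * \<xi> t) = \<phi> T * \<xi> T - \<phi> 0 * \<xi> 0"
    using assms C1T_cont[OF assms(1)] C1T_cont[OF assms(2)]
    by (intro ftc_MT[where F="\<lambda>t. \<phi> t * \<xi> t"]) (auto simp: C1T_def intro!: continuous_intros derivative_eq_intros)
  then show ?thesis using assms by (simp add: C1T_def)
qed

lemma antiderivative_UNIV:
  fixes g :: "real \<Rightarrow> real"
  assumes "continuous_on UNIV g"
  shows "\<exists>G. (\<forall>t. (G has_real_derivative g t) (at t)) \<and> G T = 0"
proof -
  have "isCont g x" for x using assms by (simp add: continuous_on_eq_continuous_at)
  then obtain F where "\<And>x. (F has_vector_derivative g x) (at x)"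
    using einterval_antiderivative[of "-\<infinity>" "\<infinity>" g] by auto
  then show ?thesis
    by (intro exI[of _ "\<lambda>t. F t - F T"])
      (auto simp: has_real_derivative_iff_has_vector_derivative[symmetric] intro!: derivative_eq_intros)
qed

text \<open>The resolvent of d/dt with zero terminal value, solved by the integrating factor exp (-
  t / h). It regularises in time without leaving \<open>C1T\<close>.\<close>

lemma C1T_resolvent:
  assumes "C1T T \<phi> \<phi>'" "h > 0"
  shows "\<exists>y y'. C1T T y y' \<and> (\<forall>t. y t - h * y' t = \<phi> t)"
proof -
  have c: "continuous_on UNIV \<phi>" "continuous_on UNIV \<phi>'" using C1T_cont assms by auto
  obtain G where G: "\<And>t. (G has_real_derivative (- exp (- t / h) * \<phi> t / h)) (at t)" "G T = 0"
  proof -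
    have "continuous_on UNIV (\<lambda>t. - exp (- t / h) * \<phi> t / h)" using assms(2) by (auto intro!: continuous_intros c)
    from antiderivative_UNIV[OF this, of T] that show thesis by blast
  qed
  define y where "y t = exp (t / h) * G t" for t
  have y: "(y has_real_derivative (y t - \<phi> t) / h) (at t)" for t
    unfolding y_def using assms(2)
    by (auto intro!: derivative_eq_intros G simp: field_simps exp_minus)
  then have "continuous_on UNIV y" using deriv_continuous_on_UNIV[of y "\<lambda>t. (y t - \<phi> t) / h"] by blast
  then have "C1T T y (\<lambda>t. (y t - \<phi> t) / h)"
    unfolding C1T_def using y assms(2) G(2) by (auto intro!: continuous_intros c simp: y_def)
  moreover have "y t - h * ((y t - \<phi> t) / h) = \<phi> t" for t using assms(2) by (simp add: field_simps)
  ultimately show ?thesis by blast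
qed

text \<open>Inner regularity exhausts {h < 0} by compact sets up to a null set, and the indicator of
  a compact set is a bounded limit of continuous functions. A compact part of positive measure would
  give a negative integral.\<close>

lemma fund_nonneg:
  fixes h :: "real \<Rightarrow> real"
  assumes h: "integrable (lebesgue_on {0..T}) h"
    and test: "\<And>\<xi>. continuous_on UNIV \<xi> \<Longrightarrow> (\<forall>t. 0 \<le> \<xi> t) \<Longrightarrow> 0 \<le> integral\<^sup>L (lebesgue_on {0..T}) (\<lambda>t. \<xi> t * h t)"
  shows "AE t in lebesgue_on {0..T}. 0 \<le> h t"
proof -
  let ?M = "lebesgue_on {0..T}"
  have [measurable]: "h \<in> borel_measurable ?M" using h by auto
  define S where "S = {t\<in>space ?M. h t < 0}"
  have "S \<in> sets ?M" unfolding S_def by measurable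
  then have S: "S \<in> sets lebesgue" by (metis lmeasurable_cbox fmeasurableD interval_cbox sets_restrict_space_subset subsetD)
  obtain K C where KC: "negligible K" "\<And>n::nat. compact (C n)" "S = (\<Union>n. C n) \<union> K"
    using lebesgue_regular_inner[OF S] by metis
  have CnS: "C n \<subseteq> S" for n using KC(3) by auto
  have Cn: "AE t in ?M. t \<notin> C n" for n
  \<comment> \<open>\<open>infdist\<close> to the empty set is 0, so the functions \<xi> below would
    not approximate its indicator.\<close>
  proof (cases "C n = {}")
    case False
    define \<xi> where "\<xi> k t = max 0 (1 - real k * infdist t (C n))" for k :: nat and t
    have c\<xi>: "continuous_on UNIV (\<xi> k)" for k unfolding \<xi>_def by (intro continuous_intros)
    have [measurable]: "\<xi> k \<in> borel_measurable ?M" for k by (rule cont_meas_MT[OF c\<xi>])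
    have lim: "(\<lambda>k. \<xi> k t) \<longlonglongrightarrow> indicator (C n) t" for t
    proof (cases "t \<in> C n")
      case True then show ?thesis by (simp add: \<xi>_def)
    next
      case f: False
      have pos: "infdist t (C n) > 0"
        using f False KC(2)[of n] by (metis compact_imp_closed in_closed_iff_infdist_zero infdist_nonneg order_le_less)
      obtain k0 :: nat where k0: "1 / infdist t (C n) < k0" using reals_Archimedean2 by blast
      have "\<xi> k t = 0" if "k \<ge> k0" for k
      proof -
        have "1 / infdist t (C n) \<le> real k" using k0 that by (meson less_le_trans of_nat_le_iff less_imp_le)
        then show ?thesis using pos by (simp add: \<xi>_def field_simps max_def)
      qed
      then show ?thesis using f by (intro tendsto_eventually) (auto simp: eventually_sequentially)
    qed
    have CS: "C n \<in> sets ?M"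
    proof -
      have "C n \<subseteq> {0..T}" using KC(3) by (auto simp: S_def)
      then show ?thesis using KC(2)[of n] by (auto simp: sets_restrict_space intro!: image_eqI[of _ _ "C n"] lmeasurable_compact fmeasurableD)
    qed
    have "(\<lambda>k. integral\<^sup>L ?M (\<lambda>t. \<xi> k t * h t)) \<longlonglongrightarrow> integral\<^sup>L ?M (\<lambda>t. indicator (C n) t * h t)"
    proof (rule integral_dominated_convergence)
      show "(\<lambda>t. indicator (C n) t * h t) \<in> borel_measurable ?M" using CS by measurable
      show "integrable ?M (\<lambda>t. norm (h t))" using h by auto
      show "AE t in ?M. (\<lambda>k. \<xi> k t * h t) \<longlonglongrightarrow> indicator (C n) t * h t" by (intro AE_I2 tendsto_intros lim)
      have "\<bar>\<xi> k t\<bar> \<le> 1" for k t by (auto simp: \<xi>_def max_def infdist_nonneg)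
      then show "AE t in ?M. norm (\<xi> k t * h t) \<le> norm (h t)" for k
        by (intro AE_I2) (auto simp: abs_mult intro: mult_left_le_one_le)
    qed measurable
    moreover have "0 \<le> integral\<^sup>L ?M (\<lambda>t. \<xi> k t * h t)" for k by (intro test c\<xi>) (simp add: \<xi>_def)
    ultimately have i0: "0 \<le> integral\<^sup>L ?M (\<lambda>t. indicator (C n) t * h t)" by (intro LIMSEQ_le_const) auto
    have neg: "indicator (C n) t * h t \<le> 0" for t using CnS[of n] by (force simp: S_def indicator_def)
    have int: "integrable ?M (\<lambda>t. indicator (C n) t * h t)"
      using integrable_real_mult_indicator[OF CS h] by (simp add: mult.commute)
    have "integral\<^sup>L ?M (\<lambda>t. - (indicator (C n) t * h t)) = 0"
      using i0 neg Bochner_Integration.integral_nonneg[of ?M "\<lambda>t. - (indicator (C n) t * h t)"] by simp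
    then have "AE t in ?M. - (indicator (C n) t * h t) = 0"
      using int neg by (subst integral_nonneg_eq_0_iff_AE[symmetric]) auto
    then show ?thesis
    proof eventually_elim
      case (elim t) then show ?case using CnS[of n] by (force simp: S_def indicator_def split: if_splits)
    qed
  qed auto
  have "AE t in lebesgue. t \<notin> K" using KC(1) by (simp add: negligible_iff_null_sets AE_not_in)
  then have "AE t in ?M. t \<notin> K" by (subst AE_restrict_space_iff) auto
  moreover have "AE t in ?M. \<forall>n. t \<notin> C n" using Cn by (simp add: AE_all_countable)
  moreover have "AE t in ?M. t \<in> space ?M" by (rule AE_space)
  ultimately show ?thesis
  proof eventually_elim
    case (elim t)
    then have "t \<notin> S" unfolding KC(3) by auto
    then show ?case using elim(3) by (auto simp: S_def)
  qed
qed

lemma fund_zero: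
  fixes h :: "real \<Rightarrow> real"
  assumes h: "integrable (lebesgue_on {0..T}) h"
    and test: "\<And>\<xi>. continuous_on UNIV \<xi> \<Longrightarrow> integral\<^sup>L (lebesgue_on {0..T}) (\<lambda>t. \<xi> t * h t) = 0"
  shows "AE t in lebesgue_on {0..T}. h t = 0"
proof -
  have "AE t in lebesgue_on {0..T}. 0 \<le> h t" by (rule fund_nonneg[OF h]) (simp add: test)
  moreover have "AE t in lebesgue_on {0..T}. 0 \<le> - h t"
    using h by (intro fund_nonneg) (auto simp: test)
  ultimately show ?thesis by eventually_elim simp
qed

lemma polynomial_approx_seq:
  fixes f :: "real \<Rightarrow> real"
  assumes "continuous_on UNIV f"
  shows "\<exists>p. (\<forall>n. real_polynomial_function (p n)) \<and> (\<forall>n::nat. \<forall>t\<in>{a..b}. \<bar>f t - p n t\<bar> < 1 / real (Suc n))"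
proof -
  have "\<exists>p. real_polynomial_function p \<and> (\<forall>t\<in>{a..b}. \<bar>f t - p t\<bar> < 1 / real (Suc n))" for n
  proof -
    have "continuous_on {a..b} f" using assms by (rule continuous_on_subset) auto
    from Stone_Weierstrass_real_polynomial_function[OF compact_Icc this, of "1 / real (Suc n)"]
    show ?thesis by (metis zero_less_divide_1_iff of_nat_0_less_iff zero_less_Suc)
  qed
  then show ?thesis by metis
qed

lemma approx_seq_tendsto:
  fixes f :: "'a \<Rightarrow> real"
  assumes "\<And>n::nat. \<bar>f t - p n t\<bar> < 1 / real (Suc n)"
  shows "(\<lambda>n. p n t) \<longlonglongrightarrow> f t"
proof (rule LIM_zero_cancel, rule Lim_null_comparison)
  show "(\<lambda>n. 1 / real (Suc n)) \<longlonglongrightarrow> 0" using LIMSEQ_inverse_real_of_nat by (simp add: inverse_eq_divide)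
  show "\<forall>\<^sub>F n in sequentially. norm (p n t - f t) \<le> 1 / real (Suc n)"
    using assms by (intro always_eventually allI) (metis abs_minus_commute less_imp_le real_norm_def)
qed

lemma real_polynomial_continuous: "real_polynomial_function p \<Longrightarrow> continuous_on UNIV (p::real\<Rightarrow>real)"
  using has_real_derivative_polynomial_function deriv_continuous_on_UNIV by metis

text \<open>Functions in \<open>C1T\<close> vanish at T, so h is first multiplied by T - t: a
  polynomial times T - t is admissible, and polynomials approximate continuous functions uniformly
  on [0,T].\<close>

lemma fund_C1T:
  fixes h :: "real \<Rightarrow> real"
  assumes h: "integrable (lebesgue_on {0..T}) h"
    and test: "\<And>\<phi> \<phi>'. C1T T \<phi> \<phi>' \<Longrightarrow> integral\<^sup>L (lebesgue_on {0..T}) (\<lambda>t. \<phi> t * h t) = 0"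
  shows "AE t in lebesgue_on {0..T}. h t = 0"
proof -
  let ?M = "lebesgue_on {0..T}"
  have [measurable]: "h \<in> borel_measurable ?M" "(\<lambda>t. t) \<in> borel_measurable ?M" using h by (auto intro: cont_meas_MT)
  have "AE t in ?M. (T - t) * h t = 0"
  proof (rule fund_zero)
    show "integrable ?M (\<lambda>t. (T - t) * h t)" by (intro cont_mult_integrable_MT h continuous_intros)
    fix \<xi> :: "real \<Rightarrow> real" assume c: "continuous_on UNIV \<xi>"
    obtain p where p: "\<And>n::nat. real_polynomial_function (p n)"
      "\<And>n t. t \<in> {0..T} \<Longrightarrow> \<bar>\<xi> t - p n t\<bar> < 1 / real (Suc n)"
      using polynomial_approx_seq[OF c, of 0 T] by metis
    have pz: "integral\<^sup>L ?M (\<lambda>t. (T - t) * p n t * h t) = 0" for n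
    proof -
      have "real_polynomial_function (\<lambda>t. (T - t) * p n t)"
        using p(1) by (intro real_polynomial_function.intros(4) real_polynomial_function_diff) auto
      then obtain q where q: "real_polynomial_function q" "\<forall>t. ((\<lambda>t. (T - t) * p n t) has_real_derivative q t) (at t)"
        using has_real_derivative_polynomial_function by blast
      then have "C1T T (\<lambda>t. (T - t) * p n t) q" by (auto simp: C1T_def real_polynomial_continuous)
      from test[OF this] show ?thesis .
    qed
    obtain K where K: "K \<ge> 0" "\<forall>t\<in>{0..T}. \<bar>\<xi> t\<bar> \<le> K" using cont_bounded_interval[OF c] by blast
    have [measurable]: "p n \<in> borel_measurable ?M" "\<xi> \<in> borel_measurable ?M" for n
      by (auto intro!: cont_meas_MT real_polynomial_continuous p c)
    have "(\<lambda>n. integral\<^sup>L ?M (\<lambda>t. (T - t) * p n t * h t)) \<longlonglongrightarrow> integral\<^sup>L ?M (\<lambda>t. \<xi> t * ((T - t) * h t))"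
    proof (rule integral_dominated_convergence)
      show "integrable ?M (\<lambda>t. T * (K + 1) * norm (h t))" using h by auto
      show "AE t in ?M. (\<lambda>n. (T - t) * p n t * h t) \<longlonglongrightarrow> \<xi> t * ((T - t) * h t)"
      proof (intro AE_I2)
        fix t assume "t \<in> space ?M"
        then have "(\<lambda>n. p n t) \<longlonglongrightarrow> \<xi> t" using p(2) by (intro approx_seq_tendsto) auto
        then have "(\<lambda>n. (T - t) * p n t * h t) \<longlonglongrightarrow> (T - t) * \<xi> t * h t" by (intro tendsto_intros)
        then show "(\<lambda>n. (T - t) * p n t * h t) \<longlonglongrightarrow> \<xi> t * ((T - t) * h t)" by (simp add: ac_simps)
      qed
      show "AE t in ?M. norm ((T - t) * p n t * h t) \<le> T * (K + 1) * norm (h t)" for n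
      proof (intro AE_I2)
        fix t assume "t \<in> space ?M"
        then have t: "t \<in> {0..T}" by simp
        have "\<bar>p n t\<bar> \<le> \<bar>\<xi> t\<bar> + \<bar>\<xi> t - p n t\<bar>" by simp
        also have "\<dots> \<le> K + 1 / real (Suc n)" using K(2) t p(2)[OF t, of n] by fastforce
        also have "\<dots> \<le> K + 1" by simp
        finally have "\<bar>p n t\<bar> \<le> K + 1" .
        then have "\<bar>T - t\<bar> * \<bar>p n t\<bar> \<le> T * (K + 1)" using t by (intro mult_mono) auto
        then show "norm ((T - t) * p n t * h t) \<le> T * (K + 1) * norm (h t)"
          by (simp add: abs_mult mult_right_mono)
      qed
    qed measurable
    then show "integral\<^sup>L ?M (\<lambda>t. \<xi> t * ((T - t) * h t)) = 0" unfolding pz by (simp add: LIMSEQ_const_iff)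
  qed
  moreover have "AE t in ?M. t \<noteq> T"
    using AE_completion[OF AE_lborel_singleton[of T]] by (subst AE_restrict_space_iff) auto
  ultimately show ?thesis by eventually_elim auto
qed

section \<open>Smooth functions of time and smooth cutoffs\<close>

lemma frechet_real:
  assumes "(f has_real_derivative d) (at x)" shows "frechet_derivative f (at x) = (\<lambda>h. d * h)"
  using assms frechet_derivative_at unfolding has_field_derivative_def by (metis)

lemma pd_real: "(f has_real_derivative d) (at x) \<Longrightarrow> pd f 1 x = d"
  by (simp add: pd_def frechet_real)

text \<open>The induction on the order of \<open>Ck\<close> runs over all members at once, because
  the derivative of a member is again a member.\<close>

lemma smooth_closed_class:
  assumes S: "\<And>f. f \<in> S \<Longrightarrow> \<exists>f'\<in>S. \<forall>t. (f has_real_derivative f' t) (at t)" and f: "f \<in> S"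
  shows "smooth f"
proof -
  have "\<forall>f\<in>S. Ck n f" for n
  proof (induction n)
    case 0 then show ?case using S deriv_continuous_on_UNIV by fastforce
  next
    case (Suc n)
    show ?case
    proof
      fix f assume "f \<in> S"
      then obtain f' where f': "f' \<in> S" "\<forall>t. (f has_real_derivative f' t) (at t)" using S by blast
      then have "pd f 1 = f'" using pd_real by blast
      then show "Ck (Suc n) f" using f' Suc deriv_continuous_on_UNIV[OF f'(2)]
        by (auto simp: differentiable_on_def intro: differentiable_at_withinI) (use real_differentiable_def in blast)
    qed
  qed
  then show ?thesis using f by (simp add: smooth_def)
qed

lemma smooth_deriv:
  assumes "smooth (f :: real \<Rightarrow> real)"
  shows "(f has_real_derivative pd f 1 t) (at t)" "smooth (pd f 1)"
proof -
  have "Ck (Suc n) f" for n using assms by (simp add: smooth_def)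
  then have "f differentiable (at t)" "\<And>n. Ck n (pd f 1)" by (auto simp: differentiable_on_def)
  then show "(f has_real_derivative pd f 1 t) (at t)" "smooth (pd f 1)"
    by (auto simp: smooth_def real_differentiable_def pd_real)
qed

lemma smooth_cont: "smooth f \<Longrightarrow> continuous_on UNIV f"
  by (metis Ck.simps(1) smooth_def)

lemma test_fun_0T_C1T:
  assumes "test_fun_0T T \<phi>" shows "C1T T \<phi> (pd \<phi> 1)"
  using assms by (auto simp: test_fun_0T_def C1T_def smooth_deriv smooth_cont)

text \<open>The functions q (1/x) exp (-1/x), extended by zero. For polynomial q the family is
  closed under differentiation, which yields smooth cutoffs without formulas for higher
  derivatives.\<close>

definition flat :: "(real \<Rightarrow> real) \<Rightarrow> real \<Rightarrow> real" where
  "flat q x = (if 0 < x then q (1/x) * exp (- (1/x)) else 0)"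

lemma polynomial_times_exp_tendsto_0:
  assumes "real_polynomial_function (p :: real \<Rightarrow> real)"
  shows "((\<lambda>y. p y * exp (- y)) \<longlongrightarrow> 0) at_top"
proof -
  obtain a n where p: "p = (\<lambda>x. \<Sum>i\<le>n. a i * x ^ i)"
    using assms by (auto simp: real_polynomial_function_iff_sum)
  have "((\<lambda>y. \<Sum>i\<le>n. a i * (y ^ i / exp y)) \<longlongrightarrow> (\<Sum>i\<le>n. a i * 0)) at_top"
    by (intro tendsto_sum tendsto_mult tendsto_const tendsto_power_div_exp_0)
  moreover have "(\<lambda>y. \<Sum>i\<le>n. a i * (y ^ i / exp y)) = (\<lambda>y. p y * exp (- y))"
    by (auto simp: p sum_distrib_right exp_minus divide_inverse mult.assoc intro!: ext sum.cong)
  ultimately show ?thesis by simp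
qed

lemma real_polynomial_function_id: "real_polynomial_function (\<lambda>x::real. x)"
  by (intro real_polynomial_function.intros bounded_linear_ident)

text \<open>At 0 the difference quotient from the right is y q(y) exp (- y) with y = 1/h, which
  decays; from the left it is zero.\<close>

lemma flat_deriv:
  assumes q: "real_polynomial_function q" "\<And>x. (q has_real_derivative q' x) (at x)"
  shows "(flat q has_real_derivative flat (\<lambda>y. y\<^sup>2 * (q y - q' y)) x) (at x)"
proof -
  consider "x > 0" | "x < 0" | "x = 0" by linarith
  then show ?thesis
  proof cases
    case 1
    have "((\<lambda>x. q (1/x) * exp (- (1/x))) has_real_derivative (1/x)\<^sup>2 * (q (1/x) - q' (1/x)) * exp (- (1/x))) (at x)"
      using 1 by (auto intro!: derivative_eq_intros DERIV_chain2[OF q(2)] simp: field_simps power2_eq_square)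
    then have "(flat q has_real_derivative (1/x)\<^sup>2 * (q (1/x) - q' (1/x)) * exp (- (1/x))) (at x)"
      by (rule has_field_derivative_transform_within_open[where S="{0<..}"]) (use 1 in \<open>auto simp: flat_def\<close>)
    then show ?thesis using 1 by (simp add: flat_def)
  next
    case 2
    have "((\<lambda>x. 0) has_real_derivative 0) (at x)" by simp
    then have "(flat q has_real_derivative 0) (at x)"
      by (rule has_field_derivative_transform_within_open[where S="{..<0}"]) (use 2 in \<open>auto simp: flat_def\<close>)
    then show ?thesis using 2 by (simp add: flat_def)
  next
    case 3
    have pol: "real_polynomial_function (\<lambda>y. y * q y)" by (intro real_polynomial_function.intros(4) real_polynomial_function_id q)
    have "((\<lambda>h. flat q h / h) \<longlongrightarrow> 0) (at_right 0)"
    proof -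
      have "((\<lambda>h. (inverse h * q (inverse h)) * exp (- inverse h)) \<longlongrightarrow> 0) (at_right 0)"
        using filterlim_compose[OF polynomial_times_exp_tendsto_0[OF pol] filterlim_inverse_at_top_right] .
      then show ?thesis
        by (rule Lim_transform_eventually) (auto simp: flat_def eventually_at_filter inverse_eq_divide)
    qed
    moreover have "((\<lambda>h. flat q h / h) \<longlongrightarrow> 0) (at_left 0)"
      by (rule tendsto_eventually) (auto simp: flat_def eventually_at_filter)
    ultimately have "((\<lambda>h. flat q h / h) \<longlongrightarrow> 0) (at 0)" by (simp add: filterlim_split_at)
    then show ?thesis unfolding 3 has_field_derivative_iff by (simp add: flat_def)
  qed
qed

text \<open>The algebra generated by polynomials and affine rescalings of \<open>flat\<close>. It is
  closed under differentiation, and that alone makes all its members smooth.\<close>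

inductive_set smooth_alg :: "(real \<Rightarrow> real) set" where
  poly: "real_polynomial_function p \<Longrightarrow> p \<in> smooth_alg"
| flat: "real_polynomial_function q \<Longrightarrow> (\<lambda>t. flat q (a * t + b)) \<in> smooth_alg"
| add: "f \<in> smooth_alg \<Longrightarrow> g \<in> smooth_alg \<Longrightarrow> (\<lambda>t. f t + g t) \<in> smooth_alg"
| mult: "f \<in> smooth_alg \<Longrightarrow> g \<in> smooth_alg \<Longrightarrow> (\<lambda>t. f t * g t) \<in> smooth_alg"

lemma smooth_alg_deriv:
  assumes "f \<in> smooth_alg" shows "\<exists>f'\<in>smooth_alg. \<forall>t. (f has_real_derivative f' t) (at t)"
  using assms
proof induction
  case (poly p)
  then show ?case using has_real_derivative_polynomial_function smooth_alg.poly by blast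
next
  case (flat q a b)
  then obtain q' where q': "real_polynomial_function q'" "\<And>x. (q has_real_derivative q' x) (at x)"
    using has_real_derivative_polynomial_function by blast
  have r: "real_polynomial_function (\<lambda>y. y\<^sup>2 * (q y - q' y))"
    by (intro real_polynomial_function.intros(4) real_polynomial_function_diff real_polynomial_function_power real_polynomial_function_id q' flat)
  have "(\<lambda>t. a * flat (\<lambda>y. y\<^sup>2 * (q y - q' y)) (a * t + b)) \<in> smooth_alg"
    by (intro smooth_alg.mult smooth_alg.flat r smooth_alg.poly) auto
  moreover have "((\<lambda>t. flat q (a * t + b)) has_real_derivative a * flat (\<lambda>y. y\<^sup>2 * (q y - q' y)) (a * t + b)) (at t)" for t
  proof -
    have "((\<lambda>t. a * t + b) has_real_derivative a) (at t)" by (auto intro!: derivative_eq_intros)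
    from DERIV_chain2[OF flat_deriv[OF flat q'(2)] this] show ?thesis by (simp add: mult.commute)
  qed
  ultimately show ?case by (intro bexI[of _ "\<lambda>t. a * flat (\<lambda>y. y\<^sup>2 * (q y - q' y)) (a * t + b)"]) auto
next
  case (add f g)
  then obtain f' g' where "f' \<in> smooth_alg" "g' \<in> smooth_alg"
    "\<forall>t. (f has_real_derivative f' t) (at t)" "\<forall>t. (g has_real_derivative g' t) (at t)" by blast
  then show ?case by (intro bexI[of _ "\<lambda>t. f' t + g' t"]) (auto intro!: smooth_alg.add derivative_eq_intros)
next
  case (mult f g)
  then obtain f' g' where "f' \<in> smooth_alg" "g' \<in> smooth_alg"
    "\<forall>t. (f has_real_derivative f' t) (at t)" "\<forall>t. (g has_real_derivative g' t) (at t)" by blast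
  then show ?case
    by (intro bexI[of _ "\<lambda>t. f' t * g t + f t * g' t"]) (auto intro!: smooth_alg.intros(3,4) mult derivative_eq_intros)
qed

lemma smooth_antiderivative:
  assumes "f \<in> smooth_alg" "\<forall>t. (F has_real_derivative f t) (at t)" shows "smooth F"
  by (rule smooth_closed_class[of "insert F smooth_alg"]) (use assms smooth_alg_deriv in blast)+

text \<open>The derivative is approximated rather than the function: smooth functions that vanish
  near T converge to \<phi>' boundedly and pointwise on [0,T), and their primitives from T are
  smooth test functions converging to \<phi>. Test functions that are merely C1 are what the time
  weights of the energy method produce.\<close>

lemma smooth_to_C1T:
  assumes a: "integrable (lebesgue_on {0..T}) a" and g: "integrable (lebesgue_on {0..T}) g" and T: "T > 0"
    and eq: "\<And>\<phi>. test_fun_0T T \<phi> \<Longrightarrow>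
       - integral\<^sup>L (lebesgue_on {0..T}) (\<lambda>t. a t * pd \<phi> 1 t) - a0 * \<phi> 0 = integral\<^sup>L (lebesgue_on {0..T}) (\<lambda>t. g t * \<phi> t)"
    and \<phi>: "C1T T \<phi> \<phi>'"
  shows "- integral\<^sup>L (lebesgue_on {0..T}) (\<lambda>t. a t * \<phi>' t) - a0 * \<phi> 0 = integral\<^sup>L (lebesgue_on {0..T}) (\<lambda>t. g t * \<phi> t)"
proof -
  let ?M = "lebesgue_on {0..T}"
  have c: "continuous_on UNIV \<phi>" "continuous_on UNIV \<phi>'" using C1T_cont[OF \<phi>] by auto
  have [measurable]: "a \<in> borel_measurable ?M" "g \<in> borel_measurable ?M" using a g by auto
  obtain p where p: "\<And>n::nat. real_polynomial_function (p n)"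
      "\<And>n t. t \<in> {0..T} \<Longrightarrow> \<bar>\<phi>' t - p n t\<bar> < 1 / real (Suc n)"
      using polynomial_approx_seq[OF c(2), of 0 T] by metis
  obtain K where K: "K \<ge> 0" "\<forall>t\<in>{0..T}. \<bar>\<phi>' t\<bar> \<le> K" using cont_bounded_interval[OF c(2)] by blast
  \<comment> \<open>The argument is n (n (T - t) - 1). It is nonpositive from T - 1/n on, and for
    every t < T it tends to infinity, so that \<open>b n t\<close> tends to 1.\<close>
  define b where "b n t = flat (\<lambda>y. 1) (- (real n)\<^sup>2 * t + ((real n)\<^sup>2 * T - real n))" for n t
  define w where "w n t = p n t * b n t" for n t
  have wS: "w n \<in> smooth_alg" for n
    unfolding w_def b_def by (intro smooth_alg.intros(4) smooth_alg.poly smooth_alg.flat p) auto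
  have cw: "continuous_on UNIV (w n)" for n using smooth_alg_deriv[OF wS] deriv_continuous_on_UNIV by blast
  have b01: "\<bar>b n t\<bar> \<le> 1" for n t by (auto simp: b_def flat_def)
  have blim: "(\<lambda>n. b n t) \<longlonglongrightarrow> 1" if "t < T" for t
  proof -
    have "filterlim (\<lambda>n. (T - t) * real n - 1) at_top sequentially"
      using that by real_asymp
    then have "filterlim (\<lambda>n. real n * ((T - t) * real n - 1)) at_top sequentially"
      by (intro filterlim_at_top_mult_at_top filterlim_real_sequentially)
    then have L: "filterlim (\<lambda>n. - (real n)\<^sup>2 * t + ((real n)\<^sup>2 * T - real n)) at_top sequentially"
      by (simp add: algebra_simps power2_eq_square)
    have "(\<lambda>n. exp (- inverse (- (real n)\<^sup>2 * t + ((real n)\<^sup>2 * T - real n)))) \<longlonglongrightarrow> exp (- 0)"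
      by (intro tendsto_intros filterlim_compose[OF tendsto_inverse_0_at_top L] tendsto_inverse_0_at_top[OF L])
    moreover have "\<forall>\<^sub>F n in sequentially. 0 < - (real n)\<^sup>2 * t + ((real n)\<^sup>2 * T - real n)"
      using L unfolding filterlim_at_top_dense by blast
    ultimately show ?thesis
      by (intro Lim_transform_eventually[of _ "exp (-0)" _ "\<lambda>n. b n t", simplified])
         (auto simp: b_def flat_def inverse_eq_divide elim!: eventually_mono)
  qed
  have wlim: "(\<lambda>n. w n t) \<longlonglongrightarrow> \<phi>' t" if "0 \<le> t" "t < T" for t
  proof -
    have "(\<lambda>n. p n t) \<longlonglongrightarrow> \<phi>' t" using p(2) that by (intro approx_seq_tendsto) auto
    from tendsto_mult[OF this blim[OF that(2)]] show ?thesis by (simp add: w_def)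
  qed
  have wbd: "\<bar>w n t\<bar> \<le> K + 1" if "t \<in> {0..T}" for n t
  proof -
    have "\<bar>p n t\<bar> \<le> \<bar>\<phi>' t\<bar> + \<bar>\<phi>' t - p n t\<bar>" by simp
    also have "\<dots> \<le> K + 1 / real (Suc n)" using K(2) that p(2)[OF that, of n] by fastforce
    also have "\<dots> \<le> K + 1" by simp
    finally have "\<bar>p n t\<bar> * \<bar>b n t\<bar> \<le> (K + 1) * 1" using K b01 by (intro mult_mono) auto
    then show ?thesis by (simp add: w_def abs_mult)
  qed
  have "\<exists>G. (\<forall>t. (G has_real_derivative w n t) (at t)) \<and> G T = 0" for n using antiderivative_UNIV[OF cw] by blast
  then obtain G where G: "\<And>n t. (G n has_real_derivative w n t) (at t)" "\<And>n. G n T = 0" by metis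
  have wz: "w n t = 0" if "n > 0" "t \<ge> T - 1 / real n" for n t
  proof -
    have "- (real n)\<^sup>2 * t + ((real n)\<^sup>2 * T - real n) = (real n)\<^sup>2 * (T - 1 / real n - t)"
      using that(1) by (simp add: field_simps power2_eq_square)
    also have "\<dots> \<le> 0" using that(2) by (intro mult_nonneg_nonpos) auto
    finally show ?thesis by (simp add: w_def b_def flat_def)
  qed
  have tf: "test_fun_0T T (G n)" if n: "n > 0" for n
  proof -
    have "G n t = 0" if "t \<ge> T - 1 / real n" for t
    proof -
      have "(G n has_field_derivative 0) (at x within {T - 1 / real n..})" if "x \<in> {T - 1 / real n..}" for x
        using has_field_derivative_at_within[OF G(1)[of n x]] wz[OF n, of x] that by simp
      then obtain c where "\<And>x. x \<in> {T - 1 / real n..} \<Longrightarrow> G n x = c"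
        using has_field_derivative_zero_constant[of "{T - 1 / real n..}" "G n"] by auto
      from this[of t] this[of T] show ?thesis using G(2)[of n] that n by simp
    qed
    moreover have "smooth (G n)" using smooth_antiderivative[OF wS] G(1) by blast
    moreover have "T - 1 / real n < T" using n by simp
    ultimately show ?thesis unfolding test_fun_0T_def by blast
  qed
  have pdG: "pd (G n) 1 = w n" for n using pd_real[OF G(1)] by blast
  have Gbd: "\<bar>G n t\<bar> \<le> (K + 1) * T" if "t \<in> {0..T}" for n t
  proof -
    have "norm (G n t - G n T) \<le> (K + 1) * norm (t - T)"
      by (rule field_differentiable_bound[of "{0..T}" _ "w n"])
         (use that T wbd G(1) in \<open>auto intro: has_field_derivative_at_within\<close>)
    also have "\<dots> \<le> (K + 1) * T" using that K by (intro mult_left_mono) auto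
    finally show ?thesis using G(2) by simp
  qed
  have AET: "AE t in lebesgue_on S. t \<noteq> T" if "S \<in> sets lebesgue" for S
    using AE_completion[OF AE_lborel_singleton[of T]] that by (subst AE_restrict_space_iff) auto
  have Glim: "(\<lambda>n. G n t) \<longlonglongrightarrow> \<phi> t" if t: "t \<in> {0..T}" for t
  proof -
    have 1: "integral\<^sup>L (lebesgue_on {t..T}) (w n) = - G n t" for n
      using ftc_MT[of "G n" "w n" t T] G cw t by auto
    have 2: "integral\<^sup>L (lebesgue_on {t..T}) \<phi>' = - \<phi> t"
      using ftc_MT[of \<phi> \<phi>' t T] \<phi> t by (auto simp: C1T_def)
    have "(\<lambda>n. integral\<^sup>L (lebesgue_on {t..T}) (w n)) \<longlonglongrightarrow> integral\<^sup>L (lebesgue_on {t..T}) \<phi>'"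
    proof (rule integral_dominated_convergence)
      show "integrable (lebesgue_on {t..T}) (\<lambda>_. K + 1)" by (intro continuous_imp_integrable_real continuous_intros)
      show "AE s in lebesgue_on {t..T}. (\<lambda>n. w n s) \<longlonglongrightarrow> \<phi>' s"
      proof -
        have "AE s in lebesgue_on {t..T}. s \<noteq> T" by (rule AET) simp
        moreover have "AE s in lebesgue_on {t..T}. s \<in> {t..T}" using AE_space[of "lebesgue_on {t..T}"] by simp
        ultimately show ?thesis by eventually_elim (use t in \<open>auto intro!: wlim\<close>)
      qed
      show "AE s in lebesgue_on {t..T}. norm (w n s) \<le> K + 1" for n
        using AE_space by eventually_elim (use t in \<open>auto intro!: wbd\<close>)
    qed (auto intro!: cont_meas_MT cw c)
    then show ?thesis unfolding 1 2 by (simp add: tendsto_minus_cancel_left)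
  qed
  have cG: "continuous_on UNIV (G n)" for n using G(1) deriv_continuous_on_UNIV by blast
  have [measurable]: "w n \<in> borel_measurable ?M" "G n \<in> borel_measurable ?M" "\<phi> \<in> borel_measurable ?M" "\<phi>' \<in> borel_measurable ?M" for n
    by (auto intro!: cont_meas_MT cw c cG)
  have L1: "(\<lambda>n. integral\<^sup>L ?M (\<lambda>t. a t * w n t)) \<longlonglongrightarrow> integral\<^sup>L ?M (\<lambda>t. a t * \<phi>' t)"
  proof (rule integral_dominated_convergence)
    show "integrable ?M (\<lambda>t. norm (a t) * (K + 1))" using a by auto
    show "AE t in ?M. (\<lambda>n. a t * w n t) \<longlonglongrightarrow> a t * \<phi>' t"
    proof -
      have "AE s in ?M. s \<noteq> T" by (rule AET) simp
      moreover have "AE s in ?M. s \<in> {0..T}" using AE_space[of ?M] by simp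
      ultimately show ?thesis by eventually_elim (auto intro!: wlim tendsto_intros)
    qed
    show "AE t in ?M. norm (a t * w n t) \<le> norm (a t) * (K + 1)" for n
      using AE_space by eventually_elim (auto simp: abs_mult intro!: wbd mult_left_mono)
  qed measurable
  have L2: "(\<lambda>n. integral\<^sup>L ?M (\<lambda>t. g t * G n t)) \<longlonglongrightarrow> integral\<^sup>L ?M (\<lambda>t. g t * \<phi> t)"
  proof (rule integral_dominated_convergence)
    show "integrable ?M (\<lambda>t. norm (g t) * ((K + 1) * T))" using g by auto
    show "AE t in ?M. (\<lambda>n. g t * G n t) \<longlonglongrightarrow> g t * \<phi> t"
      using AE_space by eventually_elim (auto intro!: Glim tendsto_intros)
    show "AE t in ?M. norm (g t * G n t) \<le> norm (g t) * ((K + 1) * T)" for n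
      using AE_space by eventually_elim (auto simp: abs_mult intro!: Gbd mult_left_mono)
  qed measurable
  have L3: "(\<lambda>n. - integral\<^sup>L ?M (\<lambda>t. a t * w n t) - a0 * G n 0) \<longlonglongrightarrow> - integral\<^sup>L ?M (\<lambda>t. a t * \<phi>' t) - a0 * \<phi> 0"
    by (intro tendsto_intros L1 Glim) (use T in auto)
  have "\<forall>\<^sub>F n in sequentially. - integral\<^sup>L ?M (\<lambda>t. a t * w n t) - a0 * G n 0 = integral\<^sup>L ?M (\<lambda>t. g t * G n t)"
    using eventually_gt_at_top[of 0] by eventually_elim (use eq[OF tf] pdG in auto)
  then show ?thesis
    using LIMSEQ_unique[OF Lim_transform_eventually[OF L3] L2] by blast
qed

section \<open>Abstract evolution equations\<close>

lemma l2_blin: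
  fixes m :: "'b::euclidean_space \<Rightarrow> 'c::euclidean_space"
  assumes "bounded_linear m" "l2 N f" shows "l2 N (\<lambda>x. m (f x))"
proof -
  obtain C where C: "\<And>x. norm (m x) \<le> norm x * C" using bounded_linear.bounded[OF assms(1)] by blast
  have [measurable]: "m \<in> borel_measurable borel"
    by (intro borel_measurable_continuous_onI linear_continuous_on assms)
  have [measurable]: "f \<in> borel_measurable N" using assms(2) by (rule l2_meas)
  have g: "l2 N (\<lambda>x. C *\<^sub>R f x)" by (intro l2_scale assms)
  show ?thesis
  proof (rule l2_bound[OF g, of _ 1])
    show "AE x in N. norm (m (f x)) \<le> 1 * norm (C *\<^sub>R f x)"
    proof (intro AE_I2)
      fix x
      have "norm (m (f x)) \<le> norm (f x) * C" by (rule C)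
      also have "\<dots> \<le> norm (f x) * \<bar>C\<bar>" by (intro mult_left_mono) auto
      finally show "norm (m (f x)) \<le> 1 * norm (C *\<^sub>R f x)" by (simp add: mult.commute)
    qed
  qed measurable
qed

lemma l2_real_scale:
  assumes "l2 N f" "\<theta> \<in> borel_measurable N" "\<And>x. x \<in> space N \<Longrightarrow> \<bar>\<theta> x\<bar> \<le> C"
  shows "l2 N (\<lambda>x. \<theta> x *\<^sub>R f x)"
proof (rule l2_bound[OF assms(1), of _ C])
  show "(\<lambda>x. \<theta> x *\<^sub>R f x) \<in> borel_measurable N" using assms(2) l2_meas[OF assms(1)] by measurable
  show "AE x in N. norm (\<theta> x *\<^sub>R f x) \<le> C * norm (f x)"
    using assms(3) by (intro AE_I2) (auto intro!: mult_right_mono)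
qed

section \<open>Square-integrable fields on a product of finite measure spaces\<close>

context
  fixes M1 :: "'a measure" and M2 :: "'c measure"
  assumes fin1: "finite_measure M1" and fin2: "finite_measure M2"
begin

lemma pair_sf: "pair_sigma_finite M1 M2"
  using fin1 fin2 by (simp add: pair_sigma_finite_def finite_measure.axioms)

lemma slice_l2: assumes "l2 (M1 \<Otimes>\<^sub>M M2) F" shows "AE t in M1. l2 M2 (\<lambda>x. F (t, x))"
proof -
  interpret P: pair_sigma_finite M1 M2 by (rule pair_sf)
  have [measurable]: "F \<in> borel_measurable (M1 \<Otimes>\<^sub>M M2)" using assms by (rule l2_meas)
  have "AE t in M1. t \<in> space M1" by (rule AE_space)
  then show ?thesis using P.AE_integrable_fst'[OF l2_integrable_sq[OF assms]]
    by eventually_elim (auto simp: l2_def)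
qed

lemma ip_slice:
  assumes "l2 (M1 \<Otimes>\<^sub>M M2) F" "l2 (M1 \<Otimes>\<^sub>M M2) G"
  shows "ip (M1 \<Otimes>\<^sub>M M2) F G = (\<integral>t. ip M2 (\<lambda>x. F (t, x)) (\<lambda>x. G (t, x)) \<partial>M1)"
    "integrable M1 (\<lambda>t. ip M2 (\<lambda>x. F (t, x)) (\<lambda>x. G (t, x)))"
proof -
  interpret P: pair_sigma_finite M1 M2 by (rule pair_sf)
  note * = l2_integrable_inner[OF assms]
  show "ip (M1 \<Otimes>\<^sub>M M2) F G = (\<integral>t. ip M2 (\<lambda>x. F (t, x)) (\<lambda>x. G (t, x)) \<partial>M1)"
    using P.integral_fst'[OF *] by (simp add: ip_def)
  show "integrable M1 (\<lambda>t. ip M2 (\<lambda>x. F (t, x)) (\<lambda>x. G (t, x)))"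
    using P.integrable_fst'[OF *] by (simp add: ip_def)
qed

lemma l2_snd:
  assumes "l2 M2 k" shows "l2 (M1 \<Otimes>\<^sub>M M2) (\<lambda>z. k (snd z))"
proof -
  interpret P: pair_sigma_finite M1 M2 by (rule pair_sf)
  have [measurable]: "k \<in> borel_measurable M2" using assms by (rule l2_meas)
  have "integrable (M1 \<Otimes>\<^sub>M M2) (\<lambda>z. (norm (k (snd z)))\<^sup>2)"
  proof (rule P.Fubini_integrable)
    show "integrable M1 (\<lambda>x. \<integral>y. norm ((norm (k (snd (x, y))))\<^sup>2) \<partial>M2)"
      using fin1 by (simp add: finite_measure.integrable_const)
    show "AE x in M1. integrable M2 (\<lambda>y. (norm (k (snd (x, y))))\<^sup>2)"
      using assms by (simp add: l2_def)
  qed measurable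
  then show ?thesis by (simp add: l2_def)
qed

text \<open>The squared slice distances integrate to the squared distance, so they tend to zero in
  L1 and, along a subsequence, almost everywhere.\<close>

lemma slice_subseq:
  assumes F: "\<And>n. l2 (M1 \<Otimes>\<^sub>M M2) (F n)" and z: "l2 (M1 \<Otimes>\<^sub>M M2) z"
    and lim: "(\<lambda>n. l2n (M1 \<Otimes>\<^sub>M M2) (\<lambda>x. F n x - z x)) \<longlonglongrightarrow> 0"
  shows "\<exists>r::nat\<Rightarrow>nat. strict_mono r \<and> (AE t in M1. (\<lambda>n. l2n M2 (\<lambda>x. F (r n) (t,x) - z (t,x))) \<longlonglongrightarrow> 0)"
proof -
  define u where "u n t = ip M2 (\<lambda>x. F n (t,x) - z (t,x)) (\<lambda>x. F n (t,x) - z (t,x))" for n t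
  have d: "l2 (M1 \<Otimes>\<^sub>M M2) (\<lambda>x. F n x - z x)" for n by (intro l2_diff F z)
  have u: "integrable M1 (u n)" "(l2n (M1 \<Otimes>\<^sub>M M2) (\<lambda>x. F n x - z x))\<^sup>2 = (\<integral>t. u n t \<partial>M1)" for n
    using ip_slice[OF d[of n] d[of n]] by (auto simp: u_def[abs_def] l2n_sq)
  have un: "u n t \<ge> 0" for n t unfolding u_def l2n_sq[symmetric] by simp
  have "(\<lambda>n. \<integral>t. norm (u n t) \<partial>M1) \<longlonglongrightarrow> 0"
    using tendsto_power[OF lim, of 2] u un by simp
  from tendsto_L1_AE_subseq[OF u(1) this]
  obtain r :: "nat \<Rightarrow> nat" where r: "strict_mono r" "AE t in M1. (\<lambda>n. u (r n) t) \<longlonglongrightarrow> 0" by blast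
  have "AE t in M1. (\<lambda>n. l2n M2 (\<lambda>x. F (r n) (t,x) - z (t,x))) \<longlonglongrightarrow> 0"
    using r(2)
  proof eventually_elim
    case (elim t)
    from tendsto_real_sqrt[OF this] show ?case
      by (simp add: u_def l2n_sq[symmetric])
  qed
  with r(1) show ?thesis by blast
qed

text \<open>Rectangles are stable under intersection and generate the product sigma-algebra. Hence h
  integrates to zero over every measurable set, in particular over {h > 0} and {h < 0}.\<close>

lemma rectangles_zero:
  fixes h :: "'a \<times> 'c \<Rightarrow> real"
  assumes h: "integrable (M1 \<Otimes>\<^sub>M M2) h"
    and rect: "\<And>A B. A \<in> sets M1 \<Longrightarrow> B \<in> sets M2 \<Longrightarrow> (\<integral>z. indicator (A \<times> B) z * h z \<partial>(M1 \<Otimes>\<^sub>M M2)) = 0"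
  shows "AE z in M1 \<Otimes>\<^sub>M M2. h z = 0"
proof -
  let ?N = "M1 \<Otimes>\<^sub>M M2"
  have [measurable]: "h \<in> borel_measurable ?N" using h by auto
  have int: "integrable ?N (\<lambda>z. indicator S z * h z)" if "S \<in> sets ?N" for S
    using integrable_real_mult_indicator[OF that h] by (simp add: mult.commute)
  have all: "(\<integral>z. indicator S z * h z \<partial>?N) = 0" if "S \<in> sets ?N" for S
    using Int_stable_pair_measure_generator pair_measure_closed that unfolding sets_pair_measure
  proof (induct rule: sigma_sets_induct_disjoint)
    case (basic A) then show ?case using rect by auto
  next
    case empty then show ?case by simp
  next
    case (compl A)
    then have A: "A \<in> sets ?N" by (simp add: sets_pair_measure)
    have "(\<integral>z. indicator (space M1 \<times> space M2 - A) z * h z \<partial>?N)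
        = (\<integral>z. indicator (space M1 \<times> space M2) z * h z - indicator A z * h z \<partial>?N)"
      using sets.sets_into_space[OF A] by (intro Bochner_Integration.integral_cong) (auto simp: indicator_def space_pair_measure)
    also have "\<dots> = (\<integral>z. indicator (space M1 \<times> space M2) z * h z \<partial>?N) - (\<integral>z. indicator A z * h z \<partial>?N)"
      by (intro Bochner_Integration.integral_diff int A) auto
    finally show ?case using compl rect[OF sets.top sets.top] by simp
  next
    case (union A)
    then have A: "A i \<in> sets ?N" for i by (auto simp: sets_pair_measure)
    have "(\<lambda>n. \<integral>z. indicator (\<Union>i<n. A i) z * h z \<partial>?N) \<longlonglongrightarrow> (\<integral>z. indicator (\<Union>i. A i) z * h z \<partial>?N)"
    proof (rule integral_dominated_convergence)
      show "integrable ?N (\<lambda>z. norm (h z))" using h by auto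
      show "AE z in ?N. (\<lambda>n. indicator (\<Union>i<n. A i) z * h z) \<longlonglongrightarrow> indicator (\<Union>i. A i) z * h z"
        by (intro AE_I2 tendsto_mult tendsto_const LIMSEQ_indicator_UN)
      show "AE z in ?N. norm (indicator (\<Union>i<n. A i) z * h z) \<le> norm (h z)" for n
        by (intro AE_I2) (auto simp: indicator_def)
    qed (use A in measurable)
    moreover have "(\<integral>z. indicator (\<Union>i<n. A i) z * h z \<partial>?N) = 0" for n
    proof -
      have "(\<integral>z. indicator (\<Union>i<n. A i) z * h z \<partial>?N) = (\<integral>z. (\<Sum>i<n. indicator (A i) z * h z) \<partial>?N)"
      proof (intro Bochner_Integration.integral_cong refl)
        fix z
        have "disjoint_family_on A {..<n}" using union(1) by (auto simp: disjoint_family_on_def)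
        then show "indicator (\<Union>i<n. A i) z * h z = (\<Sum>i<n. indicator (A i) z * h z)"
          by (subst indicator_UN_disjoint) (auto simp: sum_distrib_right)
      qed
      also have "\<dots> = (\<Sum>i<n. \<integral>z. indicator (A i) z * h z \<partial>?N)"
        by (intro Bochner_Integration.integral_sum int A)
      also have "\<dots> = 0" using union(3) by simp
      finally show ?thesis .
    qed
    ultimately show ?case by (simp add: LIMSEQ_const_iff)
  qed
  define P where "P = {z\<in>space ?N. h z > 0}"
  define N where "N = {z\<in>space ?N. h z < 0}"
  have PN: "P \<in> sets ?N" "N \<in> sets ?N" unfolding P_def N_def by measurable
  have "(\<integral>z. indicator P z * h z \<partial>?N) = 0" by (rule all[OF PN(1)])
  then have "AE z in ?N. indicator P z * h z = 0"
    by (subst integral_nonneg_eq_0_iff_AE[symmetric, OF int[OF PN(1)]]) (auto simp: P_def indicator_def)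
  moreover have "(\<integral>z. - (indicator N z * h z) \<partial>?N) = 0" using all[OF PN(2)] by simp
  then have "AE z in ?N. - (indicator N z * h z) = 0"
    using int[OF PN(2)] by (subst integral_nonneg_eq_0_iff_AE[symmetric]) (auto simp: N_def indicator_def)
  moreover have "AE z in ?N. z \<in> space ?N" by (rule AE_space)
  ultimately show ?thesis
    by eventually_elim (auto simp: P_def N_def indicator_def split: if_splits)
qed

end

text \<open>K plays the role of a closed subspace of L2. Constant sequences in
  \<open>K_closed\<close> show that K is also stable under changes on null sets.\<close>

locale evol =
  fixes T :: real and M :: "'x measure" and K :: "('x \<Rightarrow> 'b::euclidean_space) set"
  assumes T: "T > 0" and fin: "finite_measure M"
    and K_l2: "\<And>k. k \<in> K \<Longrightarrow> l2 M k"
    and K_0: "(\<lambda>x. 0) \<in> K"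
    and K_lin: "\<And>k l a b. k \<in> K \<Longrightarrow> l \<in> K \<Longrightarrow> (\<lambda>x. a *\<^sub>R k x + b *\<^sub>R l x) \<in> K"
    and K_closed: "\<And>f g. (\<And>n. f n \<in> K) \<Longrightarrow> l2 M g \<Longrightarrow> (\<lambda>n. l2n M (\<lambda>x. f n x - g x)) \<longlonglongrightarrow> 0 \<Longrightarrow> g \<in> K"
begin

abbreviation "MT \<equiv> lebesgue_on {0..T}"
abbreviation "Q \<equiv> MT \<Otimes>\<^sub>M M"

lemma finT: "finite_measure MT"
  by (rule finite_measure_lebesgue_on) (metis lmeasurable_cbox interval_cbox)

lemmas slice_l2' = slice_l2[OF finT fin]
lemmas ip_slice' = ip_slice[OF finT fin]
lemmas slice_subseq' = slice_subseq[OF finT fin]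

lemma K_scale: "k \<in> K \<Longrightarrow> (\<lambda>x. a *\<^sub>R k x) \<in> K"
  using K_lin[of k k a 0] by simp

lemma K_diff: "k \<in> K \<Longrightarrow> l \<in> K \<Longrightarrow> (\<lambda>x. k x - l x) \<in> K"
  using K_lin[of k l 1 "-1"] by simp

lemma fst_meas: "continuous_on UNIV \<theta> \<Longrightarrow> (\<lambda>z. \<theta> (fst z) :: real) \<in> borel_measurable Q"
  using cont_meas_MT[of \<theta> "{0..T}"] by measurable

lemma time_mult_l2:
  assumes "continuous_on UNIV \<theta>" "l2 Q F" shows "l2 Q (\<lambda>z. (\<theta> (fst z) :: real) *\<^sub>R F z)"
proof -
  obtain C where C: "\<forall>t\<in>{0..T}. \<bar>\<theta> t\<bar> \<le> C" using cont_bounded_interval[OF assms(1)] by blast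
  show ?thesis by (rule l2_real_scale[OF assms(2) fst_meas[OF assms(1)], of C]) (use C in \<open>auto simp: space_pair_measure\<close>)
qed

lemma tensor_l2:
  assumes "continuous_on UNIV \<phi>" "l2 M k" shows "l2 Q (\<lambda>z. (\<phi> (fst z) :: real) *\<^sub>R k (snd z))"
  by (rule time_mult_l2[OF assms(1) l2_snd[OF finT fin assms(2)]])

lemma ip_tensor:
  assumes "continuous_on UNIV \<phi>" "l2 M k" "l2 Q Z"
  shows "ip Q Z (\<lambda>z. \<phi> (fst z) *\<^sub>R k (snd z)) = (\<integral>t. \<phi> t * ip M (\<lambda>x. Z (t,x)) k \<partial>MT)"
  using ip_slice'(1)[OF assms(3) tensor_l2[OF assms(1,2)]] by (simp add: ip_scale_right)

lemma ip_tensor_integrable: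
  assumes "l2 M k" "l2 Q Z"
  shows "integrable MT (\<lambda>t. ip M (\<lambda>x. Z (t,x)) k)"
  using ip_slice'(2)[OF assms(2) tensor_l2[OF continuous_on_const[of _ 1] assms(1)]] by simp

text \<open>A relation of three arguments: the time derivative and the initial value belong to a
  chosen representation as a finite sum of products, not to the field modulo null sets.\<close>

inductive Tens :: "(real \<times> 'x \<Rightarrow> 'b) \<Rightarrow> (real \<times> 'x \<Rightarrow> 'b) \<Rightarrow> ('x \<Rightarrow> 'b) \<Rightarrow> bool" where
  base: "C1T T \<phi> \<phi>' \<Longrightarrow> k \<in> K \<Longrightarrow>
    Tens (\<lambda>z. \<phi> (fst z) *\<^sub>R k (snd z)) (\<lambda>z. \<phi>' (fst z) *\<^sub>R k (snd z)) (\<lambda>x. \<phi> 0 *\<^sub>R k x)"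
| lin: "Tens \<psi> d\<psi> \<psi>0 \<Longrightarrow> Tens \<xi> d\<xi> \<xi>0 \<Longrightarrow>
    Tens (\<lambda>z. a *\<^sub>R \<psi> z + b *\<^sub>R \<xi> z) (\<lambda>z. a *\<^sub>R d\<psi> z + b *\<^sub>R d\<xi> z) (\<lambda>x. a *\<^sub>R \<psi>0 x + b *\<^sub>R \<xi>0 x)"

lemma Tens_l2:
  assumes "Tens \<psi> d\<psi> \<psi>0"
  shows "l2 Q \<psi>" "l2 Q d\<psi>" "l2 M \<psi>0" "(\<lambda>x. \<psi> (t,x)) \<in> K"
  using assms by (induction) (auto intro!: tensor_l2 l2_lin l2_scale K_lin K_scale dest: K_l2 C1T_cont)

text \<open>For two products this is the scalar rule, since m acts on the space factor only. The
  identity is bilinear, which the nested inductions exploit; the boundary term at T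
  vanishes.\<close>

lemma Tens_ibp:
  fixes m :: "'b \<Rightarrow> 'b"
  assumes m: "bounded_linear m" and A: "Tens \<psi> d\<psi> \<psi>0" and B: "Tens \<xi> d\<xi> \<xi>0"
  shows "ip Q (\<lambda>z. m (\<psi> z)) d\<xi> + ip Q (\<lambda>z. m (d\<psi> z)) \<xi> = - ip M (\<lambda>x. m (\<psi>0 x)) \<xi>0"
  using A
proof induction
  case (base \<phi> \<phi>' k)
  interpret m: bounded_linear m by (rule m)
  note c = C1T_cont[OF base(1)] and k = K_l2[OF base(2)]
  have mk: "l2 M (\<lambda>x. m (k x))" by (rule l2_blin[OF m k])
  show ?case using B
  proof induction
    case (base \<xi> \<xi>' l)
    note c' = C1T_cont[OF base(1)] and l = K_l2[OF base(2)]
    have "ip Q (\<lambda>z. \<phi> (fst z) *\<^sub>R m (k (snd z))) (\<lambda>z. \<xi>' (fst z) *\<^sub>R l (snd z)) = (\<integral>t. \<phi> t * \<xi>' t * ip M (\<lambda>x. m (k x)) l \<partial>MT)"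
      by (subst ip_tensor[OF c'(2) l tensor_l2[OF c(1) mk]]) (simp add: ip_scale_left ac_simps)
    moreover have "ip Q (\<lambda>z. \<phi>' (fst z) *\<^sub>R m (k (snd z))) (\<lambda>z. \<xi> (fst z) *\<^sub>R l (snd z)) = (\<integral>t. \<phi>' t * \<xi> t * ip M (\<lambda>x. m (k x)) l \<partial>MT)"
      by (subst ip_tensor[OF c'(1) l tensor_l2[OF c(2) mk]]) (simp add: ip_scale_left ac_simps)
    moreover have "(\<integral>t. \<phi> t * \<xi>' t \<partial>MT) + (\<integral>t. \<phi>' t * \<xi> t \<partial>MT) = - (\<phi> 0 * \<xi> 0)"
      using C1T_ibp[OF \<open>C1T T \<phi> \<phi>'\<close> base(1) T] c c'
      by (subst (asm) Bochner_Integration.integral_add) (auto intro!: cont_integrable_MT continuous_intros)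
    ultimately show ?case
      by (simp add: m.scaleR ip_scale_left ip_scale_right) (simp add: ac_simps flip: distrib_left)
  next
    case (lin \<xi> d\<xi> \<xi>0 \<zeta> d\<zeta> \<zeta>0 a b)
    have l: "l2 Q (\<lambda>z. m (\<phi> (fst z) *\<^sub>R k (snd z)))" "l2 Q (\<lambda>z. m (\<phi>' (fst z) *\<^sub>R k (snd z)))" "l2 M (\<lambda>x. m (\<phi> 0 *\<^sub>R k x))"
      by (rule l2_blin[OF m], rule tensor_l2[OF c(1) k])
        (rule l2_blin[OF m], rule tensor_l2[OF c(2) k], rule l2_blin[OF m], rule l2_scale[OF k])
    have "a * (ip Q (\<lambda>z. m (\<phi> (fst z) *\<^sub>R k (snd z))) d\<xi> + ip Q (\<lambda>z. m (\<phi>' (fst z) *\<^sub>R k (snd z))) \<xi>)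
        = - a * ip M (\<lambda>x. m (\<phi> 0 *\<^sub>R k x)) \<xi>0"
      "b * (ip Q (\<lambda>z. m (\<phi> (fst z) *\<^sub>R k (snd z))) d\<zeta> + ip Q (\<lambda>z. m (\<phi>' (fst z) *\<^sub>R k (snd z))) \<zeta>)
        = - b * ip M (\<lambda>x. m (\<phi> 0 *\<^sub>R k x)) \<zeta>0"
      using lin.IH by simp_all
    then show ?case
      unfolding ip_lin_right[OF Tens_l2(2)[OF lin(1)] Tens_l2(2)[OF lin(2)] l(1)]
        ip_lin_right[OF Tens_l2(1)[OF lin(1)] Tens_l2(1)[OF lin(2)] l(2)]
        ip_lin_right[OF Tens_l2(3)[OF lin(1)] Tens_l2(3)[OF lin(2)] l(3)]
      by (simp add: algebra_simps)
  qed
next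
  case (lin \<psi> d\<psi> \<psi>0 \<zeta> d\<zeta> \<zeta>0 a b)
  interpret m: bounded_linear m by (rule m)
  have l: "l2 Q (\<lambda>z. m (\<psi> z))" "l2 Q (\<lambda>z. m (\<zeta> z))" "l2 Q (\<lambda>z. m (d\<psi> z))" "l2 Q (\<lambda>z. m (d\<zeta> z))"
    "l2 M (\<lambda>x. m (\<psi>0 x))" "l2 M (\<lambda>x. m (\<zeta>0 x))"
    using Tens_l2(1-3)[OF lin(1)] Tens_l2(1-3)[OF lin(2)] by (auto simp: l2_blin[OF m])
  have "ip Q (\<lambda>z. m (a *\<^sub>R \<psi> z + b *\<^sub>R \<zeta> z)) d\<xi> = a * ip Q (\<lambda>z. m (\<psi> z)) d\<xi> + b * ip Q (\<lambda>z. m (\<zeta> z)) d\<xi>"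
    "ip Q (\<lambda>z. m (a *\<^sub>R d\<psi> z + b *\<^sub>R d\<zeta> z)) \<xi> = a * ip Q (\<lambda>z. m (d\<psi> z)) \<xi> + b * ip Q (\<lambda>z. m (d\<zeta> z)) \<xi>"
    "ip M (\<lambda>z. m (a *\<^sub>R \<psi>0 z + b *\<^sub>R \<zeta>0 z)) \<xi>0 = a * ip M (\<lambda>z. m (\<psi>0 z)) \<xi>0 + b * ip M (\<lambda>z. m (\<zeta>0 z)) \<xi>0"
    by (simp_all add: m.add m.scaleR ip_lin_left l Tens_l2[OF B])
  moreover have "a * (ip Q (\<lambda>z. m (\<psi> z)) d\<xi> + ip Q (\<lambda>z. m (d\<psi> z)) \<xi>) = - a * ip M (\<lambda>x. m (\<psi>0 x)) \<xi>0"
    "b * (ip Q (\<lambda>z. m (\<zeta> z)) d\<xi> + ip Q (\<lambda>z. m (d\<zeta> z)) \<xi>) = - b * ip M (\<lambda>x. m (\<zeta>0 x)) \<xi>0"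
    using lin.IH by simp_all
  ultimately show ?case by (simp add: algebra_simps)
qed

text \<open>The equation is solved in each scalar time factor, so the space factors, and with them
  K, stay untouched.\<close>

lemma Tens_resolvent:
  assumes "Tens \<psi> d\<psi> \<psi>0" "h > 0"
  shows "\<exists>\<xi> d\<xi> \<xi>0. Tens \<xi> d\<xi> \<xi>0 \<and> (\<forall>z. \<xi> z - h *\<^sub>R d\<xi> z = \<psi> z)"
  using assms(1)
proof induction
  case (base \<phi> \<phi>' k)
  obtain y y' where y: "C1T T y y'" "\<forall>t. y t - h * y' t = \<phi> t" using C1T_resolvent[OF base(1) assms(2)] by blast
  have "y (fst z) *\<^sub>R k (snd z) - h *\<^sub>R y' (fst z) *\<^sub>R k (snd z) = \<phi> (fst z) *\<^sub>R k (snd z)" for z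
    using y(2)[rule_format, of "fst z"] by (metis scaleR_diff_left scaleR_scaleR)
  with Tens.base[OF y(1) base(2)] show ?case by blast
next
  case (lin \<psi> d\<psi> \<psi>0 \<zeta> d\<zeta> \<zeta>0 a b)
  then obtain \<xi> d\<xi> \<xi>0 \<omega> d\<omega> \<omega>0 where *: "Tens \<xi> d\<xi> \<xi>0" "\<forall>z. \<xi> z - h *\<^sub>R d\<xi> z = \<psi> z" "Tens \<omega> d\<omega> \<omega>0" "\<forall>z. \<omega> z - h *\<^sub>R d\<omega> z = \<zeta> z"
    by blast
  have "a *\<^sub>R \<xi> z + b *\<^sub>R \<omega> z - h *\<^sub>R (a *\<^sub>R d\<xi> z + b *\<^sub>R d\<omega> z) = a *\<^sub>R \<psi> z + b *\<^sub>R \<zeta> z" for z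
    unfolding *(2)[rule_format, symmetric] *(4)[rule_format, symmetric] by (simp add: algebra_simps)
  with Tens.lin[OF *(1,3), of a b] show ?case by blast
qed

lemma Tens_mult:
  assumes "Tens \<psi> d\<psi> \<psi>0" "\<forall>t. (\<theta> has_real_derivative \<theta>' t) (at t)" "continuous_on UNIV \<theta>'"
  shows "Tens (\<lambda>z. \<theta> (fst z) *\<^sub>R \<psi> z) (\<lambda>z. \<theta>' (fst z) *\<^sub>R \<psi> z + \<theta> (fst z) *\<^sub>R d\<psi> z) (\<lambda>x. \<theta> 0 *\<^sub>R \<psi>0 x)"
  using assms(1)
proof induction
  case (base \<phi> \<phi>' k)
  note c = C1T_cont[OF base(1)]
  have "C1T T (\<lambda>t. \<theta> t * \<phi> t) (\<lambda>t. \<theta>' t * \<phi> t + \<theta> t * \<phi>' t)"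
    using base(1) assms(2,3) deriv_continuous_on_UNIV[OF assms(2)] c
    by (auto simp: C1T_def intro!: derivative_eq_intros continuous_intros)
  from Tens.base[OF this base(2)] show ?case by (simp add: scaleR_add_left)
next
  case (lin \<psi> d\<psi> \<psi>0 \<zeta> d\<zeta> \<zeta>0 a b)
  from Tens.lin[OF lin.IH, of a b] show ?case by (simp add: algebra_simps)
qed

lemma proj_K: assumes "l2 M g" shows "\<exists>k\<in>K. \<forall>l\<in>K. ip M k l = ip M g l"
proof -
  have "K \<noteq> {}" using K_0 by blast
  from l2_projection[OF this K_l2 K_lin assms] obtain z f where
    "l2 M z" "\<forall>n. f n \<in> K" "(\<lambda>n. l2n M (\<lambda>x. f n x - z x)) \<longlonglongrightarrow> 0" "\<forall>v\<in>K. ip M z v = ip M g v" by blast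
  then show ?thesis using K_closed by blast
qed

text \<open>Along a subsequence almost every slice converges, and K is closed on each slice.\<close>

lemma K_valued_closed:
  assumes F: "\<And>n. l2 Q (F n)" "\<And>n. AE t in MT. (\<lambda>x. F n (t,x)) \<in> K" and z: "l2 Q z"
    and lim: "(\<lambda>n. l2n Q (\<lambda>x. F n x - z x)) \<longlonglongrightarrow> 0"
  shows "AE t in MT. (\<lambda>x. z (t,x)) \<in> K"
proof -
  obtain r :: "nat \<Rightarrow> nat" where "AE t in MT. (\<lambda>n. l2n M (\<lambda>x. F (r n) (t,x) - z (t,x))) \<longlonglongrightarrow> 0"
    using slice_subseq'[OF F(1) z lim] by blast
  moreover have "AE t in MT. \<forall>n. (\<lambda>x. F n (t,x)) \<in> K" using F(2) by (simp add: AE_all_countable)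
  ultimately show ?thesis using slice_l2'[OF z]
  proof eventually_elim
    case (elim t)
    show ?case by (rule K_closed[where f="\<lambda>n x. F (r n) (t,x)"]) (use elim in auto)
  qed
qed

text \<open>Indicators of rectangles are not K-valued. Since Z(t) lies in K, the indicator of B
  times e may be replaced by its projection on K, to which Z(t) is orthogonal for almost every t.
  Each rectangle involves a single element of K, so the dependence of the exceptional times on that
  element does no harm.\<close>

lemma K_valued_orth_zero:
  assumes Z: "l2 Q Z" "AE t in MT. (\<lambda>x. Z (t,x)) \<in> K"
    and orth: "\<And>\<phi> \<phi>' k. C1T T \<phi> \<phi>' \<Longrightarrow> k \<in> K \<Longrightarrow> ip Q Z (\<lambda>z. \<phi> (fst z) *\<^sub>R k (snd z)) = 0"
  shows "AE z in Q. Z z = 0"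
proof -
  interpret MM: finite_measure M by (rule fin)
  interpret P: pair_sigma_finite MT M by (rule pair_sf[OF finT fin])
  have [measurable]: "Z \<in> borel_measurable Q" using Z(1) by (rule l2_meas)
  have k0: "AE t in MT. ip M (\<lambda>x. Z (t,x)) k = 0" if k: "k \<in> K" for k
    by (rule fund_C1T) (use ip_tensor_integrable[OF K_l2[OF k] Z(1)] orth[OF _ k] ip_tensor[OF C1T_cont(1) K_l2[OF k] Z(1)] in auto)
  have "AE z in Q. Z z \<bullet> e = 0" for e
  proof (rule rectangles_zero[OF finT fin])
    have l2e: "l2 Q (\<lambda>z. e)" using l2_snd[OF finT fin, of "\<lambda>x. e"] by (simp add: l2_def)
    show int: "integrable Q (\<lambda>z. Z z \<bullet> e)" by (rule l2_integrable_inner[OF Z(1) l2e])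
    fix A B assume A: "A \<in> sets MT" and B: "B \<in> sets M"
    have lB: "l2 M (\<lambda>x. indicator B x *\<^sub>R e)"
    proof (rule l2_bound[where f="\<lambda>x. e" and C=1])
      show "l2 M (\<lambda>x. e)" by (simp add: l2_def)
    qed (use B in \<open>auto simp: indicator_def\<close>)
    obtain k where k: "k \<in> K" "\<forall>l\<in>K. ip M k l = ip M (\<lambda>x. indicator B x *\<^sub>R e) l" using proj_K[OF lB] by blast
    have intAB: "integrable Q (\<lambda>z. indicator (A \<times> B) z * (Z z \<bullet> e))"
      using integrable_real_mult_indicator[OF _ int, of "A \<times> B"] A B by (simp add: mult.commute)
    have "(\<integral>z. indicator (A \<times> B) z * (Z z \<bullet> e) \<partial>Q) = (\<integral>t. (\<integral>x. indicator (A \<times> B) (t,x) * (Z (t,x) \<bullet> e) \<partial>M) \<partial>MT)"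
      using P.integral_fst'[OF intAB] by simp
    also have "\<dots> = (\<integral>t. indicator A t * ip M (\<lambda>x. Z (t,x)) (\<lambda>x. indicator B x *\<^sub>R e) \<partial>MT)"
      by (intro Bochner_Integration.integral_cong) (auto simp: ip_def indicator_times mult.assoc)
    also have "\<dots> = (\<integral>t. 0 \<partial>MT)"
    proof (rule integral_cong_AE)
      show "AE t in MT. indicator A t * ip M (\<lambda>x. Z (t,x)) (\<lambda>x. indicator B x *\<^sub>R e) = 0"
        using k0[OF k(1)] Z(2)
      proof eventually_elim
        case (elim t)
        then show ?case using k(2) by (simp add: ip_commute)
      qed
      show "(\<lambda>t. indicator A t * ip M (\<lambda>x. Z (t,x)) (\<lambda>x. indicator B x *\<^sub>R e)) \<in> borel_measurable MT"
        using A borel_measurable_integrable[OF ip_tensor_integrable[OF lB Z(1)]] by measurable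
    qed auto
    finally show "(\<integral>z. indicator (A \<times> B) z * (Z z \<bullet> e) \<partial>Q) = 0" by simp
  qed
  then have "AE z in Q. \<forall>e\<in>Basis. Z z \<bullet> e = 0" by (simp add: AE_finite_all)
  then show ?thesis by eventually_elim (simp add: euclidean_all_zero_iff)
qed

lemma Tens_0: "Tens (\<lambda>z. 0) (\<lambda>z. 0) (\<lambda>x. 0)"
  using Tens.base[of "\<lambda>t. 0" "\<lambda>t. 0", OF _ K_0] by (simp add: C1T_def)

text \<open>The projection z of Z on the closure of the tensors is again K-valued, so Z - z is
  K-valued and orthogonal to every product, hence zero almost everywhere.\<close>

lemma Tens_dense:
  assumes Z: "l2 Q Z" "AE t in MT. (\<lambda>x. Z (t,x)) \<in> K"
  shows "\<exists>\<psi> d\<psi> \<psi>0. (\<forall>n. Tens (\<psi> n) (d\<psi> n) (\<psi>0 n)) \<and> (\<lambda>n. l2n Q (\<lambda>z. \<psi> n z - Z z)) \<longlonglongrightarrow> 0"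
proof -
  define V where "V = {\<psi>. \<exists>d\<psi> \<psi>0. Tens \<psi> d\<psi> \<psi>0}"
  have "\<exists>z f. l2 Q z \<and> (\<forall>n. f n \<in> V) \<and> (\<lambda>n. l2n Q (\<lambda>x. f n x - z x)) \<longlonglongrightarrow> 0 \<and> (\<forall>v\<in>V. ip Q z v = ip Q Z v)"
  proof (rule l2_projection[OF _ _ _ Z(1)])
    show "V \<noteq> {}" using Tens_0 by (auto simp: V_def)
    show "l2 Q f" if "f \<in> V" for f using that Tens_l2(1) by (auto simp: V_def)
    show "(\<lambda>x. a *\<^sub>R f x + b *\<^sub>R g x) \<in> V" if "f \<in> V" "g \<in> V" for f g a b
      using that Tens.lin by (fastforce simp: V_def)
  qed
  then obtain z f where z: "l2 Q z" "\<And>n. f n \<in> V" "(\<lambda>n. l2n Q (\<lambda>x. f n x - z x)) \<longlonglongrightarrow> 0" "\<forall>v\<in>V. ip Q z v = ip Q Z v"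
    by blast
  obtain d\<psi> \<psi>0 where T: "\<And>n. Tens (f n) (d\<psi> n) (\<psi>0 n)" using z(2) unfolding V_def mem_Collect_eq by metis
  have zK: "AE t in MT. (\<lambda>x. z (t,x)) \<in> K"
    by (rule K_valued_closed[OF Tens_l2(1)[OF T] _ z(1,3)]) (simp add: Tens_l2(4)[OF T])
  have "AE y in Q. Z y - z y = 0"
  proof (rule K_valued_orth_zero)
    show "AE t in MT. (\<lambda>x. Z (t,x) - z (t,x)) \<in> K" using Z(2) zK by eventually_elim (rule K_diff)
    fix \<phi> \<phi>' k assume "C1T T \<phi> \<phi>'" "k \<in> K"
    from Tens.base[OF this] have "(\<lambda>z. \<phi> (fst z) *\<^sub>R k (snd z)) \<in> V" unfolding V_def by blast
    then show "ip Q (\<lambda>y. Z y - z y) (\<lambda>z. \<phi> (fst z) *\<^sub>R k (snd z)) = 0"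
      using z(4) Tens_l2(1) by (subst ip_diff_left[OF Z(1) z(1)]) (auto simp: V_def)
  qed (intro l2_diff Z z)
  then have "l2n Q (\<lambda>x. f n x - Z x) = l2n Q (\<lambda>x. f n x - z x)" for n
    by (intro l2n_AE_cong) (use l2_meas[OF l2_diff[OF Tens_l2(1)[OF T] Z(1)]] l2_meas[OF l2_diff[OF Tens_l2(1)[OF T] z(1)]] in auto)
  with z(3) T show ?thesis by (intro exI[of _ f] exI[of _ d\<psi>] exI[of _ \<psi>0]) simp
qed

end

text \<open>The factor max 0 (T - t) is positive before T, so it leaves the sign of h unchanged
  there, and it makes every continuous weight vanish from T on.\<close>

lemma fund_nonneg':
  fixes h :: "real \<Rightarrow> real"
  assumes h: "integrable (lebesgue_on {0..T}) h"
    and test: "\<And>\<xi>. continuous_on UNIV \<xi> \<Longrightarrow> (\<forall>t. 0 \<le> \<xi> t) \<Longrightarrow> (\<forall>t\<ge>T. \<xi> t = 0) \<Longrightarrow> 0 \<le> integral\<^sup>L (lebesgue_on {0..T}) (\<lambda>t. \<xi> t * h t)"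
  shows "AE t in lebesgue_on {0..T}. 0 \<le> h t"
proof -
  have "AE t in lebesgue_on {0..T}. 0 \<le> max 0 (T - t) * h t"
  proof (rule fund_nonneg)
    show "integrable (lebesgue_on {0..T}) (\<lambda>t. max 0 (T - t) * h t)"
      by (intro cont_mult_integrable_MT continuous_intros h)
    fix \<xi> :: "real \<Rightarrow> real" assume "continuous_on UNIV \<xi>" "\<forall>t. 0 \<le> \<xi> t"
    then have "0 \<le> integral\<^sup>L (lebesgue_on {0..T}) (\<lambda>t. (\<xi> t * max 0 (T - t)) * h t)"
      by (intro test) (auto intro!: continuous_intros)
    then show "0 \<le> integral\<^sup>L (lebesgue_on {0..T}) (\<lambda>t. \<xi> t * (max 0 (T - t) * h t))" by (simp add: mult.assoc)
  qed
  moreover have "AE t in lebesgue_on {0..T}. t \<noteq> T"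
    using AE_completion[OF AE_lborel_singleton[of T]] by (subst AE_restrict_space_iff) auto
  moreover have "AE t in lebesgue_on {0..T}. t \<in> {0..T}" using AE_space[of "lebesgue_on {0..T}"] by simp
  ultimately show ?thesis by eventually_elim (auto simp: zero_le_mult_iff)
qed

section \<open>Degenerate evolution equations: energy inequality and existence\<close>

locale evol_form = evol T M K for T M and K :: "('x \<Rightarrow> 'b::euclidean_space) set" +
  fixes m :: "'b \<Rightarrow> 'b"
  assumes m_bl: "bounded_linear m" and m_sym: "\<And>b c. m b \<bullet> c = b \<bullet> m c" and m_psd: "\<And>b. 0 \<le> m b \<bullet> b"
begin

sublocale m: bounded_linear m by (rule m_bl)

lemma m_l2: "l2 N f \<Longrightarrow> l2 N (\<lambda>x. m (f x))"
  by (rule l2_blin[OF m_bl])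

lemma ip_m_sym: "ip N (\<lambda>x. m (f x)) g = ip N (\<lambda>x. m (g x)) f"
  unfolding ip_def by (intro Bochner_Integration.integral_cong refl) (metis m_sym inner_commute)

lemma ip_m_psd: "0 \<le> ip N (\<lambda>x. m (f x)) f"
  by (simp add: ip_def m_psd)

lemma ip_m_diff_sq:
  assumes "l2 N f" "l2 N g"
  shows "0 \<le> a\<^sup>2 * ip N (\<lambda>x. m (f x)) f + 2 * a * b * ip N (\<lambda>x. m (f x)) g + b\<^sup>2 * ip N (\<lambda>x. m (g x)) g"
proof -
  have "ip N (\<lambda>x. m (a *\<^sub>R f x + b *\<^sub>R g x)) (\<lambda>x. a *\<^sub>R f x + b *\<^sub>R g x)
    = a\<^sup>2 * ip N (\<lambda>x. m (f x)) f + 2 * a * b * ip N (\<lambda>x. m (f x)) g + b\<^sup>2 * ip N (\<lambda>x. m (g x)) g"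
    by (simp add: m.add m.scaleR ip_lin_left ip_lin_right m_l2 assms l2_lin ip_m_sym[of N g f] algebra_simps power2_eq_square)
  then show ?thesis using ip_m_psd[of N "\<lambda>x. a *\<^sub>R f x + b *\<^sub>R g x"] by simp
qed

text \<open>The equation (m U)' = Z with (m U)(0) = m U0, tested by K-valued functions that vanish
  at T. Only the part of U0 that m sees is prescribed.\<close>

definition weak :: "(real \<times> 'x \<Rightarrow> 'b) \<Rightarrow> (real \<times> 'x \<Rightarrow> 'b) \<Rightarrow> ('x \<Rightarrow> 'b) \<Rightarrow> bool" where
  "weak U Z U0 \<longleftrightarrow> (\<forall>\<psi> d\<psi> \<psi>0. Tens \<psi> d\<psi> \<psi>0 \<longrightarrow>
     - ip Q (\<lambda>z. m (U z)) d\<psi> - ip M (\<lambda>x. m (U0 x)) \<psi>0 = ip Q Z \<psi>)"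

text \<open>The product rule in time, proved by moving \<theta> onto the test function. It yields
  both the time weights of the estimates and the exponential shift used for existence.\<close>

lemma weak_mult:
  assumes U: "l2 Q U" and Z: "l2 Q Z" and U0: "l2 M U0" and w: "weak U Z U0"
    and \<theta>: "\<forall>t. (\<theta> has_real_derivative \<theta>' t) (at t)" "continuous_on UNIV \<theta>'"
  shows "weak (\<lambda>z. \<theta> (fst z) *\<^sub>R U z) (\<lambda>z. \<theta> (fst z) *\<^sub>R Z z + \<theta>' (fst z) *\<^sub>R m (U z)) (\<lambda>x. \<theta> 0 *\<^sub>R U0 x)"
  unfolding weak_def
proof (intro allI impI)
  fix \<psi> d\<psi> \<psi>0 assume A: "Tens \<psi> d\<psi> \<psi>0"
  note c = deriv_continuous_on_UNIV[OF \<theta>(1)] \<theta>(2)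
  note l = Tens_l2[OF A]
  have s: "ip Q (\<lambda>z. \<zeta> (fst z) *\<^sub>R F z) G = ip Q F (\<lambda>z. \<zeta> (fst z) *\<^sub>R G z)" for \<zeta> :: "real \<Rightarrow> real" and F G :: "real \<times> 'x \<Rightarrow> 'b"
    by (simp add: ip_def)
  have "- ip Q (\<lambda>z. m (U z)) (\<lambda>z. \<theta>' (fst z) *\<^sub>R \<psi> z + \<theta> (fst z) *\<^sub>R d\<psi> z) - ip M (\<lambda>x. m (U0 x)) (\<lambda>x. \<theta> 0 *\<^sub>R \<psi>0 x)
      = ip Q Z (\<lambda>z. \<theta> (fst z) *\<^sub>R \<psi> z)"
    using w Tens_mult[OF A \<theta>] unfolding weak_def by blast
  moreover have "ip Q (\<lambda>z. m (U z)) (\<lambda>z. \<theta>' (fst z) *\<^sub>R \<psi> z + \<theta> (fst z) *\<^sub>R d\<psi> z)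
     = ip Q (\<lambda>z. m (U z)) (\<lambda>z. \<theta>' (fst z) *\<^sub>R \<psi> z) + ip Q (\<lambda>z. m (U z)) (\<lambda>z. \<theta> (fst z) *\<^sub>R d\<psi> z)"
    using ip_lin_right[OF time_mult_l2[OF c(2) l(1)] time_mult_l2[OF c(1) l(2)] m_l2[OF U], of 1 1] by simp
  moreover have "ip Q (\<lambda>z. \<theta> (fst z) *\<^sub>R Z z + \<theta>' (fst z) *\<^sub>R m (U z)) \<psi>
     = ip Q Z (\<lambda>z. \<theta> (fst z) *\<^sub>R \<psi> z) + ip Q (\<lambda>z. m (U z)) (\<lambda>z. \<theta>' (fst z) *\<^sub>R \<psi> z)"
    using ip_lin_left[OF time_mult_l2[OF c(1) Z] time_mult_l2[OF c(2) m_l2[OF U]] l(1), of 1 1]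
    by (simp add: s[of \<theta> Z] s[of \<theta>' "\<lambda>z. m (U z)"])
  ultimately show "- ip Q (\<lambda>z. m (\<theta> (fst z) *\<^sub>R U z)) d\<psi> - ip M (\<lambda>x. m (\<theta> 0 *\<^sub>R U0 x)) \<psi>0 = ip Q (\<lambda>z. \<theta> (fst z) *\<^sub>R Z z + \<theta>' (fst z) *\<^sub>R m (U z)) \<psi>"
    by (simp add: m.scaleR s[of \<theta> "\<lambda>z. m (U z)"] ip_scale_left ip_scale_right)
qed

lemma resolvent_ibp:
  assumes "Tens \<xi> d\<xi> \<xi>0"
  shows "ip Q \<xi> d\<xi> = - (l2n M \<xi>0)\<^sup>2 / 2" "ip Q (\<lambda>z. m (\<xi> z)) d\<xi> = - ip M (\<lambda>x. m (\<xi>0 x)) \<xi>0 / 2"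
proof -
  show "ip Q \<xi> d\<xi> = - (l2n M \<xi>0)\<^sup>2 / 2"
    using Tens_ibp[OF bounded_linear_ident assms assms] by (simp add: ip_commute[of _ d\<xi>] l2n_sq)
  show "ip Q (\<lambda>z. m (\<xi> z)) d\<xi> = - ip M (\<lambda>x. m (\<xi>0 x)) \<xi>0 / 2"
    using Tens_ibp[OF m_bl assms assms] by (simp add: ip_m_sym[of _ d\<xi>])
qed

text \<open>Pairing the resolvent equation with \<xi> gives |\<xi>|^2 + h |\<xi>0|^2 / 2 = <\<xi>,
  \<psi>>.\<close>

lemma resolvent_contraction:
  assumes A: "Tens \<xi> d\<xi> \<xi>0" and eq: "\<forall>z. \<xi> z - h *\<^sub>R d\<xi> z = \<psi> z" and h: "h > 0"
  shows "l2n Q \<xi> \<le> l2n Q \<psi>"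
proof -
  note l = Tens_l2[OF A]
  have e: "\<psi> = (\<lambda>z. \<xi> z - h *\<^sub>R d\<xi> z)" using eq by auto
  have lp: "l2 Q \<psi>" unfolding e by (intro l2_diff l2_scale l)
  have "ip Q \<xi> \<psi> = ip Q \<xi> \<xi> - h * ip Q \<xi> d\<xi>"
    unfolding e by (simp add: ip_diff_right l2_scale l ip_scale_right)
  then have "(l2n Q \<xi>)\<^sup>2 \<le> ip Q \<xi> \<psi>" using resolvent_ibp(1)[OF A] h by (simp add: l2n_sq[symmetric])
  also have "\<dots> \<le> l2n Q \<xi> * l2n Q \<psi>" using l2_CS[OF l(1) lp] by linarith
  finally show ?thesis using l2n_nonneg[of Q \<xi>] l2n_nonneg[of Q \<psi>]
    by (cases "l2n Q \<xi> = 0") (auto simp: power2_eq_square mult_le_cancel_left)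
qed

text \<open>The identity \<xi> - \<psi> = h \<xi>' is paired with \<xi> - \<psi>. The derivative of
  the difference contributes a nonpositive boundary term, and only the derivative of \<psi>
  remains.\<close>

lemma resolvent_approx:
  assumes A: "Tens \<xi> d\<xi> \<xi>0" and B: "Tens \<psi> d\<psi> \<psi>0" and eq: "\<forall>z. \<xi> z - h *\<^sub>R d\<xi> z = \<psi> z" and h: "h > 0"
  shows "l2n Q (\<lambda>z. \<xi> z - \<psi> z) \<le> h * l2n Q d\<psi>"
proof -
  let ?d = "\<lambda>z. \<xi> z - \<psi> z"
  have D: "Tens ?d (\<lambda>z. d\<xi> z - d\<psi> z) (\<lambda>x. \<xi>0 x - \<psi>0 x)"
    using Tens.lin[OF A B, of 1 "-1"] by simp
  note l = Tens_l2[OF D] and la = Tens_l2[OF A] and lb = Tens_l2[OF B]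
  have e: "?d z = h *\<^sub>R d\<xi> z" for z using eq by (metis add_diff_cancel_left' diff_add_cancel)
  have "(l2n Q ?d)\<^sup>2 = ip Q ?d (\<lambda>z. h *\<^sub>R d\<xi> z)" unfolding l2n_sq by (simp only: e)
  also have "\<dots> = h * (ip Q ?d (\<lambda>z. d\<xi> z - d\<psi> z) + ip Q ?d d\<psi>)"
    by (simp add: ip_scale_right ip_diff_right[OF la(2) lb(2) l(1)])
  also have "\<dots> \<le> h * ip Q ?d d\<psi>" using resolvent_ibp(1)[OF D] h by simp
  also have "\<dots> \<le> h * (l2n Q ?d * l2n Q d\<psi>)" using l2_CS[OF l(1) lb(2)] h by (intro mult_left_mono) auto
  finally have "l2n Q ?d * l2n Q ?d \<le> l2n Q ?d * (h * l2n Q d\<psi>)" by (simp add: power2_eq_square ac_simps)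
  then show ?thesis using l2n_nonneg[of Q ?d] h l2n_nonneg[of Q d\<psi>]
    by (cases "l2n Q ?d = 0") (auto simp: mult_le_cancel_left)
qed

text \<open>Formally this is the integral of (m U)' . U = Z . U over [0,T] with the energy at T
  dropped. The test function actually used is the resolvent \<xi> of an approximant of U; the order
  of the choices i, h, n is essential.\<close>

lemma energy:
  assumes U: "l2 Q U" "AE t in MT. (\<lambda>x. U (t,x)) \<in> K" and Z: "l2 Q Z" and U0: "l2 M U0" and w: "weak U Z U0"
  shows "0 \<le> ip M (\<lambda>x. m (U0 x)) U0 / 2 + ip Q Z U"
proof -
  obtain \<psi> d\<psi> \<psi>0 where \<psi>: "\<And>n. Tens (\<psi> n) (d\<psi> n) (\<psi>0 n)" and lim: "(\<lambda>n. l2n Q (\<lambda>z. \<psi> n z - U z)) \<longlonglongrightarrow> 0"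
    using Tens_dense[OF U] by blast
  note l\<psi> = Tens_l2[OF \<psi>]
  obtain Cm where Cm: "Cm > 0" "\<And>x. norm (m x) \<le> norm x * Cm" using m.pos_bounded by blast
  have ex: "\<exists>n. l2n Q (\<lambda>z. \<psi> n z - U z) < e" if "e > 0" for e
    using order_tendstoD(2)[OF lim that] by (auto simp: eventually_sequentially)
  define X where "X = ip M (\<lambda>x. m (U0 x)) U0 / 2 + ip Q Z U"
  define C where "C = 2 * Cm * (l2n Q U + 1) + 4 * l2n Q Z"
  have main: "- (C * \<delta>) \<le> X" if \<delta>: "0 < \<delta>" "\<delta> \<le> 1" for \<delta>
  proof -
    obtain i where i: "l2n Q (\<lambda>z. \<psi> i z - U z) < \<delta>" using ex \<delta> by blast
    \<comment> \<open>Small relative to the derivative of the fixed tensor \<psi> i, so that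
      applying the resolvent to it costs at most \<delta>; the 1 prevents division by zero.\<close>
    define h where "h = \<delta> / (1 + l2n Q (d\<psi> i))"
    have dp: "1 + l2n Q (d\<psi> i) > 0" by (simp add: add_pos_nonneg)
    have h: "h > 0" using \<delta> dp by (simp add: h_def)
    have hi: "h * l2n Q (d\<psi> i) \<le> \<delta>" using \<delta> dp by (simp add: h_def field_simps)
    \<comment> \<open>Chosen after h: a distance below h \<delta> compensates the derivative of
      \<xi>, which is of size 1/h.\<close>
    obtain n where n: "l2n Q (\<lambda>z. \<psi> n z - U z) < min \<delta> (h * \<delta>)" using ex[of "min \<delta> (h * \<delta>)"] \<delta> h by auto
    obtain \<xi> d\<xi> \<xi>0 where A: "Tens \<xi> d\<xi> \<xi>0" "\<forall>z. \<xi> z - h *\<^sub>R d\<xi> z = \<psi> n z" using Tens_resolvent[OF \<psi> h] by blast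
    obtain \<omega> d\<omega> \<omega>0 where B: "Tens \<omega> d\<omega> \<omega>0" "\<forall>z. \<omega> z - h *\<^sub>R d\<omega> z = \<psi> i z" using Tens_resolvent[OF \<psi> h] by blast
    note la = Tens_l2[OF A(1)] and lb = Tens_l2[OF B(1)]
    have D: "Tens (\<lambda>z. \<xi> z - \<omega> z) (\<lambda>z. d\<xi> z - d\<omega> z) (\<lambda>x. \<xi>0 x - \<omega>0 x)"
      using Tens.lin[OF A(1) B(1), of 1 "-1"] by simp
    have "\<forall>z. (\<xi> z - \<omega> z) - h *\<^sub>R (d\<xi> z - d\<omega> z) = \<psi> n z - \<psi> i z"
      unfolding A(2)[rule_format, symmetric] B(2)[rule_format, symmetric] by (simp add: algebra_simps)
    from resolvent_contraction[OF D this h]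
    have 1: "l2n Q (\<lambda>z. \<xi> z - \<omega> z) \<le> l2n Q (\<lambda>z. \<psi> n z - \<psi> i z)" .
    have 2: "l2n Q (\<lambda>z. \<psi> n z - \<psi> i z) \<le> 2 * \<delta>"
      using l2n_diff_triangle[OF l\<psi>(1)[of n] U(1) l\<psi>(1)[of i]] i n l2n_diff_commute[of Q U "\<psi> i"] by simp
    have 3: "l2n Q (\<lambda>z. \<omega> z - \<psi> i z) \<le> \<delta>" using resolvent_approx[OF B(1) \<psi> B(2) h] hi by simp
    \<comment> \<open>The 4 is 2 + 1 + 1: from \<xi> to \<omega>, from \<omega> to \<psi> i, and
      from \<psi> i to U.\<close>
    have \<xi>U: "l2n Q (\<lambda>z. \<xi> z - U z) \<le> 4 * \<delta>"
      using l2n_diff_triangle[OF la(1) lb(1) U(1)] l2n_diff_triangle[OF lb(1) l\<psi>(1)[of i] U(1)] 1 2 3 i by linarith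
    have \<psi>n: "l2n Q (\<psi> n) \<le> l2n Q U + 1"
      using l2n_le_add_diff[OF l\<psi>(1)[of n] U(1)] n \<delta> by linarith
    have hd: "h * l2n Q d\<xi> \<le> 2 * (l2n Q U + 1)"
    proof -
      have "h * l2n Q d\<xi> = l2n Q (\<lambda>z. h *\<^sub>R d\<xi> z)" using h by (simp add: l2n_scale)
      also have "(\<lambda>z. h *\<^sub>R d\<xi> z) = (\<lambda>z. \<xi> z - \<psi> n z)" using A(2) by (metis add_diff_cancel_left' diff_add_cancel)
      also have "l2n Q \<dots> \<le> l2n Q \<xi> + l2n Q (\<psi> n)"
        using l2n_diff_triangle[OF la(1) l2_zero l\<psi>(1)[of n]] l2n_diff_commute[of Q "\<lambda>_. 0" "\<psi> n"] by simp
      also have "\<dots> \<le> 2 * (l2n Q U + 1)" using resolvent_contraction[OF A h] \<psi>n by simp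
      finally show ?thesis .
    qed
    have lU\<psi>: "l2 Q (\<lambda>z. U z - \<psi> n z)" by (intro l2_diff U l\<psi>)
    have err: "ip Q (\<lambda>z. m (U z - \<psi> n z)) d\<xi> \<le> 2 * Cm * (l2n Q U + 1) * \<delta>"
    proof -
      have "l2n Q (\<lambda>z. m (U z - \<psi> n z)) \<le> Cm * l2n Q (\<lambda>z. U z - \<psi> n z)"
        using Cm by (intro l2n_bound m_l2 lU\<psi>) (auto simp: mult.commute)
      also have "\<dots> \<le> Cm * (h * \<delta>)" using n Cm by (intro mult_left_mono) (auto simp: l2n_diff_commute[of Q U])
      finally have a: "l2n Q (\<lambda>z. m (U z - \<psi> n z)) \<le> Cm * (h * \<delta>)" .
      have "ip Q (\<lambda>z. m (U z - \<psi> n z)) d\<xi> \<le> l2n Q (\<lambda>z. m (U z - \<psi> n z)) * l2n Q d\<xi>"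
        using l2_CS[OF m_l2[OF lU\<psi>] la(2)] by linarith
      also have "\<dots> \<le> Cm * (h * \<delta>) * l2n Q d\<xi>" by (intro mult_right_mono a) simp
      also have "\<dots> = (Cm * \<delta>) * (h * l2n Q d\<xi>)" by simp
      also have "\<dots> \<le> (Cm * \<delta>) * (2 * (l2n Q U + 1))" using hd Cm \<delta> by (intro mult_left_mono) auto
      finally show ?thesis by (simp add: ac_simps)
    qed
    \<comment> \<open>Substituting \<psi> n = \<xi> - h d\<xi> leaves the extra term - h <m d\<xi>,
      d\<xi>>, which is nonpositive.\<close>
    have "ip Q (\<lambda>z. m (\<psi> n z)) d\<xi> \<le> - ip M (\<lambda>x. m (\<xi>0 x)) \<xi>0 / 2"
    proof -
      have "\<psi> n = (\<lambda>z. \<xi> z - h *\<^sub>R d\<xi> z)" using A(2) by auto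
      then have "ip Q (\<lambda>z. m (\<psi> n z)) d\<xi> = ip Q (\<lambda>z. m (\<xi> z)) d\<xi> - h * ip Q (\<lambda>z. m (d\<xi> z)) d\<xi>"
        by (simp add: m.diff m.scaleR ip_diff_left m_l2 la l2_scale ip_scale_left)
      also have "\<dots> \<le> ip Q (\<lambda>z. m (\<xi> z)) d\<xi>" using ip_m_psd[of Q d\<xi>] h by simp
      finally show ?thesis using resolvent_ibp(2)[OF A(1)] by simp
    qed
    moreover have "ip Q (\<lambda>z. m (U z)) d\<xi> = ip Q (\<lambda>z. m (\<psi> n z)) d\<xi> + ip Q (\<lambda>z. m (U z - \<psi> n z)) d\<xi>"
      by (simp add: m.diff ip_diff_left m_l2 U l\<psi> la)
    moreover have "- ip Q (\<lambda>z. m (U z)) d\<xi> - ip M (\<lambda>x. m (U0 x)) \<xi>0 = ip Q Z \<xi>"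
      using w A(1) unfolding weak_def by blast
    \<comment> \<open>The initial value \<xi>0 is not known to be close to U0; semidefiniteness of m
      at U0 - \<xi>0 removes it.\<close>
    moreover have "0 \<le> ip M (\<lambda>x. m (U0 x)) U0 - 2 * ip M (\<lambda>x. m (U0 x)) \<xi>0 + ip M (\<lambda>x. m (\<xi>0 x)) \<xi>0"
      using ip_m_diff_sq[OF U0 la(3), of 1 "-1"] by simp
    moreover have "ip Q Z \<xi> - ip Q Z U \<le> l2n Q Z * (4 * \<delta>)"
    proof -
      have "ip Q Z \<xi> - ip Q Z U = ip Q Z (\<lambda>z. \<xi> z - U z)" by (simp add: ip_diff_right la U Z)
      also have "\<dots> \<le> l2n Q Z * l2n Q (\<lambda>z. \<xi> z - U z)" using l2_CS[OF Z l2_diff[OF la(1) U(1)]] by linarith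
      also have "\<dots> \<le> l2n Q Z * (4 * \<delta>)" by (intro mult_left_mono \<xi>U) simp
      finally show ?thesis .
    qed
    ultimately show ?thesis using err unfolding X_def C_def by (simp add: algebra_simps)
  qed
  have "0 \<le> X"
  proof (rule ccontr)
    assume "\<not> ?thesis"
    then have X: "X < 0" by simp
    have C: "C \<ge> 0" unfolding C_def using Cm by simp
    define \<delta> where "\<delta> = min 1 (- X / (2 * (C + 1)))"
    have "- X / (2 * (C + 1)) > 0" using X C by (intro divide_pos_pos) auto
    then have "\<delta> > 0" "\<delta> \<le> 1" by (auto simp: \<delta>_def)
    from main[OF this] have "- X \<le> C * \<delta>" by simp
    also have "\<dots> \<le> (C + 1) * (- X / (2 * (C + 1)))"
    proof (intro mult_mono)
      show "\<delta> \<le> - X / (2 * (C + 1))" unfolding \<delta>_def by (rule min.cobounded2)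
    qed (use C \<open>\<delta> > 0\<close> in auto)
    also have "\<dots> = - X / 2" using C by (simp add: field_simps)
    finally show False using X by simp
  qed
  then show ?thesis by (simp add: X_def)
qed

lemma time_mult_integrable:
  fixes h :: "real \<times> 'x \<Rightarrow> real"
  assumes "continuous_on UNIV \<theta>" "integrable Q h" shows "integrable Q (\<lambda>z. \<theta> (fst z) * h z)"
proof -
  obtain C where C: "\<forall>t\<in>{0..T}. \<bar>\<theta> t\<bar> \<le> C" using cont_bounded_interval[OF assms(1)] by blast
  have [measurable]: "h \<in> borel_measurable Q" "(\<lambda>z. \<theta> (fst z)) \<in> borel_measurable Q" using assms fst_meas by auto
  show ?thesis
  proof (rule Bochner_Integration.integrable_bound[of _ "\<lambda>z. C * h z"])
    show "AE z in Q. norm (\<theta> (fst z) * h z) \<le> norm (C * h z)"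
      using C by (intro AE_I2) (force simp: space_pair_measure abs_mult intro!: mult_right_mono)
  qed (use assms in auto)
qed

lemma energy_weighted:
  assumes U: "l2 Q U" "AE t in MT. (\<lambda>x. U (t,x)) \<in> K" and Z: "l2 Q Z" and U0: "l2 M U0" and w: "weak U Z U0"
    and \<theta>: "\<forall>t. (\<theta> has_real_derivative \<theta>' t) (at t)" "continuous_on UNIV \<theta>'"
  shows "0 \<le> (\<theta> 0)\<^sup>2 * ip M (\<lambda>x. m (U0 x)) U0 / 2
    + (\<integral>z. (\<theta> (fst z))\<^sup>2 * (Z z \<bullet> U z) + \<theta> (fst z) * \<theta>' (fst z) * (m (U z) \<bullet> U z) \<partial>Q)"
proof -
  note c = deriv_continuous_on_UNIV[OF \<theta>(1)] \<theta>(2)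
  have "0 \<le> ip M (\<lambda>x. m (\<theta> 0 *\<^sub>R U0 x)) (\<lambda>x. \<theta> 0 *\<^sub>R U0 x) / 2 + ip Q (\<lambda>z. \<theta> (fst z) *\<^sub>R Z z + \<theta>' (fst z) *\<^sub>R m (U z)) (\<lambda>z. \<theta> (fst z) *\<^sub>R U z)"
  proof (rule energy)
    show "AE t in MT. (\<lambda>x. \<theta> (fst (t, x)) *\<^sub>R U (t, x)) \<in> K" using U(2) by eventually_elim (simp add: K_scale)
  qed (intro weak_mult time_mult_l2 l2_add l2_scale m_l2 c U(1) Z U0 w \<theta>)+
  then show ?thesis
    by (simp add: m.scaleR ip_scale_left ip_scale_right power2_eq_square)
       (simp add: ip_def inner_add_left algebra_simps)
qed

text \<open>One weight serves both estimates: \<theta>^2 = exp (- 2 \<kappa> t) \<eta>(t), where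
  \<eta>(t) is c plus the integral of \<xi> from t to T. The exponential absorbs \<kappa> m U . U,
  the derivative of \<eta> produces the energy weighted by \<xi>, and c retains the dissipation
  N.\<close>

lemma energy_cutoff:
  assumes U: "l2 Q U" "AE t in MT. (\<lambda>x. U (t,x)) \<in> K" and Z: "l2 Q Z" and U0: "l2 M U0" and w: "weak U Z U0"
    and N: "integrable Q N" "\<And>z. 0 \<le> N z" and P: "integrable Q P" "\<And>z. 0 \<le> P z"
    and ineq: "AE z in Q. Z z \<bullet> U z \<le> \<kappa> * (m (U z) \<bullet> U z) - N z + P z" and \<kappa>: "\<kappa> \<ge> 0"
    and \<xi>: "continuous_on UNIV \<xi>" "\<forall>t. 0 \<le> \<xi> t" "\<forall>t\<ge>T. \<xi> t = 0" and c: "c > 0"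
  shows "c * (\<integral>z. exp (- 2 * \<kappa> * fst z) * N z \<partial>Q) + (\<integral>z. exp (- 2 * \<kappa> * fst z) * \<xi> (fst z) * (m (U z) \<bullet> U z) \<partial>Q) / 2
     \<le> (c + (\<integral>t. \<xi> t \<partial>MT)) * (ip M (\<lambda>x. m (U0 x)) U0 / 2 + (\<integral>z. P z \<partial>Q))"
proof -
  obtain H where H: "\<And>t. (H has_real_derivative - \<xi> t) (at t)" "H T = 0"
    using antiderivative_UNIV[of "\<lambda>t. - \<xi> t" T] \<xi>(1) by (auto intro!: continuous_intros)
  have Hanti: "H b \<le> H a" if "a \<le> b" for a b
    using that by (rule DERIV_nonpos_imp_nonincreasing) (metis H(1) \<xi>(2) neg_le_0_iff_le)
  have Hpos: "0 \<le> H t" for t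
  proof (cases "t \<le> T")
    case True then show ?thesis using Hanti[of t T] H(2) by simp
  next
    case False
    then have "H T \<le> H t"
      by (intro DERIV_nonneg_imp_nondecreasing[of T t H]) (simp, metis H(1) \<xi>(3) neg_0_equal_iff_equal order_refl)
    then show ?thesis using H(2) by simp
  qed
  have H0: "H 0 = (\<integral>t. \<xi> t \<partial>MT)"
    using ftc_MT[of H "\<lambda>t. - \<xi> t" 0 T] H T continuous_on_minus[OF \<xi>(1)] by simp
  \<comment> \<open>The summand c > 0 keeps \<eta> away from zero, so its square root is C1.\<close>
  define \<eta> where "\<eta> t = c + H t" for t
  have \<eta>: "\<eta> t \<ge> c" "\<eta> t > 0" for t using Hpos[of t] c by (auto simp: \<eta>_def)
  have c\<eta>: "continuous_on UNIV \<eta>" unfolding \<eta>_def using H(1) deriv_continuous_on_UNIV[of H "\<lambda>t. - \<xi> t"] by (intro continuous_intros) auto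
  define \<theta> where "\<theta> t = exp (- \<kappa> * t) * sqrt (\<eta> t)" for t
  define \<theta>' where "\<theta>' t = - \<kappa> * exp (- \<kappa> * t) * sqrt (\<eta> t) - exp (- \<kappa> * t) * (\<xi> t / (2 * sqrt (\<eta> t)))" for t
  have d\<theta>: "(\<theta> has_real_derivative \<theta>' t) (at t)" for t
    unfolding \<theta>_def \<theta>'_def \<eta>_def using \<eta>(2)[of t]
    by (auto intro!: derivative_eq_intros H(1) simp: \<eta>_def inverse_eq_divide algebra_simps)
  have "sqrt (\<eta> t) \<noteq> 0" for t using \<eta>(2)[of t] by simp
  then have c\<theta>': "continuous_on UNIV \<theta>'"
    unfolding \<theta>'_def by (intro continuous_intros c\<eta> \<xi>) auto
  have s1: "(\<theta> t)\<^sup>2 = exp (- 2 * \<kappa> * t) * \<eta> t" for t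
    using \<eta>(2)[of t] by (simp add: \<theta>_def power_mult_distrib exp_double[symmetric] flip: exp_of_nat_mult)
  have s2: "\<theta> t * \<theta>' t = exp (- 2 * \<kappa> * t) * (- \<kappa> * \<eta> t - \<xi> t / 2)" for t
  proof -
    have e: "exp (- \<kappa> * t) * exp (- \<kappa> * t) = exp (- 2 * \<kappa> * t)" by (simp flip: exp_add)
    have "\<theta> t * \<theta>' t = (exp (- \<kappa> * t) * exp (- \<kappa> * t)) * (- \<kappa> * (sqrt (\<eta> t) * sqrt (\<eta> t)) - \<xi> t / 2 * (sqrt (\<eta> t) / sqrt (\<eta> t)))"
      by (simp add: \<theta>_def \<theta>'_def algebra_simps)
    also have "sqrt (\<eta> t) / sqrt (\<eta> t) = 1" using \<eta>(2)[of t] by simp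
    also have "sqrt (\<eta> t) * sqrt (\<eta> t) = \<eta> t" using \<eta>(2)[of t] by simp
    finally show ?thesis unfolding e by simp
  qed
  define E where "E t = exp (- 2 * \<kappa> * t)" for t
  have cE: "continuous_on UNIV E" unfolding E_def by (intro continuous_intros)
  have ZU: "integrable Q (\<lambda>z. Z z \<bullet> U z)" "integrable Q (\<lambda>z. m (U z) \<bullet> U z)"
    by (intro l2_integrable_inner m_l2 Z U)+
  have i1: "integrable Q (\<lambda>z. E (fst z) * \<eta> (fst z) * N z)" "integrable Q (\<lambda>z. E (fst z) * \<eta> (fst z) * P z)"
    "integrable Q (\<lambda>z. E (fst z) * \<xi> (fst z) * (m (U z) \<bullet> U z))" "integrable Q (\<lambda>z. E (fst z) * N z)"
    by (intro time_mult_integrable[of "\<lambda>t. E t * \<eta> t"] time_mult_integrable[of "\<lambda>t. E t * \<xi> t"]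
         time_mult_integrable[of E] N P ZU continuous_intros cE c\<eta> \<xi>)+
  have "0 \<le> (\<theta> 0)\<^sup>2 * ip M (\<lambda>x. m (U0 x)) U0 / 2
    + (\<integral>z. (\<theta> (fst z))\<^sup>2 * (Z z \<bullet> U z) + \<theta> (fst z) * \<theta>' (fst z) * (m (U z) \<bullet> U z) \<partial>Q)"
    by (rule energy_weighted[OF U Z U0 w _ c\<theta>']) (use d\<theta> in blast)
  also have "(\<integral>z. (\<theta> (fst z))\<^sup>2 * (Z z \<bullet> U z) + \<theta> (fst z) * \<theta>' (fst z) * (m (U z) \<bullet> U z) \<partial>Q)
     \<le> (\<integral>z. (E (fst z) * \<eta> (fst z) * P z - E (fst z) * \<eta> (fst z) * N z) - (E (fst z) * \<xi> (fst z) * (m (U z) \<bullet> U z)) / 2 \<partial>Q)"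
  proof (rule integral_mono_AE)
    show "integrable Q (\<lambda>z. (\<theta> (fst z))\<^sup>2 * (Z z \<bullet> U z) + \<theta> (fst z) * \<theta>' (fst z) * (m (U z) \<bullet> U z))"
      unfolding s1 s2 by (intro Bochner_Integration.integrable_add
          time_mult_integrable[of "\<lambda>t. exp (- 2 * \<kappa> * t) * \<eta> t"] time_mult_integrable[of "\<lambda>t. exp (- 2 * \<kappa> * t) * (- \<kappa> * \<eta> t - \<xi> t / 2)"] ZU continuous_intros c\<eta> \<xi>) auto
    show "integrable Q (\<lambda>z. (E (fst z) * \<eta> (fst z) * P z - E (fst z) * \<eta> (fst z) * N z) - (E (fst z) * \<xi> (fst z) * (m (U z) \<bullet> U z)) / 2)"
      using i1 by auto
    show "AE z in Q. (\<theta> (fst z))\<^sup>2 * (Z z \<bullet> U z) + \<theta> (fst z) * \<theta>' (fst z) * (m (U z) \<bullet> U z)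
      \<le> (E (fst z) * \<eta> (fst z) * P z - E (fst z) * \<eta> (fst z) * N z) - (E (fst z) * \<xi> (fst z) * (m (U z) \<bullet> U z)) / 2"
      using ineq
    proof eventually_elim
      case (elim z)
      have "E (fst z) * \<eta> (fst z) * (Z z \<bullet> U z) \<le> E (fst z) * \<eta> (fst z) * (\<kappa> * (m (U z) \<bullet> U z) - N z + P z)"
        using elim \<eta>(2)[of "fst z"] by (intro mult_left_mono) (auto simp: E_def)
      then show ?case unfolding s1 s2 E_def[symmetric] by (simp add: algebra_simps)
    qed
  qed
  also have "\<dots> = (\<integral>z. E (fst z) * \<eta> (fst z) * P z \<partial>Q) - (\<integral>z. E (fst z) * \<eta> (fst z) * N z \<partial>Q) - (\<integral>z. E (fst z) * \<xi> (fst z) * (m (U z) \<bullet> U z) \<partial>Q) / 2"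
    using i1 by simp
  finally have main: "(\<integral>z. E (fst z) * \<eta> (fst z) * N z \<partial>Q) + (\<integral>z. E (fst z) * \<xi> (fst z) * (m (U z) \<bullet> U z) \<partial>Q) / 2
     \<le> (\<theta> 0)\<^sup>2 * ip M (\<lambda>x. m (U0 x)) U0 / 2 + (\<integral>z. E (fst z) * \<eta> (fst z) * P z \<partial>Q)" by simp
  \<comment> \<open>The exponential is at most 1 and \<eta> is nonincreasing, so the weight is
    largest at time 0.\<close>
  have "(\<integral>z. E (fst z) * \<eta> (fst z) * P z \<partial>Q) \<le> (\<integral>z. \<eta> 0 * P z \<partial>Q)"
  proof (rule integral_mono[OF i1(2)])
    show "integrable Q (\<lambda>z. \<eta> 0 * P z)" using P by simp
    fix z assume "z \<in> space Q"
    then have t: "0 \<le> fst z" by (auto simp: space_pair_measure)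
    have "E (fst z) * \<eta> (fst z) \<le> 1 * \<eta> 0"
      using t \<kappa> \<eta>(2)[of "fst z"] Hanti[OF t] by (intro mult_mono) (auto simp: E_def \<eta>_def)
    then show "E (fst z) * \<eta> (fst z) * P z \<le> \<eta> 0 * P z" using P(2)[of z] by (intro mult_right_mono) auto
  qed
  moreover have "c * (\<integral>z. E (fst z) * N z \<partial>Q) \<le> (\<integral>z. E (fst z) * \<eta> (fst z) * N z \<partial>Q)"
    unfolding integral_mult_right_zero[symmetric]
  proof (rule integral_mono[OF _ i1(1)])
    show "integrable Q (\<lambda>z. c * (E (fst z) * N z))" using i1 by simp
    fix z
    have "c * (E (fst z) * N z) \<le> \<eta> (fst z) * (E (fst z) * N z)"
      using \<eta>(1) N(2)[of z] by (intro mult_right_mono) (auto simp: E_def)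
    then show "c * (E (fst z) * N z) \<le> E (fst z) * \<eta> (fst z) * N z" by (simp add: ac_simps)
  qed
  moreover have "(\<theta> 0)\<^sup>2 = \<eta> 0" using s1[of 0] by simp
  moreover have "\<eta> 0 = c + (\<integral>t. \<xi> t \<partial>MT)" by (simp add: \<eta>_def H0)
  moreover have "(\<integral>z. \<eta> 0 * P z \<partial>Q) = \<eta> 0 * (\<integral>z. P z \<partial>Q)" by simp
  moreover have "\<eta> 0 * (ip M (\<lambda>x. m (U0 x)) U0 / 2 + (\<integral>z. P z \<partial>Q)) = \<eta> 0 * ip M (\<lambda>x. m (U0 x)) U0 / 2 + \<eta> 0 * (\<integral>z. P z \<partial>Q)"
    by (simp add: distrib_left)
  ultimately have "c * (\<integral>z. E (fst z) * N z \<partial>Q) + (\<integral>z. E (fst z) * \<xi> (fst z) * (m (U z) \<bullet> U z) \<partial>Q) / 2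
     \<le> (c + (\<integral>t. \<xi> t \<partial>MT)) * (ip M (\<lambda>x. m (U0 x)) U0 / 2 + (\<integral>z. P z \<partial>Q))" using main by simp
  then show ?thesis by (simp add: E_def)
qed

text \<open>The weights \<xi> = 0, c = 1 in \<open>energy_cutoff\<close> bound the dissipation.
  Letting c tend to 0 leaves an inequality for all weights \<xi>, that is, a bound for almost every
  t. The factor exp (2 \<kappa> T) undoes the exponential weight.\<close>

theorem energy_estimate:
  assumes U: "l2 Q U" "AE t in MT. (\<lambda>x. U (t,x)) \<in> K" and Z: "l2 Q Z" and U0: "l2 M U0" and w: "weak U Z U0"
    and N: "integrable Q N" "\<And>z. 0 \<le> N z" and P: "integrable Q P" "\<And>z. 0 \<le> P z"
    and ineq: "AE z in Q. Z z \<bullet> U z \<le> \<kappa> * (m (U z) \<bullet> U z) - N z + P z" and \<kappa>: "\<kappa> \<ge> 0"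
  defines "E0 \<equiv> ip M (\<lambda>x. m (U0 x)) U0 + 2 * (\<integral>z. P z \<partial>Q)"
  shows "(\<integral>z. N z \<partial>Q) \<le> exp (2 * \<kappa> * T) * E0 / 2"
    and "AE t in MT. ip M (\<lambda>x. m (U (t,x))) (\<lambda>x. U (t,x)) \<le> exp (2 * \<kappa> * T) * E0"
proof -
  note cut = energy_cutoff[OF U Z U0 w N P ineq \<kappa>]
  have cE: "continuous_on UNIV (\<lambda>t. exp (- 2 * \<kappa> * t))" by (intro continuous_intros)
  have le: "exp (- 2 * \<kappa> * T) \<le> exp (- 2 * \<kappa> * t)" if "t \<le> T" for t using that \<kappa> by (auto intro: mult_left_mono)
  have ex: "exp (2 * \<kappa> * T) * exp (- 2 * \<kappa> * T) = 1" by (simp flip: exp_add)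
  have "(\<integral>z. exp (- 2 * \<kappa> * fst z) * N z \<partial>Q) \<le> E0 / 2"
    using cut[of "\<lambda>t. 0" 1] by (simp add: E0_def)
  moreover have "exp (- 2 * \<kappa> * T) * (\<integral>z. N z \<partial>Q) \<le> (\<integral>z. exp (- 2 * \<kappa> * fst z) * N z \<partial>Q)"
    unfolding integral_mult_right_zero[symmetric]
  proof (rule integral_mono)
    show "integrable Q (\<lambda>z. exp (- 2 * \<kappa> * fst z) * N z)" by (rule time_mult_integrable[OF cE N(1)])
    show "exp (- 2 * \<kappa> * T) * N z \<le> exp (- 2 * \<kappa> * fst z) * N z" if "z \<in> space Q" for z
      using that N(2) by (intro mult_right_mono le) (auto simp: space_pair_measure)
  qed (use N in simp)
  ultimately have "exp (2 * \<kappa> * T) * (exp (- 2 * \<kappa> * T) * (\<integral>z. N z \<partial>Q)) \<le> exp (2 * \<kappa> * T) * (E0 / 2)"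
    by (intro mult_left_mono) auto
  then show "(\<integral>z. N z \<partial>Q) \<le> exp (2 * \<kappa> * T) * E0 / 2" unfolding mult.assoc[symmetric] ex by simp
  define e where "e t = ip M (\<lambda>x. m (U (t,x))) (\<lambda>x. U (t,x))" for t
  have ie: "integrable MT e" unfolding e_def using ip_slice'(2)[OF m_l2[OF U(1)] U(1)] by simp
  have "AE t in MT. 0 \<le> E0 - exp (- 2 * \<kappa> * t) * e t"
  proof (rule fund_nonneg')
    have iEe: "integrable MT (\<lambda>t. exp (- 2 * \<kappa> * t) * e t)" by (rule cont_mult_integrable_MT[OF cE ie])
    then show "integrable MT (\<lambda>t. E0 - exp (- 2 * \<kappa> * t) * e t)"
      by (intro Bochner_Integration.integrable_diff finite_measure.integrable_const finT)
    fix \<xi> :: "real \<Rightarrow> real" assume \<xi>: "continuous_on UNIV \<xi>" "\<forall>t. 0 \<le> \<xi> t" "\<forall>t\<ge>T. \<xi> t = 0"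
    have *: "(\<integral>z. exp (- 2 * \<kappa> * fst z) * \<xi> (fst z) * (m (U z) \<bullet> U z) \<partial>Q) = (\<integral>t. \<xi> t * (exp (- 2 * \<kappa> * t) * e t) \<partial>MT)"
      using ip_slice'(1)[OF time_mult_l2[OF continuous_on_mult[OF cE \<xi>(1)] m_l2[OF U(1)]] U(1)]
      by (simp add: ip_def e_def mult.assoc mult.left_commute)
    have Npos: "0 \<le> (\<integral>z. exp (- 2 * \<kappa> * fst z) * N z \<partial>Q)" using N by simp
    have "(\<integral>t. \<xi> t * (exp (- 2 * \<kappa> * t) * e t) \<partial>MT) / 2 \<le> (c + (\<integral>t. \<xi> t \<partial>MT)) * (E0 / 2)" if "c > 0" for c
    proof -
      have "E0 / 2 = ip M (\<lambda>x. m (U0 x)) U0 / 2 + (\<integral>z. P z \<partial>Q)" by (simp add: E0_def add_divide_distrib)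
      then have A: "(c + (\<integral>t. \<xi> t \<partial>MT)) * (E0 / 2) = (c + (\<integral>t. \<xi> t \<partial>MT)) * (ip M (\<lambda>x. m (U0 x)) U0 / 2 + (\<integral>z. P z \<partial>Q))"
        by (simp only:)
      show ?thesis unfolding A using cut[OF \<xi> that] mult_nonneg_nonneg[OF less_imp_le[OF that] Npos] unfolding * by linarith
    qed
    then have "(\<integral>t. \<xi> t * (exp (- 2 * \<kappa> * t) * e t) \<partial>MT) / 2 \<le> (0 + (\<integral>t. \<xi> t \<partial>MT)) * (E0 / 2)"
      by (intro tendsto_lowerbound[where F="at_right (0::real)" and f="\<lambda>c. (c + (\<integral>t. \<xi> t \<partial>MT)) * (E0 / 2)"] tendsto_intros)
         (auto simp: eventually_at_filter)
    moreover have "(\<integral>t. \<xi> t * (E0 - exp (- 2 * \<kappa> * t) * e t) \<partial>MT) = (\<integral>t. \<xi> t \<partial>MT) * E0 - (\<integral>t. \<xi> t * (exp (- 2 * \<kappa> * t) * e t) \<partial>MT)"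
    proof -
      have "integrable MT (\<lambda>t. \<xi> t * E0)" by (intro cont_integrable_MT continuous_intros \<xi>)
      from Bochner_Integration.integral_diff[OF this cont_mult_integrable_MT[OF \<xi>(1) iEe]] show ?thesis
        by (simp add: right_diff_distrib)
    qed
    ultimately show "0 \<le> (\<integral>t. \<xi> t * (E0 - exp (- 2 * \<kappa> * t) * e t) \<partial>MT)" by simp
  qed
  moreover have "AE t in MT. t \<in> {0..T}" using AE_space[of MT] by simp
  ultimately show "AE t in MT. ip M (\<lambda>x. m (U (t,x))) (\<lambda>x. U (t,x)) \<le> exp (2 * \<kappa> * T) * E0"
  proof eventually_elim
    case (elim t)
    have "exp (- 2 * \<kappa> * T) * e t \<le> exp (- 2 * \<kappa> * t) * e t" using elim by (intro mult_right_mono le) (auto simp: e_def ip_m_psd)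
    then have "exp (2 * \<kappa> * T) * (exp (- 2 * \<kappa> * T) * e t) \<le> exp (2 * \<kappa> * T) * E0" using elim by (intro mult_left_mono) auto
    then show ?case unfolding mult.assoc[symmetric] ex by (simp add: e_def)
  qed
qed

text \<open>Existence is Lions' projection argument: the adjoint operator applied to test functions
  is bounded below because of coercivity, so the right-hand side is a bounded functional of it.\<close>

theorem weak_exists:
  fixes B B' :: "real \<times> 'x \<Rightarrow> 'b \<Rightarrow> 'b"
  assumes Bl2: "\<And>F. l2 Q F \<Longrightarrow> l2 Q (\<lambda>z. B z (F z))" and B'l2: "\<And>F. l2 Q F \<Longrightarrow> l2 Q (\<lambda>z. B' z (F z))"
    and adj: "\<And>z b c. B z b \<bullet> c = b \<bullet> B' z c"
    and Blin: "\<And>z a b. B z (a *\<^sub>R b) = a *\<^sub>R B z b"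
    and coer: "\<And>z b. c0 * (b \<bullet> b) \<le> \<kappa> * (m b \<bullet> b) - B z b \<bullet> b" and c0: "c0 > 0"
    and S: "l2 Q S" and U0: "l2 M U0"
  shows "\<exists>U. l2 Q U \<and> (AE t in MT. (\<lambda>x. U (t,x)) \<in> K) \<and> weak U (\<lambda>z. B z (U z) + S z) U0"
proof -
  \<comment> \<open>Linearity of B' is inherited from the other side of the pairing with B.\<close>
  have B'lin: "B' z (a *\<^sub>R b + a' *\<^sub>R b') = a *\<^sub>R B' z b + a' *\<^sub>R B' z b'" for z a b a' b'
  proof (rule vector_eq_ldot[THEN iffD1], rule allI)
    fix c
    show "c \<bullet> B' z (a *\<^sub>R b + a' *\<^sub>R b') = c \<bullet> (a *\<^sub>R B' z b + a' *\<^sub>R B' z b')"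
      unfolding inner_add_right inner_scaleR_right adj[symmetric] by simp
  qed
  \<comment> \<open>The unknown becomes exp (- \<kappa> t) U, which replaces - B by the coercive
    \<kappa> m - B.\<close>
  define St where "St z = exp (- \<kappa> * fst z) *\<^sub>R S z" for z
  have St: "l2 Q St" unfolding St_def by (intro time_mult_l2[of "\<lambda>t. exp (- \<kappa> * t)"] S continuous_intros)
  \<comment> \<open>The formal adjoint of z |-> (m z)' + \<kappa> m z - B z, applied to a test
    function.\<close>
  define raw where "raw \<psi> d\<psi> = (\<lambda>z. \<kappa> *\<^sub>R m (\<psi> z) - m (d\<psi> z) - B' z (\<psi> z))" for \<psi> d\<psi>
  have lraw: "l2 Q (raw \<psi> d\<psi>)" if "Tens \<psi> d\<psi> \<psi>0" for \<psi> d\<psi> \<psi>0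
    unfolding raw_def by (intro l2_diff l2_scale m_l2 B'l2 Tens_l2[OF that])
  have ipraw: "ip Q (raw \<psi> d\<psi>) v = \<kappa> * ip Q (\<lambda>z. m (\<psi> z)) v - ip Q (\<lambda>z. m (d\<psi> z)) v - ip Q (\<lambda>z. B z (v z)) \<psi>"
    if "Tens \<psi> d\<psi> \<psi>0" "l2 Q v" for \<psi> d\<psi> \<psi>0 v
  proof -
    have "ip Q (\<lambda>z. B' z (\<psi> z)) v = ip Q (\<lambda>z. B z (v z)) \<psi>"
      unfolding ip_def by (intro Bochner_Integration.integral_cong refl) (metis adj inner_commute)
    then show ?thesis unfolding raw_def
      by (simp add: ip_diff_left l2_diff l2_scale m_l2 B'l2 Tens_l2[OF that(1)] that(2) ip_scale_left)
  qed
  define VV where "VV = {v. l2 Q v \<and> (AE t in MT. (\<lambda>x. v (t,x)) \<in> K)}"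
  have VV_lin: "(\<lambda>z. a *\<^sub>R f z + b *\<^sub>R g z) \<in> VV" if "f \<in> VV" "g \<in> VV" for f g a b
  proof -
    have "AE t in MT. (\<lambda>x. f (t,x)) \<in> K" "AE t in MT. (\<lambda>x. g (t,x)) \<in> K" using that by (auto simp: VV_def)
    then have "AE t in MT. (\<lambda>x. a *\<^sub>R f (t,x) + b *\<^sub>R g (t,x)) \<in> K" by eventually_elim (rule K_lin)
    then show ?thesis using that by (auto simp: VV_def l2_lin)
  qed
  have VV_0: "(\<lambda>z. 0) \<in> VV" by (simp add: VV_def K_0)
  have VV_T: "\<psi> \<in> VV" if "Tens \<psi> d\<psi> \<psi>0" for \<psi> d\<psi> \<psi>0 using Tens_l2[OF that] by (simp add: VV_def)
  \<comment> \<open>\<open>raw\<close> is replaced by its projection w on the K-valued fields. The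
    pairing with K-valued fields is the same, and the Riesz element becomes a limit of K-valued
    fields, hence K-valued itself.\<close>
  define R where "R = {(w, y). w \<in> VV \<and> (\<exists>\<psi> d\<psi> \<psi>0. Tens \<psi> d\<psi> \<psi>0 \<and> (\<forall>v\<in>VV. ip Q w v = ip Q (raw \<psi> d\<psi>) v)
      \<and> y = ip Q St \<psi> + ip M (\<lambda>x. m (U0 x)) \<psi>0)}"
  define e0 where "e0 = ip M (\<lambda>x. m (U0 x)) U0"
  have e0: "e0 \<ge> 0" unfolding e0_def by (rule ip_m_psd)
  define C where "C = l2n Q St / c0 + (e0 + 2 / c0) / 2"
  have R_tens: "\<exists>w. (w, ip Q St \<psi> + ip M (\<lambda>x. m (U0 x)) \<psi>0) \<in> R \<and> (\<forall>v\<in>VV. ip Q w v = ip Q (raw \<psi> d\<psi>) v)" if A: "Tens \<psi> d\<psi> \<psi>0" for \<psi> d\<psi> \<psi>0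
  proof -
    have ne: "VV \<noteq> {}" using VV_0 by blast
    have ll: "\<And>f. f \<in> VV \<Longrightarrow> l2 Q f" by (simp add: VV_def)
    obtain w f where w: "l2 Q w" "\<forall>n. f n \<in> VV" "(\<lambda>n. l2n Q (\<lambda>x. f n x - w x)) \<longlonglongrightarrow> 0" "\<forall>v\<in>VV. ip Q w v = ip Q (raw \<psi> d\<psi>) v"
      using l2_projection[OF ne ll VV_lin lraw[OF A]] by blast
    have "AE t in MT. (\<lambda>x. w (t,x)) \<in> K"
      by (rule K_valued_closed[of f, OF _ _ w(1) w(3)]) (use w(2) in \<open>auto simp: VV_def\<close>)
    then have "w \<in> VV" using w(1) by (simp add: VV_def)
    then show ?thesis using w(4) A unfolding R_def by blast
  qed
  have "\<exists>z. l2 Q z \<and> l2n Q z \<le> C \<and> (\<exists>f. (\<forall>n. f n \<in> fst ` R) \<and> (\<lambda>n. l2n Q (\<lambda>x. f n x - z x)) \<longlonglongrightarrow> 0)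
     \<and> (\<forall>(f,y)\<in>R. ip Q z f = y)"
  proof (rule riesz_relation)
    show "R \<noteq> {}" using R_tens[OF Tens_0] by blast
    show "C \<ge> 0" using c0 e0 by (simp add: C_def)
  next
    fix w y assume "(w, y) \<in> R"
    then obtain \<psi> d\<psi> \<psi>0 where w: "w \<in> VV" and A: "Tens \<psi> d\<psi> \<psi>0" and wr: "\<forall>v\<in>VV. ip Q w v = ip Q (raw \<psi> d\<psi>) v"
      and y: "y = ip Q St \<psi> + ip M (\<lambda>x. m (U0 x)) \<psi>0" unfolding R_def by blast
    note l = Tens_l2[OF A]
    have lw: "l2 Q w" using w by (simp add: VV_def)
    define q where "q = ip M (\<lambda>x. m (\<psi>0 x)) \<psi>0"
    have q0: "q \<ge> 0" unfolding q_def by (rule ip_m_psd)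
    have "ip Q w \<psi> = \<kappa> * ip Q (\<lambda>z. m (\<psi> z)) \<psi> - ip Q (\<lambda>z. m (d\<psi> z)) \<psi> - ip Q (\<lambda>z. B z (\<psi> z)) \<psi>"
      using wr VV_T[OF A] ipraw[OF A l(1)] by simp
    also have "ip Q (\<lambda>z. m (d\<psi> z)) \<psi> = - q / 2" using resolvent_ibp(2)[OF A] by (simp add: q_def ip_m_sym[of Q d\<psi>])
    finally have 1: "ip Q w \<psi> = \<kappa> * ip Q (\<lambda>z. m (\<psi> z)) \<psi> - ip Q (\<lambda>z. B z (\<psi> z)) \<psi> + q / 2" by simp
    have "c0 * (l2n Q \<psi>)\<^sup>2 \<le> \<kappa> * ip Q (\<lambda>z. m (\<psi> z)) \<psi> - ip Q (\<lambda>z. B z (\<psi> z)) \<psi>"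
    proof -
      have i: "integrable Q (\<lambda>z. \<psi> z \<bullet> \<psi> z)" "integrable Q (\<lambda>z. m (\<psi> z) \<bullet> \<psi> z)" "integrable Q (\<lambda>z. B z (\<psi> z) \<bullet> \<psi> z)"
        by (intro l2_integrable_inner l m_l2 Bl2)+
      have "(\<integral>z. c0 * (\<psi> z \<bullet> \<psi> z) \<partial>Q) \<le> (\<integral>z. \<kappa> * (m (\<psi> z) \<bullet> \<psi> z) - B z (\<psi> z) \<bullet> \<psi> z \<partial>Q)"
        by (intro integral_mono coer) (use i in auto)
      then show ?thesis unfolding l2n_sq ip_def using i by simp
    qed
    \<comment> \<open>The lower bound on the adjoint: it controls \<psi> and also its initial energy
      q by w.\<close>
    with 1 have 2: "c0 * (l2n Q \<psi>)\<^sup>2 + q / 2 \<le> l2n Q w * l2n Q \<psi>" using l2_CS[OF lw l(1)] by linarith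
    have n: "l2n Q \<psi> \<le> l2n Q w / c0"
    proof -
      have "l2n Q \<psi> * (c0 * l2n Q \<psi>) \<le> l2n Q \<psi> * l2n Q w" using 2 q0 by (simp add: power2_eq_square ac_simps)
      then have "c0 * l2n Q \<psi> \<le> l2n Q w" using l2n_nonneg[of Q \<psi>] l2n_nonneg[of Q w]
        by (cases "l2n Q \<psi> = 0") (auto simp: mult_le_cancel_left)
      then show ?thesis using c0 by (simp add: field_simps)
    qed
    have qw: "q \<le> 2 * (l2n Q w)\<^sup>2 / c0"
    proof -
      have "0 \<le> c0 * (l2n Q \<psi>)\<^sup>2" using c0 by simp
      then have "q / 2 \<le> l2n Q w * l2n Q \<psi>" using 2 by linarith
      also have "\<dots> \<le> l2n Q w * (l2n Q w / c0)" by (intro mult_left_mono n) simp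
      finally show ?thesis by (simp add: power2_eq_square ac_simps)
    qed
    \<comment> \<open>From 2 s x \<le> s^2 e0 + q with a parameter s > |w|, which avoids a division
      by |w| = 0. The bound q \<le> 2 s^2 / c0 then gives the constant (e0 + 2 / c0) / 2.\<close>
    have X: "\<bar>ip M (\<lambda>x. m (U0 x)) \<psi>0\<bar> \<le> l2n Q w * ((e0 + 2 / c0) / 2)"
    proof (rule ccontr)
      define x where "x = \<bar>ip M (\<lambda>x. m (U0 x)) \<psi>0\<bar>"
      assume "\<not> ?thesis"
      then have xl: "l2n Q w * ((e0 + 2 / c0) / 2) < x" by (simp add: x_def)
      have ep: "(e0 + 2 / c0) / 2 > 0" using e0 c0 by (simp add: add_nonneg_pos)
      then have "l2n Q w < x / ((e0 + 2 / c0) / 2)" using xl by (simp add: field_simps)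
      then obtain s where s: "l2n Q w < s" "s < x / ((e0 + 2 / c0) / 2)" using dense by blast
      have sp: "s > 0" using s(1) l2n_nonneg[of Q w] by linarith
      have "0 \<le> s\<^sup>2 * e0 + 2 * s * b * ip M (\<lambda>x. m (U0 x)) \<psi>0 + b\<^sup>2 * q" for b
        using ip_m_diff_sq[OF U0 l(3), of s b] by (simp add: e0_def q_def)
      from this[of 1] this[of "-1"] have "2 * s * x \<le> s\<^sup>2 * e0 + q" by (simp add: x_def abs_if)
      also have "q \<le> 2 * s\<^sup>2 / c0"
        using s(1) c0 by (intro order_trans[OF qw] divide_right_mono mult_left_mono power_mono) auto
      finally have "s * (2 * x) \<le> s * (s * (e0 + 2 / c0))" by (simp add: power2_eq_square algebra_simps)
      then have "2 * x \<le> s * (e0 + 2 / c0)" using sp by simp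
      moreover have "s * ((e0 + 2 / c0) / 2) < x" using s(2) ep by (simp add: pos_less_divide_eq)
      ultimately show False by simp
    qed
    have "\<bar>ip Q St \<psi>\<bar> \<le> l2n Q St * (l2n Q w / c0)"
      using l2_CS[OF St l(1)] n by (meson l2n_nonneg mult_left_mono order_trans)
    moreover have "C * l2n Q w = l2n Q St * (l2n Q w / c0) + l2n Q w * ((e0 + 2 / c0) / 2)" by (simp add: C_def algebra_simps add_divide_distrib)
    ultimately have "\<bar>y\<bar> \<le> C * l2n Q w" using X unfolding y by linarith
    with lw show "l2 Q w \<and> \<bar>y\<bar> \<le> C * l2n Q w" by blast
  next
    fix w y w' y' a b assume "(w, y) \<in> R" "(w', y') \<in> R"
    then obtain \<psi> d\<psi> \<psi>0 \<xi> d\<xi> \<xi>0 where w: "w \<in> VV" "w' \<in> VV" and A: "Tens \<psi> d\<psi> \<psi>0" and A': "Tens \<xi> d\<xi> \<xi>0"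
      and wr: "\<forall>v\<in>VV. ip Q w v = ip Q (raw \<psi> d\<psi>) v" "\<forall>v\<in>VV. ip Q w' v = ip Q (raw \<xi> d\<xi>) v"
      and y: "y = ip Q St \<psi> + ip M (\<lambda>x. m (U0 x)) \<psi>0" "y' = ip Q St \<xi> + ip M (\<lambda>x. m (U0 x)) \<xi>0" unfolding R_def by blast
    have lw: "l2 Q w" "l2 Q w'" using w by (auto simp: VV_def)
    note l = Tens_l2[OF A] and l' = Tens_l2[OF A']
    have r: "raw (\<lambda>z. a *\<^sub>R \<psi> z + b *\<^sub>R \<xi> z) (\<lambda>z. a *\<^sub>R d\<psi> z + b *\<^sub>R d\<xi> z) = (\<lambda>z. a *\<^sub>R raw \<psi> d\<psi> z + b *\<^sub>R raw \<xi> d\<xi> z)"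
      unfolding raw_def by (auto simp: m.add m.scaleR B'lin algebra_simps)
    have "\<forall>v\<in>VV. ip Q (\<lambda>x. a *\<^sub>R w x + b *\<^sub>R w' x) v = ip Q (raw (\<lambda>z. a *\<^sub>R \<psi> z + b *\<^sub>R \<xi> z) (\<lambda>z. a *\<^sub>R d\<psi> z + b *\<^sub>R d\<xi> z)) v"
    proof
      fix v assume v: "v \<in> VV"
      then have lv: "l2 Q v" by (simp add: VV_def)
      show "ip Q (\<lambda>x. a *\<^sub>R w x + b *\<^sub>R w' x) v = ip Q (raw (\<lambda>z. a *\<^sub>R \<psi> z + b *\<^sub>R \<xi> z) (\<lambda>z. a *\<^sub>R d\<psi> z + b *\<^sub>R d\<xi> z)) v"
        unfolding r ip_lin_left[OF lw lv] ip_lin_left[OF lraw[OF A] lraw[OF A'] lv] using wr v by simp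
    qed
    moreover have "a * y + b * y' = ip Q St (\<lambda>z. a *\<^sub>R \<psi> z + b *\<^sub>R \<xi> z) + ip M (\<lambda>x. m (U0 x)) (\<lambda>x. a *\<^sub>R \<psi>0 x + b *\<^sub>R \<xi>0 x)"
      unfolding ip_lin_right[OF l(1) l'(1) St] ip_lin_right[OF l(3) l'(3) m_l2[OF U0]] y by (simp add: algebra_simps)
    ultimately show "(\<lambda>x. a *\<^sub>R w x + b *\<^sub>R w' x, a * y + b * y') \<in> R"
      unfolding R_def using VV_lin[OF w] Tens.lin[OF A A', of a b] by blast
  qed
  then obtain z f where z: "l2 Q z" "\<forall>n. f n \<in> fst ` R" "(\<lambda>n. l2n Q (\<lambda>x. f n x - z x)) \<longlonglongrightarrow> 0" "\<forall>(f,y)\<in>R. ip Q z f = y"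
    by blast
  have fVV: "f n \<in> VV" for n using z(2)[rule_format, of n] by (auto simp: R_def)
  have zK: "AE t in MT. (\<lambda>x. z (t,x)) \<in> K"
    by (rule K_valued_closed[of f, OF _ _ z(1,3)]) (use fVV in \<open>auto simp: VV_def\<close>)
  have zVV: "z \<in> VV" using z(1) zK by (simp add: VV_def)
  define Z where "Z = (\<lambda>x. (B x (z x) + St x) - \<kappa> *\<^sub>R m (z x))"
  have lZ: "l2 Q Z" unfolding Z_def by (intro l2_diff l2_add l2_scale m_l2 Bl2 St z)
  have wz: "weak z Z U0"
    unfolding weak_def
  proof (intro allI impI)
    fix \<psi> d\<psi> \<psi>0 assume A: "Tens \<psi> d\<psi> \<psi>0"
    note l = Tens_l2[OF A]
    obtain w where w: "(w, ip Q St \<psi> + ip M (\<lambda>x. m (U0 x)) \<psi>0) \<in> R" "\<forall>v\<in>VV. ip Q w v = ip Q (raw \<psi> d\<psi>) v"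
      using R_tens[OF A] by blast
    have "ip Q St \<psi> + ip M (\<lambda>x. m (U0 x)) \<psi>0 = ip Q w z" using z(4) w(1) by (auto simp: ip_commute[of Q w])
    also have "\<dots> = \<kappa> * ip Q (\<lambda>x. m (z x)) \<psi> - ip Q (\<lambda>x. m (z x)) d\<psi> - ip Q (\<lambda>x. B x (z x)) \<psi>"
      using w(2) zVV ipraw[OF A z(1)] by (simp add: ip_m_sym[of Q _ z])
    finally show "- ip Q (\<lambda>z'. m (z z')) d\<psi> - ip M (\<lambda>x. m (U0 x)) \<psi>0 = ip Q Z \<psi>"
      using ip_lin_left[OF Bl2[OF z(1)] St l(1), of 1 1]
      unfolding Z_def by (simp add: ip_diff_left l2_add l2_scale Bl2 St m_l2 z(1) l ip_scale_left)
  qed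
  define U where "U x = exp (\<kappa> * fst x) *\<^sub>R z x" for x
  have "weak (\<lambda>x. exp (\<kappa> * fst x) *\<^sub>R z x) (\<lambda>x. exp (\<kappa> * fst x) *\<^sub>R Z x + (\<kappa> * exp (\<kappa> * fst x)) *\<^sub>R m (z x)) (\<lambda>x. exp (\<kappa> * 0) *\<^sub>R U0 x)"
    by (rule weak_mult[OF z(1) lZ U0 wz]) (auto intro!: derivative_eq_intros continuous_intros)
  moreover have "exp (\<kappa> * fst x) *\<^sub>R Z x + (\<kappa> * exp (\<kappa> * fst x)) *\<^sub>R m (z x) = B x (U x) + S x" for x
  proof -
    have "exp (\<kappa> * fst x) *\<^sub>R St x = S x" by (simp add: St_def flip: exp_add)
    then show ?thesis unfolding Z_def U_def by (simp add: Blin algebra_simps)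
  qed
  ultimately have "weak U (\<lambda>x. B x (U x) + S x) U0" by (simp add: U_def[abs_def])
  moreover have "l2 Q U" unfolding U_def by (intro time_mult_l2[of "\<lambda>t. exp (\<kappa> * t)"] z continuous_intros)
  moreover have "AE t in MT. (\<lambda>x. U (t,x)) \<in> K" using zK by eventually_elim (simp add: U_def K_scale)
  ultimately show ?thesis by blast
qed

end

section \<open>Test functions and the space of Dirichlet fields\<close>

lemma cont_compact_support_bounded:
  fixes \<psi> :: "'a::euclidean_space \<Rightarrow> real"
  assumes "continuous_on UNIV \<psi>" "\<And>x. norm x > R \<Longrightarrow> \<psi> x = 0"
  shows "\<exists>C\<ge>0. \<forall>x. \<bar>\<psi> x\<bar> \<le> C"
proof -
  have "compact (\<psi> ` cball 0 R)" using assms(1) by (intro compact_continuous_image) (auto intro: continuous_on_subset)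
  then obtain C where C: "\<forall>x\<in>cball 0 R. \<bar>\<psi> x\<bar> \<le> C" using compact_imp_bounded bounded_iff by (metis image_eqI real_norm_def)
  have "\<bar>\<psi> x\<bar> \<le> max C 0" for x
    using C assms(2)[of x] by (cases "norm x > R") (auto simp: le_max_iff_disj)
  then show ?thesis by (meson max.cobounded2)
qed

lemma cont_compact_support_integrable:
  fixes \<psi> :: "'a::euclidean_space \<Rightarrow> real"
  assumes c: "continuous_on UNIV \<psi>" and s: "\<And>x. norm x > R \<Longrightarrow> \<psi> x = 0"
  shows "integrable lborel \<psi>"
proof -
  obtain C where C: "C \<ge> 0" "\<forall>x. \<bar>\<psi> x\<bar> \<le> C" using cont_compact_support_bounded[OF c s] by blast
  show ?thesis
  proof (rule Bochner_Integration.integrable_bound)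
    show "integrable lborel (\<lambda>x. C * indicator (cball 0 R) x :: real)"
      using emeasure_bounded_finite[OF bounded_cball, of 0 R] by (intro integrable_mult_right integrable_real_indicator) auto
    show "\<psi> \<in> borel_measurable lborel" using c by (simp add: borel_measurable_continuous_onI)
    show "AE x in lborel. norm (\<psi> x) \<le> norm (C * indicator (cball 0 R) x :: real)"
      using C s by (intro AE_I2) (auto simp: indicator_def not_le)
  qed
qed

text \<open>Translation invariance makes the integral of every difference quotient vanish.\<close>

lemma integral_directional_derivative_zero:
  fixes \<psi> :: "'a::euclidean_space \<Rightarrow> real"
  assumes d: "\<And>x. \<psi> differentiable (at x)" and g: "continuous_on UNIV (\<lambda>x. frechet_derivative \<psi> (at x) e)"
    and s: "\<And>x. norm x > R \<Longrightarrow> \<psi> x = 0"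
  shows "integral\<^sup>L lborel (\<lambda>x. frechet_derivative \<psi> (at x) e) = 0"
proof -
  define G where "G x = frechet_derivative \<psi> (at x) e" for x
  have c: "continuous_on UNIV \<psi>" using d by (simp add: continuous_at_imp_continuous_on differentiable_imp_continuous_within)
  have G0: "G x = 0" if "norm x > R" for x
  proof -
    have "open {x::'a. norm x > R}" by (intro open_Collect_less continuous_intros)
    then have "(\<psi> has_derivative (\<lambda>h. 0)) (at x)"
      by (rule has_derivative_transform_within_open[OF has_derivative_const]) (use that s in auto)
    then show ?thesis unfolding G_def using frechet_derivative_at by (metis has_derivative_const)
  qed
  obtain C where C: "C \<ge> 0" "\<forall>x. \<bar>G x\<bar> \<le> C" using cont_compact_support_bounded[OF g[folded G_def] G0] by blast
  define Dq where "Dq n x = real (Suc n) * (\<psi> (x + (1 / real (Suc n)) *\<^sub>R e) - \<psi> x)" for n x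
  \<comment> \<open>The mean value theorem bounds the quotients by the supremum of the derivative,
    on a ball enlarged by the length of e. This is the majorant for dominated convergence.\<close>
  have mvt: "\<exists>\<xi>. 0 < \<xi> \<and> \<xi> < 1 / real (Suc n) \<and> Dq n x = G (x + \<xi> *\<^sub>R e)" for n x
  proof -
    have "((\<lambda>s. \<psi> (x + s *\<^sub>R e)) has_real_derivative G (x + s *\<^sub>R e)) (at s)" for s
    proof -
      have "(\<psi> has_derivative frechet_derivative \<psi> (at (x + s *\<^sub>R e))) (at (x + s *\<^sub>R e))"
        using d frechet_derivative_works by blast
      moreover have "((\<lambda>s. x + s *\<^sub>R e) has_derivative (\<lambda>h. h *\<^sub>R e)) (at s)" by (auto intro!: derivative_eq_intros)
      ultimately have "((\<lambda>s. \<psi> (x + s *\<^sub>R e)) has_derivative (\<lambda>h. frechet_derivative \<psi> (at (x + s *\<^sub>R e)) (h *\<^sub>R e))) (at s)"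
        by (rule has_derivative_compose[rotated])
      moreover have "linear (frechet_derivative \<psi> (at (x + s *\<^sub>R e)))" using d linear_frechet_derivative by blast
      ultimately show ?thesis unfolding has_field_derivative_def G_def by (simp add: linear_scale mult_commute_abs)
    qed
    then obtain \<xi> where "0 < \<xi>" "\<xi> < 1 / real (Suc n)"
      "\<psi> (x + (1 / real (Suc n)) *\<^sub>R e) - \<psi> (x + 0 *\<^sub>R e) = (1 / real (Suc n) - 0) * G (x + \<xi> *\<^sub>R e)"
      using MVT2[of 0 "1 / real (Suc n)" "\<lambda>s. \<psi> (x + s *\<^sub>R e)" "\<lambda>s. G (x + s *\<^sub>R e)"] by auto
    then show ?thesis by (intro exI[of _ \<xi>]) (simp add: Dq_def)
  qed
  have int\<psi>: "integrable lborel \<psi>" by (rule cont_compact_support_integrable[OF c s])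
  have shift: "integrable lborel (\<lambda>x. \<psi> (x + a))" "integral\<^sup>L lborel (\<lambda>x. \<psi> (x + a)) = integral\<^sup>L lborel \<psi>" for a
  proof -
    have [measurable]: "\<psi> \<in> borel_measurable borel" using c by (simp add: borel_measurable_continuous_onI)
    have "integral\<^sup>L lborel \<psi> = integral\<^sup>L (distr lborel borel ((+) a)) \<psi>" by (simp add: lborel_distr_plus)
    also have "\<dots> = integral\<^sup>L lborel (\<lambda>x. \<psi> (a + x))" by (rule integral_distr) measurable
    finally show "integral\<^sup>L lborel (\<lambda>x. \<psi> (x + a)) = integral\<^sup>L lborel \<psi>" by (simp add: add.commute)
    have "integrable (distr lborel borel ((+) a)) \<psi>" using int\<psi> by (simp add: lborel_distr_plus)
    then show "integrable lborel (\<lambda>x. \<psi> (x + a))" by (subst (asm) integrable_distr_eq) (auto simp: add.commute)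
  qed
  have Dz: "integral\<^sup>L lborel (Dq n) = 0" for n
    unfolding Dq_def using shift int\<psi> by simp
  have "(\<lambda>n. integral\<^sup>L lborel (Dq n)) \<longlonglongrightarrow> integral\<^sup>L lborel G"
  proof (rule integral_dominated_convergence)
    show "integrable lborel (\<lambda>x. C * indicator (cball 0 (R + norm e)) x :: real)"
      using emeasure_bounded_finite[OF bounded_cball, of 0 "R + norm e"] by (intro integrable_mult_right integrable_real_indicator) auto
    show "G \<in> borel_measurable lborel" using g by (simp add: borel_measurable_continuous_onI G_def)
    show "Dq n \<in> borel_measurable lborel" for n
      unfolding Dq_def using shift(1) int\<psi> by (intro borel_measurable_times borel_measurable_diff borel_measurable_const borel_measurable_integrable)
    show "AE x in lborel. (\<lambda>n. Dq n x) \<longlonglongrightarrow> G x"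
    proof (intro AE_I2)
      fix x
      obtain \<xi> where \<xi>: "\<And>n. 0 < \<xi> n \<and> \<xi> n < 1 / real (Suc n) \<and> Dq n x = G (x + \<xi> n *\<^sub>R e)" using mvt[of _ x] by metis
      have "\<xi> \<longlonglongrightarrow> 0"
      proof (rule tendsto_sandwich[of "\<lambda>_. 0" _ _ "\<lambda>n. 1 / real (Suc n)"])
        show "(\<lambda>n. 1 / real (Suc n)) \<longlonglongrightarrow> 0" using LIMSEQ_inverse_real_of_nat by (simp add: inverse_eq_divide)
      qed (use \<xi> in \<open>auto intro!: always_eventually less_imp_le\<close>)
      then have "(\<lambda>n. x + \<xi> n *\<^sub>R e) \<longlonglongrightarrow> x + 0 *\<^sub>R e" by (intro tendsto_intros)
      then have "(\<lambda>n. G (x + \<xi> n *\<^sub>R e)) \<longlonglongrightarrow> G x"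
        using g[folded G_def] by (intro isCont_tendsto_compose[of x G]) (auto simp: continuous_on_eq_continuous_at)
      then show "(\<lambda>n. Dq n x) \<longlonglongrightarrow> G x" using \<xi> by simp
    qed
    show "AE x in lborel. norm (Dq n x) \<le> C * indicator (cball 0 (R + norm e)) x" for n
    proof (intro AE_I2)
      fix x
      obtain \<xi> where \<xi>: "0 < \<xi>" "\<xi> < 1 / real (Suc n)" "Dq n x = G (x + \<xi> *\<^sub>R e)" using mvt by blast
      show "norm (Dq n x) \<le> C * indicator (cball 0 (R + norm e)) x"
      proof (cases "norm x \<le> R + norm e")
        case True then show ?thesis using \<xi> C by simp
      next
        case False
        have "\<xi> \<le> 1" using \<xi>(2) by (rule less_imp_le[THEN order_trans]) simp
        then have "norm (\<xi> *\<^sub>R e) \<le> norm e" using \<xi>(1) by (simp add: mult_left_le_one_le)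
        then have "norm (x + \<xi> *\<^sub>R e) > R" using False norm_diff_ineq[of x "\<xi> *\<^sub>R e"] by linarith
        then show ?thesis using \<xi> G0 False by simp
      qed
    qed
  qed
  then show ?thesis unfolding Dz G_def by (simp add: LIMSEQ_const_iff)
qed

definition jac :: "(real^'d \<Rightarrow> real^'d) \<Rightarrow> real^'d \<Rightarrow> real^'d^'d" where
  "jac \<Phi> x = (\<chi> k i. pd (\<lambda>y. \<Phi> y $ k) (axis i 1) x)"

lemma axis_Basis [simp]: "axis i (1::real) \<in> Basis"
  by (simp add: axis_in_Basis_iff)

lemma Ck_lin: "Ck n f \<Longrightarrow> Ck n g \<Longrightarrow> Ck n (\<lambda>x. a * f x + b * g x)"
proof (induction n arbitrary: f g)
  case 0 then show ?case by (auto intro!: continuous_intros)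
next
  case (Suc n)
  have df: "f differentiable (at x)" "g differentiable (at x)" for x using Suc.prems by (auto simp: differentiable_on_def)
  have "pd (\<lambda>x. a * f x + b * g x) e = (\<lambda>x. a * pd f e x + b * pd g e x)" for e
  proof
    fix x
    have "((\<lambda>x. a * f x + b * g x) has_derivative (\<lambda>h. a * frechet_derivative f (at x) h + b * frechet_derivative g (at x) h)) (at x)"
      using df[of x] unfolding frechet_derivative_works by (auto intro!: derivative_eq_intros)
    from frechet_derivative_at[OF this, symmetric] show "pd (\<lambda>x. a * f x + b * g x) e x = a * pd f e x + b * pd g e x"
      by (simp add: pd_def)
  qed
  then show ?case using Suc by (auto intro!: continuous_intros derivative_intros)
qed

lemma smooth_lin: "smooth f \<Longrightarrow> smooth g \<Longrightarrow> smooth (\<lambda>x. a * f x + b * g x)"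
  by (simp add: smooth_def Ck_lin)

lemma smooth_pd: "smooth f \<Longrightarrow> b \<in> Basis \<Longrightarrow> smooth (pd f b)"
  unfolding smooth_def by (metis Ck.simps(2))

lemma smooth_differentiable: "smooth f \<Longrightarrow> f differentiable (at x)"
  unfolding smooth_def by (metis Ck.simps(2) UNIV_I differentiable_on_def)

lemma compact_closure_subset:
  assumes "compact A" "closure B \<subseteq> A" shows "compact (closure B)"
  using compact_Int_closed[OF assms(1) closed_closure[of B]] assms(2) by (simp add: inf.absorb2)

lemma test_fun_lin:
  assumes "test_fun U f" "test_fun U g" shows "test_fun U (\<lambda>x. a * f x + b * g x)"
proof -
  have "closure {x. a * f x + b * g x \<noteq> 0} \<subseteq> closure {x. f x \<noteq> 0} \<union> closure {x. g x \<noteq> 0}"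
    unfolding closure_Un[symmetric] by (intro closure_mono) auto
  moreover from this have "compact (closure {x. a * f x + b * g x \<noteq> 0})"
    using assms by (intro compact_closure_subset[OF compact_Un]) (auto simp: test_fun_def)
  ultimately show ?thesis using assms by (auto simp: test_fun_def smooth_lin)
qed

lemma test_fun_zero: "test_fun U (\<lambda>x. 0)"
proof -
  have "smooth (\<lambda>x::'a. 0::real)"
  proof -
    have "Ck n (\<lambda>x::'a. 0::real)" for n
    proof (induction n)
      case (Suc n)
      have "pd (\<lambda>x::'a. 0::real) b = (\<lambda>x. 0)" for b by (auto simp: pd_def)
      with Suc show ?case by simp
    qed simp
    then show ?thesis by (simp add: smooth_def)
  qed
  then show ?thesis by (simp add: test_fun_def)
qed

lemma pd_outside_support:
  assumes "x \<notin> closure {x. f x \<noteq> 0}" shows "pd f b x = 0"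
proof -
  have "(f has_derivative (\<lambda>h. 0)) (at x)"
    by (rule has_derivative_transform_within_open[of "\<lambda>x. 0" _ _ _ "- closure {x. f x \<noteq> 0}"])
       (use assms closure_subset[of "{x. f x \<noteq> 0}"] in auto)
  then show ?thesis unfolding pd_def by (metis frechet_derivative_at)
qed

lemma test_fun_pd:
  assumes "test_fun U f" "b \<in> Basis" shows "test_fun U (pd f b)"
proof -
  have "{x. pd f b x \<noteq> 0} \<subseteq> closure {x. f x \<noteq> 0}" using pd_outside_support by blast
  then have c: "closure {x. pd f b x \<noteq> 0} \<subseteq> closure {x. f x \<noteq> 0}" by (simp add: closure_minimal)
  moreover have "compact (closure {x. pd f b x \<noteq> 0})"
    using assms(1) c by (intro compact_closure_subset[OF _ c]) (simp add: test_fun_def)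
  ultimately show ?thesis using assms by (auto simp: test_fun_def smooth_pd)
qed

lemma test_fun_cont: "test_fun U f \<Longrightarrow> continuous_on UNIV f"
  by (simp add: test_fun_def smooth_cont)

lemma test_fun_outside: "test_fun U f \<Longrightarrow> x \<notin> U \<Longrightarrow> f x = 0"
  using closure_subset[of "{x. f x \<noteq> 0}"] by (auto simp: test_fun_def)

lemma test_fun_bounded_support: "test_fun U f \<Longrightarrow> \<exists>R. \<forall>x. norm x > R \<longrightarrow> f x = 0"
proof -
  assume "test_fun U f"
  then have "bounded (closure {x. f x \<noteq> 0})" by (simp add: test_fun_def compact_imp_bounded)
  then obtain R where "\<forall>x\<in>closure {x. f x \<noteq> 0}. norm x \<le> R" using bounded_iff by blast
  then show ?thesis using closure_subset[of "{x. f x \<noteq> 0}"] by (intro exI[of _ R]) force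
qed

section \<open>Integration by parts and the Poincare inequality for test functions\<close>

locale domain =
  fixes D :: "(real^'d) set"
  assumes openD: "open D" and bddD: "bounded D"
begin

abbreviation "MD \<equiv> lebesgue_on D"

lemma D_sets: "D \<in> sets lebesgue" "D \<in> sets borel" using openD by auto

lemma finD: "finite_measure MD"
  by (intro finite_measure_lebesgue_on bounded_set_imp_lmeasurable bddD D_sets)

lemma integral_D:
  fixes f :: "real^'d \<Rightarrow> real"
  assumes "\<And>x. x \<notin> D \<Longrightarrow> f x = 0" "f \<in> borel_measurable borel"
  shows "integral\<^sup>L MD f = integral\<^sup>L lborel f"
proof -
  have "integral\<^sup>L MD f = integral\<^sup>L lebesgue (\<lambda>x. indicator D x *\<^sub>R f x)"
    by (rule integral_restrict_space) (use D_sets in auto)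
  also have "(\<lambda>x. indicator D x *\<^sub>R f x) = f" using assms(1) by (auto simp: indicator_def fun_eq_iff)
  also have "integral\<^sup>L lebesgue f = integral\<^sup>L lborel f" by (rule integral_completion) (use assms in simp)
  finally show ?thesis .
qed

lemma cont_meas_D:
  fixes f :: "real^'d \<Rightarrow> 'b::euclidean_space"
  shows "continuous_on UNIV f \<Longrightarrow> f \<in> borel_measurable MD"
  by (intro measurable_restrict_space1 measurable_completion) (simp add: borel_measurable_continuous_onI)

lemma bounded_l2:
  assumes "f \<in> borel_measurable MD" "\<And>x. norm (f x) \<le> C" shows "l2 MD f"
proof (rule l2_bound[where f="\<lambda>x. (1::real)" and C=C])
  show "l2 MD (\<lambda>x. 1::real)" using finite_measure.integrable_const[OF finD] by (simp add: l2_def)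
qed (use assms in auto)

lemma test_fun_l2:
  assumes "test_fun D f" shows "l2 MD f"
proof -
  obtain C where "\<forall>x. \<bar>f x\<bar> \<le> C"
    using cont_compact_support_bounded[OF test_fun_cont[OF assms]] test_fun_bounded_support[OF assms] by blast
  then show ?thesis by (intro bounded_l2 cont_meas_D test_fun_cont[OF assms]) auto
qed

lemma integral_pd_zero:
  assumes d: "\<And>x. \<psi> differentiable (at x)" and c: "continuous_on UNIV (pd \<psi> b)"
    and s: "compact (closure {x. \<psi> x \<noteq> 0})" "closure {x. \<psi> x \<noteq> 0} \<subseteq> D"
  shows "integral\<^sup>L MD (pd \<psi> b) = 0"
proof -
  have "pd \<psi> b x = 0" if "x \<notin> D" for x using that s(2) pd_outside_support by blast
  then have "integral\<^sup>L MD (pd \<psi> b) = integral\<^sup>L lborel (pd \<psi> b)"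
    by (intro integral_D) (auto intro: borel_measurable_continuous_onI c)
  also obtain R where R: "\<forall>x\<in>closure {x. \<psi> x \<noteq> 0}. norm x \<le> R" using s(1) compact_imp_bounded bounded_iff by metis
  have "\<psi> x = 0" if "norm x > R" for x using R that closure_subset[of "{x. \<psi> x \<noteq> 0}"] by force
  then have "integral\<^sup>L lborel (pd \<psi> b) = 0"
    using integral_directional_derivative_zero[OF d, of b R] c unfolding pd_def[abs_def] by blast
  finally show ?thesis .
qed

lemma pd_mult:
  assumes "f differentiable (at x)" "g differentiable (at x)"
  shows "pd (\<lambda>x. f x * g x) b x = pd f b x * g x + f x * pd g b x"
proof -
  have "((\<lambda>x. f x * g x) has_derivative (\<lambda>h. f x * frechet_derivative g (at x) h + frechet_derivative f (at x) h * g x)) (at x)"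
    using assms unfolding frechet_derivative_works by (rule has_derivative_mult)
  from frechet_derivative_at[OF this, symmetric] show ?thesis by (simp add: pd_def)
qed

lemma test_fun_ibp:
  assumes f: "test_fun D f" and g: "test_fun D g" and b: "b \<in> Basis"
  shows "integral\<^sup>L MD (\<lambda>x. f x * pd g b x) = - integral\<^sup>L MD (\<lambda>x. pd f b x * g x)"
proof -
  have df: "f differentiable (at x)" "g differentiable (at x)" for x
    using f g smooth_differentiable by (auto simp: test_fun_def)
  have e: "pd (\<lambda>x. f x * g x) b = (\<lambda>x. pd f b x * g x + f x * pd g b x)" using pd_mult[OF df] by auto
  have sub: "closure {x. f x * g x \<noteq> 0} \<subseteq> closure {x. f x \<noteq> 0}" by (intro closure_mono) auto
  have "integral\<^sup>L MD (pd (\<lambda>x. f x * g x) b) = 0"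
  proof (rule integral_pd_zero)
    show "continuous_on UNIV (pd (\<lambda>x. f x * g x) b)" unfolding e
      by (intro continuous_intros test_fun_cont[OF f] test_fun_cont[OF g] test_fun_cont[OF test_fun_pd[OF f b]] test_fun_cont[OF test_fun_pd[OF g b]])
    show "compact (closure {x. f x * g x \<noteq> 0})" using f by (intro compact_closure_subset[OF _ sub]) (simp add: test_fun_def)
    show "closure {x. f x * g x \<noteq> 0} \<subseteq> D" using f sub by (auto simp: test_fun_def)
  qed (use df in auto)
  moreover have "integrable MD (\<lambda>x. pd f b x * g x)" "integrable MD (\<lambda>x. f x * pd g b x)"
    using l2_integrable_inner[OF test_fun_l2[OF test_fun_pd[OF f b]] test_fun_l2[OF g]]
      l2_integrable_inner[OF test_fun_l2[OF f] test_fun_l2[OF test_fun_pd[OF g b]]] by simp_all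
  ultimately show ?thesis unfolding e by simp
qed

lemma test_fun_integral_pd:
  assumes "test_fun D f" "b \<in> Basis" shows "integral\<^sup>L MD (pd f b) = 0"
  using assms by (intro integral_pd_zero test_fun_cont[OF test_fun_pd[OF assms]]) (auto simp: test_fun_def smooth_differentiable)

text \<open>The derivative of (x . b) f^2 in direction b integrates to zero. Expanding it gives
  |f|^2 = - 2 <(x . b) f, D_b f>, and |x . b| is at most R on D.\<close>

lemma test_fun_poincare:
  assumes f: "test_fun D f" and b: "b \<in> Basis" and R: "\<And>x. x \<in> D \<Longrightarrow> norm x \<le> R"
  shows "l2n MD f \<le> 2 * R * l2n MD (pd f b)"
proof -
  have df: "f differentiable (at x)" for x using f smooth_differentiable by (auto simp: test_fun_def)
  have lf: "l2 MD f" "l2 MD (pd f b)" by (intro test_fun_l2 test_fun_pd f b)+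
  have e1: "pd (\<lambda>x. f x * f x) b x = 2 * (f x * pd f b x)" for x using pd_mult[OF df df] by simp
  have e2: "pd (\<lambda>x. x \<bullet> b) b x = 1" for x :: "real^'d"
  proof -
    have "((\<lambda>x. x \<bullet> b) has_derivative (\<lambda>h. h \<bullet> b)) (at x)" by (auto intro!: derivative_eq_intros)
    from frechet_derivative_at[OF this, symmetric] show ?thesis using b by (simp add: pd_def)
  qed
  have e: "pd (\<lambda>x. (x \<bullet> b) * (f x * f x)) b = (\<lambda>x. f x * f x + 2 * ((x \<bullet> b) * f x * pd f b x))"
  proof
    fix x
    have "pd (\<lambda>x. (x \<bullet> b) * (f x * f x)) b x = pd (\<lambda>x. x \<bullet> b) b x * (f x * f x) + (x \<bullet> b) * pd (\<lambda>x. f x * f x) b x"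
      by (rule pd_mult) (auto intro!: derivative_intros df)
    then show "pd (\<lambda>x. (x \<bullet> b) * (f x * f x)) b x = f x * f x + 2 * ((x \<bullet> b) * f x * pd f b x)" by (simp add: e1 e2)
  qed
  have sub: "closure {x. (x \<bullet> b) * (f x * f x) \<noteq> 0} \<subseteq> closure {x. f x \<noteq> 0}" by (intro closure_mono) auto
  have z: "integral\<^sup>L MD (pd (\<lambda>x. (x \<bullet> b) * (f x * f x)) b) = 0"
  proof (rule integral_pd_zero)
    show "continuous_on UNIV (pd (\<lambda>x. (x \<bullet> b) * (f x * f x)) b)" unfolding e
      by (intro continuous_intros test_fun_cont[OF f] test_fun_cont[OF test_fun_pd[OF f b]])
    show "compact (closure {x. (x \<bullet> b) * (f x * f x) \<noteq> 0})" using f by (intro compact_closure_subset[OF _ sub]) (simp add: test_fun_def)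
    show "closure {x. (x \<bullet> b) * (f x * f x) \<noteq> 0} \<subseteq> D" using f sub by (auto simp: test_fun_def)
  qed (auto intro!: derivative_intros df)
  have bd: "\<bar>x \<bullet> b\<bar> * \<bar>f x\<bar> \<le> R * \<bar>f x\<bar>" for x
  proof (cases "x \<in> D")
    case True
    have "\<bar>x \<bullet> b\<bar> \<le> norm x" using Basis_le_norm[OF b] by blast
    then show ?thesis using R[OF True] by (intro mult_right_mono) auto
  next
    case False then show ?thesis using test_fun_outside[OF f] by simp
  qed
  have lg: "l2 MD (\<lambda>x. (x \<bullet> b) * f x)"
    by (rule l2_bound[OF lf(1), of _ R]) (auto simp: abs_mult bd intro!: cont_meas_D continuous_intros test_fun_cont[OF f])
  have i: "integrable MD (\<lambda>x. f x * f x)" "integrable MD (\<lambda>x. (x \<bullet> b) * f x * pd f b x)"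
    using l2_integrable_inner[OF lf(1) lf(1)] l2_integrable_inner[OF lg lf(2)] by simp_all
  have "(l2n MD f)\<^sup>2 = - 2 * ip MD (\<lambda>x. (x \<bullet> b) * f x) (pd f b)"
    using z i unfolding e l2n_sq ip_def by simp
  also have "\<dots> \<le> 2 * (l2n MD (\<lambda>x. (x \<bullet> b) * f x) * l2n MD (pd f b))" using l2_CS[OF lg lf(2)] by linarith
  also have "\<dots> \<le> 2 * ((R * l2n MD f) * l2n MD (pd f b))"
  proof (intro mult_left_mono mult_right_mono)
    show "l2n MD (\<lambda>x. (x \<bullet> b) * f x) \<le> R * l2n MD f"
    \<comment> \<open>For empty D the number R may be negative.\<close>
    proof (cases "\<exists>x. x \<in> D")
      case True
      then have "R \<ge> 0" using R norm_ge_zero order_trans by metis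
      then show ?thesis by (intro l2n_bound lf lg) (auto simp: abs_mult bd)
    next
      case False
      then have "f = (\<lambda>x. 0)" using test_fun_outside[OF f] by auto
      then show ?thesis by simp
    qed
  qed auto
  finally have "l2n MD f * l2n MD f \<le> l2n MD f * (2 * R * l2n MD (pd f b))" by (simp add: power2_eq_square ac_simps)
  then show ?thesis
  proof (cases "l2n MD f = 0")
    case True
    show ?thesis
    proof (cases "\<exists>x. x \<in> D")
      case True
      then have "R \<ge> 0" using R norm_ge_zero order_trans by metis
      then show ?thesis using \<open>l2n MD f = 0\<close> by simp
    next
      case False
      then have "pd f b = (\<lambda>x. 0)" using test_fun_outside[OF test_fun_pd[OF f b]] by auto
      then show ?thesis using \<open>l2n MD f = 0\<close> by simp
    qed
  qed (auto simp: mult_le_cancel_left order_less_le)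
qed

end

lemma norm_vec_sq: "(norm (x :: 'b::real_inner^'n))\<^sup>2 = (\<Sum>k\<in>UNIV. (norm (x $ k))\<^sup>2)"
  by (simp add: power2_norm_eq_inner inner_vec_def)

lemma l2_vec:
  fixes f :: "'a \<Rightarrow> 'b::euclidean_space^'n"
  assumes "\<And>k. l2 N (\<lambda>x. f x $ k)" shows "l2 N f"
proof -
  have [measurable]: "(\<lambda>x. f x $ k) \<in> borel_measurable N" for k using assms by (rule l2_meas)
  have "f \<in> borel_measurable N"
    by (subst borel_measurable_euclidean_space) (auto simp: Basis_vec_def inner_axis)
  then show ?thesis using assms by (auto simp: l2_def norm_vec_sq)
qed

lemma l2_nth:
  fixes f :: "'a \<Rightarrow> 'b::euclidean_space^'n"
  assumes "l2 N f" shows "l2 N (\<lambda>x. f x $ k)"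
  by (rule l2_blin[OF bounded_linear_vec_nth assms])

lemma l2n_vec_sq:
  fixes f :: "'a \<Rightarrow> 'b::euclidean_space^'n"
  assumes "l2 N f" shows "(l2n N f)\<^sup>2 = (\<Sum>k\<in>UNIV. (l2n N (\<lambda>x. f x $ k))\<^sup>2)"
  using l2_integrable_sq[OF l2_nth[OF assms]] by (simp add: l2n_def norm_vec_sq sum_nonneg)

lemma jac_inner_eq: "jac_inner J K = J \<bullet> K"
  by (simp add: jac_inner_def inner_vec_def)

lemma divJ_eq: "divJ J = J \<bullet> mat 1"
proof -
  have "J \<bullet> mat 1 = (\<Sum>k\<in>UNIV. \<Sum>i\<in>UNIV. J $ k $ i * (if k = i then 1 else 0))"
    by (simp add: inner_vec_def mat_def)
  also have "\<dots> = divJ J" unfolding divJ_def by (intro sum.cong refl) (simp add: if_distrib cong: if_cong)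
  finally show ?thesis by simp
qed

definition testv :: "(real^'d) set \<Rightarrow> (real^'d \<Rightarrow> real^'d) \<Rightarrow> bool" where
  "testv D \<Phi> \<longleftrightarrow> (\<forall>k. test_fun D (\<lambda>x. \<Phi> x $ k))"

section \<open>The space of Dirichlet fields with their Jacobians\<close>

context domain
begin

lemma testv_l2: assumes "testv D \<Phi>" shows "l2 MD \<Phi>" "l2 MD (jac \<Phi>)"
proof -
  have t: "test_fun D (\<lambda>x. \<Phi> x $ k)" for k using assms by (simp add: testv_def)
  show "l2 MD \<Phi>" by (intro l2_vec test_fun_l2 t)
  show "l2 MD (jac \<Phi>)"
    by (intro l2_vec) (simp add: jac_def, intro test_fun_l2 test_fun_pd t axis_Basis)
qed

lemma testv_lin:
  assumes "testv D \<Phi>" "testv D \<Psi>"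
  shows "testv D (\<lambda>x. a *\<^sub>R \<Phi> x + b *\<^sub>R \<Psi> x)" "jac (\<lambda>x. a *\<^sub>R \<Phi> x + b *\<^sub>R \<Psi> x) = (\<lambda>x. a *\<^sub>R jac \<Phi> x + b *\<^sub>R jac \<Psi> x)"
proof -
  show "testv D (\<lambda>x. a *\<^sub>R \<Phi> x + b *\<^sub>R \<Psi> x)" using assms by (simp add: testv_def test_fun_lin)
  have "pd (\<lambda>y. a * \<Phi> y $ k + b * \<Psi> y $ k) e x = a * pd (\<lambda>y. \<Phi> y $ k) e x + b * pd (\<lambda>y. \<Psi> y $ k) e x" for k e x
  proof -
    have "(\<lambda>y. \<Phi> y $ k) differentiable (at x)" "(\<lambda>y. \<Psi> y $ k) differentiable (at x)"
      using assms by (auto simp: testv_def test_fun_def smooth_differentiable)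
    then have "((\<lambda>y. a * \<Phi> y $ k + b * \<Psi> y $ k) has_derivative (\<lambda>h. a * frechet_derivative (\<lambda>y. \<Phi> y $ k) (at x) h + b * frechet_derivative (\<lambda>y. \<Psi> y $ k) (at x) h)) (at x)"
      unfolding frechet_derivative_works by (auto intro!: derivative_eq_intros)
    from frechet_derivative_at[OF this, symmetric] show ?thesis by (simp add: pd_def)
  qed
  then show "jac (\<lambda>x. a *\<^sub>R \<Phi> x + b *\<^sub>R \<Psi> x) = (\<lambda>x. a *\<^sub>R jac \<Phi> x + b *\<^sub>R jac \<Psi> x)"
    by (auto simp: jac_def vec_eq_iff)
qed

lemma testv_zero: "testv D (\<lambda>x. 0)" by (simp add: testv_def test_fun_zero)

text \<open>Integration by parts holds for test fields, and both of its sides are continuous in mean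
  square. Thus approximation by test fields already yields the weak Jacobian.\<close>

lemma has_weak_jac_limit:
  assumes v: "l2 MD v" and G: "l2 MD G" and \<Phi>: "\<And>n. testv D (\<Phi> n)"
    and lim: "(\<lambda>n. l2n MD (\<lambda>x. \<Phi> n x - v x)) \<longlonglongrightarrow> 0" "(\<lambda>n. l2n MD (\<lambda>x. jac (\<Phi> n) x - G x)) \<longlonglongrightarrow> 0"
  shows "has_weak_jac D v G"
  unfolding has_weak_jac_def
proof (intro conjI allI impI)
  show "L2v D v" "L2v D G" using v G by (auto simp: L2v_def l2_def)
  fix \<phi> and k i assume \<phi>: "test_fun D \<phi>"
  have t: "test_fun D (\<lambda>x. \<Phi> n x $ k)" for n using \<Phi> by (simp add: testv_def)
  let ?g = "\<lambda>x. pd \<phi> (axis i 1) x *\<^sub>R axis k (1::real)" and ?h = "\<lambda>x. \<phi> x *\<^sub>R axis k (axis i (1::real))"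
  have ls: "l2 MD (\<lambda>x. f x *\<^sub>R c)" if "l2 MD f" for f :: "real^'d \<Rightarrow> real" and c :: "'z::euclidean_space"
    by (rule l2_blin[OF bounded_linear_scaleR_left that])
  have l: "l2 MD ?g" "l2 MD ?h" by (intro ls test_fun_l2 test_fun_pd \<phi> axis_Basis)+
  have a: "(\<lambda>n. ip MD (\<Phi> n) ?g) \<longlonglongrightarrow> ip MD v ?g" by (rule ip_tendsto[OF testv_l2(1)[OF \<Phi>] v lim(1) l(1)])
  have b: "(\<lambda>n. ip MD (jac (\<Phi> n)) ?h) \<longlonglongrightarrow> ip MD G ?h" by (rule ip_tendsto[OF testv_l2(2)[OF \<Phi>] G lim(2) l(2)])
  have "ip MD (\<Phi> n) ?g = - ip MD (jac (\<Phi> n)) ?h" for n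
    using test_fun_ibp[OF t \<phi> axis_Basis, of n i] by (simp add: ip_def inner_axis jac_def mult.commute)
  then have "(\<lambda>n. ip MD (\<Phi> n) ?g) \<longlonglongrightarrow> - ip MD G ?h" using tendsto_minus[OF b] by simp
  from LIMSEQ_unique[OF a this] show "integral\<^sup>L MD (\<lambda>x. v x $ k * pd \<phi> (axis i 1) x) = - integral\<^sup>L MD (\<lambda>x. G x $ k $ i * \<phi> x)"
    by (simp add: ip_def inner_axis mult.commute)
qed

text \<open>Exhibits \<open>H01\<close> as the closure of the graph of \<open>jac\<close> on test
  fields, the form in which all limit arguments use it.\<close>

lemma H01_iff:
  "H01 D v G \<longleftrightarrow> l2 MD v \<and> l2 MD G \<and> (\<exists>\<Phi>. (\<forall>n. testv D (\<Phi> n)) \<and> (\<lambda>n. l2n MD (\<lambda>x. \<Phi> n x - v x)) \<longlonglongrightarrow> 0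
     \<and> (\<lambda>n. l2n MD (\<lambda>x. jac (\<Phi> n) x - G x)) \<longlonglongrightarrow> 0)"
proof -
  have e: "integral\<^sup>L MD (\<lambda>x. (norm (\<Phi> x - v x))\<^sup>2)
            + integral\<^sup>L MD (\<lambda>x. (\<Sum>k\<in>UNIV. \<Sum>i\<in>UNIV. (pd (\<lambda>y. \<Phi> y $ k) (axis i 1) x - G x $ k $ i)\<^sup>2))
     = (l2n MD (\<lambda>x. \<Phi> x - v x))\<^sup>2 + (l2n MD (\<lambda>x. jac \<Phi> x - G x))\<^sup>2" for \<Phi>
  proof -
    have "(\<Sum>k\<in>UNIV. \<Sum>i\<in>UNIV. (pd (\<lambda>y. \<Phi> y $ k) (axis i 1) x - G x $ k $ i)\<^sup>2) = (norm (jac \<Phi> x - G x))\<^sup>2" for x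
      by (simp add: norm_vec_sq jac_def)
    then show ?thesis by (simp add: l2n_def)
  qed
  have lim: "(\<lambda>n. (a n)\<^sup>2 + (b n)\<^sup>2) \<longlonglongrightarrow> 0 \<longleftrightarrow> a \<longlonglongrightarrow> 0 \<and> b \<longlonglongrightarrow> 0" if "\<And>n. 0 \<le> a n" "\<And>n. 0 \<le> b n" for a b :: "nat \<Rightarrow> real"
  proof
    assume L: "(\<lambda>n. (a n)\<^sup>2 + (b n)\<^sup>2) \<longlonglongrightarrow> 0"
    have s: "(\<lambda>n. sqrt ((a n)\<^sup>2 + (b n)\<^sup>2)) \<longlonglongrightarrow> 0" using tendsto_real_sqrt[OF L] by simp
    show "a \<longlonglongrightarrow> 0 \<and> b \<longlonglongrightarrow> 0"
      using that by (auto intro!: Lim_null_comparison[OF _ s] always_eventually real_le_rsqrt)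
  next
    assume "a \<longlonglongrightarrow> 0 \<and> b \<longlonglongrightarrow> 0"
    then have "(\<lambda>n. (a n)\<^sup>2 + (b n)\<^sup>2) \<longlonglongrightarrow> 0\<^sup>2 + 0\<^sup>2" by (intro tendsto_intros) auto
    then show "(\<lambda>n. (a n)\<^sup>2 + (b n)\<^sup>2) \<longlonglongrightarrow> 0" by simp
  qed
  have "H01 D v G \<longleftrightarrow> has_weak_jac D v G \<and> (\<exists>\<Phi>. (\<forall>n. testv D (\<Phi> n)) \<and> (\<lambda>n. l2n MD (\<lambda>x. \<Phi> n x - v x)) \<longlonglongrightarrow> 0
     \<and> (\<lambda>n. l2n MD (\<lambda>x. jac (\<Phi> n) x - G x)) \<longlonglongrightarrow> 0)"
    unfolding H01_def e testv_def by (subst lim) auto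
  also have "\<dots> \<longleftrightarrow> l2 MD v \<and> l2 MD G \<and> (\<exists>\<Phi>. (\<forall>n. testv D (\<Phi> n)) \<and> (\<lambda>n. l2n MD (\<lambda>x. \<Phi> n x - v x)) \<longlonglongrightarrow> 0
     \<and> (\<lambda>n. l2n MD (\<lambda>x. jac (\<Phi> n) x - G x)) \<longlonglongrightarrow> 0)"
    using has_weak_jac_limit[of v G] by (auto simp: has_weak_jac_def L2v_def l2_def)
  finally show ?thesis .
qed

lemma H01_l2: assumes "H01 D v G" shows "l2 MD v" "l2 MD G" using assms by (auto simp: H01_iff)

lemma H01_approx:
  assumes "H01 D v G"
  shows "\<exists>\<Phi>. (\<forall>n. testv D (\<Phi> n)) \<and> (\<lambda>n. l2n MD (\<lambda>x. \<Phi> n x - v x)) \<longlonglongrightarrow> 0 \<and> (\<lambda>n. l2n MD (\<lambda>x. jac (\<Phi> n) x - G x)) \<longlonglongrightarrow> 0"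
  using assms by (auto simp: H01_iff)

lemma l2n_lin_le:
  assumes "l2 N f" "l2 N g" shows "l2n N (\<lambda>x. a *\<^sub>R f x + b *\<^sub>R g x) \<le> \<bar>a\<bar> * l2n N f + \<bar>b\<bar> * l2n N g"
  using l2n_add[OF l2_scale[OF assms(1)] l2_scale[OF assms(2)]] by (simp add: l2n_scale)

lemma H01_lin:
  assumes 1: "H01 D v G" and 2: "H01 D w H"
  shows "H01 D (\<lambda>x. a *\<^sub>R v x + b *\<^sub>R w x) (\<lambda>x. a *\<^sub>R G x + b *\<^sub>R H x)"
proof -
  obtain \<Phi> where \<Phi>: "\<And>n. testv D (\<Phi> n)" "(\<lambda>n. l2n MD (\<lambda>x. \<Phi> n x - v x)) \<longlonglongrightarrow> 0" "(\<lambda>n. l2n MD (\<lambda>x. jac (\<Phi> n) x - G x)) \<longlonglongrightarrow> 0"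
    using H01_approx[OF 1] by blast
  obtain \<Psi> where \<Psi>: "\<And>n. testv D (\<Psi> n)" "(\<lambda>n. l2n MD (\<lambda>x. \<Psi> n x - w x)) \<longlonglongrightarrow> 0" "(\<lambda>n. l2n MD (\<lambda>x. jac (\<Psi> n) x - H x)) \<longlonglongrightarrow> 0"
    using H01_approx[OF 2] by blast
  note l = H01_l2[OF 1] H01_l2[OF 2]
  have lim: "(\<lambda>n. l2n MD (\<lambda>x. (a *\<^sub>R f n x + b *\<^sub>R g n x) - (a *\<^sub>R p x + b *\<^sub>R q x))) \<longlonglongrightarrow> 0"
    if "\<And>n. l2 MD (f n)" "\<And>n. l2 MD (g n)" "l2 MD p" "l2 MD q" "(\<lambda>n. l2n MD (\<lambda>x. f n x - p x)) \<longlonglongrightarrow> 0" "(\<lambda>n. l2n MD (\<lambda>x. g n x - q x)) \<longlonglongrightarrow> 0"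
    for f g :: "nat \<Rightarrow> real^'d \<Rightarrow> 'z::euclidean_space" and p q
  proof (rule Lim_null_comparison)
    have "(\<lambda>n. \<bar>a\<bar> * l2n MD (\<lambda>x. f n x - p x) + \<bar>b\<bar> * l2n MD (\<lambda>x. g n x - q x)) \<longlonglongrightarrow> \<bar>a\<bar> * 0 + \<bar>b\<bar> * 0" by (intro tendsto_intros that)
    then show "(\<lambda>n. \<bar>a\<bar> * l2n MD (\<lambda>x. f n x - p x) + \<bar>b\<bar> * l2n MD (\<lambda>x. g n x - q x)) \<longlonglongrightarrow> 0" by simp
    have "(a *\<^sub>R f n x + b *\<^sub>R g n x) - (a *\<^sub>R p x + b *\<^sub>R q x) = a *\<^sub>R (f n x - p x) + b *\<^sub>R (g n x - q x)" for n x
      by (simp add: algebra_simps)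
    then show "\<forall>\<^sub>F n in sequentially. norm (l2n MD (\<lambda>x. (a *\<^sub>R f n x + b *\<^sub>R g n x) - (a *\<^sub>R p x + b *\<^sub>R q x)))
       \<le> \<bar>a\<bar> * l2n MD (\<lambda>x. f n x - p x) + \<bar>b\<bar> * l2n MD (\<lambda>x. g n x - q x)"
      using l2n_lin_le[OF l2_diff[OF that(1,3)] l2_diff[OF that(2,4)], where a=a and b=b] by simp
  qed
  show ?thesis unfolding H01_iff
  proof (intro conjI exI[of _ "\<lambda>n x. a *\<^sub>R \<Phi> n x + b *\<^sub>R \<Psi> n x"] allI)
    show "(\<lambda>n. l2n MD (\<lambda>x. (a *\<^sub>R \<Phi> n x + b *\<^sub>R \<Psi> n x) - (a *\<^sub>R v x + b *\<^sub>R w x))) \<longlonglongrightarrow> 0"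
      by (intro lim testv_l2 \<Phi> \<Psi> l)
    show "(\<lambda>n. l2n MD (\<lambda>x. jac (\<lambda>x. a *\<^sub>R \<Phi> n x + b *\<^sub>R \<Psi> n x) x - (a *\<^sub>R G x + b *\<^sub>R H x))) \<longlonglongrightarrow> 0"
      unfolding testv_lin(2)[OF \<Phi>(1) \<Psi>(1)] by (intro lim testv_l2 \<Phi> \<Psi> l)
  qed (intro l2_lin l testv_lin \<Phi> \<Psi>)+
qed

lemma H01_zero: "H01 D (\<lambda>x. 0) (\<lambda>x. 0)"
proof -
  have "jac (\<lambda>x::real^'d. 0::real^'d) = (\<lambda>x. 0)" by (auto simp: jac_def pd_def vec_eq_iff)
  then show ?thesis unfolding H01_iff using testv_zero by (auto intro!: exI[of _ "\<lambda>n x. 0"])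
qed

text \<open>A diagonal choice: for each n one test field that is within 1/(n+1) of v n, together
  with its Jacobian.\<close>

lemma H01_closed:
  assumes n: "\<And>n. H01 D (v n) (G n)" and l: "l2 MD w" "l2 MD H"
    and lim: "(\<lambda>n. l2n MD (\<lambda>x. v n x - w x)) \<longlonglongrightarrow> 0" "(\<lambda>n. l2n MD (\<lambda>x. G n x - H x)) \<longlonglongrightarrow> 0"
  shows "H01 D w H"
proof -
  have "\<exists>\<Phi>. testv D \<Phi> \<and> l2n MD (\<lambda>x. \<Phi> x - v n x) < 1 / real (Suc n) \<and> l2n MD (\<lambda>x. jac \<Phi> x - G n x) < 1 / real (Suc n)" for n
  proof -
    obtain \<Phi> where \<Phi>: "\<And>k. testv D (\<Phi> k)" "(\<lambda>k. l2n MD (\<lambda>x. \<Phi> k x - v n x)) \<longlonglongrightarrow> 0" "(\<lambda>k. l2n MD (\<lambda>x. jac (\<Phi> k) x - G n x)) \<longlonglongrightarrow> 0"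
      using H01_approx[OF n[of n]] by blast
    have "\<forall>\<^sub>F k in sequentially. l2n MD (\<lambda>x. \<Phi> k x - v n x) < 1 / real (Suc n) \<and> l2n MD (\<lambda>x. jac (\<Phi> k) x - G n x) < 1 / real (Suc n)"
      by (intro eventually_conj order_tendstoD(2)[OF \<Phi>(2)] order_tendstoD(2)[OF \<Phi>(3)]) auto
    then show ?thesis using \<Phi>(1) by (auto simp: eventually_sequentially)
  qed
  then have "\<exists>\<Phi>. \<forall>n. testv D (\<Phi> n) \<and> l2n MD (\<lambda>x. \<Phi> n x - v n x) < 1 / real (Suc n) \<and> l2n MD (\<lambda>x. jac (\<Phi> n) x - G n x) < 1 / real (Suc n)"
    by (intro choice) blast
  then obtain \<Phi> where \<Phi>: "\<And>n. testv D (\<Phi> n)" "\<And>n. l2n MD (\<lambda>x. \<Phi> n x - v n x) < 1 / real (Suc n)"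
     "\<And>n. l2n MD (\<lambda>x. jac (\<Phi> n) x - G n x) < 1 / real (Suc n)" by blast
  have z: "(\<lambda>n. 1 / real (Suc n)) \<longlonglongrightarrow> 0" using LIMSEQ_inverse_real_of_nat by (simp add: inverse_eq_divide)
  have "(\<lambda>n. l2n MD (\<lambda>x. \<Phi> n x - w x)) \<longlonglongrightarrow> 0"
  proof (rule Lim_null_comparison)
    show "(\<lambda>n. 1 / real (Suc n) + l2n MD (\<lambda>x. v n x - w x)) \<longlonglongrightarrow> 0" using tendsto_add[OF z lim(1)] by simp
    have "l2n MD (\<lambda>x. \<Phi> k x - w x) \<le> 1 / real (Suc k) + l2n MD (\<lambda>x. v k x - w x)" for k
      using l2n_diff_triangle[OF testv_l2(1)[OF \<Phi>(1)] H01_l2(1)[OF n] l(1), of k k] \<Phi>(2)[of k] by linarith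
    then show "\<forall>\<^sub>F n in sequentially. norm (l2n MD (\<lambda>x. \<Phi> n x - w x)) \<le> 1 / real (Suc n) + l2n MD (\<lambda>x. v n x - w x)"
      by (intro always_eventually allI) simp
  qed
  moreover have "(\<lambda>n. l2n MD (\<lambda>x. jac (\<Phi> n) x - H x)) \<longlonglongrightarrow> 0"
  proof (rule Lim_null_comparison)
    show "(\<lambda>n. 1 / real (Suc n) + l2n MD (\<lambda>x. G n x - H x)) \<longlonglongrightarrow> 0" using tendsto_add[OF z lim(2)] by simp
    have "l2n MD (\<lambda>x. jac (\<Phi> k) x - H x) \<le> 1 / real (Suc k) + l2n MD (\<lambda>x. G k x - H x)" for k
      using l2n_diff_triangle[OF testv_l2(2)[OF \<Phi>(1)] H01_l2(2)[OF n] l(2), of k k] \<Phi>(3)[of k] by linarith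
    then show "\<forall>\<^sub>F n in sequentially. norm (l2n MD (\<lambda>x. jac (\<Phi> n) x - H x)) \<le> 1 / real (Suc n) + l2n MD (\<lambda>x. G n x - H x)"
      by (intro always_eventually allI) simp
  qed
  ultimately show ?thesis unfolding H01_iff using l \<Phi>(1) by blast
qed

lemma H01_AE_cong:
  assumes h: "H01 D v G" and "AE x in MD. v x = w x" "AE x in MD. G x = H x" "w \<in> borel_measurable MD" "H \<in> borel_measurable MD"
  shows "H01 D w H"
proof (rule H01_closed[where v="\<lambda>n. v" and G="\<lambda>n. G"])
  note l = H01_l2[OF h]
  show l': "l2 MD w" "l2 MD H" using l2_AE_cong[OF l(1) assms(4,2)] l2_AE_cong[OF l(2) assms(5,3)] by auto
  have "l2n MD (\<lambda>x. v x - w x) = l2n MD (\<lambda>x. 0::real^'d)" "l2n MD (\<lambda>x. G x - H x) = l2n MD (\<lambda>x. 0::real^'d^'d)"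
    using l2_meas[OF l2_diff[OF l(1) l'(1)]] l2_meas[OF l2_diff[OF l(2) l'(2)]] assms(2,3) by (intro l2n_AE_cong; simp)+
  then show "(\<lambda>n. l2n MD (\<lambda>x. v x - w x)) \<longlonglongrightarrow> 0" "(\<lambda>n. l2n MD (\<lambda>x. G x - H x)) \<longlonglongrightarrow> 0" by simp_all
qed (fact h)

text \<open>The difference of the Jacobians is a weak Jacobian of zero and so orthogonal to all test
  functions. Hence it is orthogonal to the Jacobians of its own approximants and, in the limit, to
  itself.\<close>

lemma H01_grad_unique:
  assumes 1: "H01 D v G" and 2: "H01 D w H" and vw: "AE x in MD. v x = w x"
  shows "AE x in MD. G x = H x"
proof -
  note l1 = H01_l2[OF 1] and l2 = H01_l2[OF 2]
  have "H01 D (\<lambda>x. v x - w x) (\<lambda>x. G x - H x)" using H01_lin[OF 1 2, of 1 "-1"] by simp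
  then have h: "H01 D (\<lambda>x. 0) (\<lambda>x. G x - H x)"
    by (rule H01_AE_cong) (use vw l2_meas[OF l2_diff[OF l1(2) l2(2)]] in auto)
  note lh = H01_l2(2)[OF h]
  obtain \<Phi> where \<Phi>: "\<And>n. testv D (\<Phi> n)" "(\<lambda>n. l2n MD (\<lambda>x. \<Phi> n x - 0)) \<longlonglongrightarrow> 0" "(\<lambda>n. l2n MD (\<lambda>x. jac (\<Phi> n) x - (G x - H x))) \<longlonglongrightarrow> 0"
    using H01_approx[OF h] by blast
  have z: "ip MD (jac (\<Phi> n)) (\<lambda>x. G x - H x) = 0" for n
  proof -
    have t: "test_fun D (\<lambda>x. jac (\<Phi> n) x $ k $ i)" for k i
      using \<Phi>(1)[of n] by (simp add: jac_def testv_def test_fun_pd)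
    have "integral\<^sup>L MD (\<lambda>x. (G x - H x) $ k $ i * jac (\<Phi> n) x $ k $ i) = 0" for k i
      using h t[of k i] unfolding H01_def has_weak_jac_def by simp
    moreover have "integrable MD (\<lambda>x. (G x - H x) $ k $ i * jac (\<Phi> n) x $ k $ i)" for k i
      using l2_integrable_inner[OF l2_nth[OF l2_nth[OF lh]] test_fun_l2[OF t], of k i k i] by simp
    ultimately show ?thesis unfolding ip_commute[of MD "jac (\<Phi> n)"] by (simp add: ip_def inner_vec_def)
  qed
  have "ip MD (\<lambda>x. G x - H x) (\<lambda>x. G x - H x) = 0"
    using ip_tendsto[OF testv_l2(2)[OF \<Phi>(1)] lh \<Phi>(3) lh] unfolding z by (simp add: LIMSEQ_const_iff)
  then have "l2n MD (\<lambda>x. G x - H x) = 0" by (simp add: l2n_sq[symmetric])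
  from l2n_eq_0_AE[OF lh this] show ?thesis by simp
qed

lemma l2_const: "l2 MD (\<lambda>x. c)"
  by (rule bounded_l2[of _ "norm c"]) auto

text \<open>The inner product with \<open>mat 1\<close> is the trace, so the quantity is the
  integral of the divergence. It vanishes for test fields, whose partial derivatives integrate to
  zero, and passes to the limit.\<close>

lemma H01_div_zero: assumes "H01 D v G" shows "ip MD G (\<lambda>x. mat 1) = 0"
proof -
  obtain \<Phi> where \<Phi>: "\<And>n. testv D (\<Phi> n)" "(\<lambda>n. l2n MD (\<lambda>x. \<Phi> n x - v x)) \<longlonglongrightarrow> 0" "(\<lambda>n. l2n MD (\<lambda>x. jac (\<Phi> n) x - G x)) \<longlonglongrightarrow> 0"
    using H01_approx[OF assms] by blast
  have "ip MD (jac (\<Phi> n)) (\<lambda>x. mat 1) = 0" for n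
  proof -
    have t: "test_fun D (\<lambda>x. \<Phi> n x $ i)" for i using \<Phi>(1) by (simp add: testv_def)
    have "integrable MD (pd (\<lambda>x. \<Phi> n x $ i) (axis i 1))" for i
      using l2_integrable_inner[OF test_fun_l2[OF test_fun_pd[OF t axis_Basis]] l2_const[of "1::real"]] by simp
    then show ?thesis using test_fun_integral_pd[OF t axis_Basis]
      unfolding ip_def divJ_eq[symmetric] by (simp add: divJ_def jac_def)
  qed
  with ip_tendsto[OF testv_l2(2)[OF \<Phi>(1)] H01_l2(2)[OF assms] \<Phi>(3) l2_const[of "mat 1"]] show ?thesis by (simp add: LIMSEQ_const_iff)
qed

lemma poincare: "\<exists>CP\<ge>0. \<forall>v G. H01 D v G \<longrightarrow> l2n MD v \<le> CP * l2n MD G"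
proof -
  obtain R where R: "\<And>x. x \<in> D \<Longrightarrow> norm x \<le> R" using bddD bounded_iff by blast
  define CP where "CP = 2 * max R 0"
  have CP: "CP \<ge> 0" by (simp add: CP_def)
  have R': "\<And>x. x \<in> D \<Longrightarrow> norm x \<le> max R 0" using R by (meson le_max_iff_disj)
  have "l2n MD v \<le> CP * l2n MD G" if h: "H01 D v G" for v G
  proof -
    obtain \<Phi> where \<Phi>: "\<And>n. testv D (\<Phi> n)" "(\<lambda>n. l2n MD (\<lambda>x. \<Phi> n x - v x)) \<longlonglongrightarrow> 0" "(\<lambda>n. l2n MD (\<lambda>x. jac (\<Phi> n) x - G x)) \<longlonglongrightarrow> 0"
      using H01_approx[OF h] by blast
    have "l2n MD (\<Phi> n) \<le> CP * l2n MD (jac (\<Phi> n))" for n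
    proof -
      note l = testv_l2[OF \<Phi>(1)[of n]]
      have t: "test_fun D (\<lambda>x. \<Phi> n x $ k)" for k using \<Phi>(1) by (simp add: testv_def)
      have "l2n MD (\<lambda>x. \<Phi> n x $ k) \<le> CP * l2n MD (\<lambda>x. jac (\<Phi> n) x $ k)" for k
      proof -
        \<comment> \<open>Any coordinate direction serves: one partial derivative of each component
          already controls that component.\<close>
        let ?i = "undefined :: 'd"
        have "l2n MD (\<lambda>x. \<Phi> n x $ k) \<le> CP * l2n MD (\<lambda>x. jac (\<Phi> n) x $ k $ ?i)"
          using test_fun_poincare[OF t axis_Basis R', of k ?i] by (simp add: jac_def CP_def)
        also have "l2n MD (\<lambda>x. jac (\<Phi> n) x $ k $ ?i) \<le> 1 * l2n MD (\<lambda>x. jac (\<Phi> n) x $ k)"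
          by (intro l2n_bound l2_nth l AE_I2) (auto simp: component_le_norm_cart)
        finally show ?thesis using CP by (simp add: mult_left_mono)
      qed
      then have "(\<Sum>k\<in>UNIV. (l2n MD (\<lambda>x. \<Phi> n x $ k))\<^sup>2) \<le> (\<Sum>k\<in>UNIV. (CP * l2n MD (\<lambda>x. jac (\<Phi> n) x $ k))\<^sup>2)"
        by (intro sum_mono power_mono) auto
      then have "(l2n MD (\<Phi> n))\<^sup>2 \<le> (CP * l2n MD (jac (\<Phi> n)))\<^sup>2"
        by (simp add: l2n_vec_sq[OF l(1)] l2n_vec_sq[OF l(2)] power_mult_distrib sum_distrib_left)
      then show ?thesis by (rule power2_le_imp_le) (simp add: CP)
    qed
    then show ?thesis
      by (intro LIMSEQ_le[OF l2n_tendsto[OF testv_l2(1)[OF \<Phi>(1)] H01_l2(1)[OF h] \<Phi>(2)]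
        tendsto_mult_left[OF l2n_tendsto[OF testv_l2(2)[OF \<Phi>(1)] H01_l2(2)[OF h] \<Phi>(3)], of CP]]) blast
  qed
  then show ?thesis using CP by blast
qed

end

section \<open>The space-time cylinder as a product of measure spaces\<close>

text \<open>Lebesgue measure on S is complete, so measurability survives arbitrary changes on null
  sets. This is how measurability is transferred from a chosen version back to the given
  function.\<close>

lemma meas_AE_lebesgue_on:
  fixes f g :: "'a::euclidean_space \<Rightarrow> 'b::topological_space"
  assumes S: "S \<in> sets lebesgue" and g: "g \<in> borel_measurable (lebesgue_on S)" and ae: "AE x in lebesgue_on S. f x = g x"
  shows "f \<in> borel_measurable (lebesgue_on S)"
proof -
  interpret complete_measure "lebesgue_on S"
  proof
    fix A B assume "B \<subseteq> A" "A \<in> null_sets (lebesgue_on S)"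
    then have "B \<in> null_sets (lebesgue_on S)"
      using S null_sets_completion_subset[of B A lborel] by (auto simp: null_sets_restrict_space)
    then show "B \<in> sets (lebesgue_on S)" by auto
  qed
  show ?thesis
  proof (rule measurableI)
    fix A :: "'b set" assume A: "A \<in> sets borel"
    show "f -` A \<inter> space (lebesgue_on S) \<in> sets (lebesgue_on S)"
    proof (rule in_sets_AE[of "g -` A \<inter> space (lebesgue_on S)"])
      show "AE x in lebesgue_on S. (x \<in> g -` A \<inter> space (lebesgue_on S)) = (x \<in> f -` A \<inter> space (lebesgue_on S))"
        using ae by eventually_elim simp
    qed (use measurable_sets[OF g A] in auto)
  qed simp
qed

lemma lebesgue_on_borel_version:
  fixes f :: "'a::euclidean_space \<Rightarrow> 'b::euclidean_space"
  assumes S: "S \<in> sets borel" and f: "f \<in> borel_measurable (lebesgue_on S)"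
  shows "\<exists>g\<in>borel_measurable borel. AE x in lebesgue_on S. f x = g x"
proof -
  have SL: "S \<in> sets lebesgue" using S by simp
  have "\<exists>g\<in>borel_measurable lborel. AE x in lborel. indicator S x * (f x \<bullet> b) = g x" for b
  proof (rule completion_ex_borel_measurable_real)
    have "(\<lambda>x. f x \<bullet> b) \<in> borel_measurable (lebesgue_on S)" using f by measurable
    then show "(\<lambda>x. indicator S x * (f x \<bullet> b)) \<in> borel_measurable lebesgue"
      using SL by (subst (asm) borel_measurable_restrict_space_iff) (auto simp: mult.commute)
  qed
  then obtain g where g: "\<And>b. g b \<in> borel_measurable lborel" "\<And>b. AE x in lborel. indicator S x * (f x \<bullet> b) = g b x" by metis
  define h where "h x = (\<Sum>b\<in>Basis. g b x *\<^sub>R b)" for x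
  have "AE x in lborel. \<forall>b\<in>Basis. indicator S x * (f x \<bullet> b) = g b x" using g(2) by (simp add: AE_finite_all)
  then have "AE x in lebesgue. \<forall>b\<in>Basis. indicator S x * (f x \<bullet> b) = g b x" by (rule AE_completion)
  then have "AE x in lebesgue. x \<in> S \<longrightarrow> f x = h x"
  proof eventually_elim
    case (elim x)
    show ?case
    proof
      assume "x \<in> S"
      then have "h x = (\<Sum>b\<in>Basis. (f x \<bullet> b) *\<^sub>R b)" using elim by (simp add: h_def)
      then show "f x = h x" by (simp add: euclidean_representation)
    qed
  qed
  then have "AE x in lebesgue_on S. f x = h x" using SL by (subst AE_restrict_space_iff) auto
  moreover have "h \<in> borel_measurable borel" unfolding h_def using g(1) by simp
  ultimately show ?thesis by blast
qed

lemma lborel_null_Times: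
  fixes N :: "'a::euclidean_space set"
  assumes "N \<in> null_sets lborel"
  shows "N \<times> (UNIV :: 'b::euclidean_space set) \<in> null_sets lborel" "(UNIV :: 'b set) \<times> N \<in> null_sets lborel"
proof -
  have N: "N \<in> sets lborel" "emeasure lborel N = 0" using assms by auto
  have "emeasure (lborel \<Otimes>\<^sub>M lborel) (N \<times> (UNIV :: 'b set)) = 0"
    by (subst lborel.emeasure_pair_measure_Times) (use N in auto)
  then show "N \<times> (UNIV :: 'b set) \<in> null_sets lborel" using N by (auto simp: lborel_prod[symmetric] null_sets_def intro!: pair_measureI)
  have "emeasure (lborel \<Otimes>\<^sub>M lborel) ((UNIV :: 'b set) \<times> N) = 0"
    by (subst lborel.emeasure_pair_measure_Times) (use N in auto)
  then show "(UNIV :: 'b set) \<times> N \<in> null_sets lborel" using N by (auto simp: lborel_prod[symmetric] null_sets_def intro!: pair_measureI)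
qed

text \<open>Each factor is a Borel set up to a subset of a Borel null set, so the product differs
  from a Borel rectangle only inside two null strips.\<close>

lemma lebesgue_Times:
  fixes A :: "'a::euclidean_space set" and B :: "'b::euclidean_space set"
  assumes "A \<in> sets lebesgue" "B \<in> sets lebesgue"
  shows "A \<times> B \<in> sets lebesgue" "emeasure lebesgue (A \<times> B) = emeasure lebesgue A * emeasure lebesgue B"
proof -
  obtain S N N' where A: "A = S \<union> N" "N \<subseteq> N'" "N' \<in> null_sets lborel" "S \<in> sets lborel" using assms(1) by (rule sets_completionE)
  obtain R P P' where B: "B = R \<union> P" "P \<subseteq> P'" "P' \<in> null_sets lborel" "R \<in> sets lborel" using assms(2) by (rule sets_completionE)
  define Z where "Z = N' \<times> (UNIV :: 'b set) \<union> (UNIV :: 'a set) \<times> P'"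
  have Z: "Z \<in> null_sets lborel" unfolding Z_def by (intro null_sets.Un lborel_null_Times A B)
  have SR: "S \<times> R \<in> sets (lborel :: ('a \<times> 'b) measure)" using A(4) B(4) by (auto simp: lborel_prod[symmetric] simp del: sets_lborel intro!: pair_measureI)
  have e: "A \<times> B = S \<times> R \<union> (A \<times> B - S \<times> R)" "A \<times> B - S \<times> R \<subseteq> Z" using A B by (auto simp: Z_def)
  show 1: "A \<times> B \<in> sets lebesgue" by (rule sets_completionI[OF e Z SR])
  have aeq: "emeasure lebesgue X = emeasure lborel Y" if "X = Y \<union> W" "W \<subseteq> V" "V \<in> null_sets lborel" "Y \<in> sets lborel" for X Y W V :: "'z::euclidean_space set"
  proof -
    have X: "X \<in> sets lebesgue" by (rule sets_completionI[OF that])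
    have "AE x in lborel. x \<notin> V" using that(3) by (rule AE_not_in)
    then have "AE x in lebesgue. x \<notin> V" by (rule AE_completion)
    then have "emeasure lebesgue X = emeasure lebesgue Y"
      by (intro emeasure_eq_AE X) (use that in \<open>auto elim!: eventually_mono\<close>)
    then show ?thesis using that(4) by simp
  qed
  have "emeasure lebesgue (A \<times> B) = emeasure lborel (S \<times> R)" by (rule aeq[OF e Z SR])
  also have "\<dots> = emeasure (lborel \<Otimes>\<^sub>M lborel) (S \<times> R)" by (simp add: lborel_prod)
  also have "\<dots> = emeasure lborel S * emeasure lborel R" by (rule lborel.emeasure_pair_measure_Times) (use A B in auto)
  also have "\<dots> = emeasure lebesgue A * emeasure lebesgue B" using aeq[OF A] aeq[OF B] by simp
  finally show "emeasure lebesgue (A \<times> B) = emeasure lebesgue A * emeasure lebesgue B" .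
qed

locale cyl = domain D for D :: "(real^'d) set" +
  fixes T :: real
  assumes T: "T > 0"
begin

abbreviation "MT \<equiv> lebesgue_on {0..T}"
abbreviation "QM \<equiv> MT \<Otimes>\<^sub>M MD"

lemma finT: "finite_measure MT"
  by (rule finite_measure_lebesgue_on) (metis lmeasurable_cbox interval_cbox)

lemma QT_sets: "QT D T \<in> sets borel" "QT D T \<in> sets lebesgue"
proof -
  have "open (QT D T)" unfolding QT_def by (intro open_Times openD) auto
  then show "QT D T \<in> sets borel" "QT D T \<in> sets lebesgue" by auto
qed

lemma sets_MT: "A \<in> sets MT \<longleftrightarrow> A \<subseteq> {0..T} \<and> A \<in> sets lebesgue"
  by (subst sets_restrict_space_iff) auto

lemma sets_MD: "B \<in> sets MD \<longleftrightarrow> B \<subseteq> D \<and> B \<in> sets lebesgue"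
  using D_sets by (subst sets_restrict_space_iff) auto

lemma id_meas: "(\<lambda>z. z) \<in> measurable (lebesgue_on (QT D T)) QM"
proof (rule measurable_sigma_sets[OF sets_pair_measure])
  show "(\<lambda>z. z) \<in> space (lebesgue_on (QT D T)) \<rightarrow> space MT \<times> space MD" by (auto simp: QT_def)
  fix y assume "y \<in> {a \<times> b |a b. a \<in> sets MT \<and> b \<in> sets MD}"
  then obtain A B where y: "y = A \<times> B" "A \<in> sets lebesgue" "B \<in> sets lebesgue" by (auto simp: sets_MT sets_MD)
  have "A \<times> B \<inter> QT D T \<in> sets lebesgue" using lebesgue_Times(1)[OF y(2,3)] QT_sets by auto
  then show "(\<lambda>z. z) -` y \<inter> space (lebesgue_on (QT D T)) \<in> sets (lebesgue_on (QT D T))"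
    unfolding y(1) using QT_sets by (subst sets_restrict_space_iff) auto
qed (auto simp: sets_MT sets_MD)

text \<open>The problem is posed with the Lebesgue sets of the open cylinder, while slicing uses the
  coarser product of the sigma-algebras of [0,T] and D. The identity carries the first measure to
  the second: both agree on rectangles, since the endpoints of [0,T] are null.\<close>

lemma QM_distr: "QM = distr (lebesgue_on (QT D T)) QM (\<lambda>z. z)"
proof (rule pair_measure_eqI)
  show "sigma_finite_measure MT" "sigma_finite_measure MD" using finT finD by (auto simp: finite_measure_def)
  fix A B assume "A \<in> sets MT" "B \<in> sets MD"
  then have A: "A \<subseteq> {0..T}" "A \<in> sets lebesgue" and B: "B \<subseteq> D" "B \<in> sets lebesgue" by (auto simp: sets_MT sets_MD)
  have A': "A \<inter> {0<..<T} \<in> sets lebesgue" using A(2) by auto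
  have "AE t in lborel. t \<noteq> 0 \<and> t \<noteq> T" by (intro AE_conjI AE_lborel_singleton)
  then have "AE t in lebesgue. t \<noteq> 0 \<and> t \<noteq> T" by (rule AE_completion)
  then have eA: "emeasure lebesgue (A \<inter> {0<..<T}) = emeasure lebesgue A"
    by (intro emeasure_eq_AE A A') (use A(1) in \<open>fastforce elim!: eventually_mono simp: subset_iff order_le_less\<close>)
  have "emeasure (distr (lebesgue_on (QT D T)) QM (\<lambda>z. z)) (A \<times> B) = emeasure (lebesgue_on (QT D T)) (A \<times> B \<inter> QT D T)"
    using \<open>A \<in> sets MT\<close> \<open>B \<in> sets MD\<close> by (subst emeasure_distr[OF id_meas]) auto
  also have "A \<times> B \<inter> QT D T = (A \<inter> {0<..<T}) \<times> B" using B by (auto simp: QT_def)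
  also have "emeasure (lebesgue_on (QT D T)) ((A \<inter> {0<..<T}) \<times> B) = emeasure lebesgue ((A \<inter> {0<..<T}) \<times> B)"
    using B QT_sets by (subst emeasure_restrict_space) (auto simp: QT_def)
  also have "\<dots> = emeasure lebesgue A * emeasure lebesgue B" by (simp only: lebesgue_Times(2)[OF A' B(2)] eA)
  also have "\<dots> = emeasure MT A * emeasure MD B"
    using A B D_sets by (simp add: emeasure_restrict_space)
  finally show "emeasure MT A * emeasure MD B = emeasure (distr (lebesgue_on (QT D T)) QM (\<lambda>z. z)) (A \<times> B)" by simp
qed simp

lemma id_borel: "(\<lambda>z. z) \<in> measurable QM borel"
proof -
  have [measurable]: "(\<lambda>t. t) \<in> borel_measurable MT" "(\<lambda>x. x) \<in> borel_measurable MD"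
    by (auto intro!: cont_meas_MT cont_meas_D)
  have "(\<lambda>z. (fst z, snd z)) \<in> measurable QM (borel \<Otimes>\<^sub>M borel)" by measurable
  then show ?thesis by (simp add: borel_prod)
qed

text \<open>A Lebesgue null set of the cylinder need not be measurable for the product, so it is
  first enclosed in a Borel null set.\<close>

lemma AE_QT_QM: assumes "AE z in lebesgue_on (QT D T). P z" shows "AE z in QM. P z"
proof -
  have "AE z in lebesgue. z \<in> QT D T \<longrightarrow> P z" using assms QT_sets by (subst (asm) AE_restrict_space_iff) auto
  then have "AE z in lborel. z \<in> QT D T \<longrightarrow> P z" by (simp add: AE_completion_iff)
  then obtain N where N: "{z \<in> space lborel. \<not> (z \<in> QT D T \<longrightarrow> P z)} \<subseteq> N" "emeasure lborel N = 0" "N \<in> sets lborel"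
    by (rule AE_E)
  \<comment> \<open>Adding the complement of the open cylinder also discards the two endpoint
    times.\<close>
  define V where "V = N \<union> - QT D T"
  have V: "V \<in> sets borel" using N(3) QT_sets by (auto simp: V_def)
  have V': "V \<inter> space QM \<in> sets QM" using measurable_sets[OF id_borel V] by simp
  have "emeasure QM (V \<inter> space QM) = emeasure (lebesgue_on (QT D T)) (V \<inter> QT D T)"
  proof -
    have "emeasure QM (V \<inter> space QM) = emeasure (distr (lebesgue_on (QT D T)) QM (\<lambda>z. z)) (V \<inter> space QM)" using QM_distr by simp
    also have "\<dots> = emeasure (lebesgue_on (QT D T)) (V \<inter> QT D T)"
      by (subst emeasure_distr[OF id_meas V']) (auto simp: QT_def space_pair_measure intro!: arg_cong[where f="emeasure _"])
    finally show ?thesis .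
  qed
  also have "\<dots> \<le> emeasure lebesgue N"
    using N(3) V QT_sets by (subst emeasure_restrict_space) (auto simp: V_def intro!: emeasure_mono)
  also have "\<dots> = 0" using N by simp
  finally have "AE z in QM. z \<notin> V \<inter> space QM" using V' by (intro AE_not_in) (auto simp: null_sets_def)
  with AE_space[of QM] show ?thesis by eventually_elim (use N(1) in \<open>auto simp: V_def\<close>)
qed

lemma QM_meas_QT: "f \<in> measurable QM N \<Longrightarrow> f \<in> measurable (lebesgue_on (QT D T)) N"
  using measurable_compose[OF id_meas] by blast

lemma integral_QT_QM:
  fixes f :: "_ \<Rightarrow> real"
  assumes "f \<in> borel_measurable QM"
  shows "integral\<^sup>L (lebesgue_on (QT D T)) f = integral\<^sup>L QM f" "integrable (lebesgue_on (QT D T)) f \<longleftrightarrow> integrable QM f"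
proof -
  have "integral\<^sup>L QM f = integral\<^sup>L (distr (lebesgue_on (QT D T)) QM (\<lambda>z. z)) f" using QM_distr by simp
  also have "\<dots> = integral\<^sup>L (lebesgue_on (QT D T)) f" by (rule integral_distr[OF id_meas assms])
  finally show "integral\<^sup>L (lebesgue_on (QT D T)) f = integral\<^sup>L QM f" by simp
  have "integrable QM f \<longleftrightarrow> integrable (distr (lebesgue_on (QT D T)) QM (\<lambda>z. z)) f" using QM_distr by simp
  also have "\<dots> \<longleftrightarrow> integrable (lebesgue_on (QT D T)) f" by (rule integrable_distr_eq[OF id_meas assms])
  finally show "integrable (lebesgue_on (QT D T)) f \<longleftrightarrow> integrable QM f" by simp
qed

lemma AE_QM_QT: assumes "AE z in QM. P z" shows "AE z in lebesgue_on (QT D T). P z"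
proof -
  have "AE z in distr (lebesgue_on (QT D T)) QM (\<lambda>z. z). P z"
    using assms by (rule subst[where P="\<lambda>N. almost_everywhere N P", OF QM_distr])
  then show ?thesis by (rule AE_distrD[OF id_meas])
qed

lemma pairQ: "pair_sigma_finite MT MD" by (rule pair_sf[OF finT finD])

text \<open>A Borel version is measurable for the product, so Fubini applies to it. The given field
  itself may have nonmeasurable slices at a null set of times.\<close>

lemma QT_version:
  fixes g :: "real \<Rightarrow> real^'d \<Rightarrow> 'b::euclidean_space"
  assumes "(\<lambda>(t,x). g t x) \<in> borel_measurable (lebesgue_on (QT D T))"
  shows "\<exists>h\<in>borel_measurable QM. (AE z in lebesgue_on (QT D T). g (fst z) (snd z) = h z) \<and> (AE t in MT. AE x in MD. g t x = h (t,x))"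
proof -
  obtain h where h: "h \<in> borel_measurable borel" "AE z in lebesgue_on (QT D T). (\<lambda>(t,x). g t x) z = h z"
    using lebesgue_on_borel_version[OF QT_sets(1) assms] by blast
  interpret P: pair_sigma_finite MT MD by (rule pairQ)
  have 1: "AE z in lebesgue_on (QT D T). g (fst z) (snd z) = h z" using h(2) by (simp add: case_prod_beta)
  have "h \<in> borel_measurable QM" using measurable_compose[OF id_borel h(1)] by simp
  moreover have "AE t in MT. AE x in MD. g t x = h (t,x)" using P.AE_pair[OF AE_QT_QM[OF 1]] by simp
  ultimately show ?thesis using 1 by blast
qed

lemma L2Q_version:
  fixes g :: "real \<Rightarrow> real^'d \<Rightarrow> 'b::euclidean_space"
  assumes "L2Q D T g"
  shows "\<exists>h. l2 QM h \<and> L2Qnorm D T g = l2n QM h \<and> (AE z in lebesgue_on (QT D T). g (fst z) (snd z) = h z) \<and> (AE t in MT. AE x in MD. g t x = h (t,x))"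
proof -
  have m: "(\<lambda>(t,x). g t x) \<in> borel_measurable (lebesgue_on (QT D T))" using assms by (simp add: L2Q_def)
  obtain h where h: "h \<in> borel_measurable QM" "AE z in lebesgue_on (QT D T). g (fst z) (snd z) = h z" "AE t in MT. AE x in MD. g t x = h (t,x)"
    using QT_version[OF m] by blast
  have h': "(\<lambda>z. (norm (h z))\<^sup>2) \<in> borel_measurable QM" using h(1) by measurable
  have ae: "AE z in lebesgue_on (QT D T). (\<lambda>(t,x). (norm (g t x))\<^sup>2) z = (norm (h z))\<^sup>2" using h(2) by eventually_elim (simp add: case_prod_beta)
  have mm: "(\<lambda>(t,x). (norm (g t x))\<^sup>2) \<in> borel_measurable (lebesgue_on (QT D T))" using assms by (auto simp: L2Q_def)
  have "integrable (lebesgue_on (QT D T)) (\<lambda>(t,x). (norm (g t x))\<^sup>2)" using assms by (simp add: L2Q_def)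
  then have "integrable (lebesgue_on (QT D T)) (\<lambda>z. (norm (h z))\<^sup>2)"
    by (subst (asm) integrable_cong_AE[OF mm QM_meas_QT[OF h'] ae])
  then have "l2 QM h" using integral_QT_QM(2)[OF h'] h(1) by (simp add: l2_def)
  moreover have "L2Qnorm D T g = l2n QM h"
    unfolding L2Qnorm_def l2n_def integral_cong_AE[OF mm QM_meas_QT[OF h'] ae] integral_QT_QM(1)[OF h'] ..
  ultimately show ?thesis using h by blast
qed

lemma l2_QM_L2Q:
  assumes "l2 QM h" shows "L2Q D T (\<lambda>t x. h (t,x))"
proof -
  have e: "(\<lambda>(t,x). h (t,x)) = h" "(\<lambda>(t,x). (norm (h (t,x)))\<^sup>2) = (\<lambda>z. (norm (h z))\<^sup>2)" by auto
  have m: "(\<lambda>z. (norm (h z))\<^sup>2) \<in> borel_measurable QM" using l2_meas[OF assms] by measurable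
  have "integrable (lebesgue_on (QT D T)) (\<lambda>z. (norm (h z))\<^sup>2)"
    unfolding integral_QT_QM(2)[OF m] by (rule l2_integrable_sq[OF assms])
  then show ?thesis unfolding L2Q_def e using QM_meas_QT[OF l2_meas[OF assms]] by blast
qed

lemma meas_AE_MT:
  fixes f g :: "real \<Rightarrow> 'b::topological_space"
  shows "g \<in> borel_measurable MT \<Longrightarrow> AE t in MT. f t = g t \<Longrightarrow> f \<in> borel_measurable MT"
  by (rule meas_AE_lebesgue_on) auto

lemma meas_AE_MD:
  fixes f g :: "real^'d \<Rightarrow> 'b::topological_space"
  shows "g \<in> borel_measurable MD \<Longrightarrow> AE t in MD. f t = g t \<Longrightarrow> f \<in> borel_measurable MD"
  by (rule meas_AE_lebesgue_on) (use D_sets in auto)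

lemma integral_AE_MT:
  fixes f g :: "real \<Rightarrow> real"
  assumes "g \<in> borel_measurable MT" "AE t in MT. f t = g t" shows "integral\<^sup>L MT f = integral\<^sup>L MT g"
  by (rule integral_cong_AE[OF meas_AE_MT[OF assms] assms])

lemma integral_AE_MD:
  fixes f g :: "real^'d \<Rightarrow> real"
  assumes "g \<in> borel_measurable MD" "AE t in MD. f t = g t" shows "integral\<^sup>L MD f = integral\<^sup>L MD g"
  by (rule integral_cong_AE[OF meas_AE_MD[OF assms] assms])

end

lemma L2vnorm_eq: "L2vnorm D g = l2n (lebesgue_on D) g"
  by (simp add: L2vnorm_def l2n_def)

lemma L2v_eq: "L2v D g \<longleftrightarrow> l2 (lebesgue_on D) g"
  by (simp add: L2v_def l2_def)

lemma L2_eq: "L2 D g \<longleftrightarrow> l2 (lebesgue_on D) g"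
  by (simp add: L2_def l2_def)

lemma L2norm_eq: "L2norm D g = l2n (lebesgue_on D) g"
  by (simp add: L2norm_def l2n_def)

text \<open>If the Jacobian has norm zero, any admissible constant already forces F v = 0. Otherwise
  |F v| divided by that norm lies below every admissible constant, hence below their
  infimum.\<close>

lemma Hm1norm_nonneg_bound:
  assumes "Hm1 D F"
  shows "0 \<le> Hm1norm D F" "\<And>v G. H01 D v G \<Longrightarrow> \<bar>F v\<bar> \<le> Hm1norm D F * L2vnorm D G"
proof -
  let ?X = "{C. C \<ge> 0 \<and> (\<forall>v G. H01 D v G \<longrightarrow> \<bar>F v\<bar> \<le> C * L2vnorm D G)}"
  obtain C where C: "\<forall>v G. H01 D v G \<longrightarrow> \<bar>F v\<bar> \<le> C * L2vnorm D G" using assms by (auto simp: Hm1_def)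
  have "\<bar>F v\<bar> \<le> max C 0 * L2vnorm D G" if "H01 D v G" for v G
  proof -
    have "\<bar>F v\<bar> \<le> C * L2vnorm D G" using C that by blast
    also have "\<dots> \<le> max C 0 * L2vnorm D G" by (intro mult_right_mono) (auto simp: L2vnorm_eq)
    finally show ?thesis .
  qed
  then have "max C 0 \<in> ?X" by auto
  then have ne: "?X \<noteq> {}" by blast
  show "0 \<le> Hm1norm D F" unfolding Hm1norm_def by (rule cInf_greatest[OF ne]) auto
  fix v G assume h: "H01 D v G"
  show "\<bar>F v\<bar> \<le> Hm1norm D F * L2vnorm D G"
  proof (cases "L2vnorm D G = 0")
    case True
    then show ?thesis using C h by fastforce
  next
    case False
    then have p: "L2vnorm D G > 0" by (simp add: L2vnorm_eq order_less_le)
    have "\<bar>F v\<bar> / L2vnorm D G \<le> Hm1norm D F" unfolding Hm1norm_def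
      by (rule cInf_greatest[OF ne]) (use h p in \<open>auto simp: field_simps\<close>)
    then show ?thesis using p by (simp add: field_simps)
  qed
qed

section \<open>Slices in time and the dual of the Dirichlet space\<close>

context cyl
begin

lemmas ipQ = ip_slice[OF finT finD]
lemmas sliceQ = slice_l2[OF finT finD]

lemma slice_meas:
  assumes f: "f \<in> borel_measurable QM" and t: "t \<in> {0..T}"
  shows "(\<lambda>x. f (t,x)) \<in> borel_measurable MD"
proof -
  have "t \<in> space MT" using t by simp
  from measurable_compose[OF measurable_Pair1'[OF this] f] show ?thesis .
qed

lemma tensorQ:
  assumes "continuous_on UNIV \<phi>" "l2 MD k" shows "l2 QM (\<lambda>z. (\<phi> (fst z) :: real) *\<^sub>R k (snd z))"
proof -
  \<comment> \<open>The locale is entered with K all of L2, which gives access to its facts about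
    products.\<close>
  interpret E: evol T MD "{k. l2 MD k}"
  proof (rule evol.intro)
    show "0 < T" "finite_measure MD" by (fact T, fact finD)
  qed (simp_all add: l2_lin)
  show ?thesis by (rule E.tensor_l2[OF assms])
qed

lemma ip_tensorQ:
  assumes "continuous_on UNIV \<phi>" "l2 MD k" "l2 QM Z"
  shows "ip QM Z (\<lambda>z. \<phi> (fst z) *\<^sub>R k (snd z)) = (\<integral>t. \<phi> t * ip MD (\<lambda>x. Z (t,x)) k \<partial>MT)"
  using ipQ(1)[OF assms(3) tensorQ[OF assms(1,2)]] by (simp add: ip_scale_right)

lemma ip_sliceQ_integrable:
  assumes "l2 MD k" "l2 QM Z"
  shows "integrable MT (\<lambda>t. ip MD (\<lambda>x. Z (t,x)) k)"
  using ipQ(2)[OF assms(2) tensorQ[OF continuous_on_const[of _ 1] assms(1)]] by simp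

lemma slice_norm_l2:
  assumes "l2 QM Z"
  shows "l2 MT (\<lambda>t. l2n MD (\<lambda>x. Z (t,x)))" "l2n MT (\<lambda>t. l2n MD (\<lambda>x. Z (t,x))) = l2n QM Z"
proof -
  have i: "integrable MT (\<lambda>t. (l2n MD (\<lambda>x. Z (t,x)))\<^sup>2)" unfolding l2n_sq by (rule ipQ(2)[OF assms assms])
  then have "(\<lambda>t. sqrt ((l2n MD (\<lambda>x. Z (t,x)))\<^sup>2)) \<in> borel_measurable MT" by measurable
  then show "l2 MT (\<lambda>t. l2n MD (\<lambda>x. Z (t,x)))" using i by (simp add: l2_def)
  have "(l2n MT (\<lambda>t. l2n MD (\<lambda>x. Z (t,x))))\<^sup>2 = (l2n QM Z)\<^sup>2"
    unfolding l2n_sq[of QM] ipQ(1)[OF assms assms] by (simp add: l2n_sq ip_def flip: power2_eq_square)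
  then show "l2n MT (\<lambda>t. l2n MD (\<lambda>x. Z (t,x))) = l2n QM Z" by (rule power2_eq_imp_eq) auto
qed

lemma slice_dominated:
  assumes "l2 QM F" "l2 QM G" "AE t in MT. l2n MD (\<lambda>x. G (t,x)) \<le> C * l2n MD (\<lambda>x. F (t,x))" "C \<ge> 0"
  shows "l2n QM G \<le> C * l2n QM F"
  using l2n_bound[OF slice_norm_l2(1)[OF assms(1)] slice_norm_l2(1)[OF assms(2)] _ assms(4)] assms(3)
  by (simp add: slice_norm_l2(2) assms)

text \<open>Riesz representation in space-time: the forcing may be taken in divergence form.\<close>

lemma Hm1_repr:
  assumes s: "L2Hm1 D T s"
  shows "\<exists>S. l2 QM S \<and> l2n QM S \<le> L2Hm1norm D T s \<and>
    (\<forall>\<phi> v Gv. continuous_on UNIV \<phi> \<longrightarrow> H01 D v Gv \<longrightarrow> (\<integral>t. s t v * \<phi> t \<partial>MT) = (\<integral>t. ip MD (\<lambda>x. S (t,x)) Gv * \<phi> t \<partial>MT))"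
proof -
  have hm: "AE t in MT. Hm1 D (s t)" and sm: "\<And>v G. H01 D v G \<Longrightarrow> (\<lambda>t. s t v) \<in> borel_measurable MT"
    and nl: "l2 MT (\<lambda>t. Hm1norm D (s t))" using s by (auto simp: L2Hm1_def l2_def)
  have nn: "l2n MT (\<lambda>t. Hm1norm D (s t)) = L2Hm1norm D T s" by (simp add: l2n_def L2Hm1norm_def)
  \<comment> \<open>R pairs slicewise gradient fields with the integral of s t applied to the
    potentials. A measurable version h of the integrand is part of the data, because
    \<open>L2Hm1\<close> gives measurability only for a field independent of t.\<close>
  define R where "R = {(\<psi>, y). l2 QM \<psi> \<and> (\<exists>\<xi> h. (\<forall>t. H01 D (\<xi> t) (\<lambda>x. \<psi> (t,x))) \<and> h \<in> borel_measurable MT \<and>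
     (AE t in MT. h t = s t (\<xi> t)) \<and> y = (\<integral>t. h t \<partial>MT))}"
  have bnd: "l2 QM \<psi> \<and> integrable MT h \<and> \<bar>\<integral>t. h t \<partial>MT\<bar> \<le> L2Hm1norm D T s * l2n QM \<psi>"
    if l: "l2 QM \<psi>" and x: "\<forall>t. H01 D (\<xi> t) (\<lambda>x. \<psi> (t,x))" and h: "h \<in> borel_measurable MT" "AE t in MT. h t = s t (\<xi> t)" for \<psi> \<xi> h
  proof -
    note sl = slice_norm_l2[OF l]
    have i: "integrable MT (\<lambda>t. Hm1norm D (s t) * l2n MD (\<lambda>x. \<psi> (t,x)))" using l2_integrable_inner[OF nl sl(1)] by simp
    have ae: "AE t in MT. norm (h t) \<le> Hm1norm D (s t) * l2n MD (\<lambda>x. \<psi> (t,x))"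
      using hm h(2)
    proof eventually_elim
      case (elim t)
      show ?case using Hm1norm_nonneg_bound(2)[OF elim(1), of "\<xi> t" "\<lambda>x. \<psi> (t,x)"] x elim(2) by (simp add: L2vnorm_eq)
    qed
    have ih: "integrable MT h"
      by (rule Bochner_Integration.integrable_bound[OF i h(1)]) (use ae in \<open>eventually_elim, auto\<close>)
    have "\<bar>\<integral>t. h t \<partial>MT\<bar> \<le> (\<integral>t. norm (h t) \<partial>MT)" using integral_norm_bound[of MT h] by simp
    also have "\<dots> \<le> (\<integral>t. Hm1norm D (s t) * l2n MD (\<lambda>x. \<psi> (t,x)) \<partial>MT)"
      by (rule integral_mono_AE) (use ih i ae in auto)
    also have "\<dots> \<le> l2n MT (\<lambda>t. Hm1norm D (s t)) * l2n MT (\<lambda>t. l2n MD (\<lambda>x. \<psi> (t,x)))"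
      using l2_CS[OF nl sl(1)] by (simp add: ip_def)
    finally show ?thesis using l ih by (simp add: nn sl)
  qed
  have "\<exists>z. l2 QM z \<and> l2n QM z \<le> L2Hm1norm D T s \<and> (\<exists>f. (\<forall>n. f n \<in> fst ` R) \<and> (\<lambda>n. l2n QM (\<lambda>x. f n x - z x)) \<longlonglongrightarrow> 0)
     \<and> (\<forall>(f,y)\<in>R. ip QM z f = y)"
  proof (rule riesz_relation)
    have "AE t in MT. 0 = s t (\<lambda>x. 0)" using hm
    proof eventually_elim
      case (elim t) then show ?case using Hm1norm_nonneg_bound(2)[OF elim H01_zero] by (simp add: L2vnorm_eq)
    qed
    then have "(\<lambda>z. 0, 0) \<in> R" unfolding R_def using H01_zero by (auto intro!: exI[of _ "\<lambda>t x. 0"] exI[of _ "\<lambda>t. 0::real"])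
    then show "R \<noteq> {}" by blast
    show "l2 QM \<psi> \<and> \<bar>y\<bar> \<le> L2Hm1norm D T s * l2n QM \<psi>" if "(\<psi>, y) \<in> R" for \<psi> y
      using that bnd unfolding R_def by blast
    show "0 \<le> L2Hm1norm D T s" by (simp add: nn[symmetric])
  next
    fix \<psi> y \<psi>' y' a b assume "(\<psi>, y) \<in> R" "(\<psi>', y') \<in> R"
    then obtain \<xi> h \<xi>' h' where l: "l2 QM \<psi>" "l2 QM \<psi>'" and x: "\<forall>t. H01 D (\<xi> t) (\<lambda>x. \<psi> (t,x))" "\<forall>t. H01 D (\<xi>' t) (\<lambda>x. \<psi>' (t,x))"
      and h: "h \<in> borel_measurable MT" "AE t in MT. h t = s t (\<xi> t)" "h' \<in> borel_measurable MT" "AE t in MT. h' t = s t (\<xi>' t)"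
      and y: "y = (\<integral>t. h t \<partial>MT)" "y' = (\<integral>t. h' t \<partial>MT)" unfolding R_def by blast
    have i: "integrable MT h" "integrable MT h'" using bnd[OF l(1) x(1) h(1,2)] bnd[OF l(2) x(2) h(3,4)] by auto
    have "AE t in MT. a * h t + b * h' t = s t (\<lambda>x. a *\<^sub>R \<xi> t x + b *\<^sub>R \<xi>' t x)"
      using hm h(2) h(4)
    proof eventually_elim
      case (elim t)
      have "s t (\<lambda>x. a *\<^sub>R \<xi> t x + b *\<^sub>R \<xi>' t x) = a * s t (\<xi> t) + b * s t (\<xi>' t)"
        using elim(1) x(1)[rule_format, of t] x(2)[rule_format, of t] unfolding Hm1_def by blast
      then show ?case using elim by simp
    qed
    moreover have "a * y + b * y' = (\<integral>t. a * h t + b * h' t \<partial>MT)" unfolding y using i by simp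
    moreover have "\<forall>t. H01 D (\<lambda>x. a *\<^sub>R \<xi> t x + b *\<^sub>R \<xi>' t x) (\<lambda>x. a *\<^sub>R \<psi> (t,x) + b *\<^sub>R \<psi>' (t,x))" using x H01_lin by blast
    ultimately show "(\<lambda>x. a *\<^sub>R \<psi> x + b *\<^sub>R \<psi>' x, a * y + b * y') \<in> R"
      unfolding R_def using l2_lin[OF l, of a b] h(1,3)
      by (auto intro!: exI[of _ "\<lambda>t x. a *\<^sub>R \<xi> t x + b *\<^sub>R \<xi>' t x"] exI[of _ "\<lambda>t. a * h t + b * h' t"])
  qed
  then obtain S where S: "l2 QM S" "l2n QM S \<le> L2Hm1norm D T s" "\<forall>(f,y)\<in>R. ip QM S f = y" by blast
  have "(\<integral>t. s t v * \<phi> t \<partial>MT) = (\<integral>t. ip MD (\<lambda>x. S (t,x)) Gv * \<phi> t \<partial>MT)" if c: "continuous_on UNIV \<phi>" and h: "H01 D v Gv" for \<phi> v Gv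
  proof -
    have [measurable]: "\<phi> \<in> borel_measurable MT" "(\<lambda>t. s t v) \<in> borel_measurable MT" using cont_meas_MT[OF c] sm[OF h] by auto
    have "AE t in MT. \<phi> t * s t v = s t (\<lambda>x. \<phi> t *\<^sub>R v x)" using hm
    proof eventually_elim
      case (elim t)
      then have "s t (\<lambda>x. \<phi> t *\<^sub>R v x + 0 *\<^sub>R v x) = \<phi> t * s t v + 0 * s t v" unfolding Hm1_def using h by blast
      then show ?case by simp
    qed
    moreover have "H01 D (\<lambda>x. \<phi> t *\<^sub>R v x) (\<lambda>x. \<phi> t *\<^sub>R Gv x)" for t using H01_lin[OF h h, of "\<phi> t" 0] by simp
    ultimately have "(\<lambda>z. \<phi> (fst z) *\<^sub>R Gv (snd z), \<integral>t. \<phi> t * s t v \<partial>MT) \<in> R"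
      unfolding R_def using tensorQ[OF c H01_l2(2)[OF h]]
      by (auto intro!: exI[of _ "\<lambda>t x. \<phi> t *\<^sub>R v x"] exI[of _ "\<lambda>t. \<phi> t * s t v"])
    then have "ip QM S (\<lambda>z. \<phi> (fst z) *\<^sub>R Gv (snd z)) = (\<integral>t. \<phi> t * s t v \<partial>MT)" using bspec[OF S(3)] by fastforce
    then show ?thesis unfolding ip_tensorQ[OF c H01_l2(2)[OF h] S(1)] by (simp add: mult.commute)
  qed
  with S show ?thesis by blast
qed

text \<open>By the Poincare inequality the potentials of a Cauchy sequence of gradients are
  themselves a Cauchy sequence.\<close>

lemma grad_closed:
  assumes n: "\<And>n. H01 D (v n) (G n)" and H: "l2 MD H" and lim: "(\<lambda>n. l2n MD (\<lambda>x. G n x - H x)) \<longlonglongrightarrow> 0"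
  shows "\<exists>w. H01 D w H"
proof -
  obtain CP where CP: "CP \<ge> 0" "\<And>v G. H01 D v G \<Longrightarrow> l2n MD v \<le> CP * l2n MD G" using poincare by blast
  note l = H01_l2[OF n]
  have "\<exists>w. l2 MD w \<and> (\<lambda>k. l2n MD (\<lambda>x. v k x - w x)) \<longlonglongrightarrow> 0"
  proof (rule l2_complete[OF l(1)])
    fix e :: real assume e: "e > 0"
    have "\<forall>\<^sub>F k in sequentially. l2n MD (\<lambda>x. G k x - H x) < e / (CP + 1) / 2"
      by (rule order_tendstoD(2)[OF lim]) (use e CP in auto)
    then obtain k where k: "\<And>m. m \<ge> k \<Longrightarrow> l2n MD (\<lambda>x. G m x - H x) < e / (CP + 1) / 2" by (auto simp: eventually_sequentially)
    have "l2n MD (\<lambda>x. v i x - v j x) < e" if "i \<ge> k" "j \<ge> k" for i j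
    proof -
      have "H01 D (\<lambda>x. v i x - v j x) (\<lambda>x. G i x - G j x)" using H01_lin[OF n n, of 1 i "-1" j] by simp
      from CP(2)[OF this] have "l2n MD (\<lambda>x. v i x - v j x) \<le> CP * l2n MD (\<lambda>x. G i x - G j x)" .
      also have "\<dots> \<le> (CP + 1) * l2n MD (\<lambda>x. G i x - G j x)" by (intro mult_right_mono) auto
      finally have 1: "l2n MD (\<lambda>x. v i x - v j x) \<le> (CP + 1) * l2n MD (\<lambda>x. G i x - G j x)" .
      have "l2n MD (\<lambda>x. G i x - G j x) < e / (CP + 1)"
      proof -
        show "l2n MD (\<lambda>x. G i x - G j x) < e / (CP + 1)"
          using l2n_diff_triangle[OF l(2)[of i] H l(2)[of j]] l2n_diff_commute[of MD H "G j"] k[OF that(1)] k[OF that(2)] by linarith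
      qed
      then have "(CP + 1) * l2n MD (\<lambda>x. G i x - G j x) < (CP + 1) * (e / (CP + 1))" using CP(1) by (intro mult_strict_left_mono) auto
      also have "(CP + 1) * (e / (CP + 1)) = e" using CP(1) by simp
      finally show "l2n MD (\<lambda>x. v i x - v j x) < e" using 1 by simp
    qed
    then show "\<exists>k. \<forall>m\<ge>k. \<forall>n\<ge>k. l2n MD (\<lambda>x. v m x - v n x) < e" by blast
  qed
  then obtain w where "l2 MD w" "(\<lambda>k. l2n MD (\<lambda>x. v k x - w x)) \<longlonglongrightarrow> 0" by blast
  from H01_closed[OF n this(1) H this(2) lim] show ?thesis by blast
qed

text \<open>The functional is represented by a field W in the closure of the gradient fields rather
  than by the pair A, b. For almost every t the slice W(t) is then itself a gradient, so the dual
  norm at t is attained and equals the norm of W(t); this makes it measurable in t.\<close>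

lemma dual_repr:
  assumes A: "l2 QM A" and b: "l2 QM b" and CP: "CP \<ge> 0" "\<And>v G. H01 D v G \<Longrightarrow> l2n MD v \<le> CP * l2n MD G"
  shows "\<exists>w. L2Hm1 D T w \<and> L2Hm1norm D T w \<le> l2n QM A + CP * l2n QM b \<and>
    (\<forall>\<phi> v Gv. continuous_on UNIV \<phi> \<longrightarrow> H01 D v Gv \<longrightarrow>
       (\<integral>t. w t v * \<phi> t \<partial>MT) = ip QM A (\<lambda>z. \<phi> (fst z) *\<^sub>R Gv (snd z)) + ip QM b (\<lambda>z. \<phi> (fst z) *\<^sub>R v (snd z)))"
proof -
  define R where "R = {(\<psi>, y). l2 QM \<psi> \<and> (\<exists>\<xi>. l2 QM \<xi> \<and> (\<forall>t. H01 D (\<lambda>x. \<xi> (t,x)) (\<lambda>x. \<psi> (t,x))) \<and> y = ip QM A \<psi> + ip QM b \<xi>)}"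
  let ?C = "l2n QM A + CP * l2n QM b"
  have "\<exists>z. l2 QM z \<and> l2n QM z \<le> ?C \<and> (\<exists>f. (\<forall>n. f n \<in> fst ` R) \<and> (\<lambda>n. l2n QM (\<lambda>x. f n x - z x)) \<longlonglongrightarrow> 0)
     \<and> (\<forall>(f,y)\<in>R. ip QM z f = y)"
  proof (rule riesz_relation)
    have "(\<lambda>z. 0, 0) \<in> R" unfolding R_def using H01_zero by (auto intro!: exI[of _ "\<lambda>z. 0"] simp: ip_def)
    then show "R \<noteq> {}" by blast
    show "0 \<le> ?C" using CP by simp
  next
    fix \<psi> y assume "(\<psi>, y) \<in> R"
    then obtain \<xi> where l: "l2 QM \<psi>" "l2 QM \<xi>" and h: "\<And>t. H01 D (\<lambda>x. \<xi> (t,x)) (\<lambda>x. \<psi> (t,x))" and y: "y = ip QM A \<psi> + ip QM b \<xi>"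
      unfolding R_def by blast
    have "l2n QM \<xi> \<le> CP * l2n QM \<psi>" by (rule slice_dominated[OF l]) (use CP h in auto)
    then have "l2n QM b * l2n QM \<xi> \<le> l2n QM b * (CP * l2n QM \<psi>)" by (intro mult_left_mono) auto
    then have "\<bar>y\<bar> \<le> ?C * l2n QM \<psi>" unfolding y using l2_CS[OF A l(1)] l2_CS[OF b l(2)] by (simp add: algebra_simps)
    with l show "l2 QM \<psi> \<and> \<bar>y\<bar> \<le> ?C * l2n QM \<psi>" by blast
  next
    fix \<psi> y \<psi>' y' a c assume "(\<psi>, y) \<in> R" "(\<psi>', y') \<in> R"
    then obtain \<xi> \<xi>' where l: "l2 QM \<psi>" "l2 QM \<xi>" "l2 QM \<psi>'" "l2 QM \<xi>'" and h: "\<And>t. H01 D (\<lambda>x. \<xi> (t,x)) (\<lambda>x. \<psi> (t,x))" "\<And>t. H01 D (\<lambda>x. \<xi>' (t,x)) (\<lambda>x. \<psi>' (t,x))"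
       and y: "y = ip QM A \<psi> + ip QM b \<xi>" "y' = ip QM A \<psi>' + ip QM b \<xi>'"
      unfolding R_def by blast
    have "a * y + c * y' = ip QM A (\<lambda>z. a *\<^sub>R \<psi> z + c *\<^sub>R \<psi>' z) + ip QM b (\<lambda>z. a *\<^sub>R \<xi> z + c *\<^sub>R \<xi>' z)"
      unfolding ip_lin_right[OF l(1,3) A] ip_lin_right[OF l(2,4) b] y by (simp add: algebra_simps)
    then show "(\<lambda>x. a *\<^sub>R \<psi> x + c *\<^sub>R \<psi>' x, a * y + c * y') \<in> R"
      unfolding R_def using l2_lin[OF l(1,3), of a c] l2_lin[OF l(2,4), of a c] H01_lin[OF h]
      by (auto intro!: exI[of _ "\<lambda>z. a *\<^sub>R \<xi> z + c *\<^sub>R \<xi>' z"])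
  qed
  then obtain W f where W: "l2 QM W" "l2n QM W \<le> ?C" "\<forall>n. f n \<in> fst ` R" "(\<lambda>n. l2n QM (\<lambda>x. f n x - W x)) \<longlonglongrightarrow> 0" "\<forall>(f,y)\<in>R. ip QM W f = y" by blast
  have f: "l2 QM (f n)" "\<exists>\<xi>. H01 D \<xi> (\<lambda>x. f n (t,x))" for n t
  proof -
    obtain y where "(f n, y) \<in> R" using W(3)[rule_format, of n] by auto
    then show "l2 QM (f n)" "\<exists>\<xi>. H01 D \<xi> (\<lambda>x. f n (t,x))" unfolding R_def by blast+
  qed
  obtain r :: "nat \<Rightarrow> nat" where r: "AE t in MT. (\<lambda>n. l2n MD (\<lambda>x. f (r n) (t,x) - W (t,x))) \<longlonglongrightarrow> 0"
    using slice_subseq[OF finT finD f(1) W(1,4)] by blast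
  have good: "AE t in MT. l2 MD (\<lambda>x. W (t,x)) \<and> (\<exists>v. H01 D v (\<lambda>x. W (t,x)))"
    using r sliceQ[OF W(1)]
  proof eventually_elim
    case (elim t)
    have "\<forall>n. \<exists>\<xi>. H01 D \<xi> (\<lambda>x. f (r n) (t,x))" using f(2) by blast
    from choice[OF this] obtain \<xi> where "\<forall>n. H01 D (\<xi> n) (\<lambda>x. f (r n) (t,x))" by blast
    then have x: "H01 D (\<xi> n) (\<lambda>x. f (r n) (t,x))" for n by blast
    show ?case using grad_closed[OF x elim(2,1)] elim(2) by blast
  qed
  \<comment> \<open>A functional in the sense of \<open>Hm1\<close> depends on v alone, so a
    Jacobian is chosen for v; it is unique almost everywhere.\<close>
  define w where "w t v = ip MD (\<lambda>x. W (t,x)) (SOME Gv. H01 D v Gv)" for t v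
  have w: "w t v = ip MD (\<lambda>x. W (t,x)) Gv" if "H01 D v Gv" "t \<in> {0..T}" for t v Gv
  proof -
    have h: "H01 D v (SOME Gv. H01 D v Gv)" by (rule someI[of "H01 D v", OF that(1)])
    have "AE x in MD. (SOME Gv. H01 D v Gv) x = Gv x" using H01_grad_unique[OF h that(1)] by simp
    then show ?thesis unfolding w_def
      using slice_meas[OF l2_meas[OF W(1)] that(2)] l2_meas[OF H01_l2(2)[OF h]] l2_meas[OF H01_l2(2)[OF that(1)]]
      by (intro ip_AE_cong) auto
  qed
  have tin: "AE t in MT. t \<in> {0..T}" using AE_space[of MT] by simp
  have bd: "\<bar>w t v\<bar> \<le> l2n MD (\<lambda>x. W (t,x)) * L2vnorm D G" if "l2 MD (\<lambda>x. W (t,x))" "t \<in> {0..T}" "H01 D v G" for t v G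
    using l2_CS[OF that(1) H01_l2(2)[OF that(3)]] w[OF that(3,2)] by (simp add: L2vnorm_eq)
  have hm: "AE t in MT. Hm1 D (w t)"
    using good tin
  proof eventually_elim
    case (elim t)
    show ?case unfolding Hm1_def
    proof (intro conjI allI impI)
      fix v1 G1 v2 G2 a c assume h: "H01 D v1 G1" "H01 D v2 G2"
      show "w t (\<lambda>x. a *\<^sub>R v1 x + c *\<^sub>R v2 x) = a * w t v1 + c * w t v2"
        unfolding w[OF h(1) elim(2)] w[OF h(2) elim(2)] w[OF H01_lin[OF h] elim(2)]
        using elim(1) by (intro ip_lin_right H01_l2(2)[OF h(1)] H01_l2(2)[OF h(2)]) auto
    next
      show "\<exists>C. \<forall>v G. H01 D v G \<longrightarrow> \<bar>w t v\<bar> \<le> C * L2vnorm D G" using bd elim by blast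
    qed
  qed
  have nrm: "AE t in MT. Hm1norm D (w t) = l2n MD (\<lambda>x. W (t,x))"
    using good tin
  proof eventually_elim
    case (elim t)
    then obtain v where v: "H01 D v (\<lambda>x. W (t,x))" by blast
    show ?case unfolding Hm1norm_def
    proof (rule cInf_eq_minimum)
      show "l2n MD (\<lambda>x. W (t,x)) \<in> {C. 0 \<le> C \<and> (\<forall>v G. H01 D v G \<longrightarrow> \<bar>w t v\<bar> \<le> C * L2vnorm D G)}" using bd elim by auto
      fix C assume "C \<in> {C. 0 \<le> C \<and> (\<forall>v G. H01 D v G \<longrightarrow> \<bar>w t v\<bar> \<le> C * L2vnorm D G)}"
      \<comment> \<open>Testing with the field whose Jacobian is W(t) shows that no smaller constant
        is admissible.\<close>
      then have C: "C \<ge> 0" "\<bar>w t v\<bar> \<le> C * L2vnorm D (\<lambda>x. W (t,x))" using v by auto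
      then have "l2n MD (\<lambda>x. W (t,x)) * l2n MD (\<lambda>x. W (t,x)) \<le> C * l2n MD (\<lambda>x. W (t,x))"
        unfolding w[OF v elim(2)] L2vnorm_eq l2n_sq[symmetric] by (simp add: power2_eq_square)
      then show "l2n MD (\<lambda>x. W (t,x)) \<le> C" using C(1) l2n_nonneg[of MD "\<lambda>x. W (t,x)"]
        by (cases "l2n MD (\<lambda>x. W (t,x)) = 0") (auto simp: mult_le_cancel_right)
    qed
  qed
  note sn = slice_norm_l2[OF W(1)]
  have nm: "(\<lambda>t. Hm1norm D (w t)) \<in> borel_measurable MT" by (rule meas_AE_MT[OF l2_meas[OF sn(1)] nrm])
  have nl: "l2 MT (\<lambda>t. Hm1norm D (w t))" by (rule l2_AE_cong[OF sn(1) nm]) (use nrm in \<open>eventually_elim, simp\<close>)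
  have "L2Hm1norm D T w = l2n QM W"
  proof -
    have "L2Hm1norm D T w = l2n MT (\<lambda>t. Hm1norm D (w t))" by (simp add: L2Hm1norm_def l2n_def)
    then show ?thesis using l2n_AE_cong[OF nrm nm l2_meas[OF sn(1)]] sn(2) by simp
  qed
  moreover have "L2Hm1 D T w" unfolding L2Hm1_def
  proof (intro conjI allI impI hm nm)
    fix v G assume h: "H01 D v G"
    show "(\<lambda>t. w t v) \<in> borel_measurable MT"
      by (rule meas_AE_MT[OF borel_measurable_integrable[OF ip_sliceQ_integrable[OF H01_l2(2)[OF h] W(1)]]])
         (use tin in \<open>eventually_elim, simp add: w[OF h]\<close>)
  qed (use nl in \<open>simp add: l2_def\<close>)
  moreover have "(\<integral>t. w t v * \<phi> t \<partial>MT) = ip QM A (\<lambda>z. \<phi> (fst z) *\<^sub>R Gv (snd z)) + ip QM b (\<lambda>z. \<phi> (fst z) *\<^sub>R v (snd z))"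
    if c: "continuous_on UNIV \<phi>" and h: "H01 D v Gv" for \<phi> v Gv
  proof -
    have "(\<lambda>z. \<phi> (fst z) *\<^sub>R Gv (snd z), ip QM A (\<lambda>z. \<phi> (fst z) *\<^sub>R Gv (snd z)) + ip QM b (\<lambda>z. \<phi> (fst z) *\<^sub>R v (snd z))) \<in> R"
      unfolding R_def using tensorQ[OF c H01_l2(2)[OF h]] tensorQ[OF c H01_l2(1)[OF h]] H01_lin[OF h h, of _ 0]
      by (auto intro!: exI[of _ "\<lambda>z. \<phi> (fst z) *\<^sub>R v (snd z)"])
    then have "ip QM W (\<lambda>z. \<phi> (fst z) *\<^sub>R Gv (snd z)) = ip QM A (\<lambda>z. \<phi> (fst z) *\<^sub>R Gv (snd z)) + ip QM b (\<lambda>z. \<phi> (fst z) *\<^sub>R v (snd z))" using bspec[OF W(5)] by fastforce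
    moreover have "(\<integral>t. w t v * \<phi> t \<partial>MT) = (\<integral>t. \<phi> t * ip MD (\<lambda>x. W (t,x)) Gv \<partial>MT)"
      by (rule Bochner_Integration.integral_cong) (auto simp: w[OF h])
    ultimately show ?thesis using ip_tensorQ[OF c H01_l2(2)[OF h] W(1)] by simp
  qed
  ultimately show ?thesis using W(2) by auto
qed

end

section \<open>The linearised compressible system as an evolution equation\<close>

context evol_form
begin

text \<open>Both sides are linear in the test function, so single products suffice. These are
  exactly the test functions of a weak formulation with separate factors in time and space.\<close>

lemma weak_baseI:
  assumes U: "l2 Q U" and Z: "l2 Q Z" and U0: "l2 M U0"
    and eq: "\<And>\<phi> \<phi>' k. C1T T \<phi> \<phi>' \<Longrightarrow> k \<in> K \<Longrightarrow>
      - (\<integral>t. ip M (\<lambda>x. m (U (t,x))) k * \<phi>' t \<partial>MT) - ip M (\<lambda>x. m (U0 x)) k * \<phi> 0 = (\<integral>t. ip M (\<lambda>x. Z (t,x)) k * \<phi> t \<partial>MT)"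
  shows "weak U Z U0"
  unfolding weak_def
proof (intro allI impI)
  fix \<psi> d\<psi> \<psi>0 assume "Tens \<psi> d\<psi> \<psi>0"
  then show "- ip Q (\<lambda>z. m (U z)) d\<psi> - ip M (\<lambda>x. m (U0 x)) \<psi>0 = ip Q Z \<psi>"
  proof induction
    case (base \<phi> \<phi>' k)
    note c = C1T_cont[OF base(1)] and k = K_l2[OF base(2)]
    show ?case using eq[OF base] unfolding ip_tensor[OF c(2) k m_l2[OF U]] ip_tensor[OF c(1) k Z]
      by (simp add: ip_scale_right mult.commute)
  next
    case (lin \<psi> d\<psi> \<psi>0 \<xi> d\<xi> \<xi>0 a b)
    note l = Tens_l2[OF lin(1)] and l' = Tens_l2[OF lin(2)]
    show ?case
      unfolding ip_lin_right[OF l(2) l'(2) m_l2[OF U]] ip_lin_right[OF l(3) l'(3) m_l2[OF U0]] ip_lin_right[OF l(1) l'(1) Z]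
        lin.IH[symmetric] by (simp add: algebra_simps)
  qed
qed

lemma weak_baseD:
  assumes w: "weak U Z U0" and U: "l2 Q U" and Z: "l2 Q Z" and \<phi>: "C1T T \<phi> \<phi>'" and kK: "k \<in> K"
  shows "- (\<integral>t. ip M (\<lambda>x. m (U (t,x))) k * \<phi>' t \<partial>MT) - ip M (\<lambda>x. m (U0 x)) k * \<phi> 0 = (\<integral>t. ip M (\<lambda>x. Z (t,x)) k * \<phi> t \<partial>MT)"
proof -
  note c = C1T_cont[OF \<phi>] and k = K_l2[OF kK]
  show ?thesis using w Tens.base[OF \<phi> kK] unfolding weak_def ip_tensor[OF c(2) k m_l2[OF U], symmetric, simplified mult.commute]
    using ip_tensor[OF c(2) k m_l2[OF U]] ip_tensor[OF c(1) k Z] by (fastforce simp: ip_scale_right mult.commute)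
qed

end

lemma l2_pair:
  assumes "l2 N f" "l2 N g" shows "l2 N (\<lambda>x. (f x, g x))"
proof -
  have [measurable]: "f \<in> borel_measurable N" "g \<in> borel_measurable N" using assms by (auto intro: l2_meas)
  have "(\<lambda>x. (f x, g x)) \<in> borel_measurable N" by simp
  moreover have "(norm (f x, g x))\<^sup>2 = (norm (f x))\<^sup>2 + (norm (g x))\<^sup>2" for x by (simp add: norm_Pair)
  ultimately show ?thesis using assms by (simp add: l2_def)
qed

lemma l2_fst_comp: "l2 N f \<Longrightarrow> l2 N (\<lambda>x. fst (f x))" by (rule l2_blin[OF bounded_linear_fst])
lemma l2_snd_comp: "l2 N f \<Longrightarrow> l2 N (\<lambda>x. snd (f x))" by (rule l2_blin[OF bounded_linear_snd])

lemma norm_components_le: "norm (fst y) \<le> norm y" "norm (snd y) \<le> norm y"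
  using norm_fst_le[of "fst y" "snd y"] norm_snd_le[of "snd y" "fst y"] by simp_all

lemma l2n_fst_le: "l2 N f \<Longrightarrow> l2n N (\<lambda>x. fst (f x)) \<le> l2n N f"
  using l2n_bound[of N f "\<lambda>x. fst (f x)" 1] by (simp add: l2_fst_comp norm_components_le)
lemma l2n_snd_le: "l2 N f \<Longrightarrow> l2n N (\<lambda>x. snd (f x)) \<le> l2n N f"
  using l2n_bound[of N f "\<lambda>x. snd (f x)" 1] by (simp add: l2_snd_comp norm_components_le)

lemma l2_scaleR_const: "l2 N f \<Longrightarrow> l2 N (\<lambda>x. f x *\<^sub>R c)"
  for f :: "'a \<Rightarrow> real" and c :: "'b::euclidean_space"
  by (rule l2_blin[OF bounded_linear_scaleR_left])

lemma l2_inner_const: "l2 N f \<Longrightarrow> l2 N (\<lambda>x. f x \<bullet> c)"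
  by (rule l2_blin[OF bounded_linear_inner_left])

context cyl
begin

text \<open>The constraint tying the second component to the first turns operators that act
  pointwise on triples into a differential system.\<close>

definition KK :: "(real^'d \<Rightarrow> (real^'d) \<times> (real^'d^'d) \<times> real) set" where
  "KK = {k. H01 D (\<lambda>x. fst (k x)) (\<lambda>x. fst (snd (k x))) \<and> l2 MD (\<lambda>x. snd (snd (k x)))}"

lemma KK_I: "H01 D v Gv \<Longrightarrow> l2 MD r \<Longrightarrow> (\<lambda>x. (v x, Gv x, r x)) \<in> KK"
  by (simp add: KK_def)

lemma KK_l2: "k \<in> KK \<Longrightarrow> l2 MD k"
  using l2_pair[of MD "\<lambda>x. fst (k x)" "\<lambda>x. (fst (snd (k x)), snd (snd (k x)))"] l2_pair[of MD "\<lambda>x. fst (snd (k x))" "\<lambda>x. snd (snd (k x))"]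
  H01_l2[of "\<lambda>x. fst (k x)" "\<lambda>x. fst (snd (k x))"] by (simp add: KK_def)

lemma KK_evol: "evol T MD KK"
proof (rule evol.intro)
  show "0 < T" by (fact T)
  show "finite_measure MD" by (fact finD)
  show "l2 MD k" if "k \<in> KK" for k using that by (rule KK_l2)
  show "(\<lambda>x. 0) \<in> KK" using H01_zero by (simp add: KK_def)
  show "(\<lambda>x. a *\<^sub>R k x + b *\<^sub>R l x) \<in> KK" if "k \<in> KK" "l \<in> KK" for k l a b
    using that H01_lin[of "\<lambda>x. fst (k x)" "\<lambda>x. fst (snd (k x))" "\<lambda>x. fst (l x)" "\<lambda>x. fst (snd (l x))" a b]
      l2_lin[of MD "\<lambda>x. snd (snd (k x))" "\<lambda>x. snd (snd (l x))" a b] by (simp add: KK_def)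
  fix f g assume f: "\<And>n. f n \<in> KK" and g: "l2 MD g" and lim: "(\<lambda>n. l2n MD (\<lambda>x. f n x - g x)) \<longlonglongrightarrow> 0"
  note d = l2_diff[OF KK_l2[OF f] g]
  have "(\<lambda>n. l2n MD (\<lambda>x. fst (f n x) - fst (g x))) \<longlonglongrightarrow> 0"
    using l2n_fst_le[OF d] by (intro Lim_null_comparison[OF _ lim]) (auto intro!: always_eventually)
  moreover have "(\<lambda>n. l2n MD (\<lambda>x. fst (snd (f n x)) - fst (snd (g x)))) \<longlonglongrightarrow> 0"
  proof (rule Lim_null_comparison[OF _ lim], intro always_eventually allI)
    fix n show "norm (l2n MD (\<lambda>x. fst (snd (f n x)) - fst (snd (g x)))) \<le> l2n MD (\<lambda>x. f n x - g x)"
      using l2n_fst_le[OF l2_snd_comp[OF d[of n]]] l2n_snd_le[OF d[of n]] by simp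
  qed
  ultimately have "H01 D (\<lambda>x. fst (g x)) (\<lambda>x. fst (snd (g x)))"
    by (rule H01_closed[OF _ l2_fst_comp[OF g] l2_fst_comp[OF l2_snd_comp[OF g]], rotated]) (use f in \<open>simp add: KK_def\<close>)
  then show "g \<in> KK" using l2_snd_comp[OF l2_snd_comp[OF g]] by (simp add: KK_def)
qed

text \<open>Turns each iterated integral of the weak formulation into one pairing on the product
  space. The integrand need only agree on almost every slice with a field measurable for the
  product, which is what \<open>QT_version\<close> provides.\<close>

lemma time_term:
  assumes ae: "AE t in MT. AE x in MD. e t x = c * (Z (t,x) \<bullet> k x)" and Z: "l2 QM Z" and k: "l2 MD k" and \<phi>: "continuous_on UNIV \<phi>"
  shows "(\<integral>t. (\<integral>x. e t x \<partial>MD) * \<phi> t \<partial>MT) = c * ip QM Z (\<lambda>z. \<phi> (fst z) *\<^sub>R k (snd z))"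
proof -
  have [measurable]: "\<phi> \<in> borel_measurable MT" "(\<lambda>t. ip MD (\<lambda>x. Z (t,x)) k) \<in> borel_measurable MT"
    using cont_meas_MT[OF \<phi>] ip_sliceQ_integrable[OF k Z] by auto
  have "(\<integral>t. (\<integral>x. e t x \<partial>MD) * \<phi> t \<partial>MT) = (\<integral>t. (c * ip MD (\<lambda>x. Z (t,x)) k) * \<phi> t \<partial>MT)"
  proof (rule integral_AE_MT)
    show "AE t in MT. (\<integral>x. e t x \<partial>MD) * \<phi> t = (c * ip MD (\<lambda>x. Z (t,x)) k) * \<phi> t"
      using ae sliceQ[OF Z]
    proof eventually_elim
      case (elim t)
      have "(\<integral>x. e t x \<partial>MD) = (\<integral>x. c * (Z (t,x) \<bullet> k x) \<partial>MD)"
        by (rule integral_AE_MD[OF _ elim(1)]) (use l2_integrable_inner[OF elim(2) k] in auto)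
      then show ?case by (simp add: ip_def)
    qed
  qed measurable
  then show ?thesis unfolding ip_tensorQ[OF \<phi> k Z] by (simp add: mult.assoc mult.commute[of "\<phi> _"])
qed

end

section \<open>The pointwise operators of the compressible system\<close>

locale system = cyl D T for D :: "(real^'d) set" and T +
  fixes \<rho> \<alpha> \<mu> \<eta> Fb :: real and ff :: "real \<times> (real^'d) \<Rightarrow> real^'d"
  assumes pos: "\<rho> > 0" "\<alpha> > 0" "\<mu> > 0" "\<eta> \<ge> 0" and Fb: "Fb \<ge> 0"
    and ff_meas: "ff \<in> borel_measurable QM" and ff_bd: "\<And>z. norm (ff z) \<le> Fb"
begin

text \<open>The quadratic form of \<open>mm\<close> is \<rho> |u|^2 + \<alpha> p^2 / \<rho>, twice
  the energy density.\<close>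

definition mm :: "(real^'d) \<times> (real^'d^'d) \<times> real \<Rightarrow> (real^'d) \<times> (real^'d^'d) \<times> real" where
  "mm b = (\<rho> *\<^sub>R fst b, 0, (\<alpha> / \<rho>) * snd (snd b))"

text \<open>The three entries are paired with v, Dv and r. The middle one is the negative viscous
  stress plus p times the identity, the last one is minus the divergence; pairing with U itself
  cancels the products of p and div u.\<close>

definition BB :: "real \<times> (real^'d) \<Rightarrow> (real^'d) \<times> (real^'d^'d) \<times> real \<Rightarrow> (real^'d) \<times> (real^'d^'d) \<times> real" where
  "BB z b = ((\<alpha> * snd (snd b)) *\<^sub>R ff z,
     snd (snd b) *\<^sub>R mat 1 - \<mu> *\<^sub>R fst (snd b) - (\<eta> * (fst (snd b) \<bullet> mat 1)) *\<^sub>R mat 1,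
     - (fst (snd b) \<bullet> mat 1))"

text \<open>The pointwise transpose of \<open>BB\<close>, in which Lions' argument is carried
  out.\<close>

definition BB' :: "real \<times> (real^'d) \<Rightarrow> (real^'d) \<times> (real^'d^'d) \<times> real \<Rightarrow> (real^'d) \<times> (real^'d^'d) \<times> real" where
  "BB' z b = (0, - (\<mu> *\<^sub>R fst (snd b)) - (\<eta> * (fst (snd b) \<bullet> mat 1) + snd (snd b)) *\<^sub>R mat 1,
     \<alpha> * (ff z \<bullet> fst b) + fst (snd b) \<bullet> mat 1)"

sublocale E: evol_form T MD KK mm
proof (rule evol_form.intro[OF KK_evol], rule evol_form_axioms.intro)
  have "linear mm" by (rule linearI) (auto simp: mm_def algebra_simps)
  then show "bounded_linear mm" by (simp add: linear_conv_bounded_linear)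
  show "mm b \<bullet> c = b \<bullet> mm c" for b c by (simp add: mm_def inner_prod_def mult.commute mult.left_commute)
  show "0 \<le> mm b \<bullet> b" for b using pos by (simp add: mm_def inner_prod_def mult.assoc)
qed

lemma BB_adj: "BB z b \<bullet> c = b \<bullet> BB' z c"
  by (simp add: BB_def BB'_def inner_prod_def inner_diff_left inner_diff_right inner_add_left inner_add_right algebra_simps inner_commute)

lemma BB_scale: "BB z (a *\<^sub>R b) = a *\<^sub>R BB z b"
  by (simp add: BB_def algebra_simps)

lemma ff_scale_l2: "l2 QM p \<Longrightarrow> l2 QM (\<lambda>z. (\<alpha> * p z) *\<^sub>R ff z)"
proof -
  assume p: "l2 QM p"
  have [measurable]: "p \<in> borel_measurable QM" "ff \<in> borel_measurable QM" using p ff_meas by (auto intro: l2_meas)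
  show ?thesis
  proof (rule l2_bound[OF p, of _ "\<alpha> * Fb"])
    show "(\<lambda>z. (\<alpha> * p z) *\<^sub>R ff z) \<in> borel_measurable QM" by measurable
    have "\<alpha> * \<bar>p z\<bar> * norm (ff z) \<le> \<alpha> * \<bar>p z\<bar> * Fb" for z using pos by (intro mult_left_mono ff_bd) auto
    then show "AE z in QM. norm ((\<alpha> * p z) *\<^sub>R ff z) \<le> \<alpha> * Fb * norm (p z)" using pos by (intro AE_I2) (simp add: abs_mult mult.commute mult.left_commute)
  qed
qed

lemma ff_inner_l2: "l2 QM u \<Longrightarrow> l2 QM (\<lambda>z. \<alpha> * (ff z \<bullet> u z))"
proof -
  assume u: "l2 QM u"
  have [measurable]: "u \<in> borel_measurable QM" "ff \<in> borel_measurable QM" using u ff_meas by (auto intro: l2_meas)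
  show ?thesis
  proof (rule l2_bound[OF u, of _ "\<alpha> * Fb"])
    show "(\<lambda>z. \<alpha> * (ff z \<bullet> u z)) \<in> borel_measurable QM" by measurable
    show "AE z in QM. norm (\<alpha> * (ff z \<bullet> u z)) \<le> \<alpha> * Fb * norm (u z)"
    proof (intro AE_I2)
      fix z
      have "\<bar>ff z \<bullet> u z\<bar> \<le> norm (ff z) * norm (u z)" by (rule Cauchy_Schwarz_ineq2)
      also have "\<dots> \<le> Fb * norm (u z)" by (intro mult_right_mono ff_bd) simp
      finally show "norm (\<alpha> * (ff z \<bullet> u z)) \<le> \<alpha> * Fb * norm (u z)" using pos by (simp add: abs_mult mult.assoc)
    qed
  qed
qed

lemma stress_l2:
  assumes "l2 QM G" "l2 QM p" shows "l2 QM (\<lambda>z. p z *\<^sub>R mat 1 - \<mu> *\<^sub>R G z - (\<eta> * (G z \<bullet> mat 1)) *\<^sub>R mat 1)"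
  using l2_diff[OF l2_diff[OF l2_scaleR_const[OF assms(2)] l2_scale[OF assms(1)]] l2_scaleR_const[OF l2_scale[OF l2_inner_const[OF assms(1)], of \<eta>]]]
  by simp

lemma BB_l2: "l2 QM F \<Longrightarrow> l2 QM (\<lambda>z. BB z (F z))"
  unfolding BB_def
  by (intro l2_pair ff_scale_l2 stress_l2 l2_fst_comp l2_snd_comp) (use l2_scale[OF l2_inner_const[OF l2_fst_comp[OF l2_snd_comp]], of QM F "-1"] in auto)

lemma BB'_l2: assumes F: "l2 QM F" shows "l2 QM (\<lambda>z. BB' z (F z))"
proof -
  note u = l2_fst_comp[OF F] and G = l2_fst_comp[OF l2_snd_comp[OF F]] and p = l2_snd_comp[OF l2_snd_comp[OF F]]
  have 1: "l2 QM (\<lambda>z. - (\<mu> *\<^sub>R fst (snd (F z))) - (\<eta> * (fst (snd (F z)) \<bullet> mat 1) + snd (snd (F z))) *\<^sub>R mat 1)"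
    using l2_diff[OF l2_scale[OF G, of "- \<mu>"] l2_scaleR_const[OF l2_add[OF l2_scale[OF l2_inner_const[OF G], of \<eta>] p]]] by simp
  have 2: "l2 QM (\<lambda>z. \<alpha> * (ff z \<bullet> fst (F z)) + fst (snd (F z)) \<bullet> mat 1)"
    by (intro l2_add ff_inner_l2 u l2_inner_const G)
  show ?thesis unfolding BB'_def by (intro l2_pair 1 2 l2_zero)
qed

text \<open>The first summand absorbs the force term \<alpha> p f . u. The second reserves half of
  the energy form for coercivity and for the source \<sigma>.\<close>

definition kap :: real where "kap = Fb * sqrt \<alpha> / 2 + 1/2"

lemma kap_nonneg: "kap \<ge> 0" using Fb pos by (simp add: kap_def)

text \<open>The products of p and div u cancel and both viscous terms have a sign, so only the force
  term has to be estimated.\<close>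

lemma BB_dissipative:
  "BB z b \<bullet> b \<le> (kap - 1/2) * (mm b \<bullet> b) - \<mu> * (norm (fst (snd b)))\<^sup>2"
proof -
  obtain u G p where b: "b = (u, G, p)" by (cases b)
  have "(\<alpha> * p) * (ff z \<bullet> u) \<le> \<alpha> * \<bar>p\<bar> * (Fb * norm u)"
  proof -
    have "\<bar>ff z \<bullet> u\<bar> \<le> norm (ff z) * norm u" by (rule Cauchy_Schwarz_ineq2)
    also have "\<dots> \<le> Fb * norm u" by (intro mult_right_mono ff_bd) simp
    finally have "\<bar>(\<alpha> * p) * (ff z \<bullet> u)\<bar> \<le> \<alpha> * \<bar>p\<bar> * (Fb * norm u)" using pos by (simp add: abs_mult mult_left_mono)
    then show ?thesis by linarith
  qed
  also have "\<dots> \<le> Fb * sqrt \<alpha> / 2 * (\<rho> * (norm u)\<^sup>2 + \<alpha> / \<rho> * p\<^sup>2)"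
  proof -
    \<comment> \<open>These weights match the energy form, cancel \<rho> in the product and leave
      one factor sqrt \<alpha> for \<open>kap\<close>, which therefore stays bounded as \<alpha>
      tends to 0.\<close>
    let ?a = "sqrt \<rho> * norm u" and ?b = "sqrt \<alpha> / sqrt \<rho> * \<bar>p\<bar>"
    have "2 * (?a * ?b) \<le> ?a\<^sup>2 + ?b\<^sup>2" using sum_squares_bound[of ?a ?b] by (simp only: mult.assoc)
    moreover have "?a * ?b = sqrt \<alpha> * \<bar>p\<bar> * norm u" using pos by simp
    moreover have "?a\<^sup>2 = \<rho> * (norm u)\<^sup>2" "?b\<^sup>2 = \<alpha> / \<rho> * p\<^sup>2" using pos by (simp_all add: power_mult_distrib power_divide)
    ultimately have "2 * (sqrt \<alpha> * \<bar>p\<bar> * norm u) \<le> \<rho> * (norm u)\<^sup>2 + \<alpha> / \<rho> * p\<^sup>2" by simp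
    then have "Fb * sqrt \<alpha> / 2 * (2 * (sqrt \<alpha> * \<bar>p\<bar> * norm u)) \<le> Fb * sqrt \<alpha> / 2 * (\<rho> * (norm u)\<^sup>2 + \<alpha> / \<rho> * p\<^sup>2)"
      using Fb pos by (intro mult_left_mono) auto
    moreover have "Fb * sqrt \<alpha> / 2 * (2 * (sqrt \<alpha> * \<bar>p\<bar> * norm u)) = \<alpha> * \<bar>p\<bar> * (Fb * norm u)"
    proof -
      have "Fb * sqrt \<alpha> / 2 * (2 * (sqrt \<alpha> * \<bar>p\<bar> * norm u)) = (sqrt \<alpha> * sqrt \<alpha>) * \<bar>p\<bar> * (Fb * norm u)" by (simp add: ac_simps)
      moreover have "sqrt \<alpha> * sqrt \<alpha> = \<alpha>" using pos by simp
      ultimately show ?thesis by simp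
    qed
    ultimately show ?thesis by (simp only:)
  qed
  finally have 1: "(\<alpha> * p) * (ff z \<bullet> u) \<le> Fb * sqrt \<alpha> / 2 * (\<rho> * (norm u)\<^sup>2 + \<alpha> / \<rho> * p\<^sup>2)" .
  have "BB z b \<bullet> b = (\<alpha> * p) * (ff z \<bullet> u) - \<mu> * (norm G)\<^sup>2 - \<eta> * (G \<bullet> mat 1)\<^sup>2"
    by (simp add: b BB_def inner_prod_def inner_diff_left dot_square_norm power2_eq_square[of "G \<bullet> mat 1"] inner_commute[of "mat 1"] mult.assoc)
  moreover have "mm b \<bullet> b = \<rho> * (norm u)\<^sup>2 + \<alpha> / \<rho> * p\<^sup>2"
    by (simp add: b mm_def inner_prod_def dot_square_norm power2_eq_square[of p])
  moreover have "0 \<le> \<eta> * (G \<bullet> mat 1)\<^sup>2" using pos by simp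
  ultimately show ?thesis using 1 by (simp add: b kap_def)
qed

lemma BB_coercive: "\<exists>c0>0. \<forall>z b. c0 * (b \<bullet> b) \<le> kap * (mm b \<bullet> b) - BB z b \<bullet> b"
proof (intro exI conjI allI)
  \<comment> \<open>Half of the weights of u and p in the energy form, from the reserve in
    \<open>kap\<close>, and the viscosity for the Jacobian.\<close>
  let ?c = "min (\<rho>/2) (min (\<alpha> / \<rho> / 2) \<mu>)"
  show "?c > 0" using pos by simp
  fix z and b :: "(real^'d) \<times> (real^'d^'d) \<times> real"
  obtain u G p where b: "b = (u, G, p)" by (cases b)
  have e: "mm b \<bullet> b = \<rho> * (norm u)\<^sup>2 + \<alpha> / \<rho> * p\<^sup>2" "b \<bullet> b = (norm u)\<^sup>2 + (norm G)\<^sup>2 + p\<^sup>2"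
    by (simp_all add: b mm_def inner_prod_def dot_square_norm power2_eq_square[of p])
  have "?c * (norm u)\<^sup>2 \<le> \<rho>/2 * (norm u)\<^sup>2" "?c * (norm G)\<^sup>2 \<le> \<mu> * (norm G)\<^sup>2" "?c * p\<^sup>2 \<le> \<alpha> / \<rho> / 2 * p\<^sup>2"
    by (intro mult_right_mono; simp)+
  then have "?c * (b \<bullet> b) \<le> (mm b \<bullet> b) / 2 + \<mu> * (norm G)\<^sup>2" unfolding e by (simp add: distrib_left add_divide_distrib)
  then show "?c * (b \<bullet> b) \<le> kap * (mm b \<bullet> b) - BB z b \<bullet> b"
    using BB_dissipative[of z b] by (simp add: b left_diff_distrib)
qed

end

lemma AE_AE_mono:
  assumes "AE t in A. AE x in B. P t x" "\<And>t x. P t x \<Longrightarrow> R t x"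
  shows "AE t in A. AE x in B. R t x"
  using assms(1) by eventually_elim (use assms(2) in \<open>auto elim: eventually_mono\<close>)

text \<open>Versions of \<sigma> and f measurable for the product and a divergence form S of s are
  fixed once, so that the data of the equation become fields on the product space.\<close>

locale system_data = system D T \<rho> \<alpha> \<mu> \<eta> Fb ff
  for D :: "(real^'d) set" and T \<rho> \<alpha> \<mu> \<eta> Fb :: real and ff :: "real \<times> (real^'d) \<Rightarrow> real^'d" +
  fixes \<sigma> :: "real \<Rightarrow> real^'d \<Rightarrow> real" and s :: "real \<Rightarrow> (real^'d \<Rightarrow> real^'d) \<Rightarrow> real" and f :: "real \<Rightarrow> real^'d \<Rightarrow> real^'d"
    and u0 :: "real^'d \<Rightarrow> real^'d" and p0 :: "real^'d \<Rightarrow> real"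
    and \<sigma>h :: "real \<times> (real^'d) \<Rightarrow> real" and S :: "real \<times> (real^'d) \<Rightarrow> real^'d^'d"
  assumes \<sigma>h: "l2 QM \<sigma>h" "AE t in MT. AE x in MD. \<sigma> t x = \<sigma>h (t,x)"
    and S: "l2 QM S" "\<And>\<phi> v Gv. continuous_on UNIV \<phi> \<Longrightarrow> H01 D v Gv \<Longrightarrow>
       (\<integral>t. s t v * \<phi> t \<partial>MT) = (\<integral>t. ip MD (\<lambda>x. S (t,x)) Gv * \<phi> t \<partial>MT)"
    and ff: "AE t in MT. AE x in MD. f t x = ff (t,x)"
    and u0: "l2 MD u0" and p0: "l2 MD p0"
begin

definition ZZ where "ZZ U z = BB z (U z) + (0, S z, \<sigma>h z / \<rho>)"
text \<open>The middle component is annihilated by \<open>mm\<close>, so 0 stands in for a Jacobian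
  that u0 need not have.\<close>

definition UU0 where "UU0 x = (u0 x, 0 :: real^'d^'d, p0 x)"

abbreviation tn (infixr "\<otimes>" 75) where "tn \<phi> k \<equiv> (\<lambda>z. (\<phi> (fst z) :: real) *\<^sub>R k (snd z))"

lemma src_l2: "l2 QM (\<lambda>z. (0::real^'d, S z, \<sigma>h z / \<rho>))"
  using l2_pair[OF l2_zero l2_pair[OF S(1) l2_scale[OF \<sigma>h(1), of "1/\<rho>"]]] by simp

lemma UU0_l2: "l2 MD UU0"
  unfolding UU0_def[abs_def] by (intro l2_pair u0 p0 l2_zero)

lemma ZZ_l2: "l2 QM U \<Longrightarrow> l2 QM (ZZ U)"
  unfolding ZZ_def[abs_def] by (intro l2_add BB_l2 src_l2)

section \<open>Equivalence of the weak formulation with the abstract equation\<close>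

context
  fixes u :: "real \<Rightarrow> real^'d \<Rightarrow> real^'d" and G :: "real \<Rightarrow> real^'d \<Rightarrow> real^'d^'d" and p :: "real \<Rightarrow> real^'d \<Rightarrow> real"
    and uh Gh ph
  assumes uh: "l2 QM uh" "AE t in MT. AE x in MD. u t x = uh (t,x)"
    and Gh: "l2 QM Gh" "AE t in MT. AE x in MD. G t x = Gh (t,x)"
    and ph: "l2 QM ph" "AE t in MT. AE x in MD. p t x = ph (t,x)"
begin

lemma eq1_iff:
  assumes c: "continuous_on UNIV \<phi>" "continuous_on UNIV \<phi>'" and r: "l2 MD r"
  shows "(- integral\<^sup>L MT (\<lambda>t. integral\<^sup>L MD (\<lambda>x. \<alpha> * p t x * r x) * \<phi>' t)
        - integral\<^sup>L MD (\<lambda>x. \<alpha> * p0 x * r x) * \<phi> 0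
        + integral\<^sup>L MT (\<lambda>t. integral\<^sup>L MD (\<lambda>x. \<rho> * divJ (G t x) * r x) * \<phi> t)
        = integral\<^sup>L MT (\<lambda>t. integral\<^sup>L MD (\<lambda>x. \<sigma> t x * r x) * \<phi> t))
     \<longleftrightarrow> (- (\<alpha> * ip QM ph (\<phi>' \<otimes> r)) - \<alpha> * ip MD p0 r * \<phi> 0 + \<rho> * ip QM Gh (\<phi> \<otimes> (\<lambda>x. r x *\<^sub>R mat 1)) = ip QM \<sigma>h (\<phi> \<otimes> r))"
proof -
  have 1: "integral\<^sup>L MT (\<lambda>t. integral\<^sup>L MD (\<lambda>x. \<alpha> * p t x * r x) * \<phi>' t) = \<alpha> * ip QM ph (\<phi>' \<otimes> r)"
    by (rule time_term[OF _ ph(1) r c(2)], rule AE_AE_mono[OF ph(2)], simp)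
  have 2: "integral\<^sup>L MT (\<lambda>t. integral\<^sup>L MD (\<lambda>x. \<rho> * divJ (G t x) * r x) * \<phi> t) = \<rho> * ip QM Gh (\<phi> \<otimes> (\<lambda>x. r x *\<^sub>R mat 1))"
    by (rule time_term[OF _ Gh(1) l2_scaleR_const[OF r] c(1)], rule AE_AE_mono[OF Gh(2)], simp add: divJ_eq)
  have 3: "integral\<^sup>L MT (\<lambda>t. integral\<^sup>L MD (\<lambda>x. \<sigma> t x * r x) * \<phi> t) = 1 * ip QM \<sigma>h (\<phi> \<otimes> r)"
    by (rule time_term[OF _ \<sigma>h(1) r c(1)], rule AE_AE_mono[OF \<sigma>h(2)], simp)
  have 4: "integral\<^sup>L MD (\<lambda>x. \<alpha> * p0 x * r x) = \<alpha> * ip MD p0 r" by (simp add: ip_def mult.assoc)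
  show ?thesis unfolding 1 2 3 4 by simp
qed

lemma eq2_iff:
  assumes c: "continuous_on UNIV \<phi>" "continuous_on UNIV \<phi>'" and v: "H01 D v Gv"
  shows "(- integral\<^sup>L MT (\<lambda>t. \<rho> * integral\<^sup>L MD (\<lambda>x. u t x \<bullet> v x) * \<phi>' t)
        - \<rho> * integral\<^sup>L MD (\<lambda>x. u0 x \<bullet> v x) * \<phi> 0
        - integral\<^sup>L MT (\<lambda>t. integral\<^sup>L MD (\<lambda>x. p t x * divJ (Gv x)) * \<phi> t)
        = - \<mu> * integral\<^sup>L MT (\<lambda>t. integral\<^sup>L MD (\<lambda>x. jac_inner (G t x) (Gv x)) * \<phi> t)
          - \<eta> * integral\<^sup>L MT (\<lambda>t. integral\<^sup>L MD (\<lambda>x. divJ (G t x) * divJ (Gv x)) * \<phi> t)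
          + integral\<^sup>L MT (\<lambda>t. integral\<^sup>L MD (\<lambda>x. \<alpha> * p t x * (f t x \<bullet> v x)) * \<phi> t)
          + integral\<^sup>L MT (\<lambda>t. s t v * \<phi> t))
     \<longleftrightarrow> (- (\<rho> * ip QM uh (\<phi>' \<otimes> v)) - \<rho> * ip MD u0 v * \<phi> 0 - ip QM ph (\<phi> \<otimes> (\<lambda>x. Gv x \<bullet> mat 1))
        = - \<mu> * ip QM Gh (\<phi> \<otimes> Gv) - \<eta> * ip QM Gh (\<phi> \<otimes> (\<lambda>x. (Gv x \<bullet> mat 1) *\<^sub>R mat 1))
          + ip QM (\<lambda>z. (\<alpha> * ph z) *\<^sub>R ff z) (\<phi> \<otimes> v) + ip QM S (\<phi> \<otimes> Gv))"
proof -
  note l = H01_l2[OF v]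
  have 1: "integral\<^sup>L MT (\<lambda>t. \<rho> * integral\<^sup>L MD (\<lambda>x. u t x \<bullet> v x) * \<phi>' t) = \<rho> * ip QM uh (\<phi>' \<otimes> v)"
  proof -
    have "integral\<^sup>L MT (\<lambda>t. integral\<^sup>L MD (\<lambda>x. u t x \<bullet> v x) * \<phi>' t) = 1 * ip QM uh (\<phi>' \<otimes> v)"
      by (rule time_term[OF _ uh(1) l(1) c(2)], rule AE_AE_mono[OF uh(2)], simp)
    then show ?thesis by (simp add: mult.assoc)
  qed
  have 2: "integral\<^sup>L MT (\<lambda>t. integral\<^sup>L MD (\<lambda>x. p t x * divJ (Gv x)) * \<phi> t) = 1 * ip QM ph (\<phi> \<otimes> (\<lambda>x. Gv x \<bullet> mat 1))"
    by (rule time_term[OF _ ph(1) l2_inner_const[OF l(2)] c(1)], rule AE_AE_mono[OF ph(2)], simp add: divJ_eq)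
  have 3: "integral\<^sup>L MT (\<lambda>t. integral\<^sup>L MD (\<lambda>x. jac_inner (G t x) (Gv x)) * \<phi> t) = 1 * ip QM Gh (\<phi> \<otimes> Gv)"
    by (rule time_term[OF _ Gh(1) l(2) c(1)], rule AE_AE_mono[OF Gh(2)], simp add: jac_inner_eq)
  have 4: "integral\<^sup>L MT (\<lambda>t. integral\<^sup>L MD (\<lambda>x. divJ (G t x) * divJ (Gv x)) * \<phi> t) = 1 * ip QM Gh (\<phi> \<otimes> (\<lambda>x. (Gv x \<bullet> mat 1) *\<^sub>R mat 1))"
    by (rule time_term[OF _ Gh(1) l2_scaleR_const[OF l2_inner_const[OF l(2)]] c(1)], rule AE_AE_mono[OF Gh(2)], simp add: divJ_eq)
  have 5: "integral\<^sup>L MT (\<lambda>t. integral\<^sup>L MD (\<lambda>x. \<alpha> * p t x * (f t x \<bullet> v x)) * \<phi> t) = 1 * ip QM (\<lambda>z. (\<alpha> * ph z) *\<^sub>R ff z) (\<phi> \<otimes> v)"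
  proof (rule time_term[OF _ ff_scale_l2[OF ph(1)] l(1) c(1)])
    show "AE t in MT. AE x in MD. \<alpha> * p t x * (f t x \<bullet> v x) = 1 * ((\<alpha> * ph (t,x)) *\<^sub>R ff (t,x) \<bullet> v x)"
      using ph(2) ff
    proof eventually_elim
      case (elim t)
      then show ?case by eventually_elim simp
    qed
  qed
  have 6: "integral\<^sup>L MT (\<lambda>t. s t v * \<phi> t) = ip QM S (\<phi> \<otimes> Gv)"
    using S(2)[OF c(1) v] ip_tensorQ[OF c(1) l(2) S(1)] by (simp add: mult.commute)
  have 7: "integral\<^sup>L MD (\<lambda>x. u0 x \<bullet> v x) = ip MD u0 v" by (simp add: ip_def)
  show ?thesis unfolding 1 2 3 4 5 6 7 by simp
qed

lemma mm_term:
  assumes c: "continuous_on UNIV \<phi>" and k: "l2 MD v" "l2 MD r"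
  shows "ip QM (\<lambda>z. mm (uh z, Gh z, ph z)) (\<phi> \<otimes> (\<lambda>x. (v x, Gv x, r x))) = \<rho> * ip QM uh (\<phi> \<otimes> v) + (\<alpha> / \<rho>) * ip QM ph (\<phi> \<otimes> r)"
proof -
  have i: "integrable QM (\<lambda>z. uh z \<bullet> \<phi> (fst z) *\<^sub>R v (snd z))" "integrable QM (\<lambda>z. ph z \<bullet> \<phi> (fst z) *\<^sub>R r (snd z))"
    by (intro l2_integrable_inner uh ph tensorQ c k)+
  have "mm (uh z, Gh z, ph z) \<bullet> (\<phi> (fst z) *\<^sub>R (v (snd z), Gv (snd z), r (snd z)))
     = \<rho> * (uh z \<bullet> \<phi> (fst z) *\<^sub>R v (snd z)) + (\<alpha> / \<rho>) * (ph z \<bullet> \<phi> (fst z) *\<^sub>R r (snd z))" for z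
    by (simp add: mm_def inner_prod_def)
  then show ?thesis unfolding ip_def using i by simp
qed

lemma ZZ_term:
  assumes c: "continuous_on UNIV \<phi>" and k: "l2 MD v" "l2 MD Gv" "l2 MD r"
  shows "ip QM (ZZ (\<lambda>z. (uh z, Gh z, ph z))) (\<phi> \<otimes> (\<lambda>x. (v x, Gv x, r x))) =
     ip QM (\<lambda>z. (\<alpha> * ph z) *\<^sub>R ff z) (\<phi> \<otimes> v) + ip QM ph (\<phi> \<otimes> (\<lambda>x. Gv x \<bullet> mat 1)) - \<mu> * ip QM Gh (\<phi> \<otimes> Gv)
     - \<eta> * ip QM Gh (\<phi> \<otimes> (\<lambda>x. (Gv x \<bullet> mat 1) *\<^sub>R mat 1)) + ip QM S (\<phi> \<otimes> Gv)
     + (1 / \<rho>) * ip QM \<sigma>h (\<phi> \<otimes> r) - ip QM Gh (\<phi> \<otimes> (\<lambda>x. r x *\<^sub>R mat 1))"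
proof -
  let ?e1 = "\<lambda>z. (\<alpha> * ph z) *\<^sub>R ff z \<bullet> \<phi> (fst z) *\<^sub>R v (snd z)" and ?e2 = "\<lambda>z. ph z \<bullet> \<phi> (fst z) *\<^sub>R (Gv (snd z) \<bullet> mat 1)"
    and ?e3 = "\<lambda>z. Gh z \<bullet> \<phi> (fst z) *\<^sub>R Gv (snd z)" and ?e4 = "\<lambda>z. Gh z \<bullet> \<phi> (fst z) *\<^sub>R ((Gv (snd z) \<bullet> mat 1) *\<^sub>R mat 1)"
    and ?e5 = "\<lambda>z. S z \<bullet> \<phi> (fst z) *\<^sub>R Gv (snd z)" and ?e6 = "\<lambda>z. \<sigma>h z \<bullet> \<phi> (fst z) *\<^sub>R r (snd z)"
    and ?e7 = "\<lambda>z. Gh z \<bullet> \<phi> (fst z) *\<^sub>R (r (snd z) *\<^sub>R mat 1)"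
  have i: "integrable QM ?e1" "integrable QM ?e2" "integrable QM ?e3" "integrable QM ?e4" "integrable QM ?e5" "integrable QM ?e6" "integrable QM ?e7"
    by (intro l2_integrable_inner ff_scale_l2 ph Gh S(1) \<sigma>h(1) tensorQ c k l2_inner_const l2_scaleR_const)+
  have "ZZ (\<lambda>z. (uh z, Gh z, ph z)) z \<bullet> (\<phi> (fst z) *\<^sub>R (v (snd z), Gv (snd z), r (snd z)))
     = ?e1 z + ?e2 z - \<mu> * ?e3 z - \<eta> * ?e4 z + ?e5 z + (1 / \<rho>) * ?e6 z - ?e7 z" for z
    by (simp add: ZZ_def BB_def inner_prod_def inner_diff_left inner_add_left algebra_simps inner_commute)
  then show ?thesis unfolding ip_def using i by simp
qed

lemma U_l2: "l2 QM (\<lambda>z. (uh z, Gh z, ph z))" by (intro l2_pair uh ph Gh)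

text \<open>The first equation divided by \<rho> plus the second is the abstract equation tested by
  the triple (v, Dv, r). It is first obtained for smooth time factors and then enlarged by
  \<open>smooth_to_C1T\<close>.\<close>

lemma weak_sol_imp_weak:
  assumes sol: "weak_sol D T \<rho> \<alpha> \<mu> \<eta> \<sigma> s f u0 p0 u G p"
  shows "E.weak (\<lambda>z. (uh z, Gh z, ph z)) (ZZ (\<lambda>z. (uh z, Gh z, ph z))) UU0"
    and "AE t in MT. (\<lambda>x. (uh (t,x), Gh (t,x), ph (t,x))) \<in> KK"
proof -
  let ?U = "\<lambda>z. (uh z, Gh z, ph z)"
  show "E.weak ?U (ZZ ?U) UU0"
  proof (rule E.weak_baseI[OF U_l2 ZZ_l2[OF U_l2] UU0_l2])
    fix \<psi> \<psi>' k assume \<psi>: "C1T T \<psi> \<psi>'" and kK: "k \<in> KK"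
    define v Gv r where vGr: "v x = fst (k x)" "Gv x = fst (snd (k x))" "r x = snd (snd (k x))" for x
    have k: "k = (\<lambda>x. (v x, Gv x, r x))" by (simp add: vGr)
    have h: "H01 D v Gv" and lr: "l2 MD r" using kK by (simp_all add: KK_def vGr[abs_def])
    note l = H01_l2[OF h] and lk = KK_l2[OF kK]
    show "- (\<integral>t. ip MD (\<lambda>x. mm (?U (t, x))) k * \<psi>' t \<partial>MT) - ip MD (\<lambda>x. mm (UU0 x)) k * \<psi> 0 = (\<integral>t. ip MD (\<lambda>x. ZZ ?U (t, x)) k * \<psi> t \<partial>MT)"
    proof (rule smooth_to_C1T[OF ip_sliceQ_integrable[OF lk E.m_l2[OF U_l2]] ip_sliceQ_integrable[OF lk ZZ_l2[OF U_l2]] T _ \<psi>])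
      fix \<phi> assume t: "test_fun_0T T \<phi>"
      note c = C1T_cont[OF test_fun_0T_C1T[OF t]]
      have e1: "- (\<alpha> * ip QM ph (pd \<phi> 1 \<otimes> r)) - \<alpha> * ip MD p0 r * \<phi> 0 + \<rho> * ip QM Gh (\<phi> \<otimes> (\<lambda>x. r x *\<^sub>R mat 1)) = ip QM \<sigma>h (\<phi> \<otimes> r)"
        using sol t lr unfolding weak_sol_def L2_eq eq1_iff[OF c lr, symmetric] by blast
      have e2: "- (\<rho> * ip QM uh (pd \<phi> 1 \<otimes> v)) - \<rho> * ip MD u0 v * \<phi> 0 - ip QM ph (\<phi> \<otimes> (\<lambda>x. Gv x \<bullet> mat 1))
        = - \<mu> * ip QM Gh (\<phi> \<otimes> Gv) - \<eta> * ip QM Gh (\<phi> \<otimes> (\<lambda>x. (Gv x \<bullet> mat 1) *\<^sub>R mat 1))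
          + ip QM (\<lambda>z. (\<alpha> * ph z) *\<^sub>R ff z) (\<phi> \<otimes> v) + ip QM S (\<phi> \<otimes> Gv)"
        using sol t h unfolding weak_sol_def eq2_iff[OF c h, symmetric] by blast
      have i0: "ip MD (\<lambda>x. mm (UU0 x)) k = \<rho> * ip MD u0 v + (\<alpha> / \<rho>) * ip MD p0 r"
        using l2_integrable_inner[OF u0 l(1)] l2_integrable_inner[OF p0 lr]
        by (simp add: ip_def k UU0_def mm_def inner_prod_def mult.assoc)
      have "- ip QM (\<lambda>z. mm (?U z)) (pd \<phi> 1 \<otimes> k) - ip MD (\<lambda>x. mm (UU0 x)) k * \<phi> 0 = ip QM (ZZ ?U) (\<phi> \<otimes> k)"
      proof -
        have e1': "- (\<alpha> / \<rho> * ip QM ph (pd \<phi> 1 \<otimes> r)) - \<alpha> / \<rho> * ip MD p0 r * \<phi> 0 = 1 / \<rho> * ip QM \<sigma>h (\<phi> \<otimes> r) - ip QM Gh (\<phi> \<otimes> (\<lambda>x. r x *\<^sub>R mat 1))"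
          unfolding e1[symmetric] using pos by (simp add: field_simps)
        show ?thesis unfolding i0 unfolding k mm_term[OF c(2) l(1) lr] ZZ_term[OF c(1) l lr] using e1' e2 by (simp add: algebra_simps)
      qed
      then show "- (\<integral>t. ip MD (\<lambda>x. mm (?U (t, x))) k * pd \<phi> 1 t \<partial>MT) - ip MD (\<lambda>x. mm (UU0 x)) k * \<phi> 0 = (\<integral>t. ip MD (\<lambda>x. ZZ ?U (t, x)) k * \<phi> t \<partial>MT)"
        unfolding ip_tensorQ[OF c(2) lk E.m_l2[OF U_l2]] ip_tensorQ[OF c(1) lk ZZ_l2[OF U_l2]] by (simp add: mult.commute)
    qed
  qed
  have "AE t in MT. H01 D (u t) (G t)" using sol by (simp add: weak_sol_def L2H01_def)
  moreover have "AE t in MT. t \<in> {0..T}" using AE_space[of MT] by simp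
  ultimately show "AE t in MT. (\<lambda>x. (uh (t,x), Gh (t,x), ph (t,x))) \<in> KK"
    using uh(2) Gh(2) sliceQ[OF ph(1)]
  proof eventually_elim
    case (elim t)
    have "H01 D (\<lambda>x. uh (t,x)) (\<lambda>x. Gh (t,x))"
      by (rule H01_AE_cong[OF elim(1,3,4) slice_meas[OF l2_meas[OF uh(1)] elim(2)] slice_meas[OF l2_meas[OF Gh(1)] elim(2)]])
    then show ?case using elim(5) by (rule KK_I)
  qed
qed

lemma weak_imp_eqs:
  assumes w: "E.weak (\<lambda>z. (uh z, Gh z, ph z)) (ZZ (\<lambda>z. (uh z, Gh z, ph z))) UU0" and \<phi>: "C1T T \<phi> \<phi>'"
    and h: "H01 D v Gv" and lr: "l2 MD r"
  shows "- (\<rho> * ip QM uh (\<phi>' \<otimes> v)) - (\<alpha> / \<rho>) * ip QM ph (\<phi>' \<otimes> r) - (\<rho> * ip MD u0 v + (\<alpha> / \<rho>) * ip MD p0 r) * \<phi> 0 =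
     ip QM (\<lambda>z. (\<alpha> * ph z) *\<^sub>R ff z) (\<phi> \<otimes> v) + ip QM ph (\<phi> \<otimes> (\<lambda>x. Gv x \<bullet> mat 1)) - \<mu> * ip QM Gh (\<phi> \<otimes> Gv)
     - \<eta> * ip QM Gh (\<phi> \<otimes> (\<lambda>x. (Gv x \<bullet> mat 1) *\<^sub>R mat 1)) + ip QM S (\<phi> \<otimes> Gv)
     + (1 / \<rho>) * ip QM \<sigma>h (\<phi> \<otimes> r) - ip QM Gh (\<phi> \<otimes> (\<lambda>x. r x *\<^sub>R mat 1))"
proof -
  let ?U = "\<lambda>z. (uh z, Gh z, ph z)" and ?k = "\<lambda>x. (v x, Gv x, r x)"
  note c = C1T_cont[OF \<phi>] and l = H01_l2[OF h] and kK = KK_I[OF h lr]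
  have i0: "ip MD (\<lambda>x. mm (UU0 x)) ?k = \<rho> * ip MD u0 v + (\<alpha> / \<rho>) * ip MD p0 r"
    using l2_integrable_inner[OF u0 l(1)] l2_integrable_inner[OF p0 lr]
    by (simp add: ip_def UU0_def mm_def inner_prod_def mult.assoc)
  have "- ip QM (\<lambda>z. mm (?U z)) (\<phi>' \<otimes> ?k) - ip MD (\<lambda>x. mm (UU0 x)) ?k * \<phi> 0 = ip QM (ZZ ?U) (\<phi> \<otimes> ?k)"
    using E.weak_baseD[OF w U_l2 ZZ_l2[OF U_l2] \<phi> kK]
    unfolding ip_tensorQ[OF c(2) KK_l2[OF kK] E.m_l2[OF U_l2]] ip_tensorQ[OF c(1) KK_l2[OF kK] ZZ_l2[OF U_l2]] by (simp add: mult.commute)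
  then show ?thesis unfolding i0 mm_term[OF c(2) l(1) lr] ZZ_term[OF c(1) l lr] by simp
qed

text \<open>Triples with v = 0 or with r = 0 separate the two equations again; multiplication by
  \<rho> restores the first.\<close>

lemma weak_imp_weak_sol:
  assumes w: "E.weak (\<lambda>z. (uh z, Gh z, ph z)) (ZZ (\<lambda>z. (uh z, Gh z, ph z))) UU0"
    and H: "L2H01 D T u G" "L2Q D T p"
  shows "weak_sol D T \<rho> \<alpha> \<mu> \<eta> \<sigma> s f u0 p0 u G p"
  unfolding weak_sol_def
proof (intro conjI allI impI H)
  fix \<phi> r assume t: "test_fun_0T T \<phi>" and "L2 D r"
  then have r: "l2 MD r" by (simp add: L2_eq)
  note \<phi> = test_fun_0T_C1T[OF t]
  note c = C1T_cont[OF \<phi>]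
  have z: "ip QM F (\<phi>'' \<otimes> (\<lambda>x. 0)) = 0" for F :: "real \<times> (real^'d) \<Rightarrow> 'z::euclidean_space" and \<phi>'' by (simp add: ip_def)
  have "- ((\<alpha> / \<rho>) * ip QM ph (pd \<phi> 1 \<otimes> r)) - (\<alpha> / \<rho>) * ip MD p0 r * \<phi> 0 = (1 / \<rho>) * ip QM \<sigma>h (\<phi> \<otimes> r) - ip QM Gh (\<phi> \<otimes> (\<lambda>x. r x *\<^sub>R mat 1))"
    using weak_imp_eqs[OF w \<phi> H01_zero r] z by (simp add: ip_def)
  then have "\<rho> * (- ((\<alpha> / \<rho>) * ip QM ph (pd \<phi> 1 \<otimes> r)) - (\<alpha> / \<rho>) * ip MD p0 r * \<phi> 0) = \<rho> * ((1 / \<rho>) * ip QM \<sigma>h (\<phi> \<otimes> r) - ip QM Gh (\<phi> \<otimes> (\<lambda>x. r x *\<^sub>R mat 1)))" by (simp only:)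
  then show "- integral\<^sup>L MT (\<lambda>t. integral\<^sup>L MD (\<lambda>x. \<alpha> * p t x * r x) * pd \<phi> 1 t)
        - integral\<^sup>L MD (\<lambda>x. \<alpha> * p0 x * r x) * \<phi> 0
        + integral\<^sup>L MT (\<lambda>t. integral\<^sup>L MD (\<lambda>x. \<rho> * divJ (G t x) * r x) * \<phi> t)
        = integral\<^sup>L MT (\<lambda>t. integral\<^sup>L MD (\<lambda>x. \<sigma> t x * r x) * \<phi> t)"
    unfolding eq1_iff[OF c r] using pos by (simp add: algebra_simps)
next
  fix \<phi> v Gv assume t: "test_fun_0T T \<phi>" and h: "H01 D v Gv"
  note \<phi> = test_fun_0T_C1T[OF t]
  note c = C1T_cont[OF \<phi>]
  show "- integral\<^sup>L MT (\<lambda>t. \<rho> * integral\<^sup>L MD (\<lambda>x. u t x \<bullet> v x) * pd \<phi> 1 t)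
        - \<rho> * integral\<^sup>L MD (\<lambda>x. u0 x \<bullet> v x) * \<phi> 0
        - integral\<^sup>L MT (\<lambda>t. integral\<^sup>L MD (\<lambda>x. p t x * divJ (Gv x)) * \<phi> t)
        = - \<mu> * integral\<^sup>L MT (\<lambda>t. integral\<^sup>L MD (\<lambda>x. jac_inner (G t x) (Gv x)) * \<phi> t)
          - \<eta> * integral\<^sup>L MT (\<lambda>t. integral\<^sup>L MD (\<lambda>x. divJ (G t x) * divJ (Gv x)) * \<phi> t)
          + integral\<^sup>L MT (\<lambda>t. integral\<^sup>L MD (\<lambda>x. \<alpha> * p t x * (f t x \<bullet> v x)) * \<phi> t)
          + integral\<^sup>L MT (\<lambda>t. s t v * \<phi> t)"
    unfolding eq2_iff[OF c h] using weak_imp_eqs[OF w \<phi> h l2_zero] by (simp add: ip_def algebra_simps)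
qed

end

end

lemma mult_le_half_squares: "(a::real) * b \<le> c / 2 * a\<^sup>2 + b\<^sup>2 / (2 * c)" if "c > 0"
proof -
  have "0 \<le> (c * a - b)\<^sup>2 / (2 * c)" using that by simp
  also have "\<dots> = c / 2 * a\<^sup>2 + b\<^sup>2 / (2 * c) - a * b" using that by (simp add: power2_eq_square field_simps)
  finally show ?thesis by simp
qed

section \<open>A priori estimates\<close>

context system_data
begin

text \<open>The exponent is 2 \<open>kap\<close> T. The second factor adds up the weights with which
  the data enter the energy estimate: \<rho> for u0, 1/\<rho> for p0 and \<sigma>, 1/\<mu> for
  s.\<close>

definition cc :: real where "cc = exp ((Fb * sqrt \<alpha> + 1) * T) * (\<rho> + 1/\<rho> + 1/\<mu>)"

text \<open>The quantity E of the theorem, with \<open>Sn\<close> in the place of the norm of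
  s.\<close>

definition EE :: "real \<Rightarrow> real" where
  "EE Sn = l2n MD u0 + sqrt \<alpha> * l2n MD p0 + l2n QM \<sigma>h / sqrt \<alpha> + Sn"

lemma cc_pos: "cc > 0" using pos by (simp add: cc_def add_pos_pos)

context
  fixes uh :: "real \<times> (real^'d) \<Rightarrow> real^'d" and Gh :: "real \<times> (real^'d) \<Rightarrow> real^'d^'d" and ph :: "real \<times> (real^'d) \<Rightarrow> real" and Sn :: real
  assumes uh: "l2 QM uh" and Gh: "l2 QM Gh" and ph: "l2 QM ph"
    and wk: "E.weak (\<lambda>z. (uh z, Gh z, ph z)) (ZZ (\<lambda>z. (uh z, Gh z, ph z))) UU0"
    and KKv: "AE t in MT. (\<lambda>x. (uh (t,x), Gh (t,x), ph (t,x))) \<in> KK"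
    and Sn: "l2n QM S \<le> Sn"
begin

abbreviation "UGP \<equiv> \<lambda>z. (uh z, Gh z, ph z)"

lemma Ul2: "l2 QM UGP" by (intro l2_pair uh ph Gh)

text \<open>Young's inequality charges S . Du to half of the viscous dissipation, and \<sigma> p /
  \<rho> to the half of the energy form reserved in \<open>kap\<close>.\<close>

lemma source_ineq:
  "ZZ UGP z \<bullet> UGP z \<le> kap * (mm (UGP z) \<bullet> UGP z) - \<mu> / 2 * (norm (Gh z))\<^sup>2 + ((norm (S z))\<^sup>2 / (2 * \<mu>) + (\<sigma>h z)\<^sup>2 / (2 * (\<alpha> * \<rho>)))"
proof -
  have 1: "S z \<bullet> Gh z \<le> \<mu> / 2 * (norm (Gh z))\<^sup>2 + (norm (S z))\<^sup>2 / (2 * \<mu>)"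
    using mult_le_half_squares[OF pos(3), of "norm (Gh z)" "norm (S z)"] norm_cauchy_schwarz[of "S z" "Gh z"] by (simp add: mult.commute)
  have 2: "\<sigma>h z / \<rho> * ph z \<le> 1/2 * (\<alpha> / \<rho> * (ph z)\<^sup>2) + (\<sigma>h z)\<^sup>2 / (2 * (\<alpha> * \<rho>))"
  proof -
    have "ph z * (\<sigma>h z / \<rho>) \<le> (\<alpha> / \<rho>) / 2 * (ph z)\<^sup>2 + (\<sigma>h z / \<rho>)\<^sup>2 / (2 * (\<alpha> / \<rho>))"
      using pos by (intro mult_le_half_squares) simp
    also have "(\<sigma>h z / \<rho>)\<^sup>2 / (2 * (\<alpha> / \<rho>)) = (\<sigma>h z)\<^sup>2 / (2 * (\<alpha> * \<rho>))" using pos by (simp add: power2_eq_square field_simps)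
    finally show ?thesis by (simp add: mult.commute)
  qed
  have 3: "mm (UGP z) \<bullet> UGP z = \<rho> * (norm (uh z))\<^sup>2 + \<alpha> / \<rho> * (ph z)\<^sup>2"
    by (simp add: mm_def inner_prod_def dot_square_norm power2_eq_square[of "ph z"])
  have "0 \<le> \<rho> * (norm (uh z))\<^sup>2" using pos by simp
  then have 4: "1/2 * (\<alpha> / \<rho> * (ph z)\<^sup>2) \<le> 1/2 * (mm (UGP z) \<bullet> UGP z)" unfolding 3 by simp
  have "ZZ UGP z \<bullet> UGP z = BB z (UGP z) \<bullet> UGP z + (S z \<bullet> Gh z + \<sigma>h z / \<rho> * ph z)"
    by (simp add: ZZ_def inner_add_left inner_prod_def distrib_right)
  then show ?thesis using BB_dissipative[of z "UGP z"] 1 2 4 by (simp add: left_diff_distrib)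
qed

lemma data_bound:
  "ip MD (\<lambda>x. mm (UU0 x)) UU0 + 2 * (\<integral>z. (norm (S z))\<^sup>2 / (2 * \<mu>) + (\<sigma>h z)\<^sup>2 / (2 * (\<alpha> * \<rho>)) \<partial>QM) \<le> (\<rho> + 1/\<rho> + 1/\<mu>) * (EE Sn)\<^sup>2"
proof -
  have "ip MD (\<lambda>x. mm (UU0 x)) UU0 = \<rho> * (l2n MD u0)\<^sup>2 + (\<alpha> / \<rho>) * (l2n MD p0)\<^sup>2"
    unfolding l2n_sq using l2_integrable_inner[OF u0 u0] l2_integrable_inner[OF p0 p0]
    by (simp add: ip_def UU0_def mm_def inner_prod_def mult.assoc)
  moreover have "2 * (\<integral>z. (norm (S z))\<^sup>2 / (2 * \<mu>) + (\<sigma>h z)\<^sup>2 / (2 * (\<alpha> * \<rho>)) \<partial>QM) = (l2n QM S)\<^sup>2 / \<mu> + (l2n QM \<sigma>h)\<^sup>2 / (\<alpha> * \<rho>)"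
    using l2_integrable_sq[OF S(1)] l2_integrable_sq[OF \<sigma>h(1)] pos by (simp add: l2n_def field_simps)
  moreover have "\<rho> * (l2n MD u0)\<^sup>2 + (\<alpha> / \<rho>) * (l2n MD p0)\<^sup>2 + ((l2n QM S)\<^sup>2 / \<mu> + (l2n QM \<sigma>h)\<^sup>2 / (\<alpha> * \<rho>)) \<le> (\<rho> + 1/\<rho> + 1/\<mu>) * (EE Sn)\<^sup>2"
  proof -
    define a b c where "a = l2n MD u0" and "b = sqrt \<alpha> * l2n MD p0" and "c = l2n QM \<sigma>h / sqrt \<alpha>"
    have nn: "a \<ge> 0" "b \<ge> 0" "c \<ge> 0" "Sn \<ge> 0" using pos order_trans[OF l2n_nonneg Sn] by (auto simp: a_def b_def c_def)
    have E: "EE Sn = a + b + c + Sn" by (simp add: EE_def a_def b_def c_def)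
    \<comment> \<open>b and c are estimated together because both carry the weight 1/\<rho>.\<close>
    have s: "a\<^sup>2 \<le> (EE Sn)\<^sup>2" "b\<^sup>2 + c\<^sup>2 \<le> (EE Sn)\<^sup>2" "(l2n QM S)\<^sup>2 \<le> (EE Sn)\<^sup>2"
    proof -
      show "a\<^sup>2 \<le> (EE Sn)\<^sup>2" unfolding E using nn by (intro power_mono) auto
      have "b\<^sup>2 + c\<^sup>2 \<le> (b + c)\<^sup>2" using nn by (simp add: power2_sum)
      also have "\<dots> \<le> (EE Sn)\<^sup>2" unfolding E using nn by (intro power_mono) auto
      finally show "b\<^sup>2 + c\<^sup>2 \<le> (EE Sn)\<^sup>2" .
      show "(l2n QM S)\<^sup>2 \<le> (EE Sn)\<^sup>2" unfolding E using nn Sn by (intro power_mono) auto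
    qed
    have "\<rho> * (l2n MD u0)\<^sup>2 + (\<alpha> / \<rho>) * (l2n MD p0)\<^sup>2 + ((l2n QM S)\<^sup>2 / \<mu> + (l2n QM \<sigma>h)\<^sup>2 / (\<alpha> * \<rho>))
      = \<rho> * a\<^sup>2 + 1/\<rho> * (b\<^sup>2 + c\<^sup>2) + 1/\<mu> * (l2n QM S)\<^sup>2"
      using pos by (simp add: a_def b_def c_def power_mult_distrib power_divide field_simps)
    also have "\<dots> \<le> \<rho> * (EE Sn)\<^sup>2 + 1/\<rho> * (EE Sn)\<^sup>2 + 1/\<mu> * (EE Sn)\<^sup>2" using pos by (intro add_mono mult_left_mono s) auto
    finally show ?thesis by (simp only: distrib_right)
  qed
  ultimately show ?thesis by simp
qed

lemma EE_nonneg: "EE Sn \<ge> 0" using pos order_trans[OF l2n_nonneg Sn] by (simp add: EE_def)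

text \<open>\<open>energy_estimate\<close> with N the half of the dissipation left over by
  \<open>source_ineq\<close>. Its bound for almost every t concerns \<rho> |u|^2 + \<alpha> |p|^2 /
  \<rho>, from which each term is read off separately.\<close>

lemma solution_bounds:
  "l2n QM Gh \<le> sqrt (cc / \<mu>) * EE Sn"
  "AE t in MT. l2n MD (\<lambda>x. uh (t,x)) \<le> sqrt (cc / \<rho>) * EE Sn \<and> sqrt \<alpha> * l2n MD (\<lambda>x. ph (t,x)) \<le> sqrt (cc * \<rho>) * EE Sn"
proof -
  let ?E0 = "ip MD (\<lambda>x. mm (UU0 x)) UU0 + 2 * (\<integral>z. (norm (S z))\<^sup>2 / (2 * \<mu>) + (\<sigma>h z)\<^sup>2 / (2 * (\<alpha> * \<rho>)) \<partial>QM)"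
  have N: "integrable QM (\<lambda>z. \<mu> / 2 * (norm (Gh z))\<^sup>2)" using l2_integrable_sq[OF Gh] by simp
  have P: "integrable QM (\<lambda>z. (norm (S z))\<^sup>2 / (2 * \<mu>) + (\<sigma>h z)\<^sup>2 / (2 * (\<alpha> * \<rho>)))"
    using l2_integrable_sq[OF S(1)] l2_integrable_sq[OF \<sigma>h(1)] by simp
  note est = E.energy_estimate[OF Ul2 KKv ZZ_l2[OF Ul2] UU0_l2 wk N _ P _ _ kap_nonneg]
  have nn: "0 \<le> \<mu> / 2 * (norm (Gh z))\<^sup>2" "0 \<le> (norm (S z))\<^sup>2 / (2 * \<mu>) + (\<sigma>h z)\<^sup>2 / (2 * (\<alpha> * \<rho>))" for z using pos by simp_all
  have ex: "exp (2 * kap * T) * ?E0 \<le> cc * (EE Sn)\<^sup>2"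
  proof -
    have "exp (2 * kap * T) * ?E0 \<le> exp (2 * kap * T) * ((\<rho> + 1/\<rho> + 1/\<mu>) * (EE Sn)\<^sup>2)" by (intro mult_left_mono data_bound) simp
    moreover have "2 * kap = Fb * sqrt \<alpha> + 1" by (simp add: kap_def)
    ultimately show ?thesis by (simp only: cc_def mult.assoc)
  qed
  have "(\<integral>z. \<mu> / 2 * (norm (Gh z))\<^sup>2 \<partial>QM) \<le> exp (2 * kap * T) * ?E0 / 2"
    by (rule est(1)) (use nn source_ineq in auto)
  then have "\<mu> / 2 * (l2n QM Gh)\<^sup>2 \<le> cc * (EE Sn)\<^sup>2 / 2" using ex by (simp add: l2n_def)
  then have "(l2n QM Gh)\<^sup>2 \<le> (sqrt (cc / \<mu>) * EE Sn)\<^sup>2" using pos cc_pos by (simp add: power_mult_distrib field_simps)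
  then show "l2n QM Gh \<le> sqrt (cc / \<mu>) * EE Sn"
    by (rule power2_le_imp_le) (use pos cc_pos EE_nonneg in \<open>intro mult_nonneg_nonneg, auto\<close>)
  have "AE t in MT. ip MD (\<lambda>x. mm (UGP (t,x))) (\<lambda>x. UGP (t,x)) \<le> exp (2 * kap * T) * ?E0"
    by (rule est(2)) (use nn source_ineq in auto)
  then show "AE t in MT. l2n MD (\<lambda>x. uh (t,x)) \<le> sqrt (cc / \<rho>) * EE Sn \<and> sqrt \<alpha> * l2n MD (\<lambda>x. ph (t,x)) \<le> sqrt (cc * \<rho>) * EE Sn"
    using sliceQ[OF uh] sliceQ[OF ph]
  proof eventually_elim
    case (elim t)
    have e: "ip MD (\<lambda>x. mm (UGP (t,x))) (\<lambda>x. UGP (t,x)) = \<rho> * (l2n MD (\<lambda>x. uh (t,x)))\<^sup>2 + (\<alpha> / \<rho>) * (l2n MD (\<lambda>x. ph (t,x)))\<^sup>2"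
      unfolding l2n_sq using l2_integrable_inner[OF elim(2) elim(2)] l2_integrable_inner[OF elim(3) elim(3)]
      by (simp add: ip_def mm_def inner_prod_def mult.assoc)
    have b: "\<rho> * (l2n MD (\<lambda>x. uh (t,x)))\<^sup>2 + (\<alpha> / \<rho>) * (l2n MD (\<lambda>x. ph (t,x)))\<^sup>2 \<le> cc * (EE Sn)\<^sup>2"
      using elim(1) ex unfolding e by linarith
    have n1: "0 \<le> \<rho> * (l2n MD (\<lambda>x. uh (t,x)))\<^sup>2" "0 \<le> (\<alpha> / \<rho>) * (l2n MD (\<lambda>x. ph (t,x)))\<^sup>2" using pos by simp_all
    show ?case
    proof
      have "\<rho> * (l2n MD (\<lambda>x. uh (t,x)))\<^sup>2 \<le> cc * (EE Sn)\<^sup>2" using b n1 by linarith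
      then have "(l2n MD (\<lambda>x. uh (t,x)))\<^sup>2 \<le> (sqrt (cc / \<rho>) * EE Sn)\<^sup>2" using pos cc_pos by (simp add: power_mult_distrib field_simps)
      then show "l2n MD (\<lambda>x. uh (t,x)) \<le> sqrt (cc / \<rho>) * EE Sn"
        by (rule power2_le_imp_le) (use pos cc_pos EE_nonneg in \<open>intro mult_nonneg_nonneg, auto\<close>)
      have "(\<alpha> / \<rho>) * (l2n MD (\<lambda>x. ph (t,x)))\<^sup>2 \<le> cc * (EE Sn)\<^sup>2" using b n1 by linarith
      then have "(sqrt \<alpha> * l2n MD (\<lambda>x. ph (t,x)))\<^sup>2 \<le> (sqrt (cc * \<rho>) * EE Sn)\<^sup>2" using pos cc_pos by (simp add: power_mult_distrib field_simps)
      then show "sqrt \<alpha> * l2n MD (\<lambda>x. ph (t,x)) \<le> sqrt (cc * \<rho>) * EE Sn"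
        by (rule power2_le_imp_le) (use pos cc_pos EE_nonneg in \<open>intro mult_nonneg_nonneg, auto\<close>)
    qed
  qed
qed

text \<open>Passing from a bound for almost every t to mean square in time costs sqrt T. Bounding p
  without its weight costs 1 / sqrt \<alpha>, the origin of that factor in the second estimate of
  the theorem.\<close>

lemma pressure_bound: "l2n QM ph \<le> sqrt T * (sqrt (cc * \<rho>) * EE Sn / sqrt \<alpha>)"
proof -
  let ?c = "sqrt (cc * \<rho>) * EE Sn / sqrt \<alpha>"
  have c0: "?c \<ge> 0" using pos cc_pos EE_nonneg by (intro divide_nonneg_nonneg mult_nonneg_nonneg) auto
  have l1: "l2 MT (\<lambda>t. 1::real)" using finite_measure.integrable_const[OF finT] by (simp add: l2_def)
  have "l2n MT (\<lambda>t. l2n MD (\<lambda>x. ph (t,x))) \<le> ?c * l2n MT (\<lambda>t. 1::real)"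
  proof (rule l2n_bound[OF l1 slice_norm_l2(1)[OF ph] _ c0])
    show "AE t in MT. norm (l2n MD (\<lambda>x. ph (t,x))) \<le> ?c * norm (1::real)"
      using solution_bounds(2) by eventually_elim (use pos in \<open>simp add: pos_le_divide_eq mult.commute\<close>)
  qed
  moreover have "l2n MT (\<lambda>t. 1::real) = sqrt T" using T by (simp add: l2n_def measure_restrict_space)
  ultimately show ?thesis by (simp add: slice_norm_l2(2)[OF ph] mult.commute)
qed

text \<open>For r = 0 the right-hand side is a divergence part plus a part of order zero, which is
  the input format of \<open>dual_repr\<close>.\<close>

lemma flux_split:
  assumes c: "continuous_on UNIV \<phi>" and v: "l2 MD v" "l2 MD Gv"
  shows "ip QM (ZZ UGP) (\<phi> \<otimes> (\<lambda>x. (v x, Gv x, 0))) = ip QM (\<lambda>z. fst (snd (ZZ UGP z))) (\<phi> \<otimes> Gv) + ip QM (\<lambda>z. fst (ZZ UGP z)) (\<phi> \<otimes> v)"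
proof -
  note Z = ZZ_l2[OF Ul2]
  have i: "integrable QM (\<lambda>z. fst (snd (ZZ UGP z)) \<bullet> \<phi> (fst z) *\<^sub>R Gv (snd z))" "integrable QM (\<lambda>z. fst (ZZ UGP z) \<bullet> \<phi> (fst z) *\<^sub>R v (snd z))"
    by (intro l2_integrable_inner l2_fst_comp l2_snd_comp Z tensorQ c v)+
  have "ZZ UGP z \<bullet> (\<phi> (fst z) *\<^sub>R (v (snd z), Gv (snd z), 0)) = fst (snd (ZZ UGP z)) \<bullet> \<phi> (fst z) *\<^sub>R Gv (snd z) + fst (ZZ UGP z) \<bullet> \<phi> (fst z) *\<^sub>R v (snd z)" for z
    by (simp add: inner_prod_def)
  then show ?thesis unfolding ip_def using i by simp
qed

lemma flux_bounds:
  "l2n QM (\<lambda>z. fst (snd (ZZ UGP z))) \<le> norm (mat 1 :: real^'d^'d) * l2n QM ph + (\<mu> + \<eta> * (norm (mat 1 :: real^'d^'d))\<^sup>2) * l2n QM Gh + l2n QM S"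
  "l2n QM (\<lambda>z. fst (ZZ UGP z)) \<le> \<alpha> * Fb * l2n QM ph"
proof -
  have tr: "l2 QM (\<lambda>z. Gh z \<bullet> mat 1)" by (rule l2_inner_const[OF Gh])
  have la: "l2 QM (\<lambda>z. ph z *\<^sub>R mat 1)" "l2 QM (\<lambda>z. (- \<mu>) *\<^sub>R Gh z)" "l2 QM (\<lambda>z. (- \<eta>) *\<^sub>R ((Gh z \<bullet> mat 1) *\<^sub>R mat 1))"
    by (intro l2_scaleR_const l2_scale ph Gh tr)+
  have e: "(\<lambda>z. fst (snd (ZZ UGP z))) = (\<lambda>z. ((ph z *\<^sub>R mat 1 + (- \<mu>) *\<^sub>R Gh z) + (- \<eta>) *\<^sub>R ((Gh z \<bullet> mat 1) *\<^sub>R mat 1)) + S z)"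
    by (auto simp: ZZ_def BB_def)
  have "l2n QM (\<lambda>z. fst (snd (ZZ UGP z))) \<le> ((l2n QM (\<lambda>z. ph z *\<^sub>R mat 1 :: real^'d^'d) + l2n QM (\<lambda>z. (- \<mu>) *\<^sub>R Gh z)) + l2n QM (\<lambda>z. (- \<eta>) *\<^sub>R ((Gh z \<bullet> mat 1) *\<^sub>R mat 1 :: real^'d^'d))) + l2n QM S"
    unfolding e by (intro order_trans[OF l2n_add] add_mono order_refl l2_add la S(1))
  moreover have "l2n QM (\<lambda>z. ph z *\<^sub>R mat 1 :: real^'d^'d) \<le> norm (mat 1 :: real^'d^'d) * l2n QM ph"
    by (rule l2n_bound[OF ph la(1)]) (auto simp: mult.commute)
  moreover have "l2n QM (\<lambda>z. (- \<mu>) *\<^sub>R Gh z) = \<mu> * l2n QM Gh" using pos by (simp add: l2n_scale del: scaleR_minus_left)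
  moreover have "l2n QM (\<lambda>z. (- \<eta>) *\<^sub>R ((Gh z \<bullet> mat 1) *\<^sub>R mat 1 :: real^'d^'d)) \<le> (\<eta> * (norm (mat 1 :: real^'d^'d))\<^sup>2) * l2n QM Gh"
  proof (rule l2n_bound[OF Gh la(3)])
    have "\<bar>Gh z \<bullet> mat 1\<bar> * norm (mat 1 :: real^'d^'d) \<le> (norm (Gh z) * norm (mat 1 :: real^'d^'d)) * norm (mat 1 :: real^'d^'d)" for z by (intro mult_right_mono Cauchy_Schwarz_ineq2) simp
    then have "\<eta> * (\<bar>Gh z \<bullet> mat 1\<bar> * norm (mat 1 :: real^'d^'d)) \<le> \<eta> * ((norm (Gh z) * norm (mat 1 :: real^'d^'d)) * norm (mat 1 :: real^'d^'d))" for z using pos by (intro mult_left_mono) auto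
    then show "AE z in QM. norm ((- \<eta>) *\<^sub>R ((Gh z \<bullet> mat 1) *\<^sub>R mat 1 :: real^'d^'d)) \<le> \<eta> * (norm (mat 1 :: real^'d^'d))\<^sup>2 * norm (Gh z)"
      using pos by (intro AE_I2) (simp add: power2_eq_square abs_mult ac_simps)
  qed (use pos in auto)
  ultimately show "l2n QM (\<lambda>z. fst (snd (ZZ UGP z))) \<le> norm (mat 1 :: real^'d^'d) * l2n QM ph + (\<mu> + \<eta> * (norm (mat 1 :: real^'d^'d))\<^sup>2) * l2n QM Gh + l2n QM S" by (simp add: distrib_right)
  have e2: "(\<lambda>z. fst (ZZ UGP z)) = (\<lambda>z. (\<alpha> * ph z) *\<^sub>R ff z)" by (auto simp: ZZ_def BB_def)
  show "l2n QM (\<lambda>z. fst (ZZ UGP z)) \<le> \<alpha> * Fb * l2n QM ph" unfolding e2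
  proof (rule l2n_bound[OF ph ff_scale_l2[OF ph]])
    have "\<alpha> * \<bar>ph z\<bar> * norm (ff z) \<le> \<alpha> * \<bar>ph z\<bar> * Fb" for z using pos by (intro mult_left_mono ff_bd) auto
    then show "AE z in QM. norm ((\<alpha> * ph z) *\<^sub>R ff z) \<le> \<alpha> * Fb * norm (ph z)" using pos by (intro AE_I2) (simp add: abs_mult mult.commute mult.left_commute)
  qed (use pos Fb in simp)
qed

text \<open>With r = 0 the equation expresses \<rho> u_t by the first two components of
  \<open>ZZ\<close>, so the dual field is read off from them after division by \<rho>. Time factors
  supported inside (0,T) remove the initial value.\<close>

lemma dt_exists:
  assumes CP: "CP \<ge> 0" "\<And>v G. H01 D v G \<Longrightarrow> l2n MD v \<le> CP * l2n MD G"
    and u: "AE t in MT. AE x in MD. u t x = uh (t,x)"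
  shows "\<exists>w. has_dt_Hm1 D T u w \<and> L2Hm1norm D T w \<le> 1/\<rho> * (l2n QM (\<lambda>z. fst (snd (ZZ UGP z))) + CP * l2n QM (\<lambda>z. fst (ZZ UGP z)))"
proof -
  let ?A = "\<lambda>z. (1/\<rho>) *\<^sub>R fst (snd (ZZ UGP z))" and ?b = "\<lambda>z. (1/\<rho>) *\<^sub>R fst (ZZ UGP z)"
  note Z = ZZ_l2[OF Ul2]
  have l: "l2 QM ?A" "l2 QM ?b" by (intro l2_scale l2_fst_comp l2_snd_comp Z)+
  obtain w where w: "L2Hm1 D T w" "L2Hm1norm D T w \<le> l2n QM ?A + CP * l2n QM ?b"
    "\<And>\<phi> v Gv. continuous_on UNIV \<phi> \<Longrightarrow> H01 D v Gv \<Longrightarrow> (\<integral>t. w t v * \<phi> t \<partial>MT) = ip QM ?A (\<phi> \<otimes> Gv) + ip QM ?b (\<phi> \<otimes> v)"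
    using dual_repr[OF l CP] by blast
  have "has_dt_Hm1 D T u w" unfolding has_dt_Hm1_def
  proof (intro conjI allI impI w(1))
    fix v Gv \<phi> assume h: "H01 D v Gv" and t: "test_fun {0<..<T} \<phi>"
    have z: "\<phi> 0 = 0" "\<phi> T = 0" using test_fun_outside[OF t] by auto
    have \<phi>: "C1T T \<phi> (pd \<phi> 1)" using t z by (auto simp: test_fun_def C1T_def smooth_deriv smooth_cont)
    note c = C1T_cont[OF \<phi>] and lv = H01_l2[OF h] and kK = KK_I[OF h l2_zero]
    have "- ip QM (\<lambda>z. mm (UGP z)) (pd \<phi> 1 \<otimes> (\<lambda>x. (v x, Gv x, 0))) = ip QM (ZZ UGP) (\<phi> \<otimes> (\<lambda>x. (v x, Gv x, 0)))"
      using E.weak_baseD[OF wk Ul2 Z \<phi> kK] z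
      unfolding ip_tensorQ[OF c(2) KK_l2[OF kK] E.m_l2[OF Ul2]] ip_tensorQ[OF c(1) KK_l2[OF kK] Z] by (simp add: mult.commute)
    moreover have "ip QM (\<lambda>z. mm (UGP z)) (pd \<phi> 1 \<otimes> (\<lambda>x. (v x, Gv x, 0))) = \<rho> * ip QM uh (pd \<phi> 1 \<otimes> v)"
      by (simp add: ip_def mm_def inner_prod_def mult.left_commute[of _ \<rho>])
    ultimately have "\<rho> * ip QM uh (pd \<phi> 1 \<otimes> v) = - (ip QM (\<lambda>z. fst (snd (ZZ UGP z))) (\<phi> \<otimes> Gv) + ip QM (\<lambda>z. fst (ZZ UGP z)) (\<phi> \<otimes> v))"
      using flux_split[OF c(1) lv] by simp
    then have "ip QM uh (pd \<phi> 1 \<otimes> v) = - (ip QM ?A (\<phi> \<otimes> Gv) + ip QM ?b (\<phi> \<otimes> v))"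
      unfolding ip_scale_left using pos by (simp add: field_simps)
    moreover have "integral\<^sup>L MT (\<lambda>t. integral\<^sup>L MD (\<lambda>x. u t x \<bullet> v x) * pd \<phi> 1 t) = 1 * ip QM uh (pd \<phi> 1 \<otimes> v)"
      by (rule time_term[OF _ uh lv(1) c(2)], rule AE_AE_mono[OF u], simp)
    ultimately show "integral\<^sup>L MT (\<lambda>t. integral\<^sup>L MD (\<lambda>x. u t x \<bullet> v x) * pd \<phi> 1 t) = - integral\<^sup>L MT (\<lambda>t. w t v * \<phi> t)"
      using w(3)[OF c(1) h] by simp
  qed
  moreover have "l2n QM ?A + CP * l2n QM ?b = 1/\<rho> * (l2n QM (\<lambda>z. fst (snd (ZZ UGP z))) + CP * l2n QM (\<lambda>z. fst (ZZ UGP z)))"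
    unfolding l2n_scale using pos by (simp add: algebra_simps)
  ultimately show ?thesis using w(2) by auto
qed

text \<open>Testing with v = 0 gives p_t = (\<sigma> - \<rho> div u) / \<alpha>, which is
  square-integrable and has mean zero because \<sigma> and div u do. Testing with r = 1 then carries
  the zero mean of p0 over to p(t).\<close>

lemma pressure_regular:
  assumes p: "AE t in MT. AE x in MD. p t x = ph (t,x)" and pQ: "L2Q D T p"
    and hat: "L2hat D p0" "AE t in MT. L2hat D (\<sigma> t)"
  shows "W12hat D T p"
proof -
  define q where "q z = (1/\<alpha>) *\<^sub>R (\<sigma>h z - \<rho> *\<^sub>R (Gh z \<bullet> mat 1))" for z
  have lq: "l2 QM q" unfolding q_def[abs_def] by (intro l2_scale l2_diff l2_inner_const Gh \<sigma>h)
  have q_time: "ip QM ph (\<phi>' \<otimes> r) = - ip QM q (\<phi> \<otimes> r) - ip MD p0 r * \<phi> 0" if \<phi>: "C1T T \<phi> \<phi>'" and r: "l2 MD r" for \<phi> \<phi>' r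
  proof -
    note c = C1T_cont[OF \<phi>]
    have z: "ip QM F (\<phi>'' \<otimes> (\<lambda>x. 0)) = 0" for F :: "real \<times> (real^'d) \<Rightarrow> 'z::euclidean_space" and \<phi>'' by (simp add: ip_def)
    have "- ((\<alpha> / \<rho>) * ip QM ph (\<phi>' \<otimes> r)) - (\<alpha> / \<rho>) * ip MD p0 r * \<phi> 0 = (1 / \<rho>) * ip QM \<sigma>h (\<phi> \<otimes> r) - ip QM Gh (\<phi> \<otimes> (\<lambda>x. r x *\<^sub>R mat 1))"
      using weak_imp_eqs[where u="\<lambda>t x. uh (t,x)" and G="\<lambda>t x. Gh (t,x)" and p="\<lambda>t x. ph (t,x)", OF uh _ Gh _ ph _ wk \<phi> H01_zero r] z
      by (simp add: ip_def)
    moreover have "ip QM q (\<phi> \<otimes> r) = (1/\<alpha>) * (ip QM \<sigma>h (\<phi> \<otimes> r) - \<rho> * ip QM Gh (\<phi> \<otimes> (\<lambda>x. r x *\<^sub>R mat 1)))"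
    proof -
      have "ip QM (\<lambda>z. Gh z \<bullet> mat 1) (\<phi> \<otimes> r) = ip QM Gh (\<phi> \<otimes> (\<lambda>x. r x *\<^sub>R mat 1))"
        unfolding ip_def by (intro Bochner_Integration.integral_cong) auto
      then show ?thesis unfolding q_def[abs_def] ip_scale_left
        by (simp add: ip_diff_left \<sigma>h(1) l2_scale l2_inner_const Gh tensorQ c r ip_scale_left del: real_scaleR_def)
    qed
    then have "(\<alpha> / \<rho>) * ip QM q (\<phi> \<otimes> r) = (1 / \<rho>) * ip QM \<sigma>h (\<phi> \<otimes> r) - ip QM Gh (\<phi> \<otimes> (\<lambda>x. r x *\<^sub>R mat 1))"
      using pos by (simp add: field_simps)
    ultimately have "(\<alpha> / \<rho>) * (ip QM q (\<phi> \<otimes> r) + ip QM ph (\<phi>' \<otimes> r) + ip MD p0 r * \<phi> 0) = 0" by (simp add: algebra_simps)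
    moreover have "\<alpha> / \<rho> \<noteq> 0" using pos by simp
    ultimately show ?thesis by simp
  qed
  have q_mean: "AE t in MT. ip MD (\<lambda>x. q (t,x)) (\<lambda>x. 1) = 0"
    using hat(2) \<sigma>h(2) KKv sliceQ[OF \<sigma>h(1)] sliceQ[OF Gh]
  proof eventually_elim
    case (elim t)
    have "H01 D (\<lambda>x. uh (t,x)) (\<lambda>x. Gh (t,x))" using elim(3) by (simp add: KK_def)
    then have G0: "(\<integral>x. Gh (t,x) \<bullet> mat 1 \<partial>MD) = 0" using H01_div_zero by (simp add: ip_def)
    have "(\<integral>x. \<sigma>h (t,x) \<partial>MD) = (\<integral>x. \<sigma> t x \<partial>MD)"
      by (rule integral_AE_MD[symmetric]) (use l2_meas[OF elim(4)] elim(2) in auto)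
    then have s0: "(\<integral>x. \<sigma>h (t,x) \<partial>MD) = 0" using elim(1) by (simp add: L2hat_def)
    have "integrable MD (\<lambda>x. \<sigma>h (t,x))" "integrable MD (\<lambda>x. Gh (t,x) \<bullet> mat 1)"
      using l2_integrable_inner[OF elim(4) l2_const[of "1::real"]] l2_integrable_inner[OF elim(5) l2_const[of "mat 1"]] by simp_all
    then show ?case using s0 G0 by (simp add: ip_def q_def)
  qed
  have p_mean: "AE t in MT. ip MD (\<lambda>x. ph (t,x)) (\<lambda>x. 1) = 0"
  proof (rule fund_zero[OF ip_sliceQ_integrable[OF l2_const ph]])
    fix \<xi> :: "real \<Rightarrow> real" assume \<xi>: "continuous_on UNIV \<xi>"
    \<comment> \<open>Every continuous \<xi> is the derivative of an admissible \<phi>, so the mean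
      of p(t) is orthogonal to all continuous functions of time.\<close>
    obtain \<phi> where \<phi>: "\<forall>t. (\<phi> has_real_derivative \<xi> t) (at t)" "\<phi> T = 0" using antiderivative_UNIV[OF \<xi>] by blast
    then have C: "C1T T \<phi> \<xi>" using \<xi> by (simp add: C1T_def)
    note c = C1T_cont[OF C]
    have "ip QM q (\<phi> \<otimes> (\<lambda>x. 1)) = (\<integral>t. \<phi> t * ip MD (\<lambda>x. q (t,x)) (\<lambda>x. 1) \<partial>MT)" by (rule ip_tensorQ[OF c(1) l2_const lq])
    also have "\<dots> = (\<integral>t. 0 \<partial>MT)" by (rule integral_AE_MT) (use q_mean in \<open>simp, eventually_elim, simp\<close>)
    finally have "ip QM q (\<phi> \<otimes> (\<lambda>x. 1)) = 0" by simp
    moreover have "ip MD p0 (\<lambda>x. 1) = 0" using hat(1) by (simp add: L2hat_def ip_def)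
    ultimately show "(\<integral>t. \<xi> t * ip MD (\<lambda>x. ph (t,x)) (\<lambda>x. 1) \<partial>MT) = 0"
      using q_time[OF C l2_const[of 1]] ip_tensorQ[OF \<xi> l2_const[of "1::real"] ph] by simp
  qed
  show ?thesis unfolding W12hat_def
  proof (intro conjI exI[of _ "\<lambda>t x. q (t,x)"] allI impI pQ l2_QM_L2Q lq)
    show "AE t in MT. L2hat D (p t)"
      using p p_mean sliceQ[OF ph]
    proof eventually_elim
      case (elim t)
      have m: "p t \<in> borel_measurable MD" by (rule meas_AE_MD[OF l2_meas[OF elim(3)] elim(1)])
      have "l2 MD (p t)" by (rule l2_AE_cong[OF elim(3) m]) (use elim(1) in \<open>eventually_elim, simp\<close>)
      moreover have "integral\<^sup>L MD (p t) = (\<integral>x. ph (t,x) \<partial>MD)" by (rule integral_AE_MD[OF l2_meas[OF elim(3)] elim(1)])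
      ultimately show ?case using elim(2) by (simp add: L2hat_def L2_eq ip_def)
    qed
    show "AE t in MT. L2hat D (\<lambda>x. q (t,x))"
      using q_mean sliceQ[OF lq] by eventually_elim (simp add: L2hat_def L2_eq ip_def)
    fix r \<phi> assume "L2 D r" and t: "test_fun {0<..<T} \<phi>"
    then have r: "l2 MD r" by (simp add: L2_eq)
    have z: "\<phi> 0 = 0" "\<phi> T = 0" using test_fun_outside[OF t] by auto
    have \<phi>: "C1T T \<phi> (pd \<phi> 1)" using t z by (auto simp: test_fun_def C1T_def smooth_deriv smooth_cont)
    note c = C1T_cont[OF \<phi>]
    have "integral\<^sup>L MT (\<lambda>t. integral\<^sup>L MD (\<lambda>x. p t x * r x) * pd \<phi> 1 t) = 1 * ip QM ph (pd \<phi> 1 \<otimes> r)"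
      by (rule time_term[OF _ ph r c(2)], rule AE_AE_mono[OF p], simp)
    moreover have "integral\<^sup>L MT (\<lambda>t. integral\<^sup>L MD (\<lambda>x. q (t,x) * r x) * \<phi> t) = 1 * ip QM q (\<phi> \<otimes> r)"
      by (rule time_term[OF _ lq r c(1)]) simp
    ultimately show "integral\<^sup>L MT (\<lambda>t. integral\<^sup>L MD (\<lambda>x. p t x * r x) * pd \<phi> 1 t) = - integral\<^sup>L MT (\<lambda>t. integral\<^sup>L MD (\<lambda>x. q (t,x) * r x) * \<phi> t)"
      using q_time[OF \<phi> r] z by simp
  qed
qed

end

lemma weak_solution_exists: "\<exists>u G p. weak_sol D T \<rho> \<alpha> \<mu> \<eta> \<sigma> s f u0 p0 u G p"
proof -
  obtain c0 where c0: "c0 > 0" "\<forall>z b. c0 * (b \<bullet> b) \<le> kap * (mm b \<bullet> b) - BB z b \<bullet> b" using BB_coercive by blast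
  obtain U where U: "l2 QM U" "AE t in MT. (\<lambda>x. U (t,x)) \<in> KK"
    "E.weak U (\<lambda>z. BB z (U z) + (0, S z, \<sigma>h z / \<rho>)) UU0"
    using E.weak_exists[OF BB_l2 BB'_l2 BB_adj BB_scale c0(2)[rule_format] c0(1) src_l2 UU0_l2] by blast
  have e: "(\<lambda>z. (fst (U z), fst (snd (U z)), snd (snd (U z)))) = U" by simp
  have w: "E.weak U (ZZ U) UU0" using U(3) by (simp add: ZZ_def[abs_def])
  note l = l2_fst_comp[OF U(1)] l2_fst_comp[OF l2_snd_comp[OF U(1)]] l2_snd_comp[OF l2_snd_comp[OF U(1)]]
  have "L2H01 D T (\<lambda>t x. fst (U (t,x))) (\<lambda>t x. fst (snd (U (t,x))))"
    unfolding L2H01_def using l2_QM_L2Q[OF l(1)] l2_QM_L2Q[OF l(2)] U(2) by (auto simp: KK_def elim!: eventually_mono)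
  from weak_imp_weak_sol[OF l(1) _ l(2) _ l(3) _ _ this l2_QM_L2Q[OF l(3)]] w e show ?thesis by auto
qed

end

section \<open>Uniqueness\<close>

context system_data
begin

lemma BB_diff: "BB z (b - b') = BB z b - BB z b'"
  by (simp add: BB_def algebra_simps)

text \<open>The difference solves the equation with zero data, so its energy vanishes for almost
  every t. The energy sees the first and third components, which are the ones compared.\<close>

lemma weak_unique:
  assumes U: "l2 QM U" "AE t in MT. (\<lambda>x. U (t,x)) \<in> KK" "E.weak U (ZZ U) UU0"
    and V: "l2 QM V" "AE t in MT. (\<lambda>x. V (t,x)) \<in> KK" "E.weak V (ZZ V) UU0"
  shows "AE z in QM. fst (U z) = fst (V z) \<and> snd (snd (U z)) = snd (snd (V z))"
proof -
  let ?W = "\<lambda>z. U z - V z" and ?Z = "\<lambda>z. ZZ U z - ZZ V z"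
  note Z = ZZ_l2[OF U(1)] ZZ_l2[OF V(1)]
  have lW: "l2 QM ?W" and lZ: "l2 QM ?Z" by (intro l2_diff U V Z)+
  have W: "AE t in MT. (\<lambda>x. U (t,x) - V (t,x)) \<in> KK" using U(2) V(2) by eventually_elim (rule E.K_diff)
  have e: "?Z z = BB z (?W z)" for z by (simp add: ZZ_def BB_diff)
  have w: "E.weak ?W ?Z (\<lambda>x. 0)" unfolding E.weak_def
  proof (intro allI impI)
    fix \<psi> d\<psi> \<psi>0 assume A: "E.Tens \<psi> d\<psi> \<psi>0"
    note l = E.Tens_l2[OF A]
    have "- ip QM (\<lambda>z. mm (U z)) d\<psi> - ip MD (\<lambda>x. mm (UU0 x)) \<psi>0 = ip QM (ZZ U) \<psi>"
      "- ip QM (\<lambda>z. mm (V z)) d\<psi> - ip MD (\<lambda>x. mm (UU0 x)) \<psi>0 = ip QM (ZZ V) \<psi>"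
      using U(3) V(3) A unfolding E.weak_def by blast+
    then show "- ip QM (\<lambda>z. mm (?W z)) d\<psi> - ip MD (\<lambda>x. mm 0) \<psi>0 = ip QM ?Z \<psi>"
      by (simp add: E.m.diff E.m.zero ip_diff_left E.m_l2 U(1) V(1) l Z) (simp add: ip_def)
  qed
  have dis: "?Z z \<bullet> ?W z \<le> kap * (mm (?W z) \<bullet> ?W z) - 0 + 0" for z
  proof -
    have "BB z (?W z) \<bullet> ?W z \<le> (kap - 1/2) * (mm (?W z) \<bullet> ?W z) - \<mu> * (norm (fst (snd (?W z))))\<^sup>2" by (rule BB_dissipative)
    moreover have "0 \<le> \<mu> * (norm (fst (snd (?W z))))\<^sup>2" using pos by simp
    ultimately show ?thesis using E.m_psd[of "?W z"] unfolding e by (simp add: left_diff_distrib)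
  qed
  have "AE t in MT. ip MD (\<lambda>x. mm (?W (t,x))) (\<lambda>x. ?W (t,x)) \<le> exp (2 * kap * T) * (ip MD (\<lambda>x. mm 0) (\<lambda>x. 0) + 2 * (\<integral>z. 0 \<partial>QM))"
    by (rule E.energy_estimate(2)[OF lW W lZ l2_zero w _ _ _ _ _ kap_nonneg, of "\<lambda>z. 0" "\<lambda>z. 0"]) (use dis in auto)
  then have en: "AE t in MT. ip MD (\<lambda>x. mm (?W (t,x))) (\<lambda>x. ?W (t,x)) \<le> 0" by (simp add: ip_def)
  note c = l2_fst_comp[OF lW] l2_snd_comp[OF l2_snd_comp[OF lW]]
  have z: "AE t in MT. l2n MD (\<lambda>x. fst (?W (t,x))) \<le> 0 \<and> l2n MD (\<lambda>x. snd (snd (?W (t,x)))) \<le> 0"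
    using en sliceQ[OF c(1)] sliceQ[OF c(2)]
  proof eventually_elim
    case (elim t)
    have "ip MD (\<lambda>x. mm (?W (t,x))) (\<lambda>x. ?W (t,x)) = \<rho> * (l2n MD (\<lambda>x. fst (?W (t,x))))\<^sup>2 + (\<alpha> / \<rho>) * (l2n MD (\<lambda>x. snd (snd (?W (t,x)))))\<^sup>2"
      unfolding l2n_sq using l2_integrable_inner[OF elim(2) elim(2)] l2_integrable_inner[OF elim(3) elim(3)]
      by (simp add: ip_def mm_def inner_prod_def mult.assoc)
    then have "\<rho> * (l2n MD (\<lambda>x. fst (?W (t,x))))\<^sup>2 + (\<alpha> / \<rho>) * (l2n MD (\<lambda>x. snd (snd (?W (t,x)))))\<^sup>2 \<le> 0" using elim(1) by simp
    moreover have "0 \<le> \<rho> * (l2n MD (\<lambda>x. fst (?W (t,x))))\<^sup>2" "0 \<le> (\<alpha> / \<rho>) * (l2n MD (\<lambda>x. snd (snd (?W (t,x)))))\<^sup>2" using pos by simp_all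
    ultimately have "\<rho> * (l2n MD (\<lambda>x. fst (?W (t,x))))\<^sup>2 = 0" "(\<alpha> / \<rho>) * (l2n MD (\<lambda>x. snd (snd (?W (t,x)))))\<^sup>2 = 0" by linarith+
    then show ?case using pos by simp
  qed
  have "l2n QM (\<lambda>z. fst (?W z)) \<le> 0 * l2n QM ?W" "l2n QM (\<lambda>z. snd (snd (?W z))) \<le> 0 * l2n QM ?W"
    by (rule slice_dominated[OF lW c(1)], use z in \<open>eventually_elim, simp\<close>, simp)
       (rule slice_dominated[OF lW c(2)], use z in \<open>eventually_elim, simp\<close>, simp)
  then have "l2n QM (\<lambda>z. fst (?W z)) = 0" "l2n QM (\<lambda>z. snd (snd (?W z))) = 0" by (simp_all add: antisym)
  from l2n_eq_0_AE[OF c(1) this(1)] l2n_eq_0_AE[OF c(2) this(2)] show ?thesis by eventually_elim simp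
qed

end

context cyl
begin

lemma LinfL2norm_le:
  fixes u :: "real \<Rightarrow> real^'d \<Rightarrow> 'b::euclidean_space"
  assumes uh: "l2 QM uh" "AE t in MT. AE x in MD. u t x = uh (t,x)" and B: "AE t in MT. l2n MD (\<lambda>x. uh (t,x)) \<le> B"
  shows "LinfL2norm D T u \<le> ereal B"
proof -
  have e: "AE t in MT. L2vnorm D (u t) = l2n MD (\<lambda>x. uh (t,x))"
    using uh(2) sliceQ[OF uh(1)]
  proof eventually_elim
    case (elim t)
    have "integral\<^sup>L MD (\<lambda>x. (norm (u t x))\<^sup>2) = integral\<^sup>L MD (\<lambda>x. (norm (uh (t,x)))\<^sup>2)"
      by (rule integral_AE_MD) (use l2_integrable_sq[OF elim(2)] elim(1) in \<open>auto elim: eventually_mono\<close>)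
    then show ?case by (simp add: L2vnorm_def l2n_def)
  qed
  have "(\<lambda>t. L2vnorm D (u t)) \<in> borel_measurable MT" by (rule meas_AE_MT[OF l2_meas[OF slice_norm_l2(1)[OF uh(1)]] e])
  then have "(\<lambda>t. ereal (L2vnorm D (u t))) \<in> borel_measurable MT" by measurable
  moreover have "AE t in MT. ereal (L2vnorm D (u t)) \<le> ereal B" using e B by eventually_elim simp
  ultimately show ?thesis unfolding LinfL2norm_def by (rule esssup_I)
qed

lemma bounded_field_version:
  assumes f: "LinfQ D T f" and ne: "D \<noteq> {}"
  shows "0 \<le> LinfQnorm D T f" "\<exists>ff\<in>borel_measurable QM. (\<forall>z. norm (ff z) \<le> LinfQnorm D T f) \<and> (AE t in MT. AE x in MD. f t x = ff (t,x))"
proof -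
  define E where "E = esssup (lebesgue_on (QT D T)) (\<lambda>(t,x). ereal (norm (f t x)))"
  have fin: "E < \<infinity>" and m: "(\<lambda>(t,x). f t x) \<in> borel_measurable (lebesgue_on (QT D T))" using f by (auto simp: LinfQ_def E_def)
  have ae: "AE z in lebesgue_on (QT D T). ereal (norm (f (fst z) (snd z))) \<le> E"
    using esssup_AE[of "\<lambda>(t,x). ereal (norm (f t x))" "lebesgue_on (QT D T)"] by (simp add: E_def case_prod_beta)
  \<comment> \<open>On a null set the essential supremum could be minus infinity; the cylinder is
    open and nonempty, hence not null.\<close>
  have E0: "0 \<le> E"
  proof (rule ccontr)
    assume neg: "\<not> 0 \<le> E"
    have "AE z in lebesgue_on (QT D T). False" using ae
    proof eventually_elim
      case (elim z)
      have "0 \<le> ereal (norm (f (fst z) (snd z)))" by simp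
      also note elim
      finally show ?case using neg by simp
    qed
    then have "AE z in lebesgue. z \<notin> QT D T" using QT_sets by (subst (asm) AE_restrict_space_iff) auto
    then have "QT D T \<in> null_sets lebesgue" using QT_sets(2) by (simp add: AE_iff_null_sets)
    moreover have "open (QT D T)" unfolding QT_def by (intro open_Times openD) auto
    moreover have "QT D T \<noteq> {}" using ne T by (auto simp: QT_def intro: dense)
    ultimately show False using open_not_negligible negligible_iff_null_sets by blast
  qed
  then have Er: "E = ereal (LinfQnorm D T f)" using fin by (cases E) (auto simp: LinfQnorm_def E_def)
  show F0: "0 \<le> LinfQnorm D T f" using E0 by (simp add: Er)
  obtain h where h: "h \<in> borel_measurable QM" "AE z in lebesgue_on (QT D T). f (fst z) (snd z) = h z" using QT_version[OF m] by blast
  \<comment> \<open>Values above the essential bound occur only on a null set. Replacing them by 0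
    makes the bound hold at every point, as the pointwise coercivity estimate requires.\<close>
  define ff where "ff z = (if norm (h z) \<le> LinfQnorm D T f then h z else 0)" for z
  have "AE z in lebesgue_on (QT D T). f (fst z) (snd z) = ff z"
    using h(2) ae by eventually_elim (auto simp: ff_def Er)
  then have "AE z in QM. f (fst z) (snd z) = ff z" by (rule AE_QT_QM)
  then have "AE t in MT. AE x in MD. f t x = ff (t,x)" using pair_sigma_finite.AE_pair[OF pairQ] by fastforce
  moreover have "ff \<in> borel_measurable QM" unfolding ff_def using h(1) by measurable
  moreover have "\<forall>z. norm (ff z) \<le> LinfQnorm D T f" using F0 by (simp add: ff_def)
  ultimately show "\<exists>ff\<in>borel_measurable QM. (\<forall>z. norm (ff z) \<le> LinfQnorm D T f) \<and> (AE t in MT. AE x in MD. f t x = ff (t,x))" by blast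
qed

end

text \<open>\<open>cc\<close> with its parameters made explicit: the constants of the theorem are
  functions of F and the coefficients, chosen before the data.\<close>

definition growth :: "real \<Rightarrow> real \<Rightarrow> real \<Rightarrow> real \<Rightarrow> real \<Rightarrow> real" where
  "growth T F \<alpha> \<rho> \<mu> = exp ((F * sqrt \<alpha> + 1) * T) * (\<rho> + 1/\<rho> + 1/\<mu>)"

text \<open>The sum of the constants in \<open>solution_bounds\<close> for Du, u and sqrt \<alpha>
  p. Reciprocals appear as factors, so that the limit \<alpha> -> 0 is taken without conditions on
  \<rho> and \<mu>.\<close>

definition energy_const :: "real \<Rightarrow> real \<Rightarrow> real \<Rightarrow> real \<Rightarrow> real \<Rightarrow> real \<Rightarrow> real" where
  "energy_const T F \<alpha> \<rho> \<mu> \<eta> = sqrt (growth T F \<alpha> \<rho> \<mu> * (1/\<mu>)) + sqrt (growth T F \<alpha> \<rho> \<mu> * (1/\<rho>)) + sqrt (growth T F \<alpha> \<rho> \<mu> * \<rho>)"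

text \<open>\<open>dn\<close> stands for the norm of the identity matrix, \<open>CP\<close> for a Poincare constant.\<close>
definition dt_const :: "real \<Rightarrow> real \<Rightarrow> real \<Rightarrow> real \<Rightarrow> real \<Rightarrow> real \<Rightarrow> real \<Rightarrow> real \<Rightarrow> real" where
  "dt_const dn CP T F \<alpha> \<rho> \<mu> \<eta> = sqrt \<alpha> * sqrt (growth T F \<alpha> \<rho> \<mu> * (1/\<mu>))
    + 1/\<rho> * (dn * (sqrt T * sqrt (growth T F \<alpha> \<rho> \<mu> * \<rho>)) + (\<mu> + \<eta> * dn\<^sup>2) * (sqrt \<alpha> * sqrt (growth T F \<alpha> \<rho> \<mu> * (1/\<mu>))) + sqrt \<alpha>
       + CP * (\<alpha> * F * (sqrt T * sqrt (growth T F \<alpha> \<rho> \<mu> * \<rho>))))"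

text \<open>\<alpha> enters both constants only through itself, sqrt \<alpha> and the exponential of
  a multiple of sqrt \<alpha>, never as a divisor, so both have finite limits at 0.\<close>

lemma consts_bounded:
  "\<exists>M. \<forall>\<^sub>F \<alpha> in at_right 0. energy_const T F \<alpha> \<rho> \<mu> \<eta> \<le> M \<and> dt_const dn CP T F \<alpha> \<rho> \<mu> \<eta> \<le> M"
proof -
  have 1: "((\<lambda>\<alpha>. energy_const T F \<alpha> \<rho> \<mu> \<eta>) \<longlongrightarrow> energy_const T F 0 \<rho> \<mu> \<eta>) (at_right 0)"
    unfolding energy_const_def growth_def by (intro tendsto_intros)
  have 2: "((\<lambda>\<alpha>. dt_const dn CP T F \<alpha> \<rho> \<mu> \<eta>) \<longlongrightarrow> dt_const dn CP T F 0 \<rho> \<mu> \<eta>) (at_right 0)"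
    unfolding dt_const_def growth_def by (intro tendsto_intros)
  let ?M = "max (energy_const T F 0 \<rho> \<mu> \<eta>) (dt_const dn CP T F 0 \<rho> \<mu> \<eta>) + 1"
  have "\<forall>\<^sub>F \<alpha> in at_right 0. energy_const T F \<alpha> \<rho> \<mu> \<eta> < ?M" "\<forall>\<^sub>F \<alpha> in at_right 0. dt_const dn CP T F \<alpha> \<rho> \<mu> \<eta> < ?M"
    by (rule order_tendstoD(2)[OF 1], simp) (rule order_tendstoD(2)[OF 2], simp)
  then have "\<forall>\<^sub>F \<alpha> in at_right 0. energy_const T F \<alpha> \<rho> \<mu> \<eta> \<le> ?M \<and> dt_const dn CP T F \<alpha> \<rho> \<mu> \<eta> \<le> ?M" by eventually_elim auto
  then show ?thesis by blast
qed

context system_data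
begin

lemma solution_estimates:
  assumes sol: "weak_sol D T \<rho> \<alpha> \<mu> \<eta> \<sigma> s f u0 p0 u G p" and Sn: "l2n QM S \<le> Sn"
    and CP: "CP \<ge> 0" "\<And>v G. H01 D v G \<Longrightarrow> l2n MD v \<le> CP * l2n MD G"
  shows "ereal (L2Qnorm D T G) + LinfL2norm D T u + ereal (sqrt \<alpha>) * LinfL2norm D T p \<le> ereal (energy_const T Fb \<alpha> \<rho> \<mu> \<eta> * EE Sn)"
    and "\<exists>w. has_dt_Hm1 D T u w \<and> L2Qnorm D T G + L2Hm1norm D T w \<le> dt_const (norm (mat 1 :: real^'d^'d)) CP T Fb \<alpha> \<rho> \<mu> \<eta> * EE Sn / sqrt \<alpha>"
    and "L2hat D p0 \<Longrightarrow> AE t in MT. L2hat D (\<sigma> t) \<Longrightarrow> W12hat D T p"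
proof -
  have L: "L2Q D T u" "L2Q D T G" "L2Q D T p" using sol by (auto simp: weak_sol_def L2H01_def)
  obtain uh where uh: "l2 QM uh" "AE t in MT. AE x in MD. u t x = uh (t,x)" using L2Q_version[OF L(1)] by blast
  obtain Gh where Gh: "l2 QM Gh" "L2Qnorm D T G = l2n QM Gh" "AE t in MT. AE x in MD. G t x = Gh (t,x)" using L2Q_version[OF L(2)] by blast
  obtain ph where ph: "l2 QM ph" "AE t in MT. AE x in MD. p t x = ph (t,x)" using L2Q_version[OF L(3)] by blast
  note wk = weak_sol_imp_weak[OF uh Gh(1,3) ph sol]
  note A = uh(1) Gh(1) ph(1) wk
  note sb = solution_bounds[OF A Sn]
  have gr: "growth T Fb \<alpha> \<rho> \<mu> = cc" by (simp add: growth_def cc_def)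
  have EE: "EE Sn \<ge> 0" by (rule EE_nonneg[OF A Sn])
  have sa: "sqrt \<alpha> > 0" using pos by simp
  have u: "LinfL2norm D T u \<le> ereal (sqrt (cc / \<rho>) * EE Sn)"
    by (rule LinfL2norm_le[OF uh]) (use sb(2) in \<open>eventually_elim, simp\<close>)
  have p: "LinfL2norm D T p \<le> ereal (sqrt (cc * \<rho>) * EE Sn / sqrt \<alpha>)"
    by (rule LinfL2norm_le[OF ph]) (use sb(2) in \<open>eventually_elim, use sa in \<open>simp add: pos_le_divide_eq mult.commute\<close>\<close>)
  have p': "ereal (sqrt \<alpha>) * LinfL2norm D T p \<le> ereal (sqrt (cc * \<rho>) * EE Sn)"
  proof -
    have "ereal (sqrt \<alpha>) * LinfL2norm D T p \<le> ereal (sqrt \<alpha>) * ereal (sqrt (cc * \<rho>) * EE Sn / sqrt \<alpha>)"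
      using sa by (intro ereal_mult_left_mono p) simp
    then show ?thesis using sa by simp
  qed
  have "ereal (L2Qnorm D T G) + LinfL2norm D T u + ereal (sqrt \<alpha>) * LinfL2norm D T p
      \<le> ereal (sqrt (cc / \<mu>) * EE Sn) + ereal (sqrt (cc / \<rho>) * EE Sn) + ereal (sqrt (cc * \<rho>) * EE Sn)"
    using sb(1) by (intro add_mono u p') (simp add: Gh(2))
  then show "ereal (L2Qnorm D T G) + LinfL2norm D T u + ereal (sqrt \<alpha>) * LinfL2norm D T p \<le> ereal (energy_const T Fb \<alpha> \<rho> \<mu> \<eta> * EE Sn)"
    by (simp add: energy_const_def gr distrib_right)
  show "W12hat D T p" if "L2hat D p0" "AE t in MT. L2hat D (\<sigma> t)"
    by (rule pressure_regular[OF A Sn ph(2) L(3) that])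
  obtain w where w: "has_dt_Hm1 D T u w" "L2Hm1norm D T w \<le> 1/\<rho> * (l2n QM (\<lambda>z. fst (snd (ZZ (\<lambda>z. (uh z, Gh z, ph z)) z))) + CP * l2n QM (\<lambda>z. fst (ZZ (\<lambda>z. (uh z, Gh z, ph z)) z)))"
    using dt_exists[OF A Sn CP uh(2)] by blast
  let ?n = "norm (mat 1 :: real^'d^'d)" and ?g = "sqrt (cc / \<mu>)" and ?q = "sqrt T * sqrt (cc * \<rho>)"
  \<comment> \<open>In units of E / sqrt \<alpha> the bound for p is free of the divisor sqrt
    \<alpha>, while those for Du and S gain a factor sqrt \<alpha>. This explains the shape of
    \<open>dt_const\<close>.\<close>
  define e where "e = EE Sn / sqrt \<alpha>"
  have Ee: "EE Sn = sqrt \<alpha> * e" using sa by (simp add: e_def)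
  have G1: "l2n QM Gh \<le> (sqrt \<alpha> * ?g) * e" using sb(1) by (simp add: Ee mult_ac)
  have p1: "l2n QM ph \<le> ?q * e" using pressure_bound[OF A Sn] by (simp add: e_def mult.assoc)
  have S1: "l2n QM S \<le> sqrt \<alpha> * e"
  proof -
    have "Sn \<le> EE Sn" using pos by (simp add: EE_def)
    then show ?thesis using Sn by (simp add: Ee)
  qed
  have A1: "l2n QM (\<lambda>z. fst (snd (ZZ (\<lambda>z. (uh z, Gh z, ph z)) z))) \<le> ?n * (?q * e) + (\<mu> + \<eta> * ?n\<^sup>2) * ((sqrt \<alpha> * ?g) * e) + sqrt \<alpha> * e"
    using pos by (intro order_trans[OF flux_bounds(1)[OF A Sn]] add_mono mult_left_mono p1 G1 S1) auto
  have b1: "l2n QM (\<lambda>z. fst (ZZ (\<lambda>z. (uh z, Gh z, ph z)) z)) \<le> \<alpha> * Fb * (?q * e)"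
    using pos Fb by (intro order_trans[OF flux_bounds(2)[OF A Sn]] mult_left_mono p1) auto
  have "L2Hm1norm D T w \<le> 1/\<rho> * ((?n * (?q * e) + (\<mu> + \<eta> * ?n\<^sup>2) * ((sqrt \<alpha> * ?g) * e) + sqrt \<alpha> * e) + CP * (\<alpha> * Fb * (?q * e)))"
    using pos CP(1) by (intro order_trans[OF w(2)] mult_left_mono add_mono A1 b1) auto
  then have "L2Qnorm D T G + L2Hm1norm D T w \<le> (sqrt \<alpha> * ?g) * e + 1/\<rho> * ((?n * (?q * e) + (\<mu> + \<eta> * ?n\<^sup>2) * ((sqrt \<alpha> * ?g) * e) + sqrt \<alpha> * e) + CP * (\<alpha> * Fb * (?q * e)))"
    using G1 Gh(2) by linarith
  also have "\<dots> = dt_const ?n CP T Fb \<alpha> \<rho> \<mu> \<eta> * e"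
    unfolding dt_const_def gr by (simp add: algebra_simps)
  finally show "\<exists>w. has_dt_Hm1 D T u w \<and> L2Qnorm D T G + L2Hm1norm D T w \<le> dt_const ?n CP T Fb \<alpha> \<rho> \<mu> \<eta> * EE Sn / sqrt \<alpha>"
    using w(1) by (auto simp: e_def)
qed

lemma solution_unique:
  assumes 1: "weak_sol D T \<rho> \<alpha> \<mu> \<eta> \<sigma> s f u0 p0 u1 G1 p1" and 2: "weak_sol D T \<rho> \<alpha> \<mu> \<eta> \<sigma> s f u0 p0 u2 G2 p2"
  shows "AE z in lebesgue_on (QT D T). u1 (fst z) (snd z) = u2 (fst z) (snd z) \<and> p1 (fst z) (snd z) = p2 (fst z) (snd z)"
proof -
  have ex: "\<exists>U. l2 QM U \<and> (AE t in MT. (\<lambda>x. U (t,x)) \<in> KK) \<and> E.weak U (ZZ U) UU0 \<and>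
     (AE z in lebesgue_on (QT D T). u (fst z) (snd z) = fst (U z) \<and> p (fst z) (snd z) = snd (snd (U z)))"
    if sol: "weak_sol D T \<rho> \<alpha> \<mu> \<eta> \<sigma> s f u0 p0 u G p" for u G p
  proof -
    have L: "L2Q D T u" "L2Q D T G" "L2Q D T p" using sol by (auto simp: weak_sol_def L2H01_def)
    obtain uh where uh: "l2 QM uh" "AE z in lebesgue_on (QT D T). u (fst z) (snd z) = uh z" "AE t in MT. AE x in MD. u t x = uh (t,x)" using L2Q_version[OF L(1)] by blast
    obtain Gh where Gh: "l2 QM Gh" "AE t in MT. AE x in MD. G t x = Gh (t,x)" using L2Q_version[OF L(2)] by blast
    obtain ph where ph: "l2 QM ph" "AE z in lebesgue_on (QT D T). p (fst z) (snd z) = ph z" "AE t in MT. AE x in MD. p t x = ph (t,x)" using L2Q_version[OF L(3)] by blast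
    note wk = weak_sol_imp_weak[OF uh(1,3) Gh ph(1,3) sol]
    have "AE z in lebesgue_on (QT D T). u (fst z) (snd z) = fst (uh z, Gh z, ph z) \<and> p (fst z) (snd z) = snd (snd (uh z, Gh z, ph z))"
      using uh(2) ph(2) by eventually_elim simp
    then show ?thesis using wk U_l2[OF uh(1,3) Gh ph(1,3)] by (intro exI[of _ "\<lambda>z. (uh z, Gh z, ph z)"]) simp
  qed
  obtain U where U: "l2 QM U" "AE t in MT. (\<lambda>x. U (t,x)) \<in> KK" "E.weak U (ZZ U) UU0"
    "AE z in lebesgue_on (QT D T). u1 (fst z) (snd z) = fst (U z) \<and> p1 (fst z) (snd z) = snd (snd (U z))" using ex[OF 1] by blast
  obtain V where V: "l2 QM V" "AE t in MT. (\<lambda>x. V (t,x)) \<in> KK" "E.weak V (ZZ V) UU0"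
    "AE z in lebesgue_on (QT D T). u2 (fst z) (snd z) = fst (V z) \<and> p2 (fst z) (snd z) = snd (snd (V z))" using ex[OF 2] by blast
  show ?thesis using AE_QM_QT[OF weak_unique[OF U(1-3) V(1-3)]] U(4) V(4) by eventually_elim simp
qed

end

theorem mainTheorem5:
  fixes D :: "(real^'d) set" and T :: real
  assumes "CARD('d) \<ge> 2" and "bounded_domain D" and "piecewise_smooth_boundary D" and "T > 0"
  shows "\<exists>C Ct :: real \<Rightarrow> real \<Rightarrow> real \<Rightarrow> real \<Rightarrow> real \<Rightarrow> real.
    (\<forall>F \<rho>0 \<mu> \<eta>. \<exists>M. \<forall>\<^sub>F \<alpha> in at_right 0. C F \<alpha> \<rho>0 \<mu> \<eta> \<le> M \<and> Ct F \<alpha> \<rho>0 \<mu> \<eta> \<le> M) \<and>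
    (\<forall>\<rho>0 \<alpha> \<mu> \<eta> \<sigma> s f u0 p0.
       \<rho>0 > 0 \<longrightarrow> \<alpha> > 0 \<longrightarrow> \<mu> > 0 \<longrightarrow> \<eta> \<ge> 0 \<longrightarrow>
       L2Q D T \<sigma> \<longrightarrow> L2Hm1 D T s \<longrightarrow> LinfQ D T f \<longrightarrow> L2v D u0 \<longrightarrow> L2 D p0 \<longrightarrow>
       (let E = L2vnorm D u0 + sqrt \<alpha> * L2norm D p0 + L2Qnorm D T \<sigma> / sqrt \<alpha> + L2Hm1norm D T s;
            F = LinfQnorm D T f
        in (\<exists>u G p. weak_sol D T \<rho>0 \<alpha> \<mu> \<eta> \<sigma> s f u0 p0 u G p) \<and>
           (\<forall>u1 G1 p1 u2 G2 p2. weak_sol D T \<rho>0 \<alpha> \<mu> \<eta> \<sigma> s f u0 p0 u1 G1 p1 \<longrightarrow>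
               weak_sol D T \<rho>0 \<alpha> \<mu> \<eta> \<sigma> s f u0 p0 u2 G2 p2 \<longrightarrow>
               (AE z in lebesgue_on (QT D T). u1 (fst z) (snd z) = u2 (fst z) (snd z) \<and>
                                              p1 (fst z) (snd z) = p2 (fst z) (snd z))) \<and>
           (\<forall>u G p. weak_sol D T \<rho>0 \<alpha> \<mu> \<eta> \<sigma> s f u0 p0 u G p \<longrightarrow>
               ereal (L2Qnorm D T G) + LinfL2norm D T u + ereal (sqrt \<alpha>) * LinfL2norm D T p
                 \<le> ereal (C F \<alpha> \<rho>0 \<mu> \<eta> * E) \<and>
               (\<exists>w. has_dt_Hm1 D T u w \<and>
                    L2Qnorm D T G + L2Hm1norm D T w \<le> Ct F \<alpha> \<rho>0 \<mu> \<eta> * E / sqrt \<alpha>) \<and>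
               (L2hat D p0 \<longrightarrow> (AE t in lebesgue_on {0..T}. L2hat D (\<sigma> t)) \<longrightarrow> W12hat D T p))))"
proof -
  interpret cyl D T
    using assms(2,4) by (auto intro!: cyl.intro domain.intro cyl_axioms.intro simp: bounded_domain_def)
  have ne: "D \<noteq> {}" using assms(2) by (simp add: bounded_domain_def)
  \<comment> \<open>The Poincare constant belongs to D alone and is fixed before coefficients and
    data, so it may enter the constant for u_t.\<close>
  obtain CP where CP: "CP \<ge> 0" "\<And>v G. H01 D v G \<Longrightarrow> l2n MD v \<le> CP * l2n MD G" using poincare by blast
  show ?thesis
  proof (rule exI[of _ "energy_const T"], rule exI[of _ "dt_const (norm (mat 1 :: real^'d^'d)) CP T"], intro conjI allI impI)
    fix F \<rho>0 \<mu> \<eta> :: real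
    show "\<exists>M. \<forall>\<^sub>F \<alpha> in at_right 0. energy_const T F \<alpha> \<rho>0 \<mu> \<eta> \<le> M \<and> dt_const (norm (mat 1 :: real^'d^'d)) CP T F \<alpha> \<rho>0 \<mu> \<eta> \<le> M"
      by (rule consts_bounded)
  next
    fix \<rho>0 \<alpha> \<mu> \<eta> :: real and \<sigma> :: "real \<Rightarrow> real^'d \<Rightarrow> real" and s :: "real \<Rightarrow> (real^'d \<Rightarrow> real^'d) \<Rightarrow> real"
      and f :: "real \<Rightarrow> real^'d \<Rightarrow> real^'d" and u0 :: "real^'d \<Rightarrow> real^'d" and p0 :: "real^'d \<Rightarrow> real"
    assume pos: "\<rho>0 > 0" "\<alpha> > 0" "\<mu> > 0" "\<eta> \<ge> 0"
      and d: "L2Q D T \<sigma>" "L2Hm1 D T s" "LinfQ D T f" "L2v D u0" "L2 D p0"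
    obtain \<sigma>h where sr: "l2 QM \<sigma>h" "L2Qnorm D T \<sigma> = l2n QM \<sigma>h" "AE t in MT. AE x in MD. \<sigma> t x = \<sigma>h (t,x)" using L2Q_version[OF d(1)] by blast
    obtain S where Sr: "l2 QM S" "l2n QM S \<le> L2Hm1norm D T s"
      "\<And>\<phi> v Gv. continuous_on UNIV \<phi> \<Longrightarrow> H01 D v Gv \<Longrightarrow> (\<integral>t. s t v * \<phi> t \<partial>MT) = (\<integral>t. ip MD (\<lambda>x. S (t,x)) Gv * \<phi> t \<partial>MT)"
      using Hm1_repr[OF d(2)] by blast
    obtain ff where ff: "ff \<in> borel_measurable QM" "\<And>z. norm (ff z) \<le> LinfQnorm D T f" "AE t in MT. AE x in MD. f t x = ff (t,x)"
      using bounded_field_version(2)[OF d(3) ne] by blast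
    interpret system_data D T \<rho>0 \<alpha> \<mu> \<eta> "LinfQnorm D T f" ff \<sigma> s f u0 p0 \<sigma>h S
    proof (intro system_data.intro system.intro system_axioms.intro system_data_axioms.intro)
      show "cyl D T" by (rule cyl_axioms)
      show "l2 MD u0" "l2 MD p0" using d by (simp_all add: L2v_eq L2_eq)
    qed (fact pos sr Sr ff bounded_field_version(1)[OF d(3) ne])+
    have E: "L2vnorm D u0 + sqrt \<alpha> * L2norm D p0 + L2Qnorm D T \<sigma> / sqrt \<alpha> + L2Hm1norm D T s = EE (L2Hm1norm D T s)"
      by (simp add: EE_def L2vnorm_eq L2norm_eq sr(2))
    show "let E = L2vnorm D u0 + sqrt \<alpha> * L2norm D p0 + L2Qnorm D T \<sigma> / sqrt \<alpha> + L2Hm1norm D T s;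
            F = LinfQnorm D T f
        in (\<exists>u G p. weak_sol D T \<rho>0 \<alpha> \<mu> \<eta> \<sigma> s f u0 p0 u G p) \<and>
           (\<forall>u1 G1 p1 u2 G2 p2. weak_sol D T \<rho>0 \<alpha> \<mu> \<eta> \<sigma> s f u0 p0 u1 G1 p1 \<longrightarrow>
               weak_sol D T \<rho>0 \<alpha> \<mu> \<eta> \<sigma> s f u0 p0 u2 G2 p2 \<longrightarrow>
               (AE z in lebesgue_on (QT D T). u1 (fst z) (snd z) = u2 (fst z) (snd z) \<and>
                                              p1 (fst z) (snd z) = p2 (fst z) (snd z))) \<and>
           (\<forall>u G p. weak_sol D T \<rho>0 \<alpha> \<mu> \<eta> \<sigma> s f u0 p0 u G p \<longrightarrow>
               ereal (L2Qnorm D T G) + LinfL2norm D T u + ereal (sqrt \<alpha>) * LinfL2norm D T p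
                 \<le> ereal (energy_const T F \<alpha> \<rho>0 \<mu> \<eta> * E) \<and>
               (\<exists>w. has_dt_Hm1 D T u w \<and>
                    L2Qnorm D T G + L2Hm1norm D T w \<le> dt_const (norm (mat 1 :: real^'d^'d)) CP T F \<alpha> \<rho>0 \<mu> \<eta> * E / sqrt \<alpha>) \<and>
               (L2hat D p0 \<longrightarrow> (AE t in MT. L2hat D (\<sigma> t)) \<longrightarrow> W12hat D T p))"
      unfolding Let_def E
      using weak_solution_exists solution_unique solution_estimates[OF _ Sr(2) CP] by blast
  qed
qed

end
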